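(* Let $1<p<\infty$, $p\neq 2$, and let $\mathcal{U}$ be a selective nonprincipal ultrafilter on $\mathbb{N}$. Then there is a unique complemented closed subspace $M$ of $\widehat{L^{p}}$ with the following property: an operator $S\in B((L^{p})^{\mathcal{U}})$ belongs to the WOT closure of $\{T^{\mathcal{U}}:T\in B(L^{p})\}$ if and only if all three subspaces $L^{p}$, $\widehat{L^{p}}$ and $M$ of $(L^{p})^{\mathcal{U}}$ are invariant under $S$.
   Context: $L^{p}=L^{p}([0,1],\mu)$ with $\mu$ Lebesgue measure; scalars are real (the result also holds over $\mathbb{C}$). For a Banach space $X$ and a nonprincipal ultrafilter $\mathcal{U}$ on $\mathbb{N}$, $X^{\mathcal{U}}$ is the ultrapower: bounded sequences $(x_n)_{n\ge1}$ in $X$ modulo those with $\lim_{n,\mathcal{U}}\|x_n\|=0$, normed by $\|(x_n)_{n,\mathcal{U}}\|=\lim_{n,\mathcal{U}}\|x_n\|$; $(x_n)_{n,\mathcal{U}}$ denotes the class of $(x_n)$. For $T\in B(X)$, $T^{\mathcal{U}}\in B(X^{\mathcal{U}})$ is $(x_n)_{n,\mathcal{U}}\mapsto(Tx_n)_{n,\mathcal{U}}$. $X$ is identified with the subspace of constant classes $\{(x)_{n,\mathcal{U}}:x\in X\}$. For reflexive $X$, $\widehat{X}=\{(x_n)_{n,\mathcal{U}}: w\text{-}\lim_{n,\mathcal{U}}x_n=0\}$ (weak limit along $\mathcal{U}$), and $X^{\mathcal{U}}=X\oplus\widehat{X}$ via the projection $(x_n)_{n,\mathcal{U}}\mapsto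 w\text{-}\lim_{n,\mathcal{U}}x_n$. An ultrafilter $\mathcal{U}$ on $\mathbb{N}$ is selective if (1) for every sequence $A_1,A_2,\dots$ in $\mathcal{U}$ there is $A\in\mathcal{U}$ with $A\setminus A_k$ finite for each $k$; and (2) for every partition of $\mathbb{N}$ into finite sets $A_1,A_2,\dots$ there is $A\in\mathcal{U}$ with $A\cap A_k$ a singleton for each $k$. WOT denotes the weak operator topology. *)

theory Defs
  imports "HOL-Analysis.Analysis"
begin

(* Elements of L^p = L^p([0,1],Lebesgue) are represented by functions real => real;
   two representatives are identified when the L^p-seminorm of their difference is 0.
   Elements of the ultrapower (L^p)^U are represented by sequences nat => real => real. *)

definition vadd :: "(real \<Rightarrow> real) \<Rightarrow> (real \<Rightarrow> real) \<Rightarrow> (real \<Rightarrow> real)" where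
  "vadd f g = (\<lambda>t. f t + g t)"
definition vscale :: "real \<Rightarrow> (real \<Rightarrow> real) \<Rightarrow> (real \<Rightarrow> real)" where
  "vscale c f = (\<lambda>t. c * f t)"
definition vsub :: "(real \<Rightarrow> real) \<Rightarrow> (real \<Rightarrow> real) \<Rightarrow> (real \<Rightarrow> real)" where
  "vsub f g = (\<lambda>t. f t - g t)"

definition uadd :: "(nat \<Rightarrow> real \<Rightarrow> real) \<Rightarrow> (nat \<Rightarrow> real \<Rightarrow> real) \<Rightarrow> (nat \<Rightarrow> real \<Rightarrow> real)" where
  "uadd x y = (\<lambda>n. vadd (x n) (y n))"
definition uscale :: "real \<Rightarrow> (nat \<Rightarrow> real \<Rightarrow> real) \<Rightarrow> (nat \<Rightarrow> real \<Rightarrow> real)" where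
  "uscale c x = (\<lambda>n. vscale c (x n))"
definition usub :: "(nat \<Rightarrow> real \<Rightarrow> real) \<Rightarrow> (nat \<Rightarrow> real \<Rightarrow> real) \<Rightarrow> (nat \<Rightarrow> real \<Rightarrow> real)" where
  "usub x y = (\<lambda>n. vsub (x n) (y n))"

definition Lp :: "real \<Rightarrow> (real \<Rightarrow> real) set" where
  "Lp p = {f. f \<in> borel_measurable (lebesgue_on {0..1}) \<and>
              integrable (lebesgue_on {0..1}) (\<lambda>t. \<bar>f t\<bar> powr p)}"

definition Lp_norm :: "real \<Rightarrow> (real \<Rightarrow> real) \<Rightarrow> real" where
  "Lp_norm p f = (\<integral>t. \<bar>f t\<bar> powr p \<partial>(lebesgue_on {0..1})) powr (1 / p)"

definition Lp_op :: "real \<Rightarrow> ((real \<Rightarrow> real) \<Rightarrow> (real \<Rightarrow> real)) \<Rightarrow> bool" where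
  "Lp_op p T \<longleftrightarrow>
     (\<forall>f\<in>Lp p. T f \<in> Lp p) \<and>
     (\<forall>f\<in>Lp p. \<forall>g\<in>Lp p. Lp_norm p (vsub (T (vadd f g)) (vadd (T f) (T g))) = 0) \<and>
     (\<forall>f\<in>Lp p. \<forall>c. Lp_norm p (vsub (T (vscale c f)) (vscale c (T f))) = 0) \<and>
     (\<exists>C. \<forall>f\<in>Lp p. Lp_norm p (T f) \<le> C * Lp_norm p f)"

definition Lp_functional :: "real \<Rightarrow> ((real \<Rightarrow> real) \<Rightarrow> real) \<Rightarrow> bool" where
  "Lp_functional p \<psi> \<longleftrightarrow>
     (\<forall>f\<in>Lp p. \<forall>g\<in>Lp p. \<psi> (vadd f g) = \<psi> f + \<psi> g) \<and>
     (\<forall>f\<in>Lp p. \<forall>c. \<psi> (vscale c f) = c * \<psi> f) \<and>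
     (\<exists>C. \<forall>f\<in>Lp p. \<bar>\<psi> f\<bar> \<le> C * Lp_norm p f)"

definition nonprincipal_ultrafilter :: "nat filter \<Rightarrow> bool" where
  "nonprincipal_ultrafilter U \<longleftrightarrow>
     U \<noteq> bot \<and>
     (\<forall>A. eventually (\<lambda>n. n \<in> A) U \<or> eventually (\<lambda>n. n \<notin> A) U) \<and>
     (\<forall>m. eventually (\<lambda>n. n \<noteq> m) U)"

definition in_uf :: "nat set \<Rightarrow> nat filter \<Rightarrow> bool" where
  "in_uf A U \<longleftrightarrow> eventually (\<lambda>n. n \<in> A) U"

definition selective :: "nat filter \<Rightarrow> bool" where
  "selective U \<longleftrightarrow>
     (\<forall>A :: nat \<Rightarrow> nat set. (\<forall>k. in_uf (A k) U) \<longrightarrow>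
        (\<exists>B. in_uf B U \<and> (\<forall>k. finite (B - A k)))) \<and>
     (\<forall>A :: nat \<Rightarrow> nat set.
        ((\<forall>k. finite (A k) \<and> A k \<noteq> {}) \<and> (\<Union>k. A k) = UNIV \<and>
         (\<forall>k l. k \<noteq> l \<longrightarrow> A k \<inter> A l = {})) \<longrightarrow>
        (\<exists>B. in_uf B U \<and> (\<forall>k. \<exists>a. B \<inter> A k = {a})))"

definition up_space :: "real \<Rightarrow> (nat \<Rightarrow> real \<Rightarrow> real) set" where
  "up_space p = {x. (\<forall>n. x n \<in> Lp p) \<and> (\<exists>B. \<forall>n. Lp_norm p (x n) \<le> B)}"

definition up_norm :: "real \<Rightarrow> nat filter \<Rightarrow> (nat \<Rightarrow> real \<Rightarrow> real) \<Rightarrow> real" where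
  "up_norm p U x = Lim U (\<lambda>n. Lp_norm p (x n))"

definition up_lift :: "((real \<Rightarrow> real) \<Rightarrow> (real \<Rightarrow> real)) \<Rightarrow>
                       (nat \<Rightarrow> real \<Rightarrow> real) \<Rightarrow> (nat \<Rightarrow> real \<Rightarrow> real)" where
  "up_lift T x = (\<lambda>n. T (x n))"

definition up_op :: "real \<Rightarrow> nat filter \<Rightarrow>
    ((nat \<Rightarrow> real \<Rightarrow> real) \<Rightarrow> (nat \<Rightarrow> real \<Rightarrow> real)) \<Rightarrow> bool" where
  "up_op p U S \<longleftrightarrow>
     (\<forall>x\<in>up_space p. S x \<in> up_space p) \<and>
     (\<forall>x\<in>up_space p. \<forall>y\<in>up_space p. up_norm p U (usub (S (uadd x y)) (uadd (S x) (S y))) = 0) \<and>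
     (\<forall>x\<in>up_space p. \<forall>c. up_norm p U (usub (S (uscale c x)) (uscale c (S x))) = 0) \<and>
     (\<exists>C. \<forall>x\<in>up_space p. up_norm p U (S x) \<le> C * up_norm p U x)"

definition up_functional :: "real \<Rightarrow> nat filter \<Rightarrow> ((nat \<Rightarrow> real \<Rightarrow> real) \<Rightarrow> real) \<Rightarrow> bool" where
  "up_functional p U \<phi> \<longleftrightarrow>
     (\<forall>x\<in>up_space p. \<forall>y\<in>up_space p. \<phi> (uadd x y) = \<phi> x + \<phi> y) \<and>
     (\<forall>x\<in>up_space p. \<forall>c. \<phi> (uscale c x) = c * \<phi> x) \<and>
     (\<exists>C. \<forall>x\<in>up_space p. \<bar>\<phi> x\<bar> \<le> C * up_norm p U x)"

definition wot_closure :: "real \<Rightarrow> nat filter \<Rightarrow>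
    ((nat \<Rightarrow> real \<Rightarrow> real) \<Rightarrow> (nat \<Rightarrow> real \<Rightarrow> real)) set \<Rightarrow>
    ((nat \<Rightarrow> real \<Rightarrow> real) \<Rightarrow> (nat \<Rightarrow> real \<Rightarrow> real)) set" where
  "wot_closure p U A = {S. up_op p U S \<and>
     (\<forall>\<epsilon>>0. \<forall>(k::nat) xs \<phi>s.
        (\<forall>i<k. xs i \<in> up_space p \<and> up_functional p U (\<phi>s i)) \<longrightarrow>
        (\<exists>T\<in>A. \<forall>i<k. \<bar>\<phi>s i (S (xs i)) - \<phi>s i (T (xs i))\<bar> < \<epsilon>))}"

text \<open>Closed linear subspaces of the ultrapower (closedness forces saturation under null perturbation).\<close>
definition up_closed_subspace :: "real \<Rightarrow> nat filter \<Rightarrow> (nat \<Rightarrow> real \<Rightarrow> real) set \<Rightarrow> bool" where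
  "up_closed_subspace p U M \<longleftrightarrow>
     M \<subseteq> up_space p \<and> M \<noteq> {} \<and>
     (\<forall>x\<in>M. \<forall>y\<in>M. uadd x y \<in> M) \<and>
     (\<forall>x\<in>M. \<forall>c. uscale c x \<in> M) \<and>
     (\<forall>y\<in>up_space p. (\<forall>\<epsilon>>0. \<exists>x\<in>M. up_norm p U (usub x y) < \<epsilon>) \<longrightarrow> y \<in> M)"

definition up_complemented_in :: "real \<Rightarrow> nat filter \<Rightarrow>
    (nat \<Rightarrow> real \<Rightarrow> real) set \<Rightarrow> (nat \<Rightarrow> real \<Rightarrow> real) set \<Rightarrow> bool" where
  "up_complemented_in p U Y M \<longleftrightarrow>
     up_closed_subspace p U M \<and> M \<subseteq> Y \<and>
     (\<exists>N. up_closed_subspace p U N \<and> N \<subseteq> Y \<and>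
          (\<forall>x\<in>M \<inter> N. up_norm p U x = 0) \<and>
          (\<forall>y\<in>Y. \<exists>m\<in>M. \<exists>n\<in>N. y = uadd m n))"

definition up_const :: "real \<Rightarrow> nat filter \<Rightarrow> (nat \<Rightarrow> real \<Rightarrow> real) set" where
  "up_const p U = {x\<in>up_space p. \<exists>f\<in>Lp p. up_norm p U (usub x (\<lambda>n. f)) = 0}"

definition up_hat :: "real \<Rightarrow> nat filter \<Rightarrow> (nat \<Rightarrow> real \<Rightarrow> real) set" where
  "up_hat p U = {x\<in>up_space p. \<forall>\<psi>. Lp_functional p \<psi> \<longrightarrow> ((\<lambda>n. \<psi> (x n)) \<longlongrightarrow> 0) U}"

definition invariant_under :: "(nat \<Rightarrow> real \<Rightarrow> real) set \<Rightarrow>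
    ((nat \<Rightarrow> real \<Rightarrow> real) \<Rightarrow> (nat \<Rightarrow> real \<Rightarrow> real)) \<Rightarrow> bool" where
  "invariant_under M S \<longleftrightarrow> (\<forall>x\<in>M. S x \<in> M)"

end

theory Submission
  imports Defs
begin

text \<open>
  Call a bounded sequence in \<open>L\<^sup>p\<close> \<^emph>\<open>disjoint\<close> if it tends to 0 in \<open>L\<^sup>1\<close> along \<open>U\<close>, and \<^emph>\<open>equi-integrable\<close> if it
  can be approximated in \<open>L\<^sup>p\<close> by uniformly bounded sequences. Every weakly null sequence is the sum of an
  equi-integrable and a disjoint one, and these two bands intersect trivially. Along a selective
  ultrafilter a weakly null sequence can be thinned out so that it satisfies an upper \<open>p\<close>-estimate in
  the disjoint case and an upper 2-estimate in the bounded case. Comparing growth rates of partial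
  sums, as in Pitt's theorem, shows that ultrapowers of operators map disjoint sequences to
  disjoint ones if \<open>p > 2\<close> and equi-integrable ones to equi-integrable ones if \<open>p < 2\<close>; this invariant
  band is \<open>M\<close>. Conversely, if \<open>h\<close> and \<open>y\<close> satisfy matching upper estimates then the operator
  \<open>f \<mapsto> \<Sum>\<^sub>i \<langle>f, h\<^sub>i\<rangle> y\<^sub>i\<close> is bounded, and its ultrapower approximates the rank-one map \<open>x \<mapsto> \<langle>x, h\<rangle> y\<close> on any given finite
  set of vectors. Finite sums of such maps approximate every operator that respects the three subspaces.
  Uniqueness holds because the rank-one maps respecting the subspaces leave no closed subspace of the
  weakly null classes invariant besides 0, \<open>M\<close> and the whole space.
\<close>

section \<open>The spaces \<open>Lp\<close>\<close>

text \<open>A subsequence says nothing about a limit along a general ultrafilter, since its index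
  set may fail to belong to it. Selectivity is what lets the index set of a gliding hump belong to
  \<open>U\<close>, so that estimates along the subsequence decide limits along \<open>U\<close>.
  The rest is governed by exponents. A rank-one map with functional \<open>h\<close> and vector
  \<open>y\<close> can be approximated when the exponents of \<open>h\<close> and \<open>y\<close>
  can be lowered to conjugate ones. Disjoint sequences have exponent \<open>p\<close> in
  \<open>Lp p\<close> and \<open>q\<close> in \<open>Lp q\<close>, bounded ones have exponent 2 in
  both. Equal bands always match. Of the two mixed combinations exactly one matches when
  \<open>p \<noteq> 2\<close>: bounded \<open>h\<close> with disjoint \<open>y\<close> for
  \<open>p > 2\<close>, disjoint \<open>h\<close> with bounded \<open>y\<close> for
  \<open>p < 2\<close>. The other one would lead out of \<open>M\<close>, and there the growth rates
  add up to \<open>1 / p + 1 / 2\<close> or \<open>1 / 2 + 1 / q\<close>, which is below one. So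
  what can be approximated and what is excluded meet without a gap; for \<open>p = 2\<close> both
  mixed combinations would match.\<close>

abbreviation mu :: "real measure" where
  "mu \<equiv> lebesgue_on {0..1}"

lemma space_mu: "space mu = {0..1}"
  by (simp add: space_restrict_space)

lemma finite_measure_mu: "finite_measure mu"
  by (rule finite_measureI) (simp add: emeasure_restrict_space space_mu)

lemma measure_space_mu [simp]: "measure mu {0..1} = 1" "measure mu (space mu) = 1"
  by (simp_all add: space_mu measure_restrict_space)

lemma integrable_bounded:
  fixes f :: "real \<Rightarrow> real"
  assumes "f \<in> borel_measurable mu" "\<And>t. \<bar>f t\<bar> \<le> K"
  shows "integrable mu f"
proof -
  interpret finite_measure mu by (rule finite_measure_mu)
  show ?thesis by (rule integrable_const_bound[where B=K]) (use assms in auto)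
qed

lemma integrable_const_mu [simp]: "integrable mu (\<lambda>t. c :: real)"
  by (rule integrable_bounded[where K="\<bar>c\<bar>"]) auto

lemma integral_const_mu [simp]: "(\<integral>t. c \<partial>mu) = (c :: real)"
  by (simp only: lebesgue_integral_const measure_space_mu) simp

section \<open>Conjugate exponents and the seminorm of \<open>Lp\<close>\<close>

definition conj_exp :: "real \<Rightarrow> real \<Rightarrow> bool" where
  "conj_exp p q \<longleftrightarrow> 1 < p \<and> 1 < q \<and> 1 / p + 1 / q = 1"

lemma conj_expD:
  assumes "conj_exp p q"
  shows "1 < p" "1 < q" "1 / p + 1 / q = 1" "p + q = p * q" "(p - 1) * q = p" "(q - 1) * p = q"
    "q = p / (p - 1)" "1 / q = (p - 1) / p"
proof -
  show 1: "1 < p" "1 < q" and 2: "1 / p + 1 / q = 1" using assms by (auto simp: conj_exp_def)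
  show 3: "p + q = p * q" using 1 2 by (simp add: field_simps)
  show "(p - 1) * q = p" "(q - 1) * p = q" using 3 by (simp_all add: algebra_simps)
  then show "q = p / (p - 1)" using 1 by (simp add: field_simps)
  show "1 / q = (p - 1) / p" using 2 1 by (simp add: field_simps)
qed

lemma conj_exp_sym: "conj_exp p q \<Longrightarrow> conj_exp q p"
  by (auto simp: conj_exp_def)

lemma conj_exp_exists: "1 < p \<Longrightarrow> conj_exp p (p / (p - 1))"
  by (auto simp: conj_exp_def field_simps)

lemma LpD [dest]:
  assumes "f \<in> Lp p"
  shows "f \<in> borel_measurable mu" "integrable mu (\<lambda>t. \<bar>f t\<bar> powr p)"
  using assms by (auto simp: Lp_def)

lemma Lp_dominated:
  assumes "g \<in> Lp p" "f \<in> borel_measurable mu" "\<And>t. \<bar>f t\<bar> \<le> \<bar>g t\<bar>" "0 \<le> p"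
  shows "f \<in> Lp p"
proof -
  have "integrable mu (\<lambda>t. \<bar>f t\<bar> powr p)"
    by (rule Bochner_Integration.integrable_bound[OF LpD(2)[OF assms(1)]])
       (use assms in \<open>auto intro!: powr_mono2\<close>)
  then show ?thesis using assms by (auto simp: Lp_def)
qed

lemma abs_powr_add_le:
  fixes a b :: real
  assumes "0 \<le> p"
  shows "\<bar>a + b\<bar> powr p \<le> 2 powr p * (\<bar>a\<bar> powr p + \<bar>b\<bar> powr p)"
proof -
  have "\<bar>a + b\<bar> powr p \<le> (2 * max \<bar>a\<bar> \<bar>b\<bar>) powr p"
    by (rule powr_mono2) (use assms in auto)
  also have "\<dots> = 2 powr p * (max \<bar>a\<bar> \<bar>b\<bar>) powr p" by (simp add: powr_mult)
  also have "\<dots> \<le> 2 powr p * (\<bar>a\<bar> powr p + \<bar>b\<bar> powr p)"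
    by (rule mult_left_mono) (auto simp: max_def)
  finally show ?thesis .
qed

lemma Lp_add [intro]:
  assumes "f \<in> Lp p" "g \<in> Lp p" "0 \<le> p"
  shows "(\<lambda>t. f t + g t) \<in> Lp p"
proof -
  have "integrable mu (\<lambda>t. 2 powr p * (\<bar>f t\<bar> powr p + \<bar>g t\<bar> powr p))"
    using assms by (intro integrable_mult_right Bochner_Integration.integrable_add LpD)
  then have "integrable mu (\<lambda>t. \<bar>f t + g t\<bar> powr p)"
    by (rule Bochner_Integration.integrable_bound)
       (use assms LpD[OF assms(1)] LpD[OF assms(2)] abs_powr_add_le[OF assms(3)] in
         \<open>auto simp: abs_mult abs_of_nonneg add_nonneg_nonneg\<close>)
  then show ?thesis using assms by (auto simp: Lp_def)
qed

lemma Lp_scale [intro]: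
  assumes "f \<in> Lp p"
  shows "(\<lambda>t. c * f t) \<in> Lp p"
  using assms by (auto simp: Lp_def abs_mult powr_mult)

lemma Lp_uminus [intro]: "f \<in> Lp p \<Longrightarrow> (\<lambda>t. - f t) \<in> Lp p"
  by (auto simp: Lp_def)

lemma Lp_abs [intro]: "f \<in> Lp p \<Longrightarrow> (\<lambda>t. \<bar>f t\<bar>) \<in> Lp p"
  by (auto simp: Lp_def)

lemma Lp_diff [intro]:
  assumes "f \<in> Lp p" "g \<in> Lp p" "0 \<le> p"
  shows "(\<lambda>t. f t - g t) \<in> Lp p"
  using Lp_add[OF assms(1) Lp_uminus[OF assms(2)] assms(3)] by simp

lemma Lp_zero [intro, simp]: "(\<lambda>t. 0) \<in> Lp p"
  by (auto simp: Lp_def)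

lemma Lp_sum [intro]:
  assumes "\<And>i. i \<in> I \<Longrightarrow> f i \<in> Lp p" "0 \<le> p"
  shows "(\<lambda>t. \<Sum>i\<in>I. f i t) \<in> Lp p"
  using assms by (induction I rule: infinite_finite_induct) (auto intro!: Lp_add)

lemma Lp_bounded:
  assumes "f \<in> borel_measurable mu" "\<And>t. \<bar>f t\<bar> \<le> K" "0 \<le> p"
  shows "f \<in> Lp p"
proof -
  have "integrable mu (\<lambda>t. \<bar>f t\<bar> powr p)"
    by (rule integrable_bounded[where K="K powr p"])
       (use assms in \<open>auto intro!: powr_mono2\<close>)
  then show ?thesis using assms by (auto simp: Lp_def)
qed

lemma Lp_norm_nonneg [simp]: "0 \<le> Lp_norm p f"
  by (simp add: Lp_norm_def)

lemma Lp_norm_powr: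
  assumes "0 < p"
  shows "Lp_norm p f powr p = (\<integral>t. \<bar>f t\<bar> powr p \<partial>mu)"
  using assms by (simp add: Lp_norm_def powr_powr)

lemma Lp_norm_le_iff:
  assumes "0 < p" "0 \<le> B"
  shows "Lp_norm p f \<le> B \<longleftrightarrow> (\<integral>t. \<bar>f t\<bar> powr p \<partial>mu) \<le> B powr p"
  using assms Lp_norm_powr[OF assms(1), of f]
  by (metis Lp_norm_nonneg less_eq_real_def not_less powr_less_mono2 powr_mono2)

lemma Lp_norm_eq_0_iff:
  assumes "f \<in> Lp p" "0 < p"
  shows "Lp_norm p f = 0 \<longleftrightarrow> (AE t in mu. f t = 0)"
proof -
  have "Lp_norm p f = 0 \<longleftrightarrow> (\<integral>t. \<bar>f t\<bar> powr p \<partial>mu) = 0"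
    using assms by (auto simp: Lp_norm_def)
  also have "\<dots> \<longleftrightarrow> (AE t in mu. \<bar>f t\<bar> powr p = 0)"
    by (rule integral_nonneg_eq_0_iff_AE) (use assms in auto)
  finally show ?thesis by simp
qed

lemma Lp_norm_zero [simp]: "Lp_norm p (\<lambda>t. 0) = 0"
  by (simp add: Lp_norm_def)

lemma Lp_norm_scale:
  assumes "0 < p"
  shows "Lp_norm p (\<lambda>t. c * f t) = \<bar>c\<bar> * Lp_norm p f"
proof -
  have "(\<integral>t. \<bar>c * f t\<bar> powr p \<partial>mu) = \<bar>c\<bar> powr p * (\<integral>t. \<bar>f t\<bar> powr p \<partial>mu)"
    by (simp add: abs_mult powr_mult)
  then show ?thesis using assms by (simp add: Lp_norm_def powr_mult powr_powr)
qed

lemma Lp_norm_uminus [simp]: "Lp_norm p (\<lambda>t. - f t) = Lp_norm p f"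
  by (simp add: Lp_norm_def)

lemma Lp_norm_abs [simp]: "Lp_norm p (\<lambda>t. \<bar>f t\<bar>) = Lp_norm p f"
  by (simp add: Lp_norm_def)

lemma Lp_norm_minus_commute: "Lp_norm p (\<lambda>t. f t - g t) = Lp_norm p (\<lambda>t. g t - f t)"
  by (simp add: Lp_norm_def abs_minus_commute)

lemma Lp_norm_mono:
  assumes "g \<in> Lp p" "f \<in> borel_measurable mu" "\<And>t. \<bar>f t\<bar> \<le> \<bar>g t\<bar>" "0 < p"
  shows "Lp_norm p f \<le> Lp_norm p g"
proof -
  have "f \<in> Lp p" by (rule Lp_dominated[OF assms(1)]) (use assms in auto)
  then have "(\<integral>t. \<bar>f t\<bar> powr p \<partial>mu) \<le> (\<integral>t. \<bar>g t\<bar> powr p \<partial>mu)"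
    by (intro integral_mono) (use assms in \<open>auto intro!: powr_mono2\<close>)
  then show ?thesis using assms unfolding Lp_norm_def by (intro powr_mono2) auto
qed

lemma Lp_norm_bounded:
  assumes "f \<in> borel_measurable mu" "\<And>t. \<bar>f t\<bar> \<le> K" "0 < p"
  shows "Lp_norm p f \<le> K"
proof -
  have K: "0 \<le> K" using assms(2)[of 0] by simp
  have "Lp_norm p f \<le> Lp_norm p (\<lambda>t. K)"
    by (rule Lp_norm_mono) (use assms K in \<open>auto intro!: Lp_bounded[where K=K]\<close>)
  also have "\<dots> = K" using K assms by (simp add: Lp_norm_def powr_powr)
  finally show ?thesis .
qed

section \<open>Hoelder's inequality, the duality map and Minkowski's inequality\<close>

lemma Lp_mult_integrable:
  assumes "conj_exp p q" "f \<in> Lp p" "g \<in> Lp q"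
  shows "integrable mu (\<lambda>t. f t * g t)"
proof -
  note c = conj_expD[OF assms(1)]
  have "integrable mu (\<lambda>t. \<bar>f t\<bar> powr p / p + \<bar>g t\<bar> powr q / q)"
    using assms by (intro Bochner_Integration.integrable_add integrable_divide LpD)
  then show ?thesis
  proof (rule Bochner_Integration.integrable_bound)
    show "AE t in mu. norm (f t * g t) \<le> norm (\<bar>f t\<bar> powr p / p + \<bar>g t\<bar> powr q / q)"
    proof (rule AE_I2)
      fix t
      have "\<bar>f t\<bar> * \<bar>g t\<bar> \<le> \<bar>f t\<bar> powr p / p + \<bar>g t\<bar> powr q / q"
        by (rule Youngs_inequality) (use c in auto)
      then show "norm (f t * g t) \<le> norm (\<bar>f t\<bar> powr p / p + \<bar>g t\<bar> powr q / q)"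
        by (simp add: abs_mult)
    qed
  qed (use LpD(1)[OF assms(2)] LpD(1)[OF assms(3)] in measurable)
qed

text \<open>Young's inequality is applied to \<open>f\<close> and \<open>g\<close> divided by their
  norms, so that the two integrals weigh in with \<open>1 / p\<close> and \<open>1 / q\<close>. A
  vanishing norm cannot be divided by, but then the product is zero almost everywhere.\<close>

lemma Holder_abs:
  assumes "conj_exp p q" "f \<in> Lp p" "g \<in> Lp q"
  shows "(\<integral>t. \<bar>f t * g t\<bar> \<partial>mu) \<le> Lp_norm p f * Lp_norm q g"
proof (cases "Lp_norm p f = 0 \<or> Lp_norm q g = 0")
  case True
  note c = conj_expD[OF assms(1)]
  have "AE t in mu. \<bar>f t * g t\<bar> = 0"
    using True Lp_norm_eq_0_iff[OF assms(2)] Lp_norm_eq_0_iff[OF assms(3)] c by auto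
  then have "(\<integral>t. \<bar>f t * g t\<bar> \<partial>mu) = 0" by (rule integral_eq_zero_AE)
  then show ?thesis by simp
next
  case False
  note c = conj_expD[OF assms(1)]
  define A B where "A = Lp_norm p f" and "B = Lp_norm q g"
  have AB: "A > 0" "B > 0" using False by (simp_all add: A_def B_def order_less_le)
  have int: "integrable mu (\<lambda>t. \<bar>f t * g t\<bar>)" using Lp_mult_integrable[OF assms] by simp
  have pt: "\<bar>f t * g t\<bar> \<le> A * B * ((\<bar>f t\<bar> powr p / A powr p) / p + (\<bar>g t\<bar> powr q / B powr q) / q)" for t
  proof -
    have "(\<bar>f t\<bar> / A) * (\<bar>g t\<bar> / B) \<le> (\<bar>f t\<bar> / A) powr p / p + (\<bar>g t\<bar> / B) powr q / q"
      by (rule Youngs_inequality) (use c AB in auto)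
    also have "\<dots> = (\<bar>f t\<bar> powr p / A powr p) / p + (\<bar>g t\<bar> powr q / B powr q) / q"
      using AB by (simp add: powr_divide)
    finally show ?thesis using AB by (simp add: field_simps abs_mult)
  qed
  have "(\<integral>t. \<bar>f t * g t\<bar> \<partial>mu) \<le>
      (\<integral>t. A * B * ((\<bar>f t\<bar> powr p / A powr p) / p + (\<bar>g t\<bar> powr q / B powr q) / q) \<partial>mu)"
    by (rule integral_mono[OF int])
       (use assms pt in \<open>auto intro!: integrable_mult_right Bochner_Integration.integrable_add integrable_divide\<close>)
  also have "\<dots> = A * B * (((\<integral>t. \<bar>f t\<bar> powr p \<partial>mu) / A powr p) / p + ((\<integral>t. \<bar>g t\<bar> powr q \<partial>mu) / B powr q) / q)"
    using LpD(2)[OF assms(2)] LpD(2)[OF assms(3)] by simp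
  also have "\<dots> = A * B * (1 / p + 1 / q)"
  proof -
    have "(\<integral>t. \<bar>f t\<bar> powr p \<partial>mu) = A powr p" "(\<integral>t. \<bar>g t\<bar> powr q \<partial>mu) = B powr q"
      using Lp_norm_powr[of p f] Lp_norm_powr[of q g] c(1,2) by (auto simp: A_def B_def)
    then show ?thesis using AB by simp
  qed
  finally show ?thesis using c by (simp add: A_def B_def)
qed

lemma Holder:
  assumes "conj_exp p q" "f \<in> Lp p" "g \<in> Lp q"
  shows "\<bar>\<integral>t. f t * g t \<partial>mu\<bar> \<le> Lp_norm p f * Lp_norm q g"
  using Holder_abs[OF assms] integral_abs_bound[of mu "\<lambda>t. f t * g t"] by linarith

text \<open>The duality map of \<open>Lp\<close>: \<open>f * Jmap p f\<close> is
  \<open>\<bar>f\<bar> powr p\<close>, and \<open>\<bar>Jmap p f\<bar> powr q\<close> is the same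
  function. It supplies an explicit norming functional wherever a Hahn-Banach argument would be
  expected.\<close>

definition Jmap :: "real \<Rightarrow> (real \<Rightarrow> real) \<Rightarrow> real \<Rightarrow> real" where
  "Jmap p f = (\<lambda>t. sgn (f t) * \<bar>f t\<bar> powr (p - 1))"

lemma abs_Jmap: "\<bar>Jmap p f t\<bar> = \<bar>f t\<bar> powr (p - 1)"
  by (cases "f t = 0") (auto simp: Jmap_def abs_mult abs_sgn_eq)

lemma Jmap_mult: "1 < p \<Longrightarrow> f t * Jmap p f t = \<bar>f t\<bar> powr p"
proof (cases "f t = 0")
  case False
  assume "1 < p"
  have "f t * Jmap p f t = \<bar>f t\<bar> * \<bar>f t\<bar> powr (p - 1)"
    using False by (simp add: Jmap_def abs_sgn[symmetric] flip: mult.assoc)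
  also have "\<dots> = \<bar>f t\<bar> powr p" using powr_mult_base[of "\<bar>f t\<bar>" "p - 1"] by simp
  finally show ?thesis .
qed (simp add: Jmap_def)

lemma Jmap_measurable [measurable]:
  "f \<in> borel_measurable M \<Longrightarrow> Jmap p f \<in> borel_measurable M"
  unfolding Jmap_def by simp

lemma abs_Jmap_powr: "conj_exp p q \<Longrightarrow> \<bar>Jmap p f t\<bar> powr q = \<bar>f t\<bar> powr p"
  using conj_expD(5)[of p q] by (simp add: abs_Jmap powr_powr)

lemma Jmap_Lp [intro]:
  assumes "conj_exp p q" "f \<in> Lp p"
  shows "Jmap p f \<in> Lp q"
  using assms by (auto simp: Lp_def abs_Jmap_powr[OF assms(1)])

lemma Lp_norm_Jmap:
  assumes "conj_exp p q"
  shows "Lp_norm q (Jmap p f) = Lp_norm p f powr (p - 1)"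
proof -
  note c = conj_expD[OF assms]
  show ?thesis unfolding Lp_norm_def abs_Jmap_powr[OF assms] powr_powr c(8)
    using c(1) by simp
qed

text \<open>Minkowski by duality: \<open>\<bar>f + g\<bar> powr p\<close> is \<open>f + g\<close>
  times its image under \<open>Jmap\<close>, Hoelder's inequality bounds each summand, and the power
  \<open>p - 1\<close> of the norm cancels.\<close>

lemma Lp_norm_triangle:
  assumes "conj_exp p q" "f \<in> Lp p" "g \<in> Lp p"
  shows "Lp_norm p (\<lambda>t. f t + g t) \<le> Lp_norm p f + Lp_norm p g"
proof (cases "Lp_norm p (\<lambda>t. f t + g t) = 0")
  case False
  note c = conj_expD[OF assms(1)]
  let ?h = "\<lambda>t. f t + g t"
  have h: "?h \<in> Lp p" using assms c by auto
  have J: "Jmap p ?h \<in> Lp q" using assms(1) h by auto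
  have i: "integrable mu (\<lambda>t. f t * Jmap p ?h t)" "integrable mu (\<lambda>t. g t * Jmap p ?h t)"
    using Lp_mult_integrable[OF assms(1) assms(2) J] Lp_mult_integrable[OF assms(1) assms(3) J] by auto
  let ?n = "Lp_norm p ?h"
  have pos: "?n > 0" using False Lp_norm_nonneg[of p ?h] by linarith
  have "?n powr p = (\<integral>t. f t * Jmap p ?h t + g t * Jmap p ?h t \<partial>mu)"
    using c Jmap_mult[OF c(1), of ?h] by (simp add: Lp_norm_powr algebra_simps)
  also have "\<dots> = (\<integral>t. f t * Jmap p ?h t \<partial>mu) + (\<integral>t. g t * Jmap p ?h t \<partial>mu)"
    by (rule Bochner_Integration.integral_add[OF i])
  also have "\<dots> \<le> Lp_norm p f * Lp_norm q (Jmap p ?h) + Lp_norm p g * Lp_norm q (Jmap p ?h)"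
    using Holder[OF assms(1,2) J] Holder[OF assms(1,3) J] by linarith
  also have "\<dots> = (Lp_norm p f + Lp_norm p g) * ?n powr (p - 1)"
    by (simp add: Lp_norm_Jmap[OF assms(1)] algebra_simps)
  finally have "?n powr (p - 1) * ?n \<le> ?n powr (p - 1) * (Lp_norm p f + Lp_norm p g)"
    using pos by (simp add: powr_diff field_simps)
  then show ?thesis using pos by simp
qed (simp add: add_nonneg_nonneg)

lemma Lp_norm_triangle_diff:
  assumes "conj_exp p q" "f \<in> Lp p" "g \<in> Lp p"
  shows "Lp_norm p (\<lambda>t. f t - g t) \<le> Lp_norm p f + Lp_norm p g"
  using Lp_norm_triangle[OF assms(1,2) Lp_uminus[OF assms(3)]] by simp

lemma Lp_norm_le_diff:
  assumes "conj_exp p q" "f \<in> Lp p" "g \<in> Lp p"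
  shows "Lp_norm p f \<le> Lp_norm p (\<lambda>t. f t - g t) + Lp_norm p g"
  using Lp_norm_triangle[OF assms(1) Lp_diff[OF assms(2,3)] assms(3)] conj_expD(1)[OF assms(1)] by simp

lemma Lp_norm_sum:
  assumes "conj_exp p q" "\<And>i. i \<in> I \<Longrightarrow> f i \<in> Lp p"
  shows "Lp_norm p (\<lambda>t. \<Sum>i\<in>I. f i t) \<le> (\<Sum>i\<in>I. Lp_norm p (f i))"
  using assms(2)
proof (induction I rule: infinite_finite_induct)
  case (insert i I)
  have "Lp_norm p (\<lambda>t. f i t + (\<Sum>j\<in>I. f j t)) \<le> Lp_norm p (f i) + Lp_norm p (\<lambda>t. \<Sum>j\<in>I. f j t)"
    by (rule Lp_norm_triangle[OF assms(1)]) (use insert.prems conj_expD(1)[OF assms(1)] in auto)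
  then show ?case using insert by simp
qed auto

lemma integral_abs_le_Lp_norm:
  assumes "conj_exp p q" "f \<in> Lp p"
  shows "integrable mu f" "(\<integral>t. \<bar>f t\<bar> \<partial>mu) \<le> Lp_norm p f"
proof -
  note c = conj_expD[OF assms(1)]
  have 1: "(\<lambda>t. 1) \<in> Lp q" by (rule Lp_bounded[where K=1]) (use c in auto)
  show "integrable mu f" using Lp_mult_integrable[OF assms(1,2) 1] by simp
  have "Lp_norm q (\<lambda>t. 1) \<le> 1" by (rule Lp_norm_bounded) (use c in auto)
  then have "Lp_norm p f * Lp_norm q (\<lambda>t. 1) \<le> Lp_norm p f"
    by (simp add: mult_left_le)
  then show "(\<integral>t. \<bar>f t\<bar> \<partial>mu) \<le> Lp_norm p f"
    using Holder_abs[OF assms(1,2) 1] by simp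
qed

section \<open>Elementary inequalities for powers and sums\<close>

lemma powr_superadd:
  fixes u v :: real
  assumes "0 \<le> u" "0 \<le> v" "1 \<le> p"
  shows "u powr p + v powr p \<le> (u + v) powr p"
proof -
  have e: "w powr p = w * w powr (p - 1)" if "0 \<le> w" for w :: real
    using powr_mult_base[of w "p - 1"] that by simp
  have "u * u powr (p - 1) \<le> u * (u + v) powr (p - 1)" "v * v powr (p - 1) \<le> v * (u + v) powr (p - 1)"
    using assms by (auto intro!: mult_left_mono powr_mono2)
  then show ?thesis using e[of u] e[of v] e[of "u + v"] assms by (simp add: distrib_right)
qed

text \<open>The tangent of the convex function \<open>x powr p\<close> at \<open>u + v\<close> lies
  below it at \<open>u\<close>. Young's inequality for \<open>u\<close> and
  \<open>(u + v) powr (p - 1)\<close> gives this without derivatives.\<close>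

lemma powr_add_le_tangent:
  fixes u v :: real
  assumes pq: "conj_exp p q" and "0 \<le> u" "0 \<le> v"
  shows "(u + v) powr p \<le> u powr p + p * v * (u + v) powr (p - 1)"
proof -
  note c = conj_expD[OF pq]
  let ?w = "u + v"
  have "u * ?w powr (p - 1) \<le> u powr p / p + (?w powr (p - 1)) powr q / q"
    by (rule Youngs_inequality) (use c assms in auto)
  also have "\<dots> = u powr p / p + ?w powr p * ((p - 1) / p)"
  proof -
    have "(?w powr (p - 1)) powr q = ?w powr p" by (simp only: powr_powr c(5))
    then show ?thesis by (simp flip: c(8))
  qed
  finally have "p * (u * ?w powr (p - 1)) \<le> u powr p + (p - 1) * ?w powr p"
    using c(1) by (simp add: field_simps)
  moreover have "?w powr p = ?w * ?w powr (p - 1)" using powr_mult_base[of ?w "p - 1"] assms by simp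
  ultimately show ?thesis by (simp add: algebra_simps)
qed

text \<open>The last two terms are products of \<open>a\<close> and \<open>t\<close>, so for
  functions with almost disjoint supports the p-th powers of the norms nearly add. Each product
  serves the case in which its factor with power \<open>p - 1\<close> is the larger of the two
  numbers.\<close>

lemma abs_powr_add_disjoint:
  fixes a t :: real
  assumes pq: "conj_exp p q"
  shows "\<bar>a + t\<bar> powr p \<le> \<bar>a\<bar> powr p + \<bar>t\<bar> powr p
    + p * 2 powr (p - 1) * (\<bar>a\<bar> powr (p - 1) * \<bar>t\<bar> + \<bar>a\<bar> * \<bar>t\<bar> powr (p - 1))"
proof -
  note c = conj_expD[OF pq]
  have main: "(u + v) powr p \<le> u powr p + v powr p + p * 2 powr (p - 1) * (u powr (p - 1) * v + u * v powr (p - 1))"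
    if uv: "0 \<le> v" "v \<le> u" for u v :: real
  proof -
    have "(u + v) powr (p - 1) \<le> (2 * u) powr (p - 1)" using uv c by (intro powr_mono2) auto
    also have "\<dots> = 2 powr (p - 1) * u powr (p - 1)" using uv by (simp add: powr_mult)
    finally have "p * v * (u + v) powr (p - 1) \<le> p * v * (2 powr (p - 1) * u powr (p - 1))"
      using uv c by (intro mult_left_mono) auto
    moreover have "0 \<le> p * 2 powr (p - 1) * (u * v powr (p - 1))" "0 \<le> v powr p" using uv c by auto
    moreover have "p * v * (2 powr (p - 1) * u powr (p - 1)) = p * 2 powr (p - 1) * (u powr (p - 1) * v)" by simp
    ultimately show ?thesis using powr_add_le_tangent[OF pq, of u v] uv unfolding distrib_left by linarith
  qed
  have "\<bar>a + t\<bar> powr p \<le> (\<bar>a\<bar> + \<bar>t\<bar>) powr p" using c by (intro powr_mono2) auto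
  also have "\<dots> \<le> \<bar>a\<bar> powr p + \<bar>t\<bar> powr p + p * 2 powr (p - 1) * (\<bar>a\<bar> powr (p - 1) * \<bar>t\<bar> + \<bar>a\<bar> * \<bar>t\<bar> powr (p - 1))"
    using main[of "\<bar>t\<bar>" "\<bar>a\<bar>"] main[of "\<bar>a\<bar>" "\<bar>t\<bar>"] by (cases "\<bar>t\<bar> \<le> \<bar>a\<bar>") (auto simp: algebra_simps)
  finally show ?thesis .
qed

text \<open>The term \<open>K * v\<close> integrates to something small on a sequence that vanishes
  in \<open>L^1\<close>, and the other two terms have small constants. Below \<open>r\<close> the
  constant \<open>d\<close> dominates, above \<open>1 / d\<close> the term
  \<open>d * v powr p\<close> does, and in between \<open>v / r\<close> is at least 1.\<close>

lemma powr_pred_le: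
  fixes p d :: real
  assumes "1 < p" "0 < d" "d < 1"
  shows "\<exists>K\<ge>0. \<forall>v\<ge>0. v powr (p - 1) \<le> d + d * v powr p + K * v"
proof (intro exI conjI allI impI)
  define r where "r = d powr (1 / (p - 1))"
  have r: "r > 0" using assms by (simp add: r_def)
  show "0 \<le> (1 / d) powr (p - 1) / r" using r by simp
  fix v :: real assume v: "0 \<le> v"
  consider "v \<le> r" | "v \<ge> 1 / d" | "r < v" "v < 1 / d" by linarith
  then show "v powr (p - 1) \<le> d + d * v powr p + (1 / d) powr (p - 1) / r * v"
  proof cases
    case 1
    have "v powr (p - 1) \<le> r powr (p - 1)" using 1 v assms by (intro powr_mono2) auto
    also have "\<dots> = d" using assms by (simp add: r_def powr_powr)
    finally show ?thesis using v assms r by (simp add: add_increasing2)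
  next
    case 2
    have "v powr (p - 1) \<le> (d * v) * v powr (p - 1)"
      using 2 assms v mult_right_mono[of 1 "d * v" "v powr (p - 1)"] by (simp add: field_simps)
    also have "\<dots> = d * v powr p" using powr_mult_base[of v "p - 1"] v by simp
    finally show ?thesis using v assms r by (simp add: add_increasing add_increasing2)
  next
    case 3
    have "v powr (p - 1) \<le> (1 / d) powr (p - 1)" using 3 v assms by (intro powr_mono2) auto
    also have "\<dots> \<le> (1 / d) powr (p - 1) * (v / r)"
      using 3 r mult_left_mono[of 1 "v / r" "(1 / d) powr (p - 1)"] by simp
    finally show ?thesis using v assms r by (simp add: add_increasing)
  qed
qed

lemma abs_le_one_of_sum:
  fixes c :: "nat \<Rightarrow> real"
  assumes "(\<Sum>i<N. \<bar>c i\<bar> powr s) \<le> (1::real)" "i < N" "0 < s"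
  shows "\<bar>c i\<bar> \<le> 1"
proof -
  have "\<bar>c i\<bar> powr s \<le> (\<Sum>i<N. \<bar>c i\<bar> powr s)"
    by (rule member_le_sum) (use assms in auto)
  then have "\<bar>c i\<bar> powr s \<le> 1" using assms by linarith
  moreover have "1 powr s < \<bar>c i\<bar> powr s" if "1 < \<bar>c i\<bar>"
    by (rule powr_less_mono2) (use assms(3) that in auto)
  ultimately show ?thesis by (cases "1 < \<bar>c i\<bar>") auto
qed

lemma sum_half_le: "(\<Sum>j<N. (1 / 2 :: real) ^ j) \<le> 2"
  by (simp add: sum_gp_strict)

text \<open>The factor 3 is the one produced by the thinning in \<open>sparse_off_diagonal\<close>;
  the geometric series contributes the factor 2.\<close>

lemma off_diagonal_sum_le:
  assumes "\<And>i. i \<noteq> j \<Longrightarrow> \<bar>a i\<bar> \<le> 3 * d * (1 / 2) ^ i" "d \<ge> 0"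
  shows "(\<Sum>i\<in>{..<N} - {j}. \<bar>a i\<bar>) \<le> 6 * (d::real)"
proof -
  have "(\<Sum>i\<in>{..<N} - {j}. \<bar>a i\<bar>) \<le> (\<Sum>i\<in>{..<N} - {j}. 3 * d * (1 / 2) ^ i)"
    by (rule sum_mono) (use assms in auto)
  also have "\<dots> \<le> (\<Sum>i<N. 3 * d * (1 / 2) ^ i)" by (rule sum_mono2) (use assms in auto)
  also have "\<dots> = 3 * d * (\<Sum>i<N. (1 / 2) ^ i)" by (simp add: sum_distrib_left)
  also have "\<dots> \<le> 3 * d * 2" using assms by (intro mult_left_mono sum_half_le) auto
  finally show ?thesis by simp
qed

text \<open>A positive multiple of \<open>N\<close> outgrows every power with exponent below one.
  This is how each argument by growth of partial sums ends in a contradiction.\<close>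

lemma linear_not_le_powr:
  fixes e C r :: real
  assumes "e > 0" "r < 1" "\<And>N::nat. real N * e \<le> C * real N powr r"
  shows False
proof -
  define A where "A = \<bar>C / e\<bar> + 1"
  have A: "A > 0" "C / e < A" unfolding A_def by linarith+
  obtain N :: nat where "A powr (1 / (1 - r)) < real N" using reals_Archimedean2 by blast
  then have N: "A powr (1 / (1 - r)) < real N" "0 < N" using A(1) by (auto intro: Nat.gr0I)
  have "A = (A powr (1 / (1 - r))) powr (1 - r)" using A assms(2) by (simp add: powr_powr)
  also have "\<dots> < real N powr (1 - r)" using N assms(2) by (intro powr_less_mono2) auto
  finally have "real N powr r * (C / e) < real N powr r * real N powr (1 - r)"
    using A N by (intro mult_strict_left_mono) auto
  also have "\<dots> = real N" using N by (simp flip: powr_add)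
  finally have "real N powr r * C < real N * e" using assms(1) by (simp add: field_simps)
  then show False using assms(3)[of N] by (simp add: mult.commute)
qed

text \<open>Multiplying the expansion of degree \<open>n + 2\<close> by \<open>a + t\<close> gives
  that of degree \<open>n + 3\<close>, up to the new term
  \<open>(n + 2) * a ^ (n + 1) * t\<^sup>2\<close>; hence the constant grows by \<open>n + 2\<close>
  in each step.\<close>

lemma power_taylor_remainder:
  "\<exists>C\<ge>0. \<forall>a t :: real. \<bar>(a + t) ^ (n + 2) - a ^ (n + 2) - real (n + 2) * a ^ (n + 1) * t\<bar> \<le> C * t\<^sup>2 * (\<bar>a\<bar> + \<bar>t\<bar>) ^ n"
proof (induction n)
  case 0
  show ?case by (intro exI[of _ 1]) (auto simp: power2_eq_square algebra_simps)
next
  case (Suc n)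
  then obtain C where C: "C \<ge> 0"
    "\<And>a t :: real. \<bar>(a + t) ^ (n + 2) - a ^ (n + 2) - real (n + 2) * a ^ (n + 1) * t\<bar> \<le> C * t\<^sup>2 * (\<bar>a\<bar> + \<bar>t\<bar>) ^ n"
    by blast
  show ?case
  proof (intro exI[of _ "C + real (n + 2)"] conjI allI)
    fix a t :: real
    let ?w = "\<bar>a\<bar> + \<bar>t\<bar>"
    let ?R = "(a + t) ^ (n + 2) - a ^ (n + 2) - real (n + 2) * a ^ (n + 1) * t"
    have "(a + t) ^ (Suc n + 2) - a ^ (Suc n + 2) - real (Suc n + 2) * a ^ (Suc n + 1) * t
        = (a + t) * ?R + real (n + 2) * a ^ (n + 1) * t\<^sup>2"
      by (simp add: algebra_simps power2_eq_square)
    also have "\<bar>\<dots>\<bar> \<le> \<bar>a + t\<bar> * \<bar>?R\<bar> + real (n + 2) * \<bar>a\<bar> ^ (n + 1) * t\<^sup>2"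
      by (rule order_trans[OF abs_triangle_ineq]) (simp add: abs_mult power_abs)
    also have "\<dots> \<le> ?w * (C * t\<^sup>2 * ?w ^ n) + real (n + 2) * ?w ^ (n + 1) * t\<^sup>2"
    proof (rule add_mono)
      show "\<bar>a + t\<bar> * \<bar>?R\<bar> \<le> ?w * (C * t\<^sup>2 * ?w ^ n)" by (rule mult_mono[OF _ C(2)]) auto
      show "real (n + 2) * \<bar>a\<bar> ^ (n + 1) * t\<^sup>2 \<le> real (n + 2) * ?w ^ (n + 1) * t\<^sup>2"
        by (rule mult_right_mono, rule mult_left_mono, rule power_mono) auto
    qed
    also have "\<dots> = (C + real (n + 2)) * t\<^sup>2 * ?w ^ Suc n" by (simp add: algebra_simps)
    finally show "\<bar>(a + t) ^ (Suc n + 2) - a ^ (Suc n + 2) - real (Suc n + 2) * a ^ (Suc n + 1) * t\<bar>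
      \<le> (C + real (n + 2)) * t\<^sup>2 * ?w ^ Suc n" .
  qed (use C in simp)
qed

text \<open>Later \<open>a\<close> is a partial sum and \<open>y\<close> the next term. The linear
  term is kept apart because weak nullity makes its integral small; the remainder carries the factor
  \<open>c\<^sup>2\<close>, and this is where square summable coefficients, hence the exponent 2,
  come from.\<close>

lemma even_power_step:
  assumes "even m"
  shows "\<exists>D\<ge>0. \<forall>a y c :: real. \<bar>c\<bar> \<le> 1 \<longrightarrow>
    (a + c * y) ^ (m + 2) \<le> a ^ (m + 2) + real (m + 2) * c * (a ^ (m + 1) * y) + D * c\<^sup>2 * (a ^ (m + 2) + y ^ (m + 2))"
proof -
  obtain C where C: "C \<ge> 0"
    "\<And>a t :: real. \<bar>(a + t) ^ (m + 2) - a ^ (m + 2) - real (m + 2) * a ^ (m + 1) * t\<bar> \<le> C * t\<^sup>2 * (\<bar>a\<bar> + \<bar>t\<bar>) ^ m"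
    using power_taylor_remainder[of m] by blast
  have ev: "even (m + 2)" using assms by simp
  show ?thesis
  \<comment> \<open>The power of 2 comes from bounding \<open>\<bar>a\<bar> + \<bar>y\<bar>\<close>
    by twice the maximum; as the exponent is even, the power of the maximum is one of the
    non-negative numbers \<open>a ^ (m + 2)\<close> and \<open>y ^ (m + 2)\<close>.\<close>
  proof (intro exI[of _ "C * 2 ^ (m + 2)"] conjI allI impI)
    fix a y c :: real assume c: "\<bar>c\<bar> \<le> 1"
    have cy: "\<bar>c * y\<bar> \<le> \<bar>y\<bar>" using c by (simp add: abs_mult mult_left_le_one_le)
    have "y\<^sup>2 * (\<bar>a\<bar> + \<bar>y\<bar>) ^ m \<le> (\<bar>a\<bar> + \<bar>y\<bar>) ^ 2 * (\<bar>a\<bar> + \<bar>y\<bar>) ^ m"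
      by (intro mult_right_mono) (auto simp: abs_le_square_iff[symmetric])
    also have "\<dots> = (\<bar>a\<bar> + \<bar>y\<bar>) ^ (m + 2)" by (simp add: power_add[symmetric] add.commute)
    also have "\<dots> \<le> (2 * max \<bar>a\<bar> \<bar>y\<bar>) ^ (m + 2)" by (intro power_mono) auto
    also have "\<dots> = 2 ^ (m + 2) * max \<bar>a\<bar> \<bar>y\<bar> ^ (m + 2)" by (simp add: power_mult_distrib)
    also have "\<dots> \<le> 2 ^ (m + 2) * (a ^ (m + 2) + y ^ (m + 2))"
      using zero_le_even_power[OF ev, of a] zero_le_even_power[OF ev, of y] power_even_abs[OF ev, of a] power_even_abs[OF ev, of y]
      by (intro mult_left_mono) (auto simp: max_def)
    finally have 1: "y\<^sup>2 * (\<bar>a\<bar> + \<bar>y\<bar>) ^ m \<le> 2 ^ (m + 2) * (a ^ (m + 2) + y ^ (m + 2))" .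
    have "C * (c * y)\<^sup>2 * (\<bar>a\<bar> + \<bar>c * y\<bar>) ^ m \<le> C * (c * y)\<^sup>2 * (\<bar>a\<bar> + \<bar>y\<bar>) ^ m"
      using C(1) cy by (intro mult_left_mono power_mono) auto
    also have "\<dots> = C * c\<^sup>2 * (y\<^sup>2 * (\<bar>a\<bar> + \<bar>y\<bar>) ^ m)" by (simp add: power_mult_distrib)
    also have "\<dots> \<le> C * c\<^sup>2 * (2 ^ (m + 2) * (a ^ (m + 2) + y ^ (m + 2)))"
      using C(1) 1 by (intro mult_left_mono) auto
    finally have 2: "C * (c * y)\<^sup>2 * (\<bar>a\<bar> + \<bar>c * y\<bar>) ^ m \<le> C * 2 ^ (m + 2) * c\<^sup>2 * (a ^ (m + 2) + y ^ (m + 2))"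
      by (simp add: mult_ac)
    have "real (m + 2) * a ^ (m + 1) * (c * y) = real (m + 2) * c * (a ^ (m + 1) * y)" by simp
    then show "(a + c * y) ^ (m + 2) \<le> a ^ (m + 2) + real (m + 2) * c * (a ^ (m + 1) * y) + C * 2 ^ (m + 2) * c\<^sup>2 * (a ^ (m + 2) + y ^ (m + 2))"
      using C(2)[of a "c * y"] 2 by linarith
  qed (use C in simp)
qed

section \<open>Functionals and operators on \<open>Lp\<close>\<close>

lemma functional_sum:
  assumes "Lp_functional p psi" "\<And>i. i < N \<Longrightarrow> y i \<in> Lp p" "0 \<le> p"
  shows "psi (\<lambda>t. \<Sum>i<(N::nat). y i t) = (\<Sum>i<N. psi (y i))"
  using assms(2)
proof (induction N)
  case 0
  have "psi (vscale 0 (\<lambda>t. 0)) = 0 * psi (\<lambda>t. 0)" using assms(1) Lp_zero unfolding Lp_functional_def by blast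
  then show ?case by (simp add: vscale_def)
next
  case (Suc N)
  have "psi (vadd (\<lambda>t. \<Sum>i<N. y i t) (y N)) = psi (\<lambda>t. \<Sum>i<N. y i t) + psi (y N)"
    using assms(1) Lp_sum[of "{..<N}" y p] Suc.prems assms(3) unfolding Lp_functional_def by simp
  then show ?case using Suc by (simp add: vadd_def)
qed

lemma functional_diff:
  assumes "Lp_functional p psi" "f \<in> Lp p" "g \<in> Lp p" "0 \<le> p"
  shows "psi (\<lambda>t. f t - g t) = psi f - psi g"
proof -
  have "psi (vadd (\<lambda>t. f t - g t) g) = psi (\<lambda>t. f t - g t) + psi g"
    using assms Lp_diff[OF assms(2,3,4)] unfolding Lp_functional_def by blast
  then show ?thesis by (simp add: vadd_def)
qed

lemma functional_bound:
  assumes "Lp_functional p psi"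
  obtains C where "C > 0" "\<And>f. f \<in> Lp p \<Longrightarrow> \<bar>psi f\<bar> \<le> C * Lp_norm p f"
proof -
  obtain C where C: "\<And>f. f \<in> Lp p \<Longrightarrow> \<bar>psi f\<bar> \<le> C * Lp_norm p f" using assms unfolding Lp_functional_def by blast
  show ?thesis
  proof (rule that[of "\<bar>C\<bar> + 1"])
    fix f assume "f \<in> Lp p"
    then have "\<bar>psi f\<bar> \<le> C * Lp_norm p f" by (rule C)
    also have "\<dots> \<le> (\<bar>C\<bar> + 1) * Lp_norm p f" by (intro mult_right_mono) auto
    finally show "\<bar>psi f\<bar> \<le> (\<bar>C\<bar> + 1) * Lp_norm p f" .
  qed simp
qed

lemma Lp_opD:
  assumes "Lp_op p T" "f \<in> Lp p"
  shows "T f \<in> Lp p"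
  using assms unfolding Lp_op_def by blast

lemma Lp_op_add:
  assumes "Lp_op p T" "f \<in> Lp p" "g \<in> Lp p"
  shows "Lp_norm p (\<lambda>t. T (\<lambda>t. f t + g t) t - (T f t + T g t)) = 0"
proof -
  have "Lp_norm p (vsub (T (vadd f g)) (vadd (T f) (T g))) = 0" using assms unfolding Lp_op_def by blast
  then show ?thesis by (simp add: vsub_def vadd_def)
qed

lemma Lp_op_scale:
  assumes "Lp_op p T" "f \<in> Lp p"
  shows "Lp_norm p (\<lambda>t. T (\<lambda>t. c * f t) t - c * T f t) = 0"
proof -
  have "Lp_norm p (vsub (T (vscale c f)) (vscale c (T f))) = 0" using assms unfolding Lp_op_def by blast
  then show ?thesis by (simp add: vsub_def vscale_def)
qed

lemma Lp_op_bound: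
  assumes "Lp_op p T"
  obtains C where "C > 0" "\<And>f. f \<in> Lp p \<Longrightarrow> Lp_norm p (T f) \<le> C * Lp_norm p f"
proof -
  obtain C where C: "\<And>f. f \<in> Lp p \<Longrightarrow> Lp_norm p (T f) \<le> C * Lp_norm p f" using assms unfolding Lp_op_def by blast
  show ?thesis
  proof (rule that[of "\<bar>C\<bar> + 1"])
    fix f assume "f \<in> Lp p"
    then have "Lp_norm p (T f) \<le> C * Lp_norm p f" by (rule C)
    also have "\<dots> \<le> (\<bar>C\<bar> + 1) * Lp_norm p f" by (intro mult_right_mono) auto
    finally show "Lp_norm p (T f) \<le> (\<bar>C\<bar> + 1) * Lp_norm p f" .
  qed simp
qed

lemma Lp_norm_eq_of_diff_null:
  assumes "conj_exp p q" "f \<in> Lp p" "g \<in> Lp p" "Lp_norm p (\<lambda>t. f t - g t) = 0"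
  shows "Lp_norm p f = Lp_norm p g"
  using Lp_norm_le_diff[OF assms(1-3)] Lp_norm_le_diff[OF assms(1,3,2)] assms(4) Lp_norm_minus_commute[of p f g] by linarith

lemma Lp_op_diff:
  assumes pq: "conj_exp p q" and T: "Lp_op p T" and f: "f \<in> Lp p" "g \<in> Lp p"
  shows "Lp_norm p (\<lambda>t. T f t - T g t) = Lp_norm p (T (\<lambda>t. f t - g t))"
proof -
  note c = conj_expD[OF pq]
  have d: "(\<lambda>t. f t - g t) \<in> Lp p" using f c by auto
  have 0: "Lp_norm p (\<lambda>t. T f t - (T (\<lambda>t. f t - g t) t + T g t)) = 0"
    using Lp_op_add[OF T d f(2)] by simp
  have Td: "T (\<lambda>t. f t - g t) \<in> Lp p" "T f \<in> Lp p" "T g \<in> Lp p" using Lp_opD[OF T] f d by auto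
  show ?thesis
    by (rule Lp_norm_eq_of_diff_null[OF pq]) (use Td c 0 in \<open>auto simp: algebra_simps\<close>)
qed

text \<open>Linearity in \<open>Lp_op\<close> holds only up to null functions, so finite additivity
  is an induction that collects these null errors.\<close>

lemma Lp_op_sum:
  assumes pq: "conj_exp p q" and T: "Lp_op p T" and y: "\<And>i. y i \<in> Lp p"
  shows "Lp_norm p (\<lambda>t. T (\<lambda>t. \<Sum>i<(N::nat). y i t) t - (\<Sum>i<N. T (y i) t)) = 0"
proof (induction N)
  case 0
  show ?case using Lp_op_scale[OF T Lp_zero, of 0] by simp
next
  case (Suc N)
  note c = conj_expD[OF pq]
  let ?s = "\<lambda>t. \<Sum>i<N. y i t" and ?r = "\<lambda>t. \<Sum>i<N. T (y i) t"
  have s: "?s \<in> Lp p" "?r \<in> Lp p" "T ?s \<in> Lp p" by (intro Lp_sum y Lp_opD[OF T]; use c in simp)+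
  have s': "T (\<lambda>t. ?s t + y N t) \<in> Lp p" by (intro Lp_opD[OF T] Lp_add s y) (use c in auto)
  note TN = Lp_opD[OF T y[of N]]
  have "Lp_norm p (\<lambda>t. (T (\<lambda>t. ?s t + y N t) t - (T ?s t + T (y N) t)) + (T ?s t - ?r t)) \<le>
      Lp_norm p (\<lambda>t. T (\<lambda>t. ?s t + y N t) t - (T ?s t + T (y N) t)) + Lp_norm p (\<lambda>t. T ?s t - ?r t)"
    by (rule Lp_norm_triangle[OF pq]; intro Lp_diff Lp_add s s' TN; use c in simp)
  also have "\<dots> = 0" using Suc Lp_op_add[OF T s(1) y[of N]] by simp
  finally show ?case by (simp add: algebra_simps order_antisym)
qed

lemma Lp_op_sum_op:
  assumes pq: "conj_exp p q" and T: "Lp_op p T" "Lp_op p T'"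
  shows "Lp_op p (\<lambda>f t. T f t + T' f t)"
proof -
  note c = conj_expD[OF pq]
  obtain C where C: "C > 0" "\<And>f. f \<in> Lp p \<Longrightarrow> Lp_norm p (T f) \<le> C * Lp_norm p f" using Lp_op_bound[OF T(1)] by metis
  obtain D where D: "D > 0" "\<And>f. f \<in> Lp p \<Longrightarrow> Lp_norm p (T' f) \<le> D * Lp_norm p f" using Lp_op_bound[OF T(2)] by metis
  note TD = Lp_opD[OF T(1)] and TD' = Lp_opD[OF T(2)]
  have two: "Lp_norm p (\<lambda>t. u t + v t) = 0" if "u \<in> Lp p" "v \<in> Lp p" "Lp_norm p u = 0" "Lp_norm p v = 0" for u v
    using Lp_norm_triangle[OF pq that(1,2)] that(3,4) by (simp add: order_antisym)
  show ?thesis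
    unfolding Lp_op_def
  proof (intro conjI ballI allI)
    fix f assume f: "f \<in> Lp p"
    show "(\<lambda>t. T f t + T' f t) \<in> Lp p" by (intro Lp_add TD TD' f) (use c(1) in simp)
  next
    fix f g assume fg: "f \<in> Lp p" "g \<in> Lp p"
    have s: "(\<lambda>t. f t + g t) \<in> Lp p" using fg c by auto
    have "Lp_norm p (\<lambda>t. (T (\<lambda>t. f t + g t) t - (T f t + T g t)) + (T' (\<lambda>t. f t + g t) t - (T' f t + T' g t))) = 0"
      by (rule two[OF _ _ Lp_op_add[OF T(1) fg] Lp_op_add[OF T(2) fg]]; intro Lp_diff Lp_add TD TD' s fg; use c in simp)
    then show "Lp_norm p (vsub (\<lambda>t. T (vadd f g) t + T' (vadd f g) t) (vadd (\<lambda>t. T f t + T' f t) (\<lambda>t. T g t + T' g t))) = 0"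
      by (simp add: vsub_def vadd_def algebra_simps)
  next
    fix f k assume f: "f \<in> Lp p"
    have s: "(\<lambda>t. k * f t) \<in> Lp p" using f by auto
    have "Lp_norm p (\<lambda>t. (T (\<lambda>t. k * f t) t - k * T f t) + (T' (\<lambda>t. k * f t) t - k * T' f t)) = 0"
      by (rule two[OF _ _ Lp_op_scale[OF T(1) f] Lp_op_scale[OF T(2) f]]; intro Lp_diff Lp_scale TD TD' s f; use c in simp)
    then show "Lp_norm p (vsub (\<lambda>t. T (vscale k f) t + T' (vscale k f) t) (vscale k (\<lambda>t. T f t + T' f t))) = 0"
      by (simp add: vsub_def vscale_def algebra_simps)
  next
    have "Lp_norm p (\<lambda>t. T f t + T' f t) \<le> (C + D) * Lp_norm p f" if f: "f \<in> Lp p" for f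
      using Lp_norm_triangle[OF pq TD[OF f] TD'[OF f]] C(2)[OF f] D(2)[OF f] by (simp add: distrib_right)
    then show "\<exists>C. \<forall>f\<in>Lp p. Lp_norm p (\<lambda>t. T f t + T' f t) \<le> C * Lp_norm p f" by blast
  qed
qed

lemma conj_exp_two: "conj_exp 2 2"
  by (simp add: conj_exp_def)

section \<open>Limits along the ultrafilter\<close>

locale selective_ultrafilter =
  fixes U :: "nat filter"
  assumes nonprincipal: "nonprincipal_ultrafilter U" and selective: "selective U"
begin

lemma U_ne_bot [simp]: "U \<noteq> bot"
  using nonprincipal by (simp add: nonprincipal_ultrafilter_def)

lemma ultra: "eventually P U \<or> eventually (\<lambda>n. \<not> P n) U"
proof -
  have "eventually (\<lambda>n. n \<in> Collect P) U \<or> eventually (\<lambda>n. n \<notin> Collect P) U"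
    using nonprincipal unfolding nonprincipal_ultrafilter_def by blast
  then show ?thesis by simp
qed

lemma U_le_sequentially: "U \<le> sequentially"
proof (rule filter_leI)
  fix P :: "nat \<Rightarrow> bool"
  assume "eventually P sequentially"
  then obtain N where N: "\<And>n. n \<ge> N \<Longrightarrow> P n" by (auto simp: eventually_sequentially)
  have "eventually (\<lambda>n. \<forall>m\<in>{..<N}. n \<noteq> m) U"
    by (subst eventually_ball_finite_distrib)
       (use nonprincipal in \<open>auto simp: nonprincipal_ultrafilter_def\<close>)
  then show "eventually P U" by eventually_elim (use N not_le in blast)
qed

lemma tendsto_along_U: "(f \<longlongrightarrow> l) sequentially \<Longrightarrow> (f \<longlongrightarrow> l) U"
  by (rule tendsto_mono[OF U_le_sequentially])

lemma eventually_ge_U: "eventually (\<lambda>n. n \<ge> (m::nat)) U"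
  using U_le_sequentially eventually_ge_at_top[of m] by (simp add: le_filter_def)

text \<open>Compactness of an interval gives a cluster point of the image filter, and the
  ultrafilter property turns a cluster point into a limit. So \<open>Lim\<close> is a genuine limit
  on every bounded sequence, which makes \<open>up_norm\<close> and \<open>pair\<close> well
  behaved.\<close>

lemma bounded_tendsto:
  fixes f :: "nat \<Rightarrow> real"
  assumes "\<And>n. \<bar>f n\<bar> \<le> B"
  shows "(f \<longlongrightarrow> Lim U f) U"
proof -
  have "filtermap f U \<noteq> bot" by (simp add: filtermap_bot_iff)
  moreover have "eventually (\<lambda>y. y \<in> {-B..B}) (filtermap f U)"
    using assms by (auto simp: eventually_filtermap abs_le_iff minus_le_iff intro!: always_eventually)
  ultimately obtain l where l: "inf (nhds l) (filtermap f U) \<noteq> bot"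
    using compact_filter[of "{-B..B}"] compact_Icc[of "-B" B] by blast
  have "(f \<longlongrightarrow> l) U"
  proof (rule topological_tendstoI)
    fix S assume S: "open S" "l \<in> S"
    show "eventually (\<lambda>n. f n \<in> S) U"
    proof (rule ccontr)
      assume "\<not> eventually (\<lambda>n. f n \<in> S) U"
      then have "eventually (\<lambda>n. f n \<notin> S) U" using ultra[of "\<lambda>n. f n \<in> S"] by blast
      then have "eventually (\<lambda>y. y \<notin> S) (filtermap f U)" by (simp add: eventually_filtermap)
      moreover have "eventually (\<lambda>y. y \<in> S) (nhds l)" using S by (rule eventually_nhds_in_open)
      ultimately have "eventually (\<lambda>y. False) (inf (nhds l) (filtermap f U))"
        unfolding eventually_inf by blast
      then show False using l by (simp add: eventually_False)
    qed
  qed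
  then show ?thesis using tendsto_Lim[OF U_ne_bot \<open>(f \<longlongrightarrow> l) U\<close>] by simp
qed

lemma Lim_eq: "(f \<longlongrightarrow> l) U \<Longrightarrow> Lim U f = (l::real)"
  by (rule tendsto_Lim) simp_all

end

section \<open>The ultrapower\<close>

lemma up_spaceI:
  assumes "\<And>n. x n \<in> Lp p" "\<And>n. Lp_norm p (x n) \<le> B"
  shows "x \<in> up_space p"
  using assms by (auto simp: up_space_def)

lemma up_spaceD: "x \<in> up_space p \<Longrightarrow> x n \<in> Lp p"
  by (auto simp: up_space_def)

lemma up_space_bound:
  assumes "x \<in> up_space p"
  obtains B where "0 < B" "\<And>n. Lp_norm p (x n) \<le> B"
proof -
  obtain B where B: "\<And>n. Lp_norm p (x n) \<le> B" using assms by (auto simp: up_space_def)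
  show ?thesis by (rule that[of "max B 1"]) (use B in \<open>auto simp: le_max_iff_disj\<close>)
qed

lemma up_space_const: "f \<in> Lp p \<Longrightarrow> (\<lambda>n. f) \<in> up_space p"
  by (auto simp: up_space_def)

lemma up_space_add:
  assumes "conj_exp p q" "x \<in> up_space p" "y \<in> up_space p"
  shows "(\<lambda>n t. x n t + y n t) \<in> up_space p"
proof -
  obtain A where A: "\<And>n. Lp_norm p (x n) \<le> A" using up_space_bound[OF assms(2)] by metis
  obtain B where B: "\<And>n. Lp_norm p (y n) \<le> B" using up_space_bound[OF assms(3)] by metis
  show ?thesis
  proof (rule up_spaceI[where B="A + B"])
    fix n
    show "(\<lambda>t. x n t + y n t) \<in> Lp p"
      using up_spaceD[OF assms(2)] up_spaceD[OF assms(3)] conj_expD(1)[OF assms(1)] by auto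
    show "Lp_norm p (\<lambda>t. x n t + y n t) \<le> A + B"
      using Lp_norm_triangle[OF assms(1) up_spaceD[OF assms(2)] up_spaceD[OF assms(3)], of n n] A[of n] B[of n]
      by linarith
  qed
qed

lemma up_space_scale:
  assumes "0 < p" "x \<in> up_space p"
  shows "(\<lambda>n t. c * x n t) \<in> up_space p"
proof -
  obtain B where B: "\<And>n. Lp_norm p (x n) \<le> B" using up_space_bound[OF assms(2)] by metis
  show ?thesis
    by (rule up_spaceI[where B="\<bar>c\<bar> * B"])
       (use up_spaceD[OF assms(2)] B in \<open>auto simp: Lp_norm_scale[OF assms(1)] intro!: mult_left_mono\<close>)
qed

lemma up_space_diff:
  assumes "conj_exp p q" "x \<in> up_space p" "y \<in> up_space p"
  shows "(\<lambda>n t. x n t - y n t) \<in> up_space p"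
  using up_space_add[OF assms(1,2) up_space_scale[OF _ assms(3), of "-1"]] conj_expD(1)[OF assms(1)]
  by simp

lemma up_space_bounded:
  assumes "\<And>n. x n \<in> borel_measurable mu" "\<And>n t. \<bar>x n t\<bar> \<le> K" "0 < p"
  shows "x \<in> up_space p"
  by (rule up_spaceI[where B=K]) (use assms Lp_norm_bounded[OF assms(1,2,3)] in \<open>auto intro: Lp_bounded[where K=K]\<close>)

lemma up_space_dominated:
  assumes "x \<in> up_space p" "\<And>n. y n \<in> borel_measurable mu" "\<And>n t. \<bar>y n t\<bar> \<le> \<bar>x n t\<bar>" "0 < p"
  shows "y \<in> up_space p"
proof -
  obtain B where B: "\<And>n. Lp_norm p (x n) \<le> B" using up_space_bound[OF assms(1)] by metis
  show ?thesis
  proof (rule up_spaceI[where B=B])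
    fix n
    show "y n \<in> Lp p"
      using Lp_dominated[OF up_spaceD[OF assms(1)] assms(2) assms(3)] assms(4) by auto
    show "Lp_norm p (y n) \<le> B"
      using Lp_norm_mono[OF up_spaceD[OF assms(1)] assms(2) assms(3) assms(4)] B order_trans by blast
  qed
qed

lemma up_space_meas [measurable_dest]: "x \<in> up_space p \<Longrightarrow> x n \<in> borel_measurable mu"
  using up_spaceD LpD(1) by blast

lemma up_space_abs: "x \<in> up_space p \<Longrightarrow> (\<lambda>n t. \<bar>x n t\<bar>) \<in> up_space p"
  by (auto simp: up_space_def)

lemma up_space_Jmap:
  assumes "conj_exp p q" "x \<in> up_space p"
  shows "(\<lambda>n. Jmap p (x n)) \<in> up_space q"
proof -
  obtain B where B: "\<And>n. Lp_norm p (x n) \<le> B" using up_space_bound[OF assms(2)] by metis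
  show ?thesis
    by (rule up_spaceI[where B="B powr (p - 1)"])
       (use up_spaceD[OF assms(2)] B assms(1) conj_expD(1)[OF assms(1)] in
         \<open>auto simp: Lp_norm_Jmap[OF assms(1)] intro!: powr_mono2\<close>)
qed

lemma pairing_bound:
  assumes "conj_exp p q" "x \<in> up_space p" "h \<in> up_space q"
  obtains B where "\<And>n m. \<bar>\<integral>t. x n t * h m t \<partial>mu\<bar> \<le> B"
proof -
  obtain A where A: "0 < A" "\<And>n. Lp_norm p (x n) \<le> A" using up_space_bound[OF assms(2)] by metis
  obtain B where B: "0 < B" "\<And>n. Lp_norm q (h n) \<le> B" using up_space_bound[OF assms(3)] by metis
  show ?thesis
  proof (rule that[of "A * B"])
    fix n m
    have "\<bar>\<integral>t. x n t * h m t \<partial>mu\<bar> \<le> Lp_norm p (x n) * Lp_norm q (h m)"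
      by (rule Holder[OF assms(1) up_spaceD[OF assms(2)] up_spaceD[OF assms(3)]])
    also have "\<dots> \<le> A * B" by (intro mult_mono) (use A B in auto)
    finally show "\<bar>\<integral>t. x n t * h m t \<partial>mu\<bar> \<le> A * B" .
  qed
qed

context selective_ultrafilter
begin

lemma up_norm_tendsto:
  assumes "x \<in> up_space p"
  shows "((\<lambda>n. Lp_norm p (x n)) \<longlongrightarrow> up_norm p U x) U"
proof -
  obtain B where "\<And>n. Lp_norm p (x n) \<le> B" using up_space_bound[OF assms] by metis
  then show ?thesis unfolding up_norm_def by (intro bounded_tendsto[where B=B]) auto
qed

lemma up_norm_eq_0_iff:
  assumes "x \<in> up_space p"
  shows "up_norm p U x = 0 \<longleftrightarrow> ((\<lambda>n. Lp_norm p (x n)) \<longlongrightarrow> 0) U"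
  using up_norm_tendsto[OF assms] Lim_eq up_norm_def by metis

lemma up_norm_nonneg:
  assumes "x \<in> up_space p"
  shows "0 \<le> up_norm p U x"
  by (rule tendsto_lowerbound[OF up_norm_tendsto[OF assms]]) auto

lemma up_norm_le:
  assumes "x \<in> up_space p" "eventually (\<lambda>n. Lp_norm p (x n) \<le> e) U"
  shows "up_norm p U x \<le> e"
  by (rule tendsto_upperbound[OF up_norm_tendsto[OF assms(1)] assms(2)]) simp

lemma up_norm_less:
  assumes "x \<in> up_space p" "up_norm p U x < e"
  shows "eventually (\<lambda>n. Lp_norm p (x n) < e) U"
  using up_norm_tendsto[OF assms(1)] assms(2) by (rule order_tendstoD)

text \<open>Each \<open>h\<close> from the ultrapower of \<open>Lp q\<close> acts on the ultrapower
  of \<open>Lp p\<close>. These functionals are explicit and numerous enough to separate the points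
  of the bands, so they stand in for the full dual space.\<close>

definition pair :: "(nat \<Rightarrow> real \<Rightarrow> real) \<Rightarrow> (nat \<Rightarrow> real \<Rightarrow> real) \<Rightarrow> real" where
  "pair x h = Lim U (\<lambda>n. \<integral>t. x n t * h n t \<partial>mu)"

lemma pair_tendsto:
  assumes "conj_exp p q" "x \<in> up_space p" "h \<in> up_space q"
  shows "((\<lambda>n. \<integral>t. x n t * h n t \<partial>mu) \<longlongrightarrow> pair x h) U"
proof -
  obtain B where "\<And>n m. \<bar>\<integral>t. x n t * h m t \<partial>mu\<bar> \<le> B" using pairing_bound[OF assms] by metis
  then show ?thesis unfolding pair_def by (intro bounded_tendsto[where B=B]) auto
qed

lemma pair_eqI: "((\<lambda>n. \<integral>t. x n t * h n t \<partial>mu) \<longlongrightarrow> l) U \<Longrightarrow> pair x h = l"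
  unfolding pair_def by (rule Lim_eq)

lemma pair_le:
  assumes "conj_exp p q" "x \<in> up_space p" "h \<in> up_space q"
  shows "\<bar>pair x h\<bar> \<le> up_norm p U x * up_norm q U h"
proof (rule tendsto_le)
  show "((\<lambda>n. \<bar>\<integral>t. x n t * h n t \<partial>mu\<bar>) \<longlongrightarrow> \<bar>pair x h\<bar>) U"
    by (rule tendsto_rabs[OF pair_tendsto[OF assms]])
  show "((\<lambda>n. Lp_norm p (x n) * Lp_norm q (h n)) \<longlongrightarrow> up_norm p U x * up_norm q U h) U"
    by (intro tendsto_mult up_norm_tendsto assms)
  show "eventually (\<lambda>n. \<bar>\<integral>t. x n t * h n t \<partial>mu\<bar> \<le> Lp_norm p (x n) * Lp_norm q (h n)) U"
    using Holder[OF assms(1) up_spaceD[OF assms(2)] up_spaceD[OF assms(3)]] by simp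
qed simp

lemma pair_add_left:
  assumes "conj_exp p q" "x \<in> up_space p" "y \<in> up_space p" "h \<in> up_space q"
  shows "pair (\<lambda>n t. x n t + y n t) h = pair x h + pair y h"
proof (rule pair_eqI)
  have "(\<integral>t. (x n t + y n t) * h n t \<partial>mu) = (\<integral>t. x n t * h n t \<partial>mu) + (\<integral>t. y n t * h n t \<partial>mu)" for n
    using Lp_mult_integrable[OF assms(1) up_spaceD[OF assms(2)] up_spaceD[OF assms(4)]]
      Lp_mult_integrable[OF assms(1) up_spaceD[OF assms(3)] up_spaceD[OF assms(4)]]
    by (simp add: distrib_right)
  then show "((\<lambda>n. \<integral>t. (x n t + y n t) * h n t \<partial>mu) \<longlongrightarrow> pair x h + pair y h) U"
    using tendsto_add[OF pair_tendsto[OF assms(1,2,4)] pair_tendsto[OF assms(1,3,4)]] by simp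
qed

lemma pair_scale_left:
  assumes "conj_exp p q" "x \<in> up_space p" "h \<in> up_space q"
  shows "pair (\<lambda>n t. c * x n t) h = c * pair x h"
  using tendsto_mult_left[OF pair_tendsto[OF assms], of c]
  by (intro pair_eqI) (simp add: mult.assoc)

lemma pair_diff_left:
  assumes "conj_exp p q" "x \<in> up_space p" "y \<in> up_space p" "h \<in> up_space q"
  shows "pair (\<lambda>n t. x n t - y n t) h = pair x h - pair y h"
  using pair_add_left[OF assms(1,2) up_space_scale[OF _ assms(3), of "-1"] assms(4)]
    pair_scale_left[OF assms(1,3,4), of "-1"] conj_expD(1)[OF assms(1)] by simp

lemma pair_commute: "pair x h = pair h x"
  by (simp add: pair_def mult.commute)

lemma pair_null:
  assumes "conj_exp p q" "x \<in> up_space p" "h \<in> up_space q" "up_norm p U x = 0"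
  shows "pair x h = 0"
  using pair_le[OF assms(1-3)] assms(4) by simp

lemma up_norm_triangle:
  assumes "conj_exp p q" "x \<in> up_space p" "y \<in> up_space p"
  shows "up_norm p U (\<lambda>n t. x n t + y n t) \<le> up_norm p U x + up_norm p U y"
  by (rule tendsto_le[OF U_ne_bot tendsto_add[OF up_norm_tendsto[OF assms(2)] up_norm_tendsto[OF assms(3)]]
      up_norm_tendsto[OF up_space_add[OF assms]]])
     (use Lp_norm_triangle[OF assms(1) up_spaceD[OF assms(2)] up_spaceD[OF assms(3)]] in simp)

lemma up_norm_scale:
  assumes "0 < p" "x \<in> up_space p"
  shows "up_norm p U (\<lambda>n t. c * x n t) = \<bar>c\<bar> * up_norm p U x"
  unfolding up_norm_def[of p U "\<lambda>n t. c * x n t"]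
  by (rule Lim_eq) (use tendsto_mult_left[OF up_norm_tendsto[OF assms(2)], of "\<bar>c\<bar>"] in
      \<open>simp add: Lp_norm_scale[OF assms(1)]\<close>)

lemma up_norm_zero [simp]: "up_norm p U (\<lambda>n t. 0) = 0"
  unfolding up_norm_def by (rule Lim_eq) simp

lemma up_norm_minus_commute: "up_norm p U (\<lambda>n t. x n t - y n t) = up_norm p U (\<lambda>n t. y n t - x n t)"
  unfolding up_norm_def by (subst Lp_norm_minus_commute) simp

end

section \<open>Truncation and weak limits\<close>

definition trunc :: "real \<Rightarrow> real \<Rightarrow> real" where
  "trunc K v = max (- K) (min K v)"

lemma trunc_measurable [measurable]:
  "f \<in> borel_measurable M \<Longrightarrow> (\<lambda>t. trunc K (f t)) \<in> borel_measurable M"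
  unfolding trunc_def by simp

lemma abs_trunc: "0 \<le> K \<Longrightarrow> \<bar>trunc K v\<bar> = min K \<bar>v\<bar>"
  by (auto simp: trunc_def max_def min_def)

lemma abs_diff_trunc_le: "0 \<le> K \<Longrightarrow> \<bar>b\<bar> \<le> K \<Longrightarrow> \<bar>v - trunc K v\<bar> \<le> \<bar>v - b\<bar>"
  by (auto simp: trunc_def max_def min_def)

lemma abs_diff_trunc_le_abs: "0 \<le> K \<Longrightarrow> \<bar>v - trunc K v\<bar> \<le> \<bar>v\<bar>"
  using abs_diff_trunc_le[of K 0 v] by simp

text \<open>Superadditivity of the p-th power turns the part of \<open>trunc k v\<close> above
  height \<open>m\<close> into a difference of truncated p-th powers. After integration the tail is
  a difference of two values of a monotone function of the height.\<close>

lemma trunc_diff_powr: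
  assumes "0 \<le> m" "m \<le> k" "1 \<le> p"
  shows "\<bar>trunc k v - trunc m (trunc k v)\<bar> powr p \<le> \<bar>trunc k v\<bar> powr p - \<bar>trunc m v\<bar> powr p"
proof -
  have "\<bar>trunc k v - trunc m (trunc k v)\<bar> = min k \<bar>v\<bar> - min m \<bar>v\<bar>"
    using assms by (auto simp: trunc_def max_def min_def)
  moreover have "(min k \<bar>v\<bar> - min m \<bar>v\<bar>) powr p + (min m \<bar>v\<bar>) powr p \<le> (min k \<bar>v\<bar>) powr p"
    using powr_superadd[of "min k \<bar>v\<bar> - min m \<bar>v\<bar>" "min m \<bar>v\<bar>" p] assms by (auto simp: min_def)
  ultimately show ?thesis using assms by (simp add: abs_trunc)
qed

text \<open>Chebyshev's argument: where the truncation acts, \<open>\<bar>v\<bar>\<close> exceeds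
  \<open>k\<close>, so \<open>\<bar>v\<bar> powr (1 - p)\<close> is at most
  \<open>k powr (1 - p)\<close>.\<close>

lemma abs_diff_trunc_le_powr:
  assumes "0 < k" "1 < p"
  shows "\<bar>v - trunc k v\<bar> \<le> k powr (1 - p) * \<bar>v\<bar> powr p"
proof (cases "\<bar>v\<bar> \<le> k")
  case True
  then have "v - trunc k v = 0" by (auto simp: trunc_def)
  then show ?thesis by simp
next
  case False
  have "\<bar>v - trunc k v\<bar> \<le> \<bar>v\<bar>" using assms by (intro abs_diff_trunc_le_abs) simp
  also have "\<dots> = \<bar>v\<bar> powr (1 - p) * \<bar>v\<bar> powr p" using False assms by (simp flip: powr_add)
  also have "\<dots> \<le> k powr (1 - p) * \<bar>v\<bar> powr p"
    using False assms by (intro mult_right_mono powr_mono2') auto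
  finally show ?thesis .
qed

lemma trunc_Lp:
  assumes "f \<in> Lp p" "0 \<le> K" "0 \<le> p"
  shows "(\<lambda>t. trunc K (f t)) \<in> Lp p" "(\<lambda>t. f t - trunc K (f t)) \<in> Lp p"
  using Lp_dominated[OF assms(1), of "\<lambda>t. trunc K (f t)"] LpD(1)[OF assms(1)] assms
    Lp_dominated[OF assms(1), of "\<lambda>t. f t - trunc K (f t)"]
  by (auto simp: abs_trunc abs_diff_trunc_le_abs)

lemma trunc_Lp_norm_tendsto:
  assumes "f \<in> Lp p" "0 < p"
  shows "(\<lambda>k. Lp_norm p (\<lambda>t. f t - trunc (real k) (f t))) \<longlonglongrightarrow> 0"
proof -
  note [measurable] = LpD(1)[OF assms(1)]
  have "(\<lambda>k. \<integral>t. \<bar>f t - trunc (real k) (f t)\<bar> powr p \<partial>mu) \<longlonglongrightarrow> (\<integral>t. 0 \<partial>mu)"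
  proof (rule integral_dominated_convergence[where w="\<lambda>t. \<bar>f t\<bar> powr p"])
    show "AE t in mu. (\<lambda>k. \<bar>f t - trunc (real k) (f t)\<bar> powr p) \<longlonglongrightarrow> 0"
    proof (rule AE_I2)
      fix t
      obtain N where N: "\<bar>f t\<bar> \<le> real N" using real_arch_simple by blast
      have "eventually (\<lambda>k. \<bar>f t - trunc (real k) (f t)\<bar> powr p = 0) sequentially"
        using eventually_ge_at_top[of N]
        by eventually_elim (use N in \<open>auto simp: trunc_def max_def min_def\<close>)
      then show "(\<lambda>k. \<bar>f t - trunc (real k) (f t)\<bar> powr p) \<longlonglongrightarrow> 0"
        by (rule tendsto_eventually)
    qed
    show "AE t in mu. norm (\<bar>f t - trunc (real k) (f t)\<bar> powr p) \<le> \<bar>f t\<bar> powr p" for k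
      using assms by (auto intro!: powr_mono2 abs_diff_trunc_le_abs)
  qed (use assms in auto)
  then have "(\<lambda>k. (\<integral>t. \<bar>f t - trunc (real k) (f t)\<bar> powr p \<partial>mu) powr (1 / p)) \<longlonglongrightarrow> 0 powr (1 / p)"
    by (intro tendsto_powr') (use assms in auto)
  then show ?thesis by (simp add: Lp_norm_def)
qed

text \<open>Only bounded test functions occur, so that weak limits can be identified from integrals
  over sets. Density and norm boundedness extend the convergence to all of \<open>Lp q\<close>, and
  later it is extended to all abstract functionals.\<close>

definition wnull :: "real \<Rightarrow> nat filter \<Rightarrow> (nat \<Rightarrow> real \<Rightarrow> real) \<Rightarrow> bool" where
  "wnull p U x \<longleftrightarrow> x \<in> up_space p \<and>
     (\<forall>g K. g \<in> borel_measurable mu \<longrightarrow> (\<forall>t. \<bar>g t\<bar> \<le> K) \<longrightarrow>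
        ((\<lambda>n. \<integral>t. x n t * g t \<partial>mu) \<longlongrightarrow> 0) U)"

lemma wnullD: "wnull p U x \<Longrightarrow> x \<in> up_space p"
  by (simp add: wnull_def)

lemma (in selective_ultrafilter) wnull_Lq:
  assumes "conj_exp p q" "wnull p U x" "g \<in> Lp q"
  shows "((\<lambda>n. \<integral>t. x n t * g t \<partial>mu) \<longlongrightarrow> 0) U"
proof (rule tendstoI)
  fix e :: real assume e: "e > 0"
  note c = conj_expD[OF assms(1)]
  have x: "x \<in> up_space p" using assms(2) by (rule wnullD)
  obtain B where B: "0 < B" "\<And>n. Lp_norm p (x n) \<le> B" using up_space_bound[OF x] by metis
  have "eventually (\<lambda>k. Lp_norm q (\<lambda>t. g t - trunc (real k) (g t)) < e / (2 * B)) sequentially"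
    using trunc_Lp_norm_tendsto[OF assms(3)] c e B by (intro order_tendstoD) auto
  then obtain k :: nat where k: "Lp_norm q (\<lambda>t. g t - trunc (real k) (g t)) < e / (2 * B)"
    by (auto simp: eventually_sequentially)
  let ?b = "\<lambda>t. trunc (real k) (g t)"
  have b: "?b \<in> Lp q" "(\<lambda>t. g t - ?b t) \<in> Lp q" using trunc_Lp[OF assms(3)] c by auto
  have "((\<lambda>n. \<integral>t. x n t * ?b t \<partial>mu) \<longlongrightarrow> 0) U"
    using assms(2)[unfolded wnull_def, THEN conjunct2, rule_format, of ?b "real k"]
      trunc_measurable[OF LpD(1)[OF assms(3)]] by (simp add: abs_trunc)
  then have "eventually (\<lambda>n. \<bar>\<integral>t. x n t * ?b t \<partial>mu\<bar> < e / 2) U"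
    using e by (auto dest!: tendstoD[where e="e/2"] simp: dist_real_def)
  then show "eventually (\<lambda>n. dist (\<integral>t. x n t * g t \<partial>mu) 0 < e) U"
  proof eventually_elim
    case (elim n)
    note xn = up_spaceD[OF x, of n]
    have "(\<integral>t. x n t * g t \<partial>mu) = (\<integral>t. x n t * ?b t + x n t * (g t - ?b t) \<partial>mu)"
      by (simp add: algebra_simps)
    also have "\<dots> = (\<integral>t. x n t * ?b t \<partial>mu) + (\<integral>t. x n t * (g t - ?b t) \<partial>mu)"
      by (rule Bochner_Integration.integral_add[OF Lp_mult_integrable[OF assms(1) xn b(1)] Lp_mult_integrable[OF assms(1) xn b(2)]])
    finally have eq: "(\<integral>t. x n t * g t \<partial>mu) = (\<integral>t. x n t * ?b t \<partial>mu) + (\<integral>t. x n t * (g t - ?b t) \<partial>mu)" .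
    have "\<bar>\<integral>t. x n t * (g t - ?b t) \<partial>mu\<bar> \<le> Lp_norm p (x n) * Lp_norm q (\<lambda>t. g t - ?b t)"
      by (rule Holder[OF assms(1) xn b(2)])
    also have "\<dots> \<le> B * (e / (2 * B))" by (intro mult_mono) (use B k in auto)
    also have "\<dots> = e / 2" using B by simp
    finally show ?case using elim eq by (simp add: dist_real_def)
  qed
qed

lemma measure_decseq_tendsto_0:
  assumes "range A \<subseteq> sets mu" "decseq A" "(\<Inter>i. A i) = {}"
  shows "(\<lambda>i. measure mu (A i)) \<longlonglongrightarrow> 0"
proof -
  interpret finite_measure mu by (rule finite_measure_mu)
  show ?thesis using finite_Lim_measure_decseq[OF assms(1,2)] assms(3) by simp
qed

lemma Lp_norm_indicator:
  assumes "E \<in> sets mu" "0 < q"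
  shows "Lp_norm q (indicator E) = measure mu E powr (1 / q)"
proof -
  have "(\<integral>t. \<bar>indicator E t :: real\<bar> powr q \<partial>mu) = (\<integral>t. indicator E t \<partial>mu)"
    by (rule Bochner_Integration.integral_cong) (auto simp: indicator_def)
  also have "\<dots> = measure mu (E \<inter> space mu)" using assms by (simp add: Int_absorb2 sets.sets_into_space)
  also have "E \<inter> space mu = E" using sets.sets_into_space[OF assms(1)] by blast
  finally show ?thesis by (simp add: Lp_norm_def)
qed

context selective_ultrafilter
begin

text \<open>The limit is a Radon-Nikodym derivative of the set function that sends \<open>E\<close>
  to the limit of the integrals over \<open>E\<close>. Hoelder's inequality bounds it by a multiple
  of \<open>measure mu E powr (1 / q)\<close>, which gives both continuity at the empty set, hence
  countable additivity, and absolute continuity.\<close>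

lemma weak_limit_density:
  assumes pq: "conj_exp p q" and x: "x \<in> up_space p" and nn: "\<And>n t. 0 \<le> x n t"
  obtains D where "integrable mu D" "\<And>t. 0 \<le> D t"
    "\<And>E. E \<in> sets mu \<Longrightarrow> ((\<lambda>n. \<integral>t. x n t * indicator E t \<partial>mu) \<longlongrightarrow> (\<integral>t. D t * indicator E t \<partial>mu)) U"
proof -
  note c = conj_expD[OF pq]
  interpret finite_measure mu by (rule finite_measure_mu)
  obtain B where B: "0 < B" "\<And>n. Lp_norm p (x n) \<le> B" using up_space_bound[OF x] by metis
  have ind: "indicator E \<in> Lp q" if "E \<in> sets mu" for E
    by (rule Lp_bounded[where K=1]) (use that c in \<open>auto simp: indicator_def\<close>)
  have int: "integrable mu (\<lambda>t. x n t * indicator E t)" if "E \<in> sets mu" for E n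
    by (rule Lp_mult_integrable[OF pq up_spaceD[OF x] ind[OF that]])
  define L where "L = (\<lambda>E. Lim U (\<lambda>n. \<integral>t. x n t * indicator E t \<partial>mu))"
  have bd: "\<bar>\<integral>t. x n t * indicator E t \<partial>mu\<bar> \<le> B * measure mu E powr (1 / q)" if E: "E \<in> sets mu" for E n
  proof -
    have "\<bar>\<integral>t. x n t * indicator E t \<partial>mu\<bar> \<le> Lp_norm p (x n) * Lp_norm q (indicator E)"
      by (rule Holder[OF pq up_spaceD[OF x] ind[OF E]])
    also have "\<dots> \<le> B * Lp_norm q (indicator E)" using B by (intro mult_right_mono) auto
    finally show ?thesis using Lp_norm_indicator[OF E, of q] c by simp
  qed
  have Lt: "((\<lambda>n. \<integral>t. x n t * indicator E t \<partial>mu) \<longlongrightarrow> L E) U" if E: "E \<in> sets mu" for E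
    unfolding L_def by (rule bounded_tendsto[OF bd[OF E]])
  have L0: "0 \<le> L E" if E: "E \<in> sets mu" for E
    by (rule tendsto_lowerbound[OF Lt[OF E]]) (use nn in \<open>auto intro!: always_eventually Bochner_Integration.integral_nonneg\<close>)
  have LB: "L E \<le> B * measure mu E powr (1 / q)" if E: "E \<in> sets mu" for E
    by (rule tendsto_upperbound[OF Lt[OF E]]) (use bd[OF E] in \<open>auto intro!: always_eventually simp: abs_le_iff\<close>)
  have Ladd: "L (E \<union> F) = L E + L F" if EF: "E \<in> sets mu" "F \<in> sets mu" "E \<inter> F = {}" for E F
  proof -
    have "(\<integral>t. x n t * indicator (E \<union> F) t \<partial>mu) = (\<integral>t. x n t * indicator E t \<partial>mu) + (\<integral>t. x n t * indicator F t \<partial>mu)" for n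
      using int[OF EF(1)] int[OF EF(2)] EF(3) by (simp add: indicator_add[symmetric] distrib_left)
    then show ?thesis
      unfolding L_def[of] using tendsto_add[OF Lt[OF EF(1)] Lt[OF EF(2)]] by (simp add: Lim_eq L_def)
  qed
  define nu where "nu = (\<lambda>E. ennreal (L E))"
  have pos: "positive (sets mu) nu" unfolding positive_def nu_def L_def by (simp add: Lim_eq[OF tendsto_const])
  have add: "additive (sets mu) nu"
    unfolding additive_def nu_def using Ladd L0 by (auto simp: ennreal_plus)
  have ca: "countably_additive (sets mu) nu"
  proof (rule sets.empty_continuous_imp_countably_additive[OF pos add])
    show "\<forall>A\<in>sets mu. nu A \<noteq> \<infinity>" by (simp add: nu_def)
    fix A :: "nat \<Rightarrow> real set"
    assume A: "range A \<subseteq> sets mu" "decseq A" "(\<Inter>i. A i) = {}"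
    have "(\<lambda>i. measure mu (A i) powr (1 / q)) \<longlonglongrightarrow> 0 powr (1 / q)"
      using measure_decseq_tendsto_0[OF A] c by (intro tendsto_powr') auto
    then have "(\<lambda>i. B * measure mu (A i) powr (1 / q)) \<longlonglongrightarrow> 0"
      using tendsto_mult_left[of _ 0 sequentially B] by simp
    then have "(\<lambda>i. L (A i)) \<longlonglongrightarrow> 0"
      by (rule tendsto_sandwich[OF _ _ tendsto_const, rotated 2])
         (use A L0 LB in \<open>auto intro!: always_eventually\<close>)
    then show "(\<lambda>i. nu (A i)) \<longlonglongrightarrow> 0"
      unfolding nu_def using tendsto_ennrealI[of "\<lambda>i. L (A i)" 0 sequentially] by simp
  qed
  define N where "N = measure_of (space mu) (sets mu) nu"
  have setsN: "sets N = sets mu" by (simp only: N_def sets.sets_measure_of_eq)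
  have emN: "emeasure N E = nu E" if "E \<in> sets mu" for E
    unfolding N_def by (rule emeasure_measure_of_sigma[OF sets.sigma_algebra_axioms pos ca that])
  have spN: "space N = space mu" using setsN by (rule sets_eq_imp_space_eq)
  have finN: "finite_measure N"
    by (rule finite_measureI) (simp add: spN emN nu_def)
  have ac: "absolutely_continuous mu N"
    unfolding absolutely_continuous_def
  proof
    fix E assume E: "E \<in> null_sets mu"
    then have "E \<in> sets mu" "measure mu E = 0" by (auto simp: null_sets_def measure_def)
    then have "L E = 0" using L0[of E] LB[of E] by simp
    then show "E \<in> null_sets N" using \<open>E \<in> sets mu\<close> emN[of E] setsN by (auto simp: null_sets_def nu_def)
  qed
  obtain D where D: "D \<in> borel_measurable mu" "AE t in mu. RN_deriv mu N t = ennreal (D t)" "\<And>t. 0 \<le> D t"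
    by (rule real_RN_deriv[OF finN ac setsN]) blast
  have em: "(\<integral>\<^sup>+t. ennreal (D t * indicator E t) \<partial>mu) = ennreal (L E)" if E: "E \<in> sets mu" for E
  proof -
    have "ennreal (L E) = emeasure (density mu (RN_deriv mu N)) E"
      using emN[OF E] density_RN_deriv[OF ac setsN] by (simp add: nu_def)
    also have "\<dots> = (\<integral>\<^sup>+t. RN_deriv mu N t * indicator E t \<partial>mu)"
      by (rule emeasure_density) (use E in auto)
    also have "\<dots> = (\<integral>\<^sup>+t. ennreal (D t * indicator E t) \<partial>mu)"
      by (rule nn_integral_cong_AE) (use D in \<open>auto simp: ennreal_mult'' indicator_def\<close>)
    finally show ?thesis by simp
  qed
  have intD: "integrable mu (\<lambda>t. D t * indicator E t)" if E: "E \<in> sets mu" for E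
    by (rule integrableI_nonneg) (use D E em[OF E] in auto)
  have eq: "(\<integral>t. D t * indicator E t \<partial>mu) = L E" if E: "E \<in> sets mu" for E
    by (rule integral_eq_nn_integral[THEN trans]) (use D E em[OF E] L0[OF E] in auto)
  have "integrable mu D"
    using intD[OF sets.top] by (rule Bochner_Integration.integrable_cong[THEN iffD1, rotated -1]) auto
  then show ?thesis
  proof (rule that)
    fix E assume "E \<in> sets mu"
    then show "((\<lambda>n. \<integral>t. x n t * indicator E t \<partial>mu) \<longlongrightarrow> (\<integral>t. D t * indicator E t \<partial>mu)) U"
      using Lt eq by simp
  qed (rule D(3))
qed

lemma weak_limit_nonneg:
  assumes pq: "conj_exp p q" and x: "x \<in> up_space p" and nn: "\<And>n t. 0 \<le> x n t"
  obtains D where "D \<in> Lp p"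
    "\<And>g K. g \<in> borel_measurable mu \<Longrightarrow> (\<And>t. \<bar>g t\<bar> \<le> K) \<Longrightarrow>
       ((\<lambda>n. \<integral>t. x n t * g t \<partial>mu) \<longlongrightarrow> (\<integral>t. D t * g t \<partial>mu)) U"
proof -
  note c = conj_expD[OF pq]
  obtain B where B: "0 < B" "\<And>n. Lp_norm p (x n) \<le> B" using up_space_bound[OF x] by metis
  obtain D where D: "integrable mu D" "\<And>t. 0 \<le> D t"
    and Dlim: "\<And>E. E \<in> sets mu \<Longrightarrow> ((\<lambda>n. \<integral>t. x n t * indicator E t \<partial>mu) \<longlongrightarrow> (\<integral>t. D t * indicator E t \<partial>mu)) U"
    by (rule weak_limit_density[OF pq x nn]) blast
  have [measurable]: "D \<in> borel_measurable mu" using D(1) by auto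
  have xint: "integrable mu (x n)" "(\<integral>t. x n t \<partial>mu) \<le> B" for n
    using integral_abs_le_Lp_norm[OF pq up_spaceD[OF x], of n] B(2)[of n] nn by auto
  have lim: "((\<lambda>n. \<integral>t. x n t * g t \<partial>mu) \<longlongrightarrow> (\<integral>t. D t * g t \<partial>mu)) U"
    if g[measurable]: "g \<in> borel_measurable mu" and gK: "\<And>t. \<bar>g t\<bar> \<le> K" for g K
  proof (rule tendstoI)
    fix e :: real assume e: "e > 0"
    define d where "d = e / (2 * (B + (\<integral>t. D t \<partial>mu) + 1))"
    have ID: "0 \<le> (\<integral>t. D t \<partial>mu)" using D by simp
    have d: "d > 0" using e B ID by (simp add: d_def)
    \<comment> \<open>A step function within \<open>d\<close> of \<open>g\<close>, constant where
      the floor of \<open>g / d\<close> is fixed. By \<open>gK\<close> it has finitely many values,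
      so its integrals converge by \<open>Dlim\<close>. The denominator of \<open>d\<close> is
      chosen for the final estimate by \<open>e / 2\<close>.\<close>
    define s where "s = (\<lambda>t. d * real_of_int \<lfloor>g t / d\<rfloor>)"
    have gs: "\<bar>g t - s t\<bar> \<le> d" for t
    proof -
      have "g t / d - 1 \<le> real_of_int \<lfloor>g t / d\<rfloor>" "real_of_int \<lfloor>g t / d\<rfloor> \<le> g t / d" by linarith+
      then have "d * (g t / d - 1) \<le> s t" "s t \<le> d * (g t / d)"
        unfolding s_def using d by (intro mult_left_mono; simp)+
      then show ?thesis using d by (simp add: algebra_simps)
    qed
    have [measurable]: "s \<in> borel_measurable mu" unfolding s_def by measurable
    have sK: "\<bar>s t\<bar> \<le> K + d" for t using gs[of t] gK[of t] by linarith
    define E where "E = (\<lambda>k::int. {t \<in> space mu. \<lfloor>g t / d\<rfloor> = k})"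
    have E[measurable]: "E k \<in> sets mu" for k unfolding E_def by measurable
    define m where "m = \<lceil>K / d\<rceil> + 1"
    have fl: "\<lfloor>g t / d\<rfloor> \<in> {-m..m}" for t
    proof -
      have "\<bar>g t / d\<bar> \<le> K / d" using gK[of t] d by (simp add: divide_right_mono)
      then show ?thesis unfolding m_def atLeastAtMost_iff by linarith
    qed
    have srep: "s t = (\<Sum>k\<in>{-m..m}. d * real_of_int k * indicator (E k) t)" if "t \<in> space mu" for t
    proof -
      have "(\<Sum>k\<in>{-m..m}. d * real_of_int k * indicator (E k) t)
          = (\<Sum>k\<in>{-m..m}. if k = \<lfloor>g t / d\<rfloor> then d * real_of_int k else 0)"
        by (rule sum.cong) (use that in \<open>auto simp: E_def indicator_def\<close>)
      also have "\<dots> = s t" using fl[of t] by (simp add: s_def)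
      finally show ?thesis by simp
    qed
    have sint: "(\<integral>t. w t * s t \<partial>mu) = (\<Sum>k\<in>{-m..m}. d * real_of_int k * (\<integral>t. w t * indicator (E k) t \<partial>mu))"
      if w: "integrable mu w" for w
    proof -
      have i: "integrable mu (\<lambda>t. w t * indicator (E k) t)" for k
        by (rule integrable_real_mult_indicator[OF E w])
      have "(\<integral>t. w t * s t \<partial>mu) = (\<integral>t. (\<Sum>k\<in>{-m..m}. d * real_of_int k * (w t * indicator (E k) t)) \<partial>mu)"
        by (rule Bochner_Integration.integral_cong) (auto simp: srep sum_distrib_left algebra_simps)
      also have "\<dots> = (\<Sum>k\<in>{-m..m}. \<integral>t. d * real_of_int k * (w t * indicator (E k) t) \<partial>mu)"
        by (rule Bochner_Integration.integral_sum) (use i in auto)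
      finally show ?thesis by simp
    qed
    have "((\<lambda>n. \<integral>t. x n t * s t \<partial>mu) \<longlongrightarrow> (\<integral>t. D t * s t \<partial>mu)) U"
      unfolding sint[OF xint(1)] sint[OF D(1)]
      by (intro tendsto_sum tendsto_mult tendsto_const Dlim E)
    then have ev: "eventually (\<lambda>n. \<bar>(\<integral>t. x n t * s t \<partial>mu) - (\<integral>t. D t * s t \<partial>mu)\<bar> < e / 2) U"
      using e by (auto dest!: tendstoD[where e="e/2"] simp: dist_real_def)
    have mult: "integrable mu (\<lambda>t. w t * v t)"
      if "integrable mu w" "v \<in> borel_measurable mu" "\<And>t. \<bar>v t\<bar> \<le> C" for w v :: "real \<Rightarrow> real" and C
    proof (rule Bochner_Integration.integrable_bound)
      show "integrable mu (\<lambda>t. C * w t)" using that by simp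
      have "\<bar>w t\<bar> * \<bar>v t\<bar> \<le> \<bar>w t\<bar> * \<bar>C\<bar>" for t
        using that(3)[of t] by (intro mult_left_mono) auto
      then show "AE t in mu. norm (w t * v t) \<le> norm (C * w t)"
        by (auto simp: abs_mult mult.commute)
    qed (use that in measurable)
    have diff: "\<bar>(\<integral>t. w t * g t \<partial>mu) - (\<integral>t. w t * s t \<partial>mu)\<bar> \<le> d * (\<integral>t. w t \<partial>mu)"
      if w: "integrable mu w" "\<And>t. 0 \<le> w t" for w
    proof -
      have i: "integrable mu (\<lambda>t. w t * g t)" "integrable mu (\<lambda>t. w t * s t)"
        using mult[OF w(1) g gK] mult[OF w(1) _ sK] by auto
      have "\<bar>(\<integral>t. w t * g t \<partial>mu) - (\<integral>t. w t * s t \<partial>mu)\<bar> = \<bar>\<integral>t. w t * (g t - s t) \<partial>mu\<bar>"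
        using i by (simp add: right_diff_distrib)
      also have "\<dots> \<le> (\<integral>t. \<bar>w t * (g t - s t)\<bar> \<partial>mu)" by (rule integral_abs_bound)
      also have "\<dots> \<le> (\<integral>t. d * w t \<partial>mu)"
      proof (rule Bochner_Integration.integral_mono)
        show "integrable mu (\<lambda>t. \<bar>w t * (g t - s t)\<bar>)" using i by (simp add: right_diff_distrib)
        show "\<bar>w t * (g t - s t)\<bar> \<le> d * w t" for t
          using mult_left_mono[OF gs[of t] w(2)[of t]] w(2)[of t] by (simp add: abs_mult mult.commute)
      qed (use w in auto)
      finally show ?thesis by simp
    qed
    from ev show "eventually (\<lambda>n. dist (\<integral>t. x n t * g t \<partial>mu) (\<integral>t. D t * g t \<partial>mu) < e) U"
    proof eventually_elim
      case (elim n)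
      have "d * (\<integral>t. x n t \<partial>mu) \<le> d * B" using xint d by (intro mult_left_mono) auto
      moreover have "d * B + d * (\<integral>t. D t \<partial>mu) < e / 2"
      proof -
        have "d * B + d * (\<integral>t. D t \<partial>mu) < d * (B + (\<integral>t. D t \<partial>mu) + 1)" using d by (simp add: algebra_simps)
        also have "\<dots> = e / 2"
        proof -
          have "e / (2 * S) * S = e / 2" if "S \<noteq> 0" for S :: real using that by simp
          then show ?thesis using B(1) ID unfolding d_def by (smt (verit))
        qed
        finally show ?thesis .
      qed
      moreover have "\<bar>xg - Dg\<bar> < e"
        if "a \<le> a'" "a' + b < e / 2" "\<bar>xs - Ds\<bar> < e / 2" "\<bar>xg - xs\<bar> \<le> a" "\<bar>Dg - Ds\<bar> \<le> b"
        for xg xs Dg Ds a a' b :: real using that by linarith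
      ultimately show ?case
        using elim(1) diff[OF xint(1)[of n] nn] diff[OF D] unfolding dist_real_def by blast
    qed
  qed
  \<comment> \<open>So far \<open>D\<close> is only integrable. Testing its truncation
    \<open>Dk\<close> against the bounded function \<open>Jmap p Dk\<close> and comparing with
    \<open>x n\<close> gives \<open>Lp_norm p Dk \<le> B\<close> at every level; monotone
    convergence then puts \<open>D\<close> into \<open>Lp p\<close>.\<close>
  have bound: "(\<integral>t. (min (D t) (real k)) powr p \<partial>mu) \<le> B powr p" for k
  proof -
    define Dk where "Dk = (\<lambda>t. min (D t) (real k))"
    have Dk: "0 \<le> Dk t" "\<bar>Dk t\<bar> \<le> real k" "Dk t \<le> D t" for t using D(2)[of t] by (auto simp: Dk_def)
    have [measurable]: "Dk \<in> borel_measurable mu" unfolding Dk_def by measurable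
    have DkL: "Dk \<in> Lp p" by (rule Lp_bounded[where K="real k"]) (use Dk c in auto)
    have J: "Jmap p Dk \<in> Lp q" using pq DkL by auto
    have Jk: "\<bar>Jmap p Dk t\<bar> \<le> real k powr (p - 1)" for t
      unfolding abs_Jmap using Dk c by (auto intro!: powr_mono2)
    have J0: "0 \<le> Jmap p Dk t" for t using Dk(1)[of t] by (simp add: Jmap_def)
    have l: "((\<lambda>n. \<integral>t. x n t * Jmap p Dk t \<partial>mu) \<longlongrightarrow> (\<integral>t. D t * Jmap p Dk t \<partial>mu)) U"
      by (rule lim[OF _ Jk]) measurable
    have iD: "integrable mu (\<lambda>t. D t * Jmap p Dk t)"
    proof (rule Bochner_Integration.integrable_bound)
      show "integrable mu (\<lambda>t. real k powr (p - 1) * D t)" using D by simp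
      show "AE t in mu. norm (D t * Jmap p Dk t) \<le> norm (real k powr (p - 1) * D t)"
        using Jk D(2) by (auto simp: abs_mult mult.commute intro!: mult_left_mono)
    qed measurable
    have "Lp_norm p Dk powr p = (\<integral>t. Dk t * Jmap p Dk t \<partial>mu)"
      using c Jmap_mult[OF c(1), of Dk] by (simp add: Lp_norm_powr)
    also have "\<dots> \<le> (\<integral>t. D t * Jmap p Dk t \<partial>mu)"
      by (rule Bochner_Integration.integral_mono[OF Lp_mult_integrable[OF pq DkL J] iD])
         (use Dk J0 in \<open>auto intro: mult_right_mono\<close>)
    also have "\<dots> \<le> B * Lp_norm p Dk powr (p - 1)"
    proof (rule tendsto_upperbound[OF l])
      show "\<forall>\<^sub>F n in U. (\<integral>t. x n t * Jmap p Dk t \<partial>mu) \<le> B * Lp_norm p Dk powr (p - 1)"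
      proof (rule always_eventually, rule allI)
        fix n
        have "(\<integral>t. x n t * Jmap p Dk t \<partial>mu) \<le> Lp_norm p (x n) * Lp_norm q (Jmap p Dk)"
          using Holder[OF pq up_spaceD[OF x] J, of n] by linarith
        also have "\<dots> \<le> B * Lp_norm q (Jmap p Dk)" using B by (intro mult_right_mono) auto
        finally show "(\<integral>t. x n t * Jmap p Dk t \<partial>mu) \<le> B * Lp_norm p Dk powr (p - 1)"
          by (simp add: Lp_norm_Jmap[OF pq])
      qed
    qed simp
    finally have le: "Lp_norm p Dk powr p \<le> B * Lp_norm p Dk powr (p - 1)" .
    have "Lp_norm p Dk \<le> B"
    proof (cases "Lp_norm p Dk = 0")
      case False
      then have "Lp_norm p Dk > 0" by (simp add: order_less_le)
      then show ?thesis using le by (simp add: powr_diff field_simps)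
    qed (use B in simp)
    then have "(\<integral>t. \<bar>Dk t\<bar> powr p \<partial>mu) \<le> B powr p" using Lp_norm_le_iff[of p B Dk] B c by simp
    then show ?thesis using Dk by (simp add: Dk_def)
  qed
  have mono: "(min (D t) (real i)) powr p \<le> (min (D t) (real j)) powr p" if "i \<le> j" for i j t
    using that c D(2)[of t] by (intro powr_mono2) auto
  have ik: "integrable mu (\<lambda>t. (min (D t) (real k)) powr p)" for k
    by (rule integrable_bounded[where K="real k powr p"]) (use c D(2) in \<open>auto intro!: powr_mono2\<close>)
  have "convergent (\<lambda>k. \<integral>t. (min (D t) (real k)) powr p \<partial>mu)"
  proof (rule Bseq_mono_convergent)
    show "Bseq (\<lambda>k. \<integral>t. (min (D t) (real k)) powr p \<partial>mu)"
      by (rule BseqI'[where K="B powr p"]) (use bound in auto)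
  qed (use ik mono in \<open>auto intro!: Bochner_Integration.integral_mono\<close>)
  then obtain l where l: "(\<lambda>k. \<integral>t. (min (D t) (real k)) powr p \<partial>mu) \<longlonglongrightarrow> l" by (auto simp: convergent_def)
  have "integrable mu (\<lambda>t. D t powr p)"
  proof (rule integrable_monotone_convergence[OF ik _ _ l])
    show "AE t in mu. mono (\<lambda>k. (min (D t) (real k)) powr p)" using mono by (auto simp: mono_def)
    show "AE t in mu. (\<lambda>k. (min (D t) (real k)) powr p) \<longlonglongrightarrow> D t powr p"
    proof (rule AE_I2)
      fix t
      obtain N where N: "D t \<le> real N" using real_arch_simple by blast
      have "eventually (\<lambda>k. (min (D t) (real k)) powr p = D t powr p) sequentially"
        using eventually_ge_at_top[of N] by eventually_elim (use N in \<open>auto simp: min_def\<close>)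
      then show "(\<lambda>k. (min (D t) (real k)) powr p) \<longlonglongrightarrow> D t powr p" by (rule tendsto_eventually)
    qed
  qed measurable
  then have "D \<in> Lp p" using D(2) by (simp add: Lp_def)
  then show ?thesis by (rule that) (rule lim)
qed

lemma weak_limit_tendsto:
  assumes pq: "conj_exp p q" and x: "x \<in> up_space p" and f: "f \<in> Lp p" and y: "wnull p U (\<lambda>n t. x n t - f t)"
    and g: "g \<in> Lp q"
  shows "((\<lambda>n. \<integral>t. x n t * g t \<partial>mu) \<longlongrightarrow> (\<integral>t. f t * g t \<partial>mu)) U"
proof -
  have "((\<lambda>n. \<integral>t. (x n t - f t) * g t \<partial>mu) \<longlongrightarrow> 0) U" by (rule wnull_Lq[OF pq y g])
  moreover have "(\<integral>t. (x n t - f t) * g t \<partial>mu) = (\<integral>t. x n t * g t \<partial>mu) - (\<integral>t. f t * g t \<partial>mu)" for n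
    using Lp_mult_integrable[OF pq up_spaceD[OF x] g] Lp_mult_integrable[OF pq f g]
    by (simp add: left_diff_distrib)
  ultimately show ?thesis by (simp add: LIM_zero_iff)
qed

text \<open>This takes the place of reflexivity: bounded sequences have weak limits along
  \<open>U\<close>. Positive and negative parts are treated separately because the density argument
  is for non-negative functions.\<close>

lemma weak_limit_exists:
  assumes pq: "conj_exp p q" and x: "x \<in> up_space p"
  obtains f where "f \<in> Lp p" "wnull p U (\<lambda>n t. x n t - f t)"
proof -
  note c = conj_expD[OF pq]
  let ?xp = "\<lambda>n t. max (x n t) 0" and ?xm = "\<lambda>n t. max (- x n t) 0"
  note [measurable] = up_space_meas[OF x]
  have xp: "?xp \<in> up_space p" and xm: "?xm \<in> up_space p"
    by (rule up_space_dominated[OF x]; use c in auto)+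
  obtain P where P: "P \<in> Lp p" "\<And>g K. g \<in> borel_measurable mu \<Longrightarrow> (\<And>t. \<bar>g t\<bar> \<le> K) \<Longrightarrow>
       ((\<lambda>n. \<integral>t. ?xp n t * g t \<partial>mu) \<longlongrightarrow> (\<integral>t. P t * g t \<partial>mu)) U"
    by (rule weak_limit_nonneg[OF pq xp]) auto
  obtain Q where Q: "Q \<in> Lp p" "\<And>g K. g \<in> borel_measurable mu \<Longrightarrow> (\<And>t. \<bar>g t\<bar> \<le> K) \<Longrightarrow>
       ((\<lambda>n. \<integral>t. ?xm n t * g t \<partial>mu) \<longlongrightarrow> (\<integral>t. Q t * g t \<partial>mu)) U"
    by (rule weak_limit_nonneg[OF pq xm]) auto
  let ?f = "\<lambda>t. P t - Q t"
  have f: "?f \<in> Lp p" using P Q c by auto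
  have "wnull p U (\<lambda>n t. x n t - ?f t)"
    unfolding wnull_def
  proof (intro conjI allI impI)
    show "(\<lambda>n t. x n t - ?f t) \<in> up_space p" by (rule up_space_diff[OF pq x up_space_const[OF f]])
    fix g :: "real \<Rightarrow> real" and K assume g: "g \<in> borel_measurable mu" "\<forall>t. \<bar>g t\<bar> \<le> K"
    then have gq: "g \<in> Lp q" by (intro Lp_bounded[where K=K]) (use c in auto)
    note i = Lp_mult_integrable[OF pq _ gq]
    have "((\<lambda>n. ((\<integral>t. ?xp n t * g t \<partial>mu) - (\<integral>t. P t * g t \<partial>mu)) - ((\<integral>t. ?xm n t * g t \<partial>mu) - (\<integral>t. Q t * g t \<partial>mu))) \<longlongrightarrow> 0 - 0) U"
      using P(2)[of g K] Q(2)[of g K] g by (intro tendsto_diff) (auto simp: LIM_zero_iff)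
    moreover have "((\<integral>t. ?xp n t * g t \<partial>mu) - (\<integral>t. P t * g t \<partial>mu)) - ((\<integral>t. ?xm n t * g t \<partial>mu) - (\<integral>t. Q t * g t \<partial>mu))
        = (\<integral>t. (x n t - ?f t) * g t \<partial>mu)" for n
    proof -
      have "(\<integral>t. (x n t - ?f t) * g t \<partial>mu) = (\<integral>t. (?xp n t * g t - P t * g t) - (?xm n t * g t - Q t * g t) \<partial>mu)"
        by (rule Bochner_Integration.integral_cong) (auto simp: max_def algebra_simps)
      also have "\<dots> = ((\<integral>t. ?xp n t * g t \<partial>mu) - (\<integral>t. P t * g t \<partial>mu)) - ((\<integral>t. ?xm n t * g t \<partial>mu) - (\<integral>t. Q t * g t \<partial>mu))"
        using i[OF up_spaceD[OF xp, of n]] i[OF up_spaceD[OF xm, of n]] i[OF P(1)] i[OF Q(1)] by simp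
      finally show ?thesis by simp
    qed
    ultimately show "((\<lambda>n. \<integral>t. (x n t - ?f t) * g t \<partial>mu) \<longlongrightarrow> 0) U" by simp
  qed
  with f show ?thesis by (rule that)
qed

end

section \<open>Equi-integrable and disjoint parts\<close>

context selective_ultrafilter
begin

text \<open>Bounded in \<open>Lp\<close> but vanishing in \<open>L^1\<close>: the p-th powers
  concentrate on sets of measure tending to 0, as for the almost disjoint sequences of Kadec and
  Pelczynski.\<close>

definition Disj :: "real \<Rightarrow> (nat \<Rightarrow> real \<Rightarrow> real) set" where
  "Disj p = {x \<in> up_space p. ((\<lambda>n. \<integral>t. \<bar>x n t\<bar> \<partial>mu) \<longlongrightarrow> 0) U}"

text \<open>Uniform integrability of \<open>\<bar>x n\<bar> powr p\<close> along \<open>U\<close>,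
  expressed by truncations of \<open>x n\<close> itself.\<close>

definition Equi :: "real \<Rightarrow> (nat \<Rightarrow> real \<Rightarrow> real) set" where
  "Equi p = {x \<in> up_space p. \<forall>e>0. \<exists>K\<ge>0. eventually (\<lambda>n. Lp_norm p (\<lambda>t. x n t - trunc K (x n t)) < e) U}"

text \<open>The bound holds at every point and not merely almost everywhere, so products and powers
  are bounded without exceptional sets.\<close>

definition Bdd :: "(nat \<Rightarrow> real \<Rightarrow> real) set" where
  "Bdd = {b. (\<forall>n. b n \<in> borel_measurable mu) \<and> (\<exists>K. \<forall>n t. \<bar>b n t\<bar> \<le> K)}"

lemma BddI: "(\<And>n. b n \<in> borel_measurable mu) \<Longrightarrow> (\<And>n t. \<bar>b n t\<bar> \<le> K) \<Longrightarrow> b \<in> Bdd"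
  by (auto simp: Bdd_def)

lemma BddE:
  assumes "b \<in> Bdd"
  obtains K where "0 < K" "\<And>n t. \<bar>b n t\<bar> \<le> K"
proof -
  obtain K where "\<And>n t. \<bar>b n t\<bar> \<le> K" using assms by (auto simp: Bdd_def)
  then show ?thesis by (intro that[of "max K 1"]) (auto simp: le_max_iff_disj)
qed

lemma Bdd_meas: "b \<in> Bdd \<Longrightarrow> b n \<in> borel_measurable mu"
  by (auto simp: Bdd_def)

lemma Bdd_up_space: "b \<in> Bdd \<Longrightarrow> 0 < p \<Longrightarrow> b \<in> up_space p"
  by (rule BddE, assumption, rule up_space_bounded) (simp_all add: Bdd_meas)

lemma Bdd_add: "b \<in> Bdd \<Longrightarrow> b' \<in> Bdd \<Longrightarrow> (\<lambda>n t. b n t + b' n t) \<in> Bdd"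
proof -
  assume b: "b \<in> Bdd" "b' \<in> Bdd"
  obtain K where K: "\<And>n t. \<bar>b n t\<bar> \<le> K" using BddE[OF b(1)] by metis
  obtain K' where K': "\<And>n t. \<bar>b' n t\<bar> \<le> K'" using BddE[OF b(2)] by metis
  show ?thesis
  proof (rule BddI[where K="K + K'"])
    fix n t show "\<bar>b n t + b' n t\<bar> \<le> K + K'" using K[of n t] K'[of n t] by linarith
  qed (use Bdd_meas[OF b(1)] Bdd_meas[OF b(2)] in measurable)
qed

lemma Bdd_scale: "b \<in> Bdd \<Longrightarrow> (\<lambda>n t. c * b n t) \<in> Bdd"
proof -
  assume b: "b \<in> Bdd"
  obtain K where K: "\<And>n t. \<bar>b n t\<bar> \<le> K" using BddE[OF b(1)] by metis
  show ?thesis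
    by (rule BddI[where K="\<bar>c\<bar> * K"]) (use Bdd_meas[OF b(1)] K in \<open>auto simp: abs_mult intro!: mult_left_mono\<close>)
qed

section \<open>Linear structure and closedness of the bands\<close>

lemma wnull_add:
  assumes "conj_exp p q" "wnull p U x" "wnull p U y"
  shows "wnull p U (\<lambda>n t. x n t + y n t)"
  unfolding wnull_def
proof (intro conjI allI impI)
  note c = conj_expD[OF assms(1)]
  show "(\<lambda>n t. x n t + y n t) \<in> up_space p" by (rule up_space_add[OF assms(1) wnullD[OF assms(2)] wnullD[OF assms(3)]])
  fix g :: "real \<Rightarrow> real" and K assume g: "g \<in> borel_measurable mu" "\<forall>t. \<bar>g t\<bar> \<le> K"
  then have gq: "g \<in> Lp q" by (intro Lp_bounded[where K=K]) (use c in auto)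
  note i = Lp_mult_integrable[OF assms(1) _ gq]
  have "(\<integral>t. (x n t + y n t) * g t \<partial>mu) = (\<integral>t. x n t * g t \<partial>mu) + (\<integral>t. y n t * g t \<partial>mu)" for n
    using i[OF up_spaceD[OF wnullD[OF assms(2)], of n]] i[OF up_spaceD[OF wnullD[OF assms(3)], of n]]
    by (simp add: distrib_right)
  then show "((\<lambda>n. \<integral>t. (x n t + y n t) * g t \<partial>mu) \<longlongrightarrow> 0) U"
    using tendsto_add[OF wnull_Lq[OF assms(1,2) gq] wnull_Lq[OF assms(1,3) gq]] by simp
qed

lemma wnull_scale:
  assumes "0 < p" "wnull p U x"
  shows "wnull p U (\<lambda>n t. c * x n t)"
  unfolding wnull_def
proof (intro conjI allI impI)
  show "(\<lambda>n t. c * x n t) \<in> up_space p" by (rule up_space_scale[OF assms(1) wnullD[OF assms(2)]])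
  fix g :: "real \<Rightarrow> real" and K assume "g \<in> borel_measurable mu" "\<forall>t. \<bar>g t\<bar> \<le> K"
  then have "((\<lambda>n. \<integral>t. x n t * g t \<partial>mu) \<longlongrightarrow> 0) U" using assms(2) by (auto simp: wnull_def)
  from tendsto_mult_left[OF this, of c]
  show "((\<lambda>n. \<integral>t. c * x n t * g t \<partial>mu) \<longlongrightarrow> 0) U" by (simp add: mult.assoc)
qed

lemma wnull_diff:
  assumes "conj_exp p q" "wnull p U x" "wnull p U y"
  shows "wnull p U (\<lambda>n t. x n t - y n t)"
  using wnull_add[OF assms(1,2) wnull_scale[OF _ assms(3), of "-1"]] conj_expD(1)[OF assms(1)] by simp

lemma Disj_up_space: "x \<in> Disj p \<Longrightarrow> x \<in> up_space p"
  by (simp add: Disj_def)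

lemma Equi_up_space: "x \<in> Equi p \<Longrightarrow> x \<in> up_space p"
  by (simp add: Equi_def)

text \<open>The \<open>L^1\<close> norm is dominated by the norm of \<open>Lp\<close>, so vanishing
  in \<open>L^1\<close> is a closed condition.\<close>

lemma DisjI_approx:
  assumes pq: "conj_exp p q" and y: "y \<in> up_space p"
    and a: "\<And>e. e > 0 \<Longrightarrow> \<exists>x\<in>Disj p. up_norm p U (\<lambda>n t. x n t - y n t) < e"
  shows "y \<in> Disj p"
proof -
  have "((\<lambda>n. \<integral>t. \<bar>y n t\<bar> \<partial>mu) \<longlongrightarrow> 0) U"
  proof (rule tendstoI)
    fix e :: real assume e: "e > 0"
    then obtain x where x: "x \<in> Disj p" "up_norm p U (\<lambda>n t. x n t - y n t) < e / 2" using a[of "e/2"] by auto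
    note xs = Disj_up_space[OF x(1)]
    have 1: "eventually (\<lambda>n. (\<integral>t. \<bar>x n t\<bar> \<partial>mu) < e / 2) U"
      using x(1) e by (intro order_tendstoD(2)[where y=0]) (auto simp: Disj_def)
    have 2: "eventually (\<lambda>n. Lp_norm p (\<lambda>t. x n t - y n t) < e / 2) U"
      by (rule up_norm_less[OF up_space_diff[OF pq xs y] x(2)])
    show "eventually (\<lambda>n. dist (\<integral>t. \<bar>y n t\<bar> \<partial>mu) 0 < e) U"
      using 1 2
    proof eventually_elim
      case (elim n)
      note ix = integral_abs_le_Lp_norm(1)[OF pq up_spaceD[OF xs, of n]]
      note iy = integral_abs_le_Lp_norm(1)[OF pq up_spaceD[OF y, of n]]
      note d = integral_abs_le_Lp_norm[OF pq up_spaceD[OF up_space_diff[OF pq xs y], of n]]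
      have "(\<integral>t. \<bar>y n t\<bar> \<partial>mu) \<le> (\<integral>t. \<bar>x n t\<bar> + \<bar>x n t - y n t\<bar> \<partial>mu)"
        by (rule Bochner_Integration.integral_mono) (use ix iy d in auto)
      also have "\<dots> = (\<integral>t. \<bar>x n t\<bar> \<partial>mu) + (\<integral>t. \<bar>x n t - y n t\<bar> \<partial>mu)" using ix d by simp
      finally show ?case using elim d(2) by (simp add: dist_real_def)
    qed
  qed
  then show ?thesis using y by (simp add: Disj_def)
qed

lemma Disj_add:
  assumes pq: "conj_exp p q" and "x \<in> Disj p" "y \<in> Disj p"
  shows "(\<lambda>n t. x n t + y n t) \<in> Disj p"
proof -
  note xs = Disj_up_space[OF assms(2)] and ys = Disj_up_space[OF assms(3)]
  have "((\<lambda>n. (\<integral>t. \<bar>x n t\<bar> \<partial>mu) + (\<integral>t. \<bar>y n t\<bar> \<partial>mu)) \<longlongrightarrow> 0 + 0) U"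
    using assms by (intro tendsto_add) (auto simp: Disj_def)
  then have l: "((\<lambda>n. (\<integral>t. \<bar>x n t\<bar> \<partial>mu) + (\<integral>t. \<bar>y n t\<bar> \<partial>mu)) \<longlongrightarrow> 0) U" by simp
  have "((\<lambda>n. \<integral>t. \<bar>x n t + y n t\<bar> \<partial>mu) \<longlongrightarrow> 0) U"
  proof (rule tendsto_sandwich[OF _ _ tendsto_const l])
    show "\<forall>\<^sub>F n in U. (\<integral>t. \<bar>x n t + y n t\<bar> \<partial>mu) \<le> (\<integral>t. \<bar>x n t\<bar> \<partial>mu) + (\<integral>t. \<bar>y n t\<bar> \<partial>mu)"
    proof (rule always_eventually, rule allI)
      fix n
      note i = integral_abs_le_Lp_norm(1)[OF pq up_spaceD[OF xs, of n]] integral_abs_le_Lp_norm(1)[OF pq up_spaceD[OF ys, of n]]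
      have "(\<integral>t. \<bar>x n t + y n t\<bar> \<partial>mu) \<le> (\<integral>t. \<bar>x n t\<bar> + \<bar>y n t\<bar> \<partial>mu)"
        by (rule Bochner_Integration.integral_mono) (use i in auto)
      then show "(\<integral>t. \<bar>x n t + y n t\<bar> \<partial>mu) \<le> (\<integral>t. \<bar>x n t\<bar> \<partial>mu) + (\<integral>t. \<bar>y n t\<bar> \<partial>mu)" using i by simp
    qed
  qed simp
  then show ?thesis using up_space_add[OF pq xs ys] by (simp add: Disj_def)
qed

lemma Disj_scale:
  assumes "0 < p" "x \<in> Disj p"
  shows "(\<lambda>n t. c * x n t) \<in> Disj p"
  using assms up_space_scale[OF assms(1), of x c] tendsto_mult_left[of "\<lambda>n. \<integral>t. \<bar>x n t\<bar> \<partial>mu" 0 U "\<bar>c\<bar>"]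
  by (auto simp: Disj_def abs_mult)

lemma Disj_abs: "x \<in> Disj p \<Longrightarrow> (\<lambda>n t. \<bar>x n t\<bar>) \<in> Disj p"
  by (auto simp: Disj_def up_space_abs)

lemma Disj_wnull:
  assumes pq: "conj_exp p q" and x: "x \<in> Disj p"
  shows "wnull p U x"
  unfolding wnull_def
proof (intro conjI allI impI)
  show xs: "x \<in> up_space p" by (rule Disj_up_space[OF x])
  fix g :: "real \<Rightarrow> real" and K assume g: "g \<in> borel_measurable mu" "\<forall>t. \<bar>g t\<bar> \<le> K"
  have "((\<lambda>n. K * (\<integral>t. \<bar>x n t\<bar> \<partial>mu)) \<longlongrightarrow> K * 0) U"
    using x by (intro tendsto_mult tendsto_const) (auto simp: Disj_def)
  then have l: "((\<lambda>n. K * (\<integral>t. \<bar>x n t\<bar> \<partial>mu)) \<longlongrightarrow> 0) U" by simp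
  show "((\<lambda>n. \<integral>t. x n t * g t \<partial>mu) \<longlongrightarrow> 0) U"
  proof (rule tendsto_rabs_zero_cancel, rule tendsto_sandwich[OF _ _ tendsto_const l])
    show "\<forall>\<^sub>F n in U. \<bar>\<integral>t. x n t * g t \<partial>mu\<bar> \<le> K * (\<integral>t. \<bar>x n t\<bar> \<partial>mu)"
    proof (rule always_eventually, rule allI)
      fix n
      note i = integral_abs_le_Lp_norm(1)[OF pq up_spaceD[OF xs, of n]]
      have gq: "g \<in> Lp q" by (rule Lp_bounded[where K=K]) (use g conj_expD[OF pq] in auto)
      note i2 = Lp_mult_integrable[OF pq up_spaceD[OF xs, of n] gq]
      have "\<bar>\<integral>t. x n t * g t \<partial>mu\<bar> \<le> (\<integral>t. \<bar>x n t * g t\<bar> \<partial>mu)" by (rule integral_abs_bound)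
      also have "\<dots> \<le> (\<integral>t. K * \<bar>x n t\<bar> \<partial>mu)"
      proof (rule Bochner_Integration.integral_mono)
        show "\<bar>x n t * g t\<bar> \<le> K * \<bar>x n t\<bar>" for t
          using g(2) by (auto simp: abs_mult mult.commute[of K] intro!: mult_left_mono)
      qed (use i i2 in auto)
      finally show "\<bar>\<integral>t. x n t * g t \<partial>mu\<bar> \<le> K * (\<integral>t. \<bar>x n t\<bar> \<partial>mu)" by simp
    qed
  qed simp
qed

text \<open>At every point, clipping at \<open>K\<close> is at least as close to \<open>x n\<close>
  as any function with values between \<open>- K\<close> and \<open>K\<close>. Hence an
  approximating bounded sequence may be replaced by truncations of \<open>x\<close>.\<close>

lemma EquiI_approx:
  assumes pq: "conj_exp p q" and x: "x \<in> up_space p"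
    and a: "\<And>e. e > 0 \<Longrightarrow> \<exists>b\<in>Bdd. eventually (\<lambda>n. Lp_norm p (\<lambda>t. x n t - b n t) < e) U"
  shows "x \<in> Equi p"
  unfolding Equi_def
proof (intro CollectI conjI allI impI x)
  fix e :: real assume "e > 0"
  then obtain b where b: "b \<in> Bdd" "eventually (\<lambda>n. Lp_norm p (\<lambda>t. x n t - b n t) < e) U" using a by auto
  obtain K where K: "0 < K" "\<And>n t. \<bar>b n t\<bar> \<le> K" using BddE[OF b(1)] by metis
  note c = conj_expD[OF pq]
  show "\<exists>K\<ge>0. eventually (\<lambda>n. Lp_norm p (\<lambda>t. x n t - trunc K (x n t)) < e) U"
  proof (intro exI[of _ K] conjI)
    show "eventually (\<lambda>n. Lp_norm p (\<lambda>t. x n t - trunc K (x n t)) < e) U"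
      using b(2)
    proof eventually_elim
      case (elim n)
      have "Lp_norm p (\<lambda>t. x n t - trunc K (x n t)) \<le> Lp_norm p (\<lambda>t. x n t - b n t)"
        by (rule Lp_norm_mono)
           (use K abs_diff_trunc_le up_space_meas[OF x, of n] Bdd_meas[OF b(1), of n] c
             up_spaceD[OF up_space_diff[OF pq x Bdd_up_space[OF b(1)]], of n] in auto)
      then show ?case using elim by linarith
    qed
  qed (use K in simp)
qed

lemma Equi_approx:
  assumes "x \<in> Equi p" "e > 0"
  obtains b where "b \<in> Bdd" "eventually (\<lambda>n. Lp_norm p (\<lambda>t. x n t - b n t) < e) U"
proof -
  obtain K where K: "K \<ge> 0" "eventually (\<lambda>n. Lp_norm p (\<lambda>t. x n t - trunc K (x n t)) < e) U"
    using assms by (auto simp: Equi_def)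
  show ?thesis
    by (rule that[OF _ K(2)], rule BddI[where K=K])
       (use K(1) up_space_meas[OF Equi_up_space[OF assms(1)]] in \<open>auto simp: abs_trunc\<close>)
qed

lemma Equi_add:
  assumes pq: "conj_exp p q" and x: "x \<in> Equi p" and y: "y \<in> Equi p"
  shows "(\<lambda>n t. x n t + y n t) \<in> Equi p"
proof (rule EquiI_approx[OF pq])
  note xs = Equi_up_space[OF x] and ys = Equi_up_space[OF y]
  show "(\<lambda>n t. x n t + y n t) \<in> up_space p" by (rule up_space_add[OF pq xs ys])
  fix e :: real assume e: "e > 0"
  obtain a where a: "a \<in> Bdd" "eventually (\<lambda>n. Lp_norm p (\<lambda>t. x n t - a n t) < e / 2) U"
    using Equi_approx[OF x, of "e/2"] e by auto
  obtain b where b: "b \<in> Bdd" "eventually (\<lambda>n. Lp_norm p (\<lambda>t. y n t - b n t) < e / 2) U"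
    using Equi_approx[OF y, of "e/2"] e by auto
  note c = conj_expD[OF pq]
  have as: "a \<in> up_space p" and bs: "b \<in> up_space p" using Bdd_up_space a b c by auto
  have "eventually (\<lambda>n. Lp_norm p (\<lambda>t. x n t + y n t - (a n t + b n t)) < e) U"
    using a(2) b(2)
  proof eventually_elim
    case (elim n)
    have "Lp_norm p (\<lambda>t. (x n t - a n t) + (y n t - b n t)) \<le> Lp_norm p (\<lambda>t. x n t - a n t) + Lp_norm p (\<lambda>t. y n t - b n t)"
      by (rule Lp_norm_triangle[OF pq up_spaceD[OF up_space_diff[OF pq xs as]] up_spaceD[OF up_space_diff[OF pq ys bs]]])
    moreover have "(\<lambda>t. (x n t - a n t) + (y n t - b n t)) = (\<lambda>t. x n t + y n t - (a n t + b n t))" by auto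
    ultimately show ?case using elim by simp
  qed
  then show "\<exists>b\<in>Bdd. eventually (\<lambda>n. Lp_norm p (\<lambda>t. x n t + y n t - b n t) < e) U"
    using Bdd_add[OF a(1) b(1)] by (intro bexI[of _ "\<lambda>n t. a n t + b n t"]) auto
qed

lemma Equi_scale:
  assumes pq: "conj_exp p q" and x: "x \<in> Equi p"
  shows "(\<lambda>n t. c * x n t) \<in> Equi p"
proof (rule EquiI_approx[OF pq])
  note xs = Equi_up_space[OF x] and cc = conj_expD[OF pq]
  show "(\<lambda>n t. c * x n t) \<in> up_space p" using up_space_scale[OF _ xs] cc by simp
  fix e :: real assume e: "e > 0"
  obtain a where a: "a \<in> Bdd" "eventually (\<lambda>n. Lp_norm p (\<lambda>t. x n t - a n t) < e / (\<bar>c\<bar> + 1)) U"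
    by (rule Equi_approx[OF x, of "e/(\<bar>c\<bar>+1)"]) (use e in auto)
  have "eventually (\<lambda>n. Lp_norm p (\<lambda>t. c * x n t - c * a n t) < e) U"
    using a(2)
  proof eventually_elim
    case (elim n)
    have "Lp_norm p (\<lambda>t. c * x n t - c * a n t) = \<bar>c\<bar> * Lp_norm p (\<lambda>t. x n t - a n t)"
      using Lp_norm_scale[of p c "\<lambda>t. x n t - a n t"] cc by (simp add: right_diff_distrib)
    also have "\<dots> \<le> \<bar>c\<bar> * (e / (\<bar>c\<bar> + 1))" using elim by (intro mult_left_mono) auto
    also have "\<dots> < e" using e by (simp add: field_simps)
    finally show ?case .
  qed
  then show "\<exists>b\<in>Bdd. eventually (\<lambda>n. Lp_norm p (\<lambda>t. c * x n t - b n t) < e) U"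
    using Bdd_scale[OF a(1)] by (intro bexI[of _ "\<lambda>n t. c * a n t"]) auto
qed

lemma EquiI_up_approx:
  assumes pq: "conj_exp p q" and y: "y \<in> up_space p"
    and a: "\<And>e. e > 0 \<Longrightarrow> \<exists>x\<in>Equi p. up_norm p U (\<lambda>n t. x n t - y n t) < e"
  shows "y \<in> Equi p"
proof (rule EquiI_approx[OF pq y])
  fix e :: real assume e: "e > 0"
  note c = conj_expD[OF pq]
  obtain x where x: "x \<in> Equi p" "up_norm p U (\<lambda>n t. x n t - y n t) < e / 2" using a[of "e/2"] e by auto
  note xs = Equi_up_space[OF x(1)]
  obtain b where b: "b \<in> Bdd" "eventually (\<lambda>n. Lp_norm p (\<lambda>t. x n t - b n t) < e / 2) U"
    using Equi_approx[OF x(1), of "e/2"] e by auto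
  have bs: "b \<in> up_space p" using Bdd_up_space b c by auto
  have "eventually (\<lambda>n. Lp_norm p (\<lambda>t. y n t - b n t) < e) U"
    using b(2) up_norm_less[OF up_space_diff[OF pq xs y] x(2)]
  proof eventually_elim
    case (elim n)
    have "Lp_norm p (\<lambda>t. (x n t - b n t) - (x n t - y n t)) \<le> Lp_norm p (\<lambda>t. x n t - b n t) + Lp_norm p (\<lambda>t. x n t - y n t)"
      by (rule Lp_norm_triangle_diff[OF pq up_spaceD[OF up_space_diff[OF pq xs bs]] up_spaceD[OF up_space_diff[OF pq xs y]]])
    moreover have "(\<lambda>t. (x n t - b n t) - (x n t - y n t)) = (\<lambda>t. y n t - b n t)" by auto
    ultimately show ?case using elim by simp
  qed
  then show "\<exists>b\<in>Bdd. eventually (\<lambda>n. Lp_norm p (\<lambda>t. y n t - b n t) < e) U" using b by auto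
qed

lemma Bdd_Equi: "conj_exp p q \<Longrightarrow> b \<in> Bdd \<Longrightarrow> b \<in> Equi p"
  by (rule EquiI_approx) (auto intro!: Bdd_up_space bexI[of _ b] dest: conj_expD(1))

text \<open>Weak lower semicontinuity of the norm. Testing the weak limit \<open>f\<close> against
  \<open>Jmap p f\<close> bounds \<open>Lp_norm p f powr p\<close> by
  \<open>B * Lp_norm p f powr (p - 1)\<close>.\<close>

lemma weak_limit_norm:
  assumes pq: "conj_exp p q" and x: "x \<in> up_space p" and f: "f \<in> Lp p"
    and w: "wnull p U (\<lambda>n t. x n t - f t)" and B: "eventually (\<lambda>n. Lp_norm p (x n) \<le> B) U"
  shows "Lp_norm p f \<le> B"
proof -
  note c = conj_expD[OF pq]
  have B0: "0 \<le> B" using eventually_happens'[OF U_ne_bot B] Lp_norm_nonneg order_trans by blast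
  have J: "Jmap p f \<in> Lp q" using pq f by auto
  have "Lp_norm p f powr p = (\<integral>t. f t * Jmap p f t \<partial>mu)"
    using c Jmap_mult[OF c(1), of f] by (simp add: Lp_norm_powr)
  also have "\<dots> \<le> B * Lp_norm p f powr (p - 1)"
  proof (rule tendsto_upperbound[OF weak_limit_tendsto[OF pq x f w J]])
    show "\<forall>\<^sub>F n in U. (\<integral>t. x n t * Jmap p f t \<partial>mu) \<le> B * Lp_norm p f powr (p - 1)"
      using B
    proof eventually_elim
      case (elim n)
      have "(\<integral>t. x n t * Jmap p f t \<partial>mu) \<le> Lp_norm p (x n) * Lp_norm q (Jmap p f)"
        using Holder[OF pq up_spaceD[OF x] J, of n] by linarith
      also have "\<dots> \<le> B * Lp_norm q (Jmap p f)" using elim by (intro mult_right_mono) auto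
      finally show ?case by (simp add: Lp_norm_Jmap[OF pq])
    qed
  qed simp
  finally have le: "Lp_norm p f powr p \<le> B * Lp_norm p f powr (p - 1)" .
  show ?thesis
  proof (cases "Lp_norm p f = 0")
    case False
    then have "Lp_norm p f > 0" by (simp add: order_less_le)
    then show ?thesis using le by (simp add: powr_diff field_simps)
  qed (use B0 in simp)
qed

text \<open>Testing against the indicator of the set where \<open>f\<close> exceeds \<open>K\<close>
  shows that the integral of \<open>f - K\<close> over this set is at most 0, so the set is
  null.\<close>

lemma weak_limit_upper_AE:
  assumes pq: "conj_exp p q" and x: "x \<in> up_space p" "\<And>n t. x n t \<le> K" and f: "f \<in> Lp p"
    and w: "wnull p U (\<lambda>n t. x n t - f t)"
  shows "AE t in mu. f t \<le> K"
proof -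
  note c = conj_expD[OF pq]
  note [measurable] = LpD(1)[OF f]
  let ?g = "\<lambda>t. if f t > K then 1 else 0 :: real"
  have g: "?g \<in> Lp q" by (rule Lp_bounded[where K=1]) (use c in auto)
  have ig: "integrable mu ?g" by (rule integrable_bounded[where K=1]) auto
  have if': "integrable mu (\<lambda>t. f t * ?g t)" by (rule Lp_mult_integrable[OF pq f g])
  have "(\<integral>t. f t * ?g t \<partial>mu) \<le> (\<integral>t. K * ?g t \<partial>mu)"
  proof (rule tendsto_upperbound[OF weak_limit_tendsto[OF pq x(1) f w g]])
    show "\<forall>\<^sub>F n in U. (\<integral>t. x n t * ?g t \<partial>mu) \<le> (\<integral>t. K * ?g t \<partial>mu)"
      by (intro always_eventually allI Bochner_Integration.integral_mono Lp_mult_integrable[OF pq up_spaceD[OF x(1)] g])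
         (use ig x(2) in auto)
  qed simp
  then have le: "(\<integral>t. (f t - K) * ?g t \<partial>mu) \<le> 0"
    using if' ig by (simp add: left_diff_distrib)
  have int: "integrable mu (\<lambda>t. (f t - K) * ?g t)" using if' ig by (simp add: left_diff_distrib)
  have nn: "0 \<le> (f t - K) * ?g t" for t by auto
  have "(\<integral>t. (f t - K) * ?g t \<partial>mu) = 0"
    using le Bochner_Integration.integral_nonneg[of mu "\<lambda>t. (f t - K) * ?g t"] nn by (simp add: order_antisym)
  then have "AE t in mu. (f t - K) * ?g t = 0"
    using integral_nonneg_eq_0_iff_AE[OF int] nn by auto
  then show ?thesis by eventually_elim (auto split: if_splits)
qed

lemma wnull_cong_AE:
  assumes "wnull p U x" "\<And>n. y n \<in> borel_measurable mu" "\<And>n. AE t in mu. x n t = y n t" "y \<in> up_space p"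
  shows "wnull p U y"
  unfolding wnull_def
proof (intro conjI allI impI assms(4))
  fix g :: "real \<Rightarrow> real" and K assume g: "g \<in> borel_measurable mu" "\<forall>t. \<bar>g t\<bar> \<le> K"
  have "(\<integral>t. x n t * g t \<partial>mu) = (\<integral>t. y n t * g t \<partial>mu)" for n
    by (rule integral_cong_AE)
       (use g(1) assms(2)[of n] up_space_meas[OF wnullD[OF assms(1)], of n] assms(3)[of n] in auto)
  moreover have "((\<lambda>n. \<integral>t. x n t * g t \<partial>mu) \<longlongrightarrow> 0) U"
    using assms(1)[unfolded wnull_def, THEN conjunct2, rule_format, OF g(1), of K] g(2) by simp
  ultimately show "((\<lambda>n. \<integral>t. y n t * g t \<partial>mu) \<longlongrightarrow> 0) U" by simp
qed

text \<open>The weak limit is bounded only almost everywhere, whereas \<open>Bdd\<close> asks for a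
  bound at every point; so the limit is replaced by its truncation, which agrees with it almost
  everywhere.\<close>

lemma weak_limit_bounded:
  assumes pq: "conj_exp p q" and b: "b \<in> Bdd"
  obtains f K where "f \<in> borel_measurable mu" "\<And>t. \<bar>f t\<bar> \<le> K" "f \<in> Lp p" "wnull p U (\<lambda>n t. b n t - f t)"
proof -
  note c = conj_expD[OF pq]
  obtain K where K: "0 < K" "\<And>n t. \<bar>b n t\<bar> \<le> K" using BddE[OF b] by metis
  have bs: "b \<in> up_space p" using Bdd_up_space[OF b] c by auto
  obtain f where f: "f \<in> Lp p" "wnull p U (\<lambda>n t. b n t - f t)" by (rule weak_limit_exists[OF pq bs])
  have 1: "AE t in mu. f t \<le> K"
    by (rule weak_limit_upper_AE[OF pq bs _ f]) (use K(2) in \<open>auto simp: abs_le_iff\<close>)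
  have "wnull p U (\<lambda>n t. - b n t - (- f t))"
    using wnull_scale[OF _ f(2), of "-1"] c by (simp add: algebra_simps)
  moreover have "(\<lambda>n t. - b n t) \<in> up_space p" using up_space_scale[OF _ bs, of "-1"] c by simp
  ultimately have 2: "AE t in mu. - f t \<le> K"
    using weak_limit_upper_AE[OF pq, of "\<lambda>n t. - b n t" K "\<lambda>t. - f t"] K(2) Lp_uminus[OF f(1)] by (auto simp: abs_le_iff)
  have 3: "AE t in mu. f t = trunc K (f t)" using 1 2 by eventually_elim (auto simp: trunc_def)
  note [measurable] = LpD(1)[OF f(1)] Bdd_meas[OF b]
  have L: "(\<lambda>t. trunc K (f t)) \<in> Lp p" by (rule trunc_Lp(1)[OF f(1)]) (use K c in auto)
  have "wnull p U (\<lambda>n t. b n t - trunc K (f t))"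
    by (rule wnull_cong_AE[OF f(2) _ _ up_space_diff[OF pq bs up_space_const[OF L]]]) (use 3 in auto)
  then show ?thesis by (intro that[of "\<lambda>t. trunc K (f t)" K] L) (use K in \<open>auto simp: abs_trunc\<close>)
qed

text \<open>The bounded approximation \<open>a\<close> need not be weakly null, so its weak limit
  \<open>f\<close> is subtracted. Since \<open>x\<close> is weakly null, \<open>f\<close> is also
  the weak limit of \<open>a - x\<close>, whose norms are eventually at most \<open>e / 3\<close>;
  the correction costs no more than the approximation itself.\<close>

lemma Equi_wnull_approx:
  assumes pq: "conj_exp p q" and x: "x \<in> Equi p" "wnull p U x" and e: "e > 0"
  obtains b where "b \<in> Bdd" "wnull p U b" "up_norm p U (\<lambda>n t. x n t - b n t) < e"
proof -
  note c = conj_expD[OF pq]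
  note xs = Equi_up_space[OF x(1)]
  obtain a where a: "a \<in> Bdd" "eventually (\<lambda>n. Lp_norm p (\<lambda>t. x n t - a n t) < e / 3) U"
    using Equi_approx[OF x(1), of "e/3"] e by auto
  have as: "a \<in> up_space p" using Bdd_up_space[OF a(1)] c by auto
  obtain f K where f: "f \<in> borel_measurable mu" "\<And>t. \<bar>f t\<bar> \<le> K" "f \<in> Lp p" "wnull p U (\<lambda>n t. a n t - f t)"
    by (rule weak_limit_bounded[OF pq a(1)]) blast
  let ?b = "\<lambda>n t. a n t - f t"
  have ff: "(\<lambda>n. f) \<in> Bdd" by (rule BddI[where K=K]) (use f in auto)
  have b: "?b \<in> Bdd" using Bdd_add[OF a(1) Bdd_scale[OF ff, of "-1"]] by simp
  have bs: "?b \<in> up_space p" using Bdd_up_space[OF b] c by auto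
  have ax: "(\<lambda>n t. a n t - x n t) \<in> up_space p" by (rule up_space_diff[OF pq as xs])
  have "wnull p U (\<lambda>n t. (a n t - f t) - x n t)" by (rule wnull_diff[OF pq f(4) x(2)])
  then have "wnull p U (\<lambda>n t. (a n t - x n t) - f t)" by (simp add: algebra_simps)
  moreover have "eventually (\<lambda>n. Lp_norm p (\<lambda>t. a n t - x n t) \<le> e / 3) U"
    using a(2) by eventually_elim (simp add: Lp_norm_minus_commute[of p "a _"])
  ultimately have fn: "Lp_norm p f \<le> e / 3" by (intro weak_limit_norm[OF pq ax f(3)])
  have "eventually (\<lambda>n. Lp_norm p (\<lambda>t. x n t - ?b n t) \<le> 2 * e / 3) U"
    using a(2)
  proof eventually_elim
    case (elim n)
    have "Lp_norm p (\<lambda>t. (x n t - a n t) + f t) \<le> Lp_norm p (\<lambda>t. x n t - a n t) + Lp_norm p f"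
      by (rule Lp_norm_triangle[OF pq up_spaceD[OF up_space_diff[OF pq xs as]] f(3)])
    moreover have "(\<lambda>t. (x n t - a n t) + f t) = (\<lambda>t. x n t - ?b n t)" by auto
    ultimately show ?case using elim fn by simp
  qed
  then have "up_norm p U (\<lambda>n t. x n t - ?b n t) \<le> 2 * e / 3" by (rule up_norm_le[OF up_space_diff[OF pq xs bs]])
  then show ?thesis using that[OF b f(4)] e by simp
qed

text \<open>The subsequence splitting of Kadec and Pelczynski, without a subsequence. Each
  \<open>x n\<close> is cut at a level \<open>kk n\<close> that tends to infinity along
  \<open>U\<close>, but so slowly that the p-mass below it does not exceed, in the limit, the
  supremum \<open>l\<close> of the masses found below fixed levels. Then no mass escapes from the
  lower part, which is therefore equi-integrable.\<close>

lemma equi_disj_split: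
  assumes pq: "conj_exp p q" and x: "x \<in> up_space p"
  obtains e d where "e \<in> Equi p" "d \<in> Disj p" "x = (\<lambda>n t. e n t + d n t)"
proof -
  note c = conj_expD[OF pq]
  note [measurable] = up_space_meas[OF x]
  obtain B where B: "0 < B" "\<And>n. Lp_norm p (x n) \<le> B" using up_space_bound[OF x] by metis
  have Bp: "(\<integral>t. \<bar>x n t\<bar> powr p \<partial>mu) \<le> B powr p" for n
    using Lp_norm_le_iff[of p B "x n"] B c by simp
  define F where "F = (\<lambda>n (k::nat). \<integral>t. \<bar>trunc (real k) (x n t)\<bar> powr p \<partial>mu)"
  have Fi: "integrable mu (\<lambda>t. \<bar>trunc (real k) (x n t)\<bar> powr p)" for n k
    using trunc_Lp(1)[OF up_spaceD[OF x], of "real k" n] c by auto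
  have Fmono: "F n j \<le> F n k" if "j \<le> k" for n j k
    unfolding F_def using that c by (intro Bochner_Integration.integral_mono Fi powr_mono2) (auto simp: abs_trunc)
  have FB: "F n k \<le> B powr p" for n k
  proof -
    have "F n k \<le> (\<integral>t. \<bar>x n t\<bar> powr p \<partial>mu)"
      unfolding F_def using c up_spaceD[OF x]
      by (intro Bochner_Integration.integral_mono Fi powr_mono2) (auto simp: abs_trunc)
    then show ?thesis using Bp[of n] by linarith
  qed
  have F0: "0 \<le> F n k" for n k by (simp add: F_def)
  define L where "L = (\<lambda>k. Lim U (\<lambda>n. F n k))"
  have Lt: "((\<lambda>n. F n k) \<longlongrightarrow> L k) U" for k
    unfolding L_def by (rule bounded_tendsto[where B="B powr p"]) (use FB F0 in \<open>simp add: abs_of_nonneg\<close>)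
  have LB: "L k \<le> B powr p" for k by (rule tendsto_upperbound[OF Lt]) (use FB in auto)
  have "incseq L"
    unfolding incseq_def using Fmono by (auto intro!: tendsto_le[OF U_ne_bot Lt Lt])
  then obtain l where l: "L \<longlonglongrightarrow> l" "\<And>k. L k \<le> l" using incseq_convergent[of L "B powr p"] LB by blast
  \<comment> \<open>The condition \<open>k \<le> n\<close> makes the set finite, so there is a
    largest admissible level. The slack tends to 0 with \<open>k\<close> but is positive, so every
    fixed level becomes admissible eventually because \<open>L k \<le> l\<close>.\<close>
  define K where "K = (\<lambda>n. {k. k \<le> n \<and> F n k \<le> l + 1 / (real k + 1)})"
  have Kfin: "finite (K n)" for n unfolding K_def by simp
  have K0: "0 \<in> K n" for n
  proof -
    have "F m 0 = 0" for m using c by (simp add: F_def trunc_def)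
    then have "L 0 = 0" unfolding L_def by (simp add: Lim_eq[OF tendsto_const])
    then show ?thesis using l(2)[of 0] \<open>\<And>m. F m 0 = 0\<close> by (simp add: K_def)
  qed
  define kk where "kk = (\<lambda>n. Max (K n))"
  have kkK: "kk n \<in> K n" for n unfolding kk_def using Max_in[OF Kfin] K0 by blast
  have kkge: "eventually (\<lambda>n. kk n \<ge> m) U" for m
  proof -
    have "L m < l + 1 / (real m + 1)" using l(2)[of m] by (smt (verit) divide_pos_pos of_nat_0_le_iff)
    then have "eventually (\<lambda>n. F n m < l + 1 / (real m + 1)) U" by (rule order_tendstoD(2)[OF Lt])
    then show ?thesis using eventually_ge_U[of m]
    proof eventually_elim
      case (elim n)
      then have "m \<in> K n" by (simp add: K_def)
      then show ?case unfolding kk_def using Kfin by simp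
    qed
  qed
  define e where "e = (\<lambda>n t. trunc (real (kk n)) (x n t))"
  define d where "d = (\<lambda>n t. x n t - e n t)"
  have em[measurable]: "e n \<in> borel_measurable mu" for n unfolding e_def by measurable
  have es: "e \<in> up_space p"
    by (rule up_space_dominated[OF x]) (use c in \<open>auto simp: e_def abs_trunc\<close>)
  have ds: "d \<in> up_space p" unfolding d_def by (rule up_space_diff[OF pq x es])
  have "((\<lambda>n. \<integral>t. \<bar>d n t\<bar> \<partial>mu) \<longlongrightarrow> 0) U"
  proof (rule tendstoI)
    fix r :: real assume r: "r > 0"
    have "((\<lambda>k. B powr p * real k powr (1 - p)) \<longlongrightarrow> B powr p * 0) sequentially"
      by (intro tendsto_mult tendsto_const tendsto_neg_powr filterlim_real_sequentially) (use c in auto)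
    then have "eventually (\<lambda>k. B powr p * real k powr (1 - p) < r) sequentially"
      using r by (intro order_tendstoD(2)) auto
    moreover have "eventually (\<lambda>k. k > (0::nat)) sequentially" by (rule eventually_gt_at_top)
    ultimately have "eventually (\<lambda>k. B powr p * real k powr (1 - p) < r \<and> k > 0) sequentially"
      by (rule eventually_conj)
    then obtain m :: nat where m: "B powr p * real m powr (1 - p) < r" "m > 0"
      by (auto simp: eventually_sequentially)
    show "eventually (\<lambda>n. dist (\<integral>t. \<bar>d n t\<bar> \<partial>mu) 0 < r) U"
      using kkge[of m]
    proof eventually_elim
      case (elim n)
      have "(\<integral>t. \<bar>d n t\<bar> \<partial>mu) \<le> (\<integral>t. real m powr (1 - p) * \<bar>x n t\<bar> powr p \<partial>mu)"
      proof (rule Bochner_Integration.integral_mono)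
        show "integrable mu (\<lambda>t. \<bar>d n t\<bar>)" using integral_abs_le_Lp_norm(1)[OF pq up_spaceD[OF ds]] by simp
        show "integrable mu (\<lambda>t. real m powr (1 - p) * \<bar>x n t\<bar> powr p)" using up_spaceD[OF x, of n] by auto
        fix t
        have "\<bar>d n t\<bar> \<le> real (kk n) powr (1 - p) * \<bar>x n t\<bar> powr p"
          unfolding d_def e_def using abs_diff_trunc_le_powr[of "real (kk n)" p "x n t"] elim m c by simp
        also have "\<dots> \<le> real m powr (1 - p) * \<bar>x n t\<bar> powr p"
          using elim m c by (intro mult_right_mono powr_mono2') auto
        finally show "\<bar>d n t\<bar> \<le> real m powr (1 - p) * \<bar>x n t\<bar> powr p" .
      qed
      also have "\<dots> = real m powr (1 - p) * (\<integral>t. \<bar>x n t\<bar> powr p \<partial>mu)" by simp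
      also have "\<dots> \<le> real m powr (1 - p) * B powr p" by (intro mult_left_mono Bp) simp
      finally show ?case using m by (simp add: dist_real_def mult.commute)
    qed
  qed
  then have d: "d \<in> Disj p" using ds by (simp add: Disj_def)
  have "e \<in> Equi p"
    unfolding Equi_def
  proof (intro CollectI conjI allI impI es)
    fix r :: real assume r: "r > 0"
    \<comment> \<open>Cutting the lower part at height \<open>m\<close> removes at most
      \<open>F n (kk n) - F n m\<close>, which is below \<open>2 * h\<close>, half of
      \<open>r powr p\<close>.\<close>
    define h where "h = r powr p / 4"
    have h: "h > 0" using r by (simp add: h_def)
    have "eventually (\<lambda>m. l - h < L m) sequentially" using l(1) h by (intro order_tendstoD) auto
    then obtain m where m: "l - h < L m" by (auto simp: eventually_sequentially)
    obtain M where M: "1 / (real M + 1) < h" using nat_approx_posE[OF h] by (metis of_nat_Suc add.commute)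
    have "eventually (\<lambda>n. l - h < F n m) U" by (rule order_tendstoD(1)[OF Lt m])
    then have "eventually (\<lambda>n. Lp_norm p (\<lambda>t. e n t - trunc (real m) (e n t)) < r) U"
      using kkge[of "max m M"]
    proof eventually_elim
      case (elim n)
      have "1 / (real (kk n) + 1) \<le> 1 / (real M + 1)" using elim by (intro divide_left_mono) auto
      then have up: "F n (kk n) \<le> l + h" using kkK[of n] M by (simp add: K_def)
      have "(\<integral>t. \<bar>e n t - trunc (real m) (e n t)\<bar> powr p \<partial>mu)
          \<le> (\<integral>t. \<bar>trunc (real (kk n)) (x n t)\<bar> powr p - \<bar>trunc (real m) (x n t)\<bar> powr p \<partial>mu)"
      proof (rule Bochner_Integration.integral_mono)
        show "integrable mu (\<lambda>t. \<bar>e n t - trunc (real m) (e n t)\<bar> powr p)"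
          using trunc_Lp(2)[OF up_spaceD[OF es], of "real m" n] c by auto
        show "\<bar>e n t - trunc (real m) (e n t)\<bar> powr p \<le> \<bar>trunc (real (kk n)) (x n t)\<bar> powr p - \<bar>trunc (real m) (x n t)\<bar> powr p" for t
          unfolding e_def using elim c by (intro trunc_diff_powr) auto
      qed (use Fi in auto)
      also have "\<dots> = F n (kk n) - F n m" unfolding F_def using Fi by simp
      also have "\<dots> < r powr p" using up elim h unfolding h_def by linarith
      finally have "Lp_norm p (\<lambda>t. e n t - trunc (real m) (e n t)) powr p < r powr p"
        using c by (simp add: Lp_norm_powr)
      then show ?case using r c by (meson Lp_norm_nonneg not_le powr_mono2 less_imp_le order_less_le_trans zero_less_one)
    qed
    then show "\<exists>K\<ge>0. eventually (\<lambda>n. Lp_norm p (\<lambda>t. e n t - trunc K (e n t)) < r) U"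
      by (intro exI[of _ "real m"]) auto
  qed
  then show ?thesis using d by (rule that) (simp add: d_def)
qed

end

section \<open>Thinning out along a selective ultrafilter\<close>

context selective_ultrafilter
begin

text \<open>A gliding hump: \<open>A n\<close> holds the indices that are good with respect to
  everything up to \<open>n\<close>. Membership in \<open>A 0\<close> is demanded of all terms
  because the first one has no predecessor.\<close>

definition chain :: "(nat \<Rightarrow> nat set) \<Rightarrow> (nat \<Rightarrow> nat) \<Rightarrow> bool" where
  "chain A b \<longleftrightarrow> strict_mono b \<and> (\<forall>j. b j \<in> A 0) \<and> (\<forall>i j. i < j \<longrightarrow> b j \<in> A (b i))"

text \<open>Stated through the sets \<open>A\<close> rather than through the existence of one good
  subsequence, so that finitely many requirements can be met at once by intersecting the
  sets.\<close>

definition sparse :: "((nat \<Rightarrow> nat) \<Rightarrow> bool) \<Rightarrow> bool" where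
  "sparse P \<longleftrightarrow> (\<exists>A. (\<forall>n. eventually (\<lambda>m. m \<in> A n) U) \<and> (\<forall>b. chain A b \<longrightarrow> P b))"

lemma sparseI:
  assumes "\<And>n. eventually (\<lambda>m. m \<in> A n) U" "\<And>b. chain A b \<Longrightarrow> P b"
  shows "sparse P"
  using assms by (auto simp: sparse_def)

lemma sparse_mono: "sparse P \<Longrightarrow> (\<And>b. P b \<Longrightarrow> Q b) \<Longrightarrow> sparse Q"
  unfolding sparse_def by blast

lemma sparse_conj:
  assumes "sparse P" "sparse Q"
  shows "sparse (\<lambda>b. P b \<and> Q b)"
proof -
  obtain A where A: "\<And>n. eventually (\<lambda>m. m \<in> A n) U" "\<And>b. chain A b \<Longrightarrow> P b"
    using assms(1) by (auto simp: sparse_def)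
  obtain B where B: "\<And>n. eventually (\<lambda>m. m \<in> B n) U" "\<And>b. chain B b \<Longrightarrow> Q b"
    using assms(2) by (auto simp: sparse_def)
  show ?thesis
  proof (rule sparseI[where A="\<lambda>n. A n \<inter> B n"])
    show "eventually (\<lambda>m. m \<in> A n \<inter> B n) U" for n using eventually_conj[OF A(1) B(1)] by simp
    fix b assume "chain (\<lambda>n. A n \<inter> B n) b"
    then have "chain A b" "chain B b" by (auto simp: chain_def)
    then show "P b \<and> Q b" using A B by blast
  qed
qed

lemma sparse_all_less:
  assumes "\<And>i. i < (k::nat) \<Longrightarrow> sparse (P i)"
  shows "sparse (\<lambda>b. \<forall>i<k. P i b)"
  using assms
proof (induction k)
  case 0
  show ?case by (rule sparseI[where A="\<lambda>n. UNIV"]) auto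
next
  case (Suc k)
  have "sparse (\<lambda>b. (\<forall>i<k. P i b) \<and> P k b)" by (rule sparse_conj) (use Suc in auto)
  then show ?case by (rule sparse_mono) (auto simp: less_Suc_eq)
qed

lemma infinite_of_eventually:
  assumes "eventually (\<lambda>m. m \<in> B) U"
  shows "infinite B"
proof
  assume "finite B"
  then obtain N where N: "\<And>m. m \<in> B \<Longrightarrow> m < N" using finite_nat_set_iff_bounded[of B] by auto
  have "eventually (\<lambda>m. False) U"
    using assms eventually_ge_U[of N] by eventually_elim (use N not_le in blast)
  then show False by (simp add: eventually_False)
qed

text \<open>The P-point property makes all members of a set in \<open>U\<close> that lie beyond a threshold \<open>f n\<close>
  belong to \<open>A n\<close>. Picking one point from each of a sequence of intervals adapted to \<open>f\<close> and
  keeping only the intervals of one parity leaves consecutive points far enough apart.\<close>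
lemma sparse_imp_ex:
  assumes "sparse P"
  obtains b where "strict_mono b" "eventually (\<lambda>m. m \<in> range b) U" "P b"
proof -
  obtain A where A: "\<And>n. eventually (\<lambda>m. m \<in> A n) U" "\<And>b. chain A b \<Longrightarrow> P b"
    using assms by (auto simp: sparse_def)
  obtain B0 where B0: "eventually (\<lambda>m. m \<in> B0) U" "\<And>k. finite (B0 - A k)"
  proof -
    have "\<exists>B. in_uf B U \<and> (\<forall>k. finite (B - A k))"
      using selective[unfolded selective_def, THEN conjunct1, THEN spec[of _ A]] A(1) by (simp add: in_uf_def)
    then obtain B where "in_uf B U" "\<forall>k. finite (B - A k)" by blast
    then show ?thesis by (intro that[of B]) (simp_all add: in_uf_def)
  qed
  have "\<exists>f. \<forall>m. m \<in> B0 \<longrightarrow> m \<ge> f \<longrightarrow> m \<in> A k" for k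
  proof -
    obtain N where "\<And>m. m \<in> B0 - A k \<Longrightarrow> m < N" using B0(2)[of k] finite_nat_set_iff_bounded[of "B0 - A k"] by auto
    then show ?thesis by (intro exI[of _ N]) (use not_le in blast)
  qed
  then obtain f where f: "\<And>k m. m \<in> B0 \<Longrightarrow> m \<ge> f k \<Longrightarrow> m \<in> A k"
    using choice[of "\<lambda>k f. \<forall>m. m \<in> B0 \<longrightarrow> m \<ge> f \<longrightarrow> m \<in> A k"] by auto
  \<comment> \<open>\<open>a (Suc k)\<close> exceeds every threshold \<open>f n\<close> with
    \<open>n \<le> a k\<close>; hence \<open>m\<close> lies beyond \<open>f n\<close> as soon as a
    whole interval separates it from the interval of \<open>n\<close>.\<close>
  define a where "a = rec_nat 0 (\<lambda>_ a. Suc (a + (\<Sum>n\<le>a. f n)))"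
  have a0: "a 0 = 0" and aS: "a (Suc k) = Suc (a k + (\<Sum>n\<le>a k. f n))" for k by (simp_all add: a_def)
  have amono: "strict_mono a" by (rule strict_mono_Suc_iff[THEN iffD2]) (simp add: aS)
  have fa: "f n \<le> a (Suc k)" if "n \<le> a k" for n k
    using member_le_sum[of n "{..a k}" f] that by (simp add: aS)
  define I where "I = (\<lambda>k. {a k..<a (Suc k)})"
  have disj: "k = l" if "m \<in> I k" "m \<in> I l" for k l m
  proof (rule ccontr)
    assume "k \<noteq> l"
    then consider "Suc k \<le> l" | "Suc l \<le> k" by linarith
    then show False
    proof cases
      case 1
      then have "a (Suc k) \<le> a l" using amono strict_mono_less_eq by blast
      then show False using that by (simp add: I_def)
    next
      case 2
      then have "a (Suc l) \<le> a k" using amono strict_mono_less_eq by blast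
      then show False using that by (simp add: I_def)
    qed
  qed
  have cover: "\<exists>k. m \<in> I k" for m
  proof (induction m)
    case 0
    then show ?case by (intro exI[of _ 0]) (simp add: I_def a0 aS)
  next
    case (Suc m)
    then obtain k where k: "m \<in> I k" by blast
    have "a (Suc k) < a (Suc (Suc k))" using amono by (simp add: strict_mono_def)
    then show ?case using k by (cases "Suc m < a (Suc k)") (auto simp: I_def intro: exI[of _ k] exI[of _ "Suc k"])
  qed
  have part: "(\<forall>k. finite (I k) \<and> I k \<noteq> {}) \<and> (\<Union>k. I k) = UNIV \<and> (\<forall>k l. k \<noteq> l \<longrightarrow> I k \<inter> I l = {})"
  proof (intro conjI allI impI)
    show "I k \<noteq> {}" for k using amono by (simp add: I_def strict_mono_def)
    show "(\<Union>k. I k) = UNIV" using cover by auto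
    show "I k \<inter> I l = {}" if "k \<noteq> l" for k l using disj that by blast
  qed (simp add: I_def)
  obtain B1 where B1: "eventually (\<lambda>m. m \<in> B1) U" "\<And>k. \<exists>c. B1 \<inter> I k = {c}"
  proof -
    have "\<exists>B. in_uf B U \<and> (\<forall>k. \<exists>a. B \<inter> I k = {a})"
      by (rule selective[unfolded selective_def, THEN conjunct2, THEN spec[of _ I], THEN mp, OF part])
    then obtain B where "in_uf B U" "\<forall>k. \<exists>a. B \<inter> I k = {a}" by blast
    then show ?thesis by (intro that[of B]) (simp_all add: in_uf_def)
  qed
  obtain idx where idx: "\<And>m. m \<in> I (idx m)" using choice[of "\<lambda>m k. m \<in> I k"] cover by auto
  obtain Q where Q: "eventually (\<lambda>m. m \<in> Q) U" "\<And>m n. m \<in> Q \<Longrightarrow> n \<in> Q \<Longrightarrow> even (idx m) = even (idx n)"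
  proof (cases "eventually (\<lambda>m. even (idx m)) U")
    case True
    show ?thesis by (rule that[of "{m. even (idx m)}"]) (use True in simp_all)
  next
    case False
    show ?thesis by (rule that[of "{m. odd (idx m)}"]) (use False ultra[of "\<lambda>m. even (idx m)"] in simp_all)
  qed
  define B where "B = B0 \<inter> B1 \<inter> A 0 \<inter> Q"
  have BU: "eventually (\<lambda>m. m \<in> B) U"
    using B0(1) B1(1) A(1)[of 0] Q(1) unfolding B_def by eventually_elim simp
  then have inf: "infinite B" by (rule infinite_of_eventually)
  let ?b = "enumerate B"
  have bm: "strict_mono ?b" using inf by (rule strict_mono_enumerate)
  have rb: "range ?b = B" using inf by (rule range_enumerate)
  have far: "m \<in> A n" if "n \<in> B" "m \<in> B" "n < m" for n m
  proof -
    have "idx n \<noteq> idx m"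
    proof
      assume eq: "idx n = idx m"
      obtain c where "B1 \<inter> I (idx n) = {c}" using B1(2) by blast
      then have "n = c" "m = c" using that idx[of n] idx[of m] eq by (auto simp: B_def)
      then show False using that by simp
    qed
    moreover have "\<not> idx m < idx n"
    proof
      assume "idx m < idx n"
      then have "a (Suc (idx m)) \<le> a (idx n)" using amono by (simp add: strict_mono_less_eq)
      then show False using idx[of n] idx[of m] that by (simp add: I_def)
    qed
    moreover have "even (idx n) = even (idx m)" using Q(2) that by (simp add: B_def)
    ultimately have "Suc (Suc (idx n)) \<le> idx m" by presburger
    then have "a (Suc (Suc (idx n))) \<le> a (idx m)" using amono by (simp add: strict_mono_less_eq)
    moreover have "f n \<le> a (Suc (Suc (idx n)))" using fa[of n "Suc (idx n)"] idx[of n] by (simp add: I_def)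
    ultimately have "f n \<le> m" using idx[of m] by (simp add: I_def)
    then show ?thesis using f[of m n] that by (simp add: B_def)
  qed
  have "chain A ?b"
    unfolding chain_def
  proof (intro conjI allI impI bm)
    show "?b j \<in> A 0" for j using rb by (auto simp: B_def)
    show "?b j \<in> A (?b i)" if "i < j" for i j
      using far[of "?b i" "?b j"] rb bm that by (auto simp: strict_mono_def)
  qed
  then show ?thesis using that[OF bm] BU rb A(2) by simp
qed

lemma chain_pred:
  assumes "chain A b" "0 < j"
  shows "b j \<in> A (b (j - 1))"
  using assms by (auto simp: chain_def)

lemma chain_ge: "chain A b \<Longrightarrow> i \<le> b i"
  by (simp add: chain_def strict_mono_imp_increasing)

text \<open>Tolerances are indexed by the preceding term \<open>b (j - 1)\<close>, while series run
  over positions \<open>j\<close>; the shift by one position costs a factor 2.\<close>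

lemma chain_power_le:
  assumes "chain A b" "0 < j"
  shows "(1 / 2 :: real) ^ b (j - 1) \<le> 2 * (1 / 2) ^ j"
proof -
  have "(1 / 2 :: real) ^ b (j - 1) \<le> (1 / 2) ^ (j - 1)"
    using chain_ge[OF assms(1), of "j - 1"] by (intro power_decreasing) auto
  also have "\<dots> = 2 * (1 / 2) ^ j" using assms(2) by (cases j) auto
  finally show ?thesis .
qed

section \<open>Upper estimates\<close>

text \<open>Boundedness of the map from finitely supported sequences in \<open>l^s\<close> to
  \<open>Lp\<close> that sends the i-th unit vector to \<open>y (b i)\<close>. By homogeneity it
  suffices to consider coefficients in the unit ball.\<close>

definition upper_estimate :: "real \<Rightarrow> real \<Rightarrow> (nat \<Rightarrow> real \<Rightarrow> real) \<Rightarrow> (nat \<Rightarrow> nat) \<Rightarrow> bool" where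
  "upper_estimate p s y b \<longleftrightarrow> (\<exists>C\<ge>0. \<forall>c N. (\<Sum>i<N. \<bar>c i\<bar> powr s) \<le> 1 \<longrightarrow> Lp_norm p (\<lambda>t. \<Sum>i<N. c i * y (b i) t) \<le> C)"

text \<open>In the unit ball all coefficients are at most one in absolute value, so the ball of a
  smaller exponent is contained in that of a larger one.\<close>

lemma upper_estimate_mono:
  assumes "upper_estimate p s y b" "a \<le> s" "0 < a"
  shows "upper_estimate p a y b"
proof -
  obtain C where C: "C \<ge> 0" "\<And>c N. (\<Sum>i<N. \<bar>c i\<bar> powr s) \<le> 1 \<Longrightarrow> Lp_norm p (\<lambda>t. \<Sum>i<N. c i * y (b i) t) \<le> C"
    using assms(1) by (auto simp: upper_estimate_def)
  have "(\<Sum>i<N. \<bar>c i\<bar> powr s) \<le> 1" if "(\<Sum>i<N. \<bar>c i\<bar> powr a) \<le> 1" for c :: "nat \<Rightarrow> real" and N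
  proof -
    have "(\<Sum>i<N. \<bar>c i\<bar> powr s) \<le> (\<Sum>i<N. \<bar>c i\<bar> powr a)"
    proof (rule sum_mono)
      fix i assume "i \<in> {..<N}"
      then have "\<bar>c i\<bar> \<le> 1" using abs_le_one_of_sum[OF that _ assms(3)] by simp
      then show "\<bar>c i\<bar> powr s \<le> \<bar>c i\<bar> powr a" using assms(2) by (cases "c i = 0") (auto intro!: powr_mono')
    qed
    then show ?thesis using that by linarith
  qed
  then show ?thesis unfolding upper_estimate_def using C by blast
qed

text \<open>The absolute value of \<open>Jmap p (d n)\<close> is
  \<open>\<bar>d n\<bar> powr (p - 1)\<close>, which \<open>powr_pred_le\<close> dominates by a
  small constant, a small multiple of the p-th power and a multiple of
  \<open>\<bar>d n\<bar>\<close>.\<close>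

lemma Jmap_Disj:
  assumes pq: "conj_exp p q" and d: "d \<in> Disj p"
  shows "(\<lambda>n. Jmap p (d n)) \<in> Disj q"
proof -
  note c = conj_expD[OF pq]
  note ds = Disj_up_space[OF d]
  obtain B where B: "0 < B" "\<And>n. Lp_norm p (d n) \<le> B" using up_space_bound[OF ds] by metis
  have Bp: "(\<integral>t. \<bar>d n t\<bar> powr p \<partial>mu) \<le> B powr p" for n
    using Lp_norm_le_iff[of p B "d n"] B c by simp
  have Js: "(\<lambda>n. Jmap p (d n)) \<in> up_space q" by (rule up_space_Jmap[OF pq ds])
  have "((\<lambda>n. \<integral>t. \<bar>Jmap p (d n) t\<bar> \<partial>mu) \<longlongrightarrow> 0) U"
  proof (rule tendstoI)
    fix e :: real assume e: "e > 0"
    \<comment> \<open>Half of \<open>e\<close> goes to the two terms with factor \<open>r\<close>,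
      the other half to \<open>K\<close> times the \<open>L^1\<close> norm. The cap
      \<open>1 / 2\<close> ensures \<open>r < 1\<close>.\<close>
    define r where "r = min (1 / 2) (e / (2 * (1 + B powr p)))"
    have B1: "1 + B powr p > 0" by (simp add: add_pos_nonneg)
    have r: "0 < r" "r < 1" "r * (1 + B powr p) \<le> e / 2"
    proof -
      show "0 < r" "r < 1" using e B1 by (auto simp: r_def)
      have "r * (1 + B powr p) \<le> e / (2 * (1 + B powr p)) * (1 + B powr p)"
        using B1 by (intro mult_right_mono) (auto simp: r_def)
      also have "\<dots> = e / 2" using B1 by (simp add: field_simps)
      finally show "r * (1 + B powr p) \<le> e / 2" .
    qed
    obtain K where K: "K \<ge> 0" "\<And>v. v \<ge> 0 \<Longrightarrow> v powr (p - 1) \<le> r + r * v powr p + K * v"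
      using powr_pred_le[OF c(1) r(1,2)] by blast
    have "((\<lambda>n. K * (\<integral>t. \<bar>d n t\<bar> \<partial>mu)) \<longlongrightarrow> K * 0) U"
      using d by (intro tendsto_mult tendsto_const) (auto simp: Disj_def)
    then have "eventually (\<lambda>n. K * (\<integral>t. \<bar>d n t\<bar> \<partial>mu) < e / 2) U"
      using e by (intro order_tendstoD(2)[where y="K * 0"]) auto
    then show "eventually (\<lambda>n. dist (\<integral>t. \<bar>Jmap p (d n) t\<bar> \<partial>mu) 0 < e) U"
    proof eventually_elim
      case (elim n)
      note i = integral_abs_le_Lp_norm(1)[OF pq up_spaceD[OF ds, of n]] LpD(2)[OF up_spaceD[OF ds, of n]]
      have "(\<integral>t. \<bar>Jmap p (d n) t\<bar> \<partial>mu) \<le> (\<integral>t. r + r * \<bar>d n t\<bar> powr p + K * \<bar>d n t\<bar> \<partial>mu)"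
      proof (rule Bochner_Integration.integral_mono)
        show "integrable mu (\<lambda>t. \<bar>Jmap p (d n) t\<bar>)"
          using integral_abs_le_Lp_norm(1)[OF conj_exp_sym[OF pq] up_spaceD[OF Js]] by simp
        show "\<bar>Jmap p (d n) t\<bar> \<le> r + r * \<bar>d n t\<bar> powr p + K * \<bar>d n t\<bar>" for t
          unfolding abs_Jmap by (rule K(2)) simp
      qed (use i in auto)
      also have "\<dots> = r + r * (\<integral>t. \<bar>d n t\<bar> powr p \<partial>mu) + K * (\<integral>t. \<bar>d n t\<bar> \<partial>mu)" using i by simp
      also have "\<dots> \<le> r + r * B powr p + K * (\<integral>t. \<bar>d n t\<bar> \<partial>mu)"
        using Bp[of n] r K(1) by (intro add_mono mult_left_mono) auto
      also have "\<dots> < e" using elim r(3) by (simp add: distrib_left)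
      finally show ?case by (simp add: dist_real_def)
    qed
  qed
  then show ?thesis using Js by (simp add: Disj_def)
qed

text \<open>Terms are added one at a time with \<open>abs_powr_add_disjoint\<close>, so only the
  mixed terms have to be small. The coefficients are unknown when the subsequence is chosen;
  therefore the mixed terms are controlled by \<open>G n\<close>, the sum of all
  \<open>\<bar>d i\<bar>\<close> with \<open>i \<le> n\<close>, which dominates every partial sum
  with coefficients at most one.\<close>

lemma Disj_sparse_upper_estimate:
  assumes pq: "conj_exp p q" and d: "d \<in> Disj p"
  shows "sparse (upper_estimate p p d)"
proof -
  note c = conj_expD[OF pq]
  note ds = Disj_up_space[OF d]
  note [measurable] = up_space_meas[OF ds]
  obtain B where B: "0 < B" "\<And>n. Lp_norm p (d n) \<le> B" using up_space_bound[OF ds] by metis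
  have Bp: "(\<integral>t. \<bar>d n t\<bar> powr p \<partial>mu) \<le> B powr p" for n
    using Lp_norm_le_iff[of p B "d n"] B c by simp
  define G where "G = (\<lambda>n t. \<Sum>i\<le>n. \<bar>d i t\<bar>)"
  have G: "G n \<in> Lp p" for n unfolding G_def by (rule Lp_sum) (use up_spaceD[OF ds] c in auto)
  have G0: "0 \<le> G n t" for n t by (simp add: G_def sum_nonneg)
  have JG: "Jmap p (G n) \<in> Lp q" for n using pq G by auto
  have da: "(\<lambda>n t. \<bar>d n t\<bar>) \<in> Disj p" by (rule Disj_abs[OF d])
  have Jd: "(\<lambda>n t. \<bar>Jmap p (d n) t\<bar>) \<in> Disj q" by (rule Disj_abs[OF Jmap_Disj[OF pq d]])
  \<comment> \<open>One condition for each of the two mixed terms: \<open>\<bar>d m\<bar>\<close>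
    and the absolute value of its image under \<open>Jmap\<close> are both weakly null, hence vanish
    against the fixed functions \<open>Jmap p (G n)\<close> and \<open>G n\<close>.\<close>
  define A where "A = (\<lambda>n. {m. (\<integral>t. \<bar>d m t\<bar> * Jmap p (G n) t \<partial>mu) < (1 / 2) ^ n \<and>
      (\<integral>t. \<bar>Jmap p (d m) t\<bar> * G n t \<partial>mu) < (1 / 2) ^ n})"
  show ?thesis
  proof (rule sparseI[where A=A])
    fix n
    have "((\<lambda>m. \<integral>t. \<bar>d m t\<bar> * Jmap p (G n) t \<partial>mu) \<longlongrightarrow> 0) U"
      by (rule wnull_Lq[OF pq Disj_wnull[OF pq da] JG])
    moreover have "((\<lambda>m. \<integral>t. \<bar>Jmap p (d m) t\<bar> * G n t \<partial>mu) \<longlongrightarrow> 0) U"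
      by (rule wnull_Lq[OF conj_exp_sym[OF pq] Disj_wnull[OF conj_exp_sym[OF pq] Jd] G])
    ultimately show "eventually (\<lambda>m. m \<in> A n) U"
      unfolding A_def mem_Collect_eq by (intro eventually_conj order_tendstoD(2)[where y=0]) auto
  next
    fix b assume ch: "chain A b"
    then have bm: "strict_mono b" by (simp add: chain_def)
    define D where "D = p * 2 powr (p - 1)"
    have D: "D > 0" using c by (simp add: D_def)
    \<comment> \<open>Each step costs \<open>\<bar>c j\<bar> powr p * B powr p\<close> and two mixed
      terms of at most \<open>D * 2 * (1 / 2) ^ j\<close>; the geometric series doubles the
      resulting \<open>4 * D\<close>.\<close>
    have bound: "(\<integral>t. \<bar>\<Sum>i<N. c i * d (b i) t\<bar> powr p \<partial>mu) \<le> B powr p + 8 * D"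
      if cN: "(\<Sum>i<N. \<bar>c i\<bar> powr p) \<le> 1" for c :: "nat \<Rightarrow> real" and N
    proof -
      define S where "S = (\<lambda>j t. \<Sum>i<j. c i * d (b i) t)"
      have SL: "S j \<in> Lp p" for j unfolding S_def by (rule Lp_sum) (use up_spaceD[OF ds] conj_expD[OF pq] in auto)
      note [measurable] = LpD(1)[OF SL]
      have c1: "\<bar>c i\<bar> \<le> 1" if "i < N" for i using abs_le_one_of_sum[OF cN that] conj_expD[OF pq] by simp
      have step: "(\<integral>t. \<bar>S (Suc j) t\<bar> powr p \<partial>mu) \<le> (\<integral>t. \<bar>S j t\<bar> powr p \<partial>mu) + \<bar>c j\<bar> powr p * B powr p + 4 * D * (1 / 2) ^ j"
        if j: "j < N" for j
      proof (cases "j = 0")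
        case True
        have "(\<integral>t. \<bar>S (Suc j) t\<bar> powr p \<partial>mu) = \<bar>c j\<bar> powr p * (\<integral>t. \<bar>d (b j) t\<bar> powr p \<partial>mu)"
          using True by (simp add: S_def abs_mult powr_mult)
        also have "\<dots> \<le> \<bar>c j\<bar> powr p * B powr p" using Bp by (intro mult_left_mono) auto
        finally show ?thesis using D by (simp add: S_def True add_nonneg_nonneg) 
      next
        case False
        define n where "n = b (j - 1)"
        have SG: "\<bar>S j t\<bar> \<le> G n t" for t
        proof -
          have "\<bar>S j t\<bar> \<le> (\<Sum>i<j. \<bar>c i * d (b i) t\<bar>)" unfolding S_def by (rule sum_abs)
          also have "\<dots> \<le> (\<Sum>i<j. \<bar>d (b i) t\<bar>)"
            by (rule sum_mono) (use c1 j in \<open>auto simp: abs_mult intro!: mult_left_le_one_le\<close>)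
          also have "\<dots> = (\<Sum>i\<in>b ` {..<j}. \<bar>d i t\<bar>)"
            using bm by (subst sum.reindex) (auto intro: strict_mono_imp_inj_on inj_on_subset)
          also have "\<dots> \<le> G n t" unfolding G_def n_def
          proof (rule sum_mono2)
            show "b ` {..<j} \<subseteq> {..b (j - 1)}"
              using bm by (auto simp: strict_mono_less_eq)
          qed auto
          finally show ?thesis .
        qed
        have "b j \<in> A n" unfolding n_def using chain_pred[OF ch] False by simp
        then have A1: "(\<integral>t. \<bar>d (b j) t\<bar> * Jmap p (G n) t \<partial>mu) < (1 / 2) ^ n"
          and A2: "(\<integral>t. \<bar>Jmap p (d (b j)) t\<bar> * G n t \<partial>mu) < (1 / 2) ^ n" by (auto simp: A_def)
        have n2: "(1 / 2 :: real) ^ n \<le> 2 * (1 / 2) ^ j" unfolding n_def using chain_power_le[OF ch] False by simp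
        let ?R = "\<lambda>t. \<bar>S j t\<bar> powr p + \<bar>c j\<bar> powr p * \<bar>d (b j) t\<bar> powr p
            + D * (\<bar>d (b j) t\<bar> * Jmap p (G n) t + \<bar>Jmap p (d (b j)) t\<bar> * G n t)"
        have pt: "\<bar>S (Suc j) t\<bar> powr p \<le> ?R t" for t
        proof -
          have c1j: "\<bar>c j\<bar> \<le> 1" using c1 j by simp
          have "S (Suc j) t = S j t + c j * d (b j) t" by (simp add: S_def)
          then have "\<bar>S (Suc j) t\<bar> powr p \<le> \<bar>S j t\<bar> powr p + \<bar>c j * d (b j) t\<bar> powr p
              + D * (\<bar>S j t\<bar> powr (p - 1) * \<bar>c j * d (b j) t\<bar> + \<bar>S j t\<bar> * \<bar>c j * d (b j) t\<bar> powr (p - 1))"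
            using abs_powr_add_disjoint[OF pq, of "S j t" "c j * d (b j) t"] by (simp add: D_def)
          moreover have "\<bar>c j * d (b j) t\<bar> powr p = \<bar>c j\<bar> powr p * \<bar>d (b j) t\<bar> powr p"
            by (simp add: abs_mult powr_mult)
          moreover have cd: "\<bar>c j * d (b j) t\<bar> \<le> \<bar>d (b j) t\<bar>"
            using c1j by (simp add: abs_mult mult_left_le_one_le)
          have "\<bar>S j t\<bar> powr (p - 1) * \<bar>c j * d (b j) t\<bar> \<le> \<bar>d (b j) t\<bar> * Jmap p (G n) t"
          proof -
            have "\<bar>S j t\<bar> powr (p - 1) \<le> G n t powr (p - 1)"
              using SG conj_expD[OF pq] by (intro powr_mono2) auto
            moreover have "G n t powr (p - 1) = Jmap p (G n) t"
              using G0[of n t] by (cases "G n t = 0") (auto simp: Jmap_def)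
            ultimately show ?thesis using cd by (subst mult.commute) (intro mult_mono, auto)
          qed
          moreover have "\<bar>S j t\<bar> * \<bar>c j * d (b j) t\<bar> powr (p - 1) \<le> \<bar>Jmap p (d (b j)) t\<bar> * G n t"
          proof -
            have "\<bar>c j * d (b j) t\<bar> powr (p - 1) \<le> \<bar>Jmap p (d (b j)) t\<bar>"
              unfolding abs_Jmap using cd conj_expD[OF pq] by (intro powr_mono2) auto
            then show ?thesis using SG[of t] by (subst mult.commute) (intro mult_mono, auto)
          qed
          ultimately show ?thesis using D
            by (elim order_trans) (intro add_mono mult_left_mono, auto)
        qed
        note i1 = LpD(2)[OF SL[of j]] and i2 = LpD(2)[OF up_spaceD[OF ds, of "b j"]]
          and i3 = Lp_mult_integrable[OF pq up_spaceD[OF Disj_up_space[OF da]] JG, of "b j" n]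
          and i4 = Lp_mult_integrable[OF conj_exp_sym[OF pq] up_spaceD[OF Disj_up_space[OF Jd]] G, of "b j" n]
        have "(\<integral>t. \<bar>S (Suc j) t\<bar> powr p \<partial>mu) \<le> (\<integral>t. ?R t \<partial>mu)"
          by (rule Bochner_Integration.integral_mono[OF LpD(2)[OF SL] _ pt]) (use i1 i2 i3 i4 in auto)
        also have "\<dots> = (\<integral>t. \<bar>S j t\<bar> powr p \<partial>mu) + \<bar>c j\<bar> powr p * (\<integral>t. \<bar>d (b j) t\<bar> powr p \<partial>mu)
            + D * ((\<integral>t. \<bar>d (b j) t\<bar> * Jmap p (G n) t \<partial>mu) + (\<integral>t. \<bar>Jmap p (d (b j)) t\<bar> * G n t \<partial>mu))"
          using i1 i2 i3 i4 by simp
        also have "\<dots> \<le> (\<integral>t. \<bar>S j t\<bar> powr p \<partial>mu) + \<bar>c j\<bar> powr p * B powr p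
            + D * (2 * (1 / 2) ^ j + 2 * (1 / 2) ^ j)"
          using A1 A2 n2 D Bp[of "b j"] by (intro add_mono mult_left_mono) auto
        finally show ?thesis by (simp add: algebra_simps)
      qed
      have "(\<integral>t. \<bar>S j t\<bar> powr p \<partial>mu) \<le> (\<Sum>i<j. \<bar>c i\<bar> powr p) * B powr p + 4 * D * (\<Sum>i<j. (1 / 2) ^ i)" if "j \<le> N" for j
        using that
      proof (induction j)
        case 0
        then show ?case by (simp add: S_def)
      next
        case (Suc j)
        then show ?case using step[of j] by (simp add: algebra_simps)
      qed
      from this[of N] have "(\<integral>t. \<bar>S N t\<bar> powr p \<partial>mu) \<le> (\<Sum>i<N. \<bar>c i\<bar> powr p) * B powr p + 4 * D * (\<Sum>i<N. (1 / 2) ^ i)" by simp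
      also have "\<dots> \<le> 1 * B powr p + 4 * D * 2"
        using cN D by (intro add_mono mult_right_mono mult_left_mono sum_half_le) auto
      finally show ?thesis by (simp add: S_def)
    qed
    show "upper_estimate p p d b"
      unfolding upper_estimate_def
    proof (intro exI conjI allI impI)
      fix cc :: "nat \<Rightarrow> real" and N assume "(\<Sum>i<N. \<bar>cc i\<bar> powr p) \<le> 1"
      then show "Lp_norm p (\<lambda>t. \<Sum>i<N. cc i * d (b i) t) \<le> (B powr p + 8 * D) powr (1 / p)"
        unfolding Lp_norm_def using bound[of cc N] c by (intro powr_mono2) auto
    qed simp
  qed
qed


text \<open>Expanding \<open>S ^ (m + 1)\<close> into monomials reduces the smallness of \<open>\<integral> S ^ (m + 1) * y\<close>, uniformly in
  the coefficients of \<open>S\<close>, to finitely many instances of weak nullity.\<close>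
lemma Bdd_sparse_even_power:
  assumes pq: "conj_exp p q" and y: "y \<in> Bdd" "wnull p U y" and m: "even m"
  shows "sparse (\<lambda>b. \<exists>C. \<forall>c N. (\<Sum>i<N. (c i)\<^sup>2) \<le> 1 \<longrightarrow> (\<integral>t. (\<Sum>i<N. c i * y (b i) t) ^ (m + 2) \<partial>mu) \<le> C)"
proof -
  obtain K where K: "0 < K" "\<And>n t. \<bar>y n t\<bar> \<le> K" using BddE[OF y(1)] by metis
  note [measurable] = Bdd_meas[OF y(1)]
  obtain D where D: "D \<ge> 0" "\<And>a y c :: real. \<bar>c\<bar> \<le> 1 \<Longrightarrow>
    (a + c * y) ^ (m + 2) \<le> a ^ (m + 2) + real (m + 2) * c * (a ^ (m + 1) * y) + D * c\<^sup>2 * (a ^ (m + 2) + y ^ (m + 2))"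
    using even_power_step[OF m] by blast
  have ev: "even (m + 2)" using m by simp
  \<comment> \<open>One index for each factor of \<open>S ^ (m + 1)\<close>; a map from
    \<open>I\<close> to the positions selects one monomial of the expansion.\<close>
  define I where "I = {..<m + 1}"
  have If: "finite I" "card I = m + 1" by (simp_all add: I_def)
  have prod_bound: "\<bar>\<Prod>i\<in>I. y (f i) t\<bar> \<le> K ^ (m + 1)" for f t
  proof -
    have "\<bar>\<Prod>i\<in>I. y (f i) t\<bar> = (\<Prod>i\<in>I. \<bar>y (f i) t\<bar>)" by (rule abs_prod)
    also have "\<dots> \<le> (\<Prod>i\<in>I. K)" by (rule prod_mono) (use K in auto)
    finally show ?thesis by (simp add: If)
  qed
  \<comment> \<open>Dividing by \<open>(n + 1) ^ (m + 1)\<close>, the number of maps from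
    \<open>I\<close> to \<open>{..n}\<close>, makes the sum over all monomials at most
    \<open>(1 / 2) ^ n\<close>.\<close>
  define A where "A = (\<lambda>n. {j. \<forall>f\<in>(I \<rightarrow>\<^sub>E {..n}). \<bar>\<integral>t. y j t * (\<Prod>i\<in>I. y (f i) t) \<partial>mu\<bar> < (1 / 2) ^ n / real (n + 1) ^ (m + 1)})"
  show ?thesis
  proof (rule sparseI[where A=A])
    fix n
    have "eventually (\<lambda>j. \<bar>\<integral>t. y j t * (\<Prod>i\<in>I. y (f i) t) \<partial>mu\<bar> < (1 / 2) ^ n / real (n + 1) ^ (m + 1)) U" for f
    proof -
      have "(\<lambda>t. \<Prod>i\<in>I. y (f i) t) \<in> borel_measurable mu" by measurable
      then have "((\<lambda>j. \<integral>t. y j t * (\<Prod>i\<in>I. y (f i) t) \<partial>mu) \<longlongrightarrow> 0) U"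
        using y(2)[unfolded wnull_def, THEN conjunct2, rule_format, of "\<lambda>t. \<Prod>i\<in>I. y (f i) t" "K ^ (m + 1)"] prod_bound by simp
      then have "((\<lambda>j. \<bar>\<integral>t. y j t * (\<Prod>i\<in>I. y (f i) t) \<partial>mu\<bar>) \<longlongrightarrow> 0) U" by (rule tendsto_rabs_zero)
      then show ?thesis by (rule order_tendstoD) simp
    qed
    then show "eventually (\<lambda>j. j \<in> A n) U"
      unfolding A_def mem_Collect_eq by (intro eventually_ball_finite finite_PiE) (auto simp: If)
  next
    fix b assume ch: "chain A b"
    then have bm: "strict_mono b" by (simp add: chain_def)
    define E where "E = D * (1 + K ^ (m + 2))"
    have E: "E \<ge> 0" using D K by (simp add: E_def)
    have bound: "(\<integral>t. (\<Sum>i<N. c i * y (b i) t) ^ (m + 2) \<partial>mu) \<le> exp (4 * real (m + 2) + E)"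
      if cN: "(\<Sum>i<N. (c i)\<^sup>2) \<le> 1" for c :: "nat \<Rightarrow> real" and N
    proof -
      define S where "S = (\<lambda>j t. \<Sum>i<j. c i * y (b i) t)"
      have [measurable]: "S j \<in> borel_measurable mu" for j unfolding S_def by measurable
      have c1: "\<bar>c i\<bar> \<le> 1" if "i < N" for i
      proof -
        have "(c i)\<^sup>2 \<le> (\<Sum>i<N. (c i)\<^sup>2)" by (rule member_le_sum) (use that in auto)
        then have "(c i)\<^sup>2 \<le> 1" using cN by linarith
        then show ?thesis using abs_square_le_1 by blast
      qed
      have SK: "\<bar>S j t\<bar> \<le> (\<Sum>i<j. \<bar>c i\<bar> * K)" for j t
        unfolding S_def by (rule order_trans[OF sum_abs]) (use K in \<open>auto simp: abs_mult intro!: sum_mono mult_left_mono\<close>)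
      have Si: "integrable mu (\<lambda>t. S j t ^ k)" for j k
        by (rule integrable_bounded[where K="(\<Sum>i<j. \<bar>c i\<bar> * K) ^ k"]) (use SK in \<open>auto simp: power_abs intro!: power_mono\<close>)
      have Siy: "integrable mu (\<lambda>t. S j t ^ k * y n t)" for j k n
      proof (rule integrable_bounded[where K="(\<Sum>i<j. \<bar>c i\<bar> * K) ^ k * K"])
        show "\<bar>S j t ^ k * y n t\<bar> \<le> (\<Sum>i<j. \<bar>c i\<bar> * K) ^ k * K" for t
          unfolding abs_mult power_abs using SK[of j t] K by (intro mult_mono power_mono) (auto intro!: sum_nonneg)
      qed measurable
      have yi: "integrable mu (\<lambda>t. y n t ^ k)" for n k
        by (rule integrable_bounded[where K="K ^ k"]) (use K in \<open>auto simp: power_abs intro!: power_mono\<close>)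
      have yK: "(\<integral>t. y n t ^ (m + 2) \<partial>mu) \<le> K ^ (m + 2)" for n
      proof -
        have "(\<integral>t. y n t ^ (m + 2) \<partial>mu) \<le> (\<integral>t. K ^ (m + 2) \<partial>mu)"
        proof (rule Bochner_Integration.integral_mono[OF yi])
          fix t show "y n t ^ (m + 2) \<le> K ^ (m + 2)"
            using power_mono[of "\<bar>y n t\<bar>" K "m + 2"] K(2)[of n t] power_even_abs[OF ev, of "y n t"] by simp
        qed simp
        then show ?thesis by simp
      qed
      have S0: "0 \<le> (\<integral>t. S j t ^ (m + 2) \<partial>mu)" for j
        by (rule Bochner_Integration.integral_nonneg) (rule zero_le_even_power[OF ev])
      have cross: "\<bar>\<integral>t. S j t ^ (m + 1) * y (b j) t \<partial>mu\<bar> \<le> 2 * (1 / 2) ^ j" if j: "j < N" for j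
      proof (cases "j = 0")
        case True
        then show ?thesis by (simp add: S_def)
      next
        case False
        define n where "n = b (j - 1)"
        have jn: "j \<le> n + 1" using chain_ge[OF ch, of "j - 1"] False by (simp add: n_def)
        have bn: "b i \<le> n" if "i < j" for i
          using bm that by (simp add: n_def strict_mono_less_eq)
        have "b j \<in> A n" unfolding n_def using chain_pred[OF ch] False by simp
        have trm: "\<bar>\<integral>t. y (b j) t * (\<Prod>i\<in>I. y (b (f i)) t) \<partial>mu\<bar> \<le> (1 / 2) ^ n / real (n + 1) ^ (m + 1)"
          if f: "f \<in> I \<rightarrow>\<^sub>E {..<j}" for f
        proof -
          let ?g = "restrict (\<lambda>i. b (f i)) I"
          have "?g \<in> I \<rightarrow>\<^sub>E {..n}" using f bn by auto
          then have "\<bar>\<integral>t. y (b j) t * (\<Prod>i\<in>I. y (?g i) t) \<partial>mu\<bar> < (1 / 2) ^ n / real (n + 1) ^ (m + 1)"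
            using \<open>b j \<in> A n\<close> unfolding A_def by blast
          moreover have "(\<Prod>i\<in>I. y (?g i) t) = (\<Prod>i\<in>I. y (b (f i)) t)" for t by (rule prod.cong) auto
          ultimately show ?thesis by simp
        qed
        have exp: "S j t ^ (m + 1) = (\<Sum>f\<in>(I \<rightarrow>\<^sub>E {..<j}). (\<Prod>i\<in>I. c (f i)) * (\<Prod>i\<in>I. y (b (f i)) t))" for t
        proof -
          have "S j t ^ (m + 1) = (\<Prod>i\<in>I. \<Sum>l<j. c l * y (b l) t)" by (simp add: S_def If)
          also have "\<dots> = (\<Sum>f\<in>(I \<rightarrow>\<^sub>E {..<j}). \<Prod>i\<in>I. c (f i) * y (b (f i)) t)"
            by (rule prod_sum_PiE) (auto simp: If)
          finally show ?thesis by (simp add: prod.distrib)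
        qed
        have i: "integrable mu (\<lambda>t. y (b j) t * (\<Prod>i\<in>I. y (b (f i)) t))" for f
        proof (rule integrable_bounded[where K="K * K ^ (m + 1)"])
          show "\<bar>y (b j) t * (\<Prod>i\<in>I. y (b (f i)) t)\<bar> \<le> K * K ^ (m + 1)" for t
            unfolding abs_mult using K prod_bound[of "\<lambda>i. b (f i)" t] by (intro mult_mono) auto
        qed measurable
        have "(\<integral>t. S j t ^ (m + 1) * y (b j) t \<partial>mu)
            = (\<integral>t. (\<Sum>f\<in>(I \<rightarrow>\<^sub>E {..<j}). (\<Prod>i\<in>I. c (f i)) * (y (b j) t * (\<Prod>i\<in>I. y (b (f i)) t))) \<partial>mu)"
          unfolding exp by (simp add: sum_distrib_right sum_distrib_left mult_ac)
        also have "\<dots> = (\<Sum>f\<in>(I \<rightarrow>\<^sub>E {..<j}). (\<Prod>i\<in>I. c (f i)) * (\<integral>t. y (b j) t * (\<Prod>i\<in>I. y (b (f i)) t) \<partial>mu))"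
          by (subst Bochner_Integration.integral_sum) (use i in auto)
        also have "\<bar>\<dots>\<bar> \<le> (\<Sum>f\<in>(I \<rightarrow>\<^sub>E {..<j}). (1 / 2) ^ n / real (n + 1) ^ (m + 1))"
        proof (rule order_trans[OF sum_abs], rule sum_mono)
          fix f assume f: "f \<in> I \<rightarrow>\<^sub>E {..<j}"
          have "\<bar>\<Prod>i\<in>I. c (f i)\<bar> = (\<Prod>i\<in>I. \<bar>c (f i)\<bar>)" by (rule abs_prod)
          also have "\<dots> \<le> 1"
          proof (rule prod_le_1)
            fix i assume "i \<in> I"
            then have "f i < j" using f by auto
            then show "0 \<le> \<bar>c (f i)\<bar> \<and> \<bar>c (f i)\<bar> \<le> 1" using c1[of "f i"] j by simp
          qed
          finally have "\<bar>\<Prod>i\<in>I. c (f i)\<bar> * \<bar>\<integral>t. y (b j) t * (\<Prod>i\<in>I. y (b (f i)) t) \<partial>mu\<bar> \<le> 1 * ((1 / 2) ^ n / real (n + 1) ^ (m + 1))"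
            using trm[OF f] by (intro mult_mono) auto
          then show "\<bar>(\<Prod>i\<in>I. c (f i)) * (\<integral>t. y (b j) t * (\<Prod>i\<in>I. y (b (f i)) t) \<partial>mu)\<bar> \<le> (1 / 2) ^ n / real (n + 1) ^ (m + 1)"
            by (simp add: abs_mult)
        qed
        also have "\<dots> = real j ^ (m + 1) * ((1 / 2) ^ n / real (n + 1) ^ (m + 1))"
          by (simp add: card_PiE If)
        also have "\<dots> \<le> real (n + 1) ^ (m + 1) * ((1 / 2) ^ n / real (n + 1) ^ (m + 1))"
          using jn by (intro mult_right_mono power_mono) auto
        also have "\<dots> = (1 / 2) ^ n" by simp
        also have "\<dots> \<le> 2 * (1 / 2) ^ j" unfolding n_def using chain_power_le[OF ch] False by simp
        finally show ?thesis .
      qed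
      \<comment> \<open>A discrete Gronwall argument: the added 1 absorbs the parts of the increment
        that do not contain the old integral, so each new term only multiplies by \<open>exp\<close>
        of a summable quantity. The exponents sum to at most \<open>4 * (m + 2) + E\<close>.\<close>
      have step: "1 + (\<integral>t. S (Suc j) t ^ (m + 2) \<partial>mu) \<le>
          (1 + (\<integral>t. S j t ^ (m + 2) \<partial>mu)) * exp (real (m + 2) * (2 * (1 / 2) ^ j) + E * (c j)\<^sup>2)" if j: "j < N" for j
      proof -
        let ?u = "\<integral>t. S j t ^ (m + 2) \<partial>mu"
        have "(\<integral>t. S (Suc j) t ^ (m + 2) \<partial>mu) \<le> (\<integral>t. S j t ^ (m + 2) + real (m + 2) * c j * (S j t ^ (m + 1) * y (b j) t)
            + D * (c j)\<^sup>2 * (S j t ^ (m + 2) + y (b j) t ^ (m + 2)) \<partial>mu)"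
        proof (rule Bochner_Integration.integral_mono[OF Si])
          fix t
          have "S (Suc j) t = S j t + c j * y (b j) t" by (simp add: S_def)
          then show "S (Suc j) t ^ (m + 2) \<le> S j t ^ (m + 2) + real (m + 2) * c j * (S j t ^ (m + 1) * y (b j) t)
            + D * (c j)\<^sup>2 * (S j t ^ (m + 2) + y (b j) t ^ (m + 2))" using D(2)[OF c1[OF j], of "S j t" "y (b j) t"] by simp
        qed (intro Bochner_Integration.integrable_add integrable_mult_right Si Siy yi)
        also have "\<dots> = ?u + real (m + 2) * c j * (\<integral>t. S j t ^ (m + 1) * y (b j) t \<partial>mu)
            + D * (c j)\<^sup>2 * (?u + (\<integral>t. y (b j) t ^ (m + 2) \<partial>mu))"
          using Si Siy yi by (simp del: power_Suc power_add add_2_eq_Suc')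
        also have "\<dots> \<le> ?u + real (m + 2) * (2 * (1 / 2) ^ j) + D * (c j)\<^sup>2 * (?u + K ^ (m + 2))"
        proof (intro add_mono mult_left_mono yK)
          have "c j * (\<integral>t. S j t ^ (m + 1) * y (b j) t \<partial>mu) \<le> \<bar>c j\<bar> * \<bar>\<integral>t. S j t ^ (m + 1) * y (b j) t \<partial>mu\<bar>"
            unfolding abs_mult[symmetric] by (rule abs_ge_self)
          also have "\<dots> \<le> 1 * (2 * (1 / 2) ^ j)" using c1[OF j] cross[OF j] by (intro mult_mono) auto
          finally have "real (m + 2) * (c j * (\<integral>t. S j t ^ (m + 1) * y (b j) t \<partial>mu)) \<le> real (m + 2) * (2 * (1 / 2) ^ j)"
            by (intro mult_left_mono) auto
          then show "real (m + 2) * c j * (\<integral>t. S j t ^ (m + 1) * y (b j) t \<partial>mu) \<le> real (m + 2) * (2 * (1 / 2) ^ j)"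
            by (simp only: mult.assoc)
        qed (use D in auto)
        finally have "1 + (\<integral>t. S (Suc j) t ^ (m + 2) \<partial>mu) \<le> (1 + ?u) * (1 + (real (m + 2) * (2 * (1 / 2) ^ j) + E * (c j)\<^sup>2))"
        proof -
          assume a: "(\<integral>t. S (Suc j) t ^ (m + 2) \<partial>mu) \<le> ?u + real (m + 2) * (2 * (1 / 2) ^ j) + D * (c j)\<^sup>2 * (?u + K ^ (m + 2))"
          have gen: "1 + v \<le> (1 + u) * (1 + (e + D * (1 + k) * s))"
            if "v \<le> u + e + D * s * (u + k)" "0 \<le> u" "0 \<le> e" "0 \<le> s" "0 \<le> k" for u v e s k :: real
          proof -
            have "0 \<le> u * e" "0 \<le> u * (D * k * s)" "0 \<le> D * s" using that D(1) by auto
            then show ?thesis using that(1) by (simp add: algebra_simps)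
          qed
          show ?thesis unfolding E_def by (rule gen[OF a S0]) (use K in auto)
        qed
        also have "\<dots> \<le> (1 + ?u) * exp (real (m + 2) * (2 * (1 / 2) ^ j) + E * (c j)\<^sup>2)"
          using S0[of j] exp_ge_add_one_self by (intro mult_left_mono) auto
        finally show ?thesis .
      qed
      have "1 + (\<integral>t. S j t ^ (m + 2) \<partial>mu) \<le> exp (\<Sum>i<j. real (m + 2) * (2 * (1 / 2) ^ i) + E * (c i)\<^sup>2)" if "j \<le> N" for j
        using that
      proof (induction j)
        case 0
        then show ?case by (simp add: S_def)
      next
        case (Suc j)
        have "1 + (\<integral>t. S (Suc j) t ^ (m + 2) \<partial>mu) \<le>
          (1 + (\<integral>t. S j t ^ (m + 2) \<partial>mu)) * exp (real (m + 2) * (2 * (1 / 2) ^ j) + E * (c j)\<^sup>2)"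
          using step[of j] Suc.prems by simp
        also have "\<dots> \<le> exp (\<Sum>i<j. real (m + 2) * (2 * (1 / 2) ^ i) + E * (c i)\<^sup>2) * exp (real (m + 2) * (2 * (1 / 2) ^ j) + E * (c j)\<^sup>2)"
          using Suc by (intro mult_right_mono) auto
        also have "\<dots> = exp (\<Sum>i<Suc j. real (m + 2) * (2 * (1 / 2) ^ i) + E * (c i)\<^sup>2)"
          by (simp only: exp_add[symmetric] sum.lessThan_Suc)
        finally show ?case .
      qed
      from this[of N] have "1 + (\<integral>t. S N t ^ (m + 2) \<partial>mu) \<le> exp (\<Sum>i<N. real (m + 2) * (2 * (1 / 2) ^ i) + E * (c i)\<^sup>2)" by simp
      also have "(\<Sum>i<N. real (m + 2) * (2 * (1 / 2) ^ i) + E * (c i)\<^sup>2) = real (m + 2) * 2 * (\<Sum>i<N. (1 / 2) ^ i) + E * (\<Sum>i<N. (c i)\<^sup>2)"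
        by (simp only: sum.distrib sum_distrib_left mult.assoc)
      also have "exp \<dots> \<le> exp (real (m + 2) * 2 * 2 + E * 1)"
        using cN E by (intro exp_le_cancel_iff[THEN iffD2] add_mono mult_left_mono sum_half_le) auto
      finally show ?thesis by (simp add: S_def algebra_simps)
    qed
    then show "\<exists>C. \<forall>c N. (\<Sum>i<N. (c i)\<^sup>2) \<le> 1 \<longrightarrow> (\<integral>t. (\<Sum>i<N. c i * y (b i) t) ^ (m + 2) \<partial>mu) \<le> C"
      by blast
  qed
qed

text \<open>The exponent is raised to an even integer \<open>m + 2 \<ge> p\<close>, where powers
  expand into monomials without absolute values. As \<open>mu\<close> has total mass one, this
  controls the exponent \<open>p\<close> through
  \<open>\<bar>v\<bar> powr p \<le> 1 + v ^ (m + 2)\<close>.\<close>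

lemma Bdd_sparse_upper_estimate:
  assumes pq: "conj_exp p q" and y: "y \<in> Bdd" "wnull p U y"
  shows "sparse (upper_estimate p 2 y)"
proof -
  note c = conj_expD[OF pq]
  obtain k :: nat where k: "p \<le> real k" using real_arch_simple by blast
  define m where "m = 2 * k"
  note [measurable] = Bdd_meas[OF y(1)]
  obtain K where K: "0 < K" "\<And>n t. \<bar>y n t\<bar> \<le> K" using BddE[OF y(1)] by metis
  have ev: "even (m + 2)" by (simp add: m_def)
  have pm: "p \<le> real (m + 2)" using k by (simp add: m_def)
  have pt: "\<bar>v\<bar> powr p \<le> 1 + v ^ (m + 2)" for v :: real
  proof (cases "\<bar>v\<bar> \<le> 1")
    case True
    then have "\<bar>v\<bar> powr p \<le> 1 powr p" using c by (intro powr_mono2) auto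
    then show ?thesis using zero_le_even_power[OF ev, of v] by simp
  next
    case False
    then have "\<bar>v\<bar> powr p \<le> \<bar>v\<bar> powr real (m + 2)" using pm by (intro powr_mono) auto
    also have "\<dots> = v ^ (m + 2)" using False power_even_abs[OF ev, of v] by (subst powr_realpow) auto
    finally show ?thesis by simp
  qed
  have "sparse (\<lambda>b. \<exists>C. \<forall>c N. (\<Sum>i<N. (c i)\<^sup>2) \<le> 1 \<longrightarrow> (\<integral>t. (\<Sum>i<N. c i * y (b i) t) ^ (m + 2) \<partial>mu) \<le> C)"
    by (rule Bdd_sparse_even_power[OF pq y]) (simp add: m_def)
  then show ?thesis
  proof (rule sparse_mono)
    fix b :: "nat \<Rightarrow> nat" assume "\<exists>C. \<forall>c N. (\<Sum>i<N. (c i)\<^sup>2) \<le> 1 \<longrightarrow> (\<integral>t. (\<Sum>i<N. c i * y (b i) t) ^ (m + 2) \<partial>mu) \<le> C"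
    then obtain C where C: "\<And>c N. (\<Sum>i<N. (c i)\<^sup>2) \<le> 1 \<Longrightarrow> (\<integral>t. (\<Sum>i<N. c i * y (b i) t) ^ (m + 2) \<partial>mu) \<le> C"
      by blast
    show "upper_estimate p 2 y b"
      unfolding upper_estimate_def
    proof (intro exI conjI allI impI)
      fix a :: "nat \<Rightarrow> real" and N assume "(\<Sum>i<N. \<bar>a i\<bar> powr 2) \<le> 1"
      then have aN: "(\<Sum>i<N. (a i)\<^sup>2) \<le> 1" by simp
      let ?S = "\<lambda>t. \<Sum>i<N. a i * y (b i) t"
      have SK: "\<bar>?S t\<bar> \<le> (\<Sum>i<N. \<bar>a i\<bar> * K)" for t
        by (rule order_trans[OF sum_abs]) (use K in \<open>auto simp: abs_mult intro!: sum_mono mult_left_mono\<close>)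
      have Si: "integrable mu (\<lambda>t. ?S t ^ (m + 2))"
        by (rule integrable_bounded[where K="(\<Sum>i<N. \<bar>a i\<bar> * K) ^ (m + 2)"])
           (use SK in \<open>auto simp: power_abs simp del: power_Suc power_add add_2_eq_Suc' intro!: power_mono\<close>)
      have "(\<integral>t. \<bar>?S t\<bar> powr p \<partial>mu) \<le> (\<integral>t. 1 + ?S t ^ (m + 2) \<partial>mu)"
        by (rule Bochner_Integration.integral_mono[OF LpD(2)[OF Lp_bounded[OF _ SK]]])
           (use Si c pt in auto)
      also have "\<dots> = 1 + (\<integral>t. ?S t ^ (m + 2) \<partial>mu)" using Si by (simp del: power_Suc power_add add_2_eq_Suc')
      also have "\<dots> \<le> 1 + C" using C[OF aN] by simp
      finally show "Lp_norm p ?S \<le> (1 + C) powr (1 / p)"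
        unfolding Lp_norm_def using c by (intro powr_mono2) auto
    qed simp
  qed
qed

section \<open>Almost biorthogonal thinning\<close>

text \<open>As \<open>x\<close> need not be weakly null, its later terms paired with an earlier
  \<open>h (b i)\<close> approach the pairing of the weak limit \<open>f\<close> with
  \<open>h (b i)\<close>, which in turn is small because \<open>b i\<close> was chosen late. The
  bound decays in the index of \<open>h\<close> and is uniform in that of \<open>x\<close>, so it
  can be summed over \<open>i\<close> for fixed \<open>j\<close>.\<close>

lemma sparse_off_diagonal:
  assumes pq: "conj_exp p q" and x: "x \<in> up_space p" and f: "f \<in> Lp p" "wnull p U (\<lambda>n t. x n t - f t)"
    and h: "wnull q U h" and d: "d > 0"
  shows "sparse (\<lambda>b. \<forall>i j. i \<noteq> j \<longrightarrow> \<bar>\<integral>t. x (b j) t * h (b i) t \<partial>mu\<bar> \<le> 3 * d * (1 / 2) ^ i)"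
proof -
  note qp = conj_exp_sym[OF pq]
  note hs = wnullD[OF h]
  define A where "A = (\<lambda>n. {m. (\<forall>l\<in>{..n}. \<bar>\<integral>t. x l t * h m t \<partial>mu\<bar> < d * (1 / 2) ^ n) \<and>
      \<bar>\<integral>t. f t * h m t \<partial>mu\<bar> < d * (1 / 2) ^ n \<and>
      (\<forall>l\<in>{..n}. \<bar>\<integral>t. x m t * h l t \<partial>mu\<bar> < \<bar>\<integral>t. f t * h l t \<partial>mu\<bar> + d * (1 / 2) ^ n)})"
  have dn: "0 < d * (1 / 2) ^ n" for n using d by simp
  show ?thesis
  proof (rule sparseI[where A=A])
    fix n
    have 1: "((\<lambda>m. \<bar>\<integral>t. g t * h m t \<partial>mu\<bar>) \<longlongrightarrow> 0) U" if "g \<in> Lp p" for g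
      using wnull_Lq[OF qp h that] by (intro tendsto_rabs_zero) (simp add: mult.commute)
    have 2: "((\<lambda>m. \<bar>\<integral>t. x m t * h l t \<partial>mu\<bar>) \<longlongrightarrow> \<bar>\<integral>t. f t * h l t \<partial>mu\<bar>) U" for l
      by (intro tendsto_rabs weak_limit_tendsto[OF pq x f] up_spaceD[OF hs])
    show "eventually (\<lambda>m. m \<in> A n) U"
      unfolding A_def mem_Collect_eq
    proof (intro eventually_conj eventually_ball_finite ballI)
      show "eventually (\<lambda>m. \<bar>\<integral>t. x l t * h m t \<partial>mu\<bar> < d * (1 / 2) ^ n) U" for l
        by (rule order_tendstoD(2)[OF 1[OF up_spaceD[OF x]] dn])
      show "eventually (\<lambda>m. \<bar>\<integral>t. f t * h m t \<partial>mu\<bar> < d * (1 / 2) ^ n) U"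
        by (rule order_tendstoD(2)[OF 1[OF f(1)] dn])
      show "eventually (\<lambda>m. \<bar>\<integral>t. x m t * h l t \<partial>mu\<bar> < \<bar>\<integral>t. f t * h l t \<partial>mu\<bar> + d * (1 / 2) ^ n) U" for l
        by (rule order_tendstoD(2)[OF 2]) (use dn[of n] in linarith)
    qed auto
  next
    fix b assume ch: "chain A b"
    then have bm: "strict_mono b" by (simp add: chain_def)
    have pw: "d * (1 / 2) ^ b (i - 1) \<le> 2 * d * (1 / 2) ^ i" if "0 < i" for i
      using mult_left_mono[OF chain_power_le[OF ch that], of d] d by simp
    show "\<forall>i j. i \<noteq> j \<longrightarrow> \<bar>\<integral>t. x (b j) t * h (b i) t \<partial>mu\<bar> \<le> 3 * d * (1 / 2) ^ i"
    proof (intro allI impI)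
      fix i j :: nat assume ij: "i \<noteq> j"
      show "\<bar>\<integral>t. x (b j) t * h (b i) t \<partial>mu\<bar> \<le> 3 * d * (1 / 2) ^ i"
      proof (cases "i < j")
        case True
        have "b j \<in> A (b i)" using ch True by (simp add: chain_def)
        then have a: "\<bar>\<integral>t. x (b j) t * h (b i) t \<partial>mu\<bar> < \<bar>\<integral>t. f t * h (b i) t \<partial>mu\<bar> + d * (1 / 2) ^ b i" by (simp add: A_def)
        have "\<bar>\<integral>t. f t * h (b i) t \<partial>mu\<bar> \<le> 2 * d * (1 / 2) ^ i"
        \<comment> \<open>For \<open>i = 0\<close> there is no preceding term that would make
          \<open>h (b 0)\<close> small on \<open>f\<close>; membership in \<open>A 0\<close> does
          it.\<close>
        proof (cases "i = 0")
          case True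
          have "b 0 \<in> A 0" using ch by (simp add: chain_def)
          then show ?thesis using d True by (simp add: A_def)
        next
          case False
          then have "b i \<in> A (b (i - 1))" using chain_pred[OF ch] by simp
          then have "\<bar>\<integral>t. f t * h (b i) t \<partial>mu\<bar> < d * (1 / 2) ^ b (i - 1)" by (simp add: A_def)
          then show ?thesis using pw[of i] False by simp
        qed
        moreover have "d * (1 / 2) ^ b i \<le> d * (1 / 2) ^ i"
          using d chain_ge[OF ch, of i] by (intro mult_left_mono power_decreasing) auto
        ultimately show ?thesis using a by (simp add: algebra_simps)
      next
        case False
        then have i: "0 < i" "j \<le> i - 1" using ij by auto
        then have "b i \<in> A (b (i - 1))" using chain_pred[OF ch] by simp
        moreover have "b j \<le> b (i - 1)" using bm i by (simp add: strict_mono_less_eq)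
        ultimately have "\<bar>\<integral>t. x (b j) t * h (b i) t \<partial>mu\<bar> < d * (1 / 2) ^ b (i - 1)" by (simp add: A_def)
        moreover have "0 \<le> d * (1 / 2) ^ i" using d by simp
        ultimately show ?thesis using pw[OF i(1)] by linarith
      qed
    qed
  qed
qed

section \<open>Growth of partial sums\<close>

text \<open>Upper estimates with all coefficients equal to one. The exponent \<open>s\<close> there
  becomes the rate \<open>r = 1 / s\<close> here, and bounded operators preserve the rate.\<close>

definition growth :: "real \<Rightarrow> real \<Rightarrow> (nat \<Rightarrow> real \<Rightarrow> real) \<Rightarrow> (nat \<Rightarrow> nat) \<Rightarrow> bool" where
  "growth p r y b \<longleftrightarrow> (\<exists>C\<ge>0. \<forall>N. Lp_norm p (\<lambda>t. \<Sum>i<N. y (b i) t) \<le> C * real N powr r)"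

lemma upper_estimate_growth:
  assumes "0 < p" "0 < s" "upper_estimate p s y b"
  shows "growth p (1 / s) y b"
proof -
  obtain C where C: "C \<ge> 0" "\<And>c N. (\<Sum>i<N. \<bar>c i\<bar> powr s) \<le> 1 \<Longrightarrow> Lp_norm p (\<lambda>t. \<Sum>i<N. c i * y (b i) t) \<le> C"
    using assms(3) by (auto simp: upper_estimate_def)
  show ?thesis
    unfolding growth_def
  proof (intro exI conjI allI)
    fix N
    show "Lp_norm p (\<lambda>t. \<Sum>i<N. y (b i) t) \<le> C * real N powr (1 / s)"
    proof (cases "N = 0")
      case False
      let ?e = "real N powr (- (1 / s))"
      have "(\<Sum>i<N. \<bar>?e\<bar> powr s) = 1"
      proof -
        have "\<bar>?e\<bar> powr s = real N powr (- 1)" using assms(2) by (simp add: powr_powr)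
        then show ?thesis using False by (simp add: powr_minus)
      qed
      then have "Lp_norm p (\<lambda>t. \<Sum>i<N. ?e * y (b i) t) \<le> C" using C(2)[of "\<lambda>i. ?e" N] by simp
      then have "?e * Lp_norm p (\<lambda>t. \<Sum>i<N. y (b i) t) \<le> C"
        using Lp_norm_scale[OF assms(1), of ?e "\<lambda>t. \<Sum>i<N. y (b i) t"] by (simp add: sum_distrib_left)
      then show ?thesis using False by (simp add: powr_minus field_simps)
    qed simp
  qed (rule C(1))
qed

text \<open>This plays the role of Pitt's theorem. Pair the \<open>N\<close>-th partial sums with each other: the diagonal
  terms contribute a multiple of \<open>N\<close>, while Holder's inequality bounds the total by \<open>N powr (r + s)\<close>.\<close>

lemma pair_eq_0_of_growth:
  assumes pq: "conj_exp p q" and y: "wnull p U y" and h: "wnull q U h"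
    and gy: "sparse (growth p r y)" and gh: "sparse (growth q s h)" and rs: "r + s < 1"
  shows "pair y h = 0"
proof -
  note c = conj_expD[OF pq]
  \<comment> \<open>Only a positive pairing is excluded here; replacing \<open>h\<close> by its
    negative then excludes a negative one.\<close>
  have main: "\<not> pair y h > 0" if h: "wnull q U h" and gh: "sparse (growth q s h)" for h
  proof
    assume pos: "pair y h > 0"
    define e where "e = pair y h"
    note ys = wnullD[OF y] and hs = wnullD[OF h]
    have e: "e > 0" using pos by (simp add: e_def)
    have "eventually (\<lambda>n. e / 2 < (\<integral>t. y n t * h n t \<partial>mu)) U"
      by (rule order_tendstoD(1)[OF pair_tendsto[OF pq ys hs]]) (use e in \<open>simp add: e_def\<close>)
    then have s1: "sparse (\<lambda>b. \<forall>i. e / 2 < (\<integral>t. y (b i) t * h (b i) t \<partial>mu))"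
      by (intro sparseI[where A="\<lambda>n. {n. e / 2 < (\<integral>t. y n t * h n t \<partial>mu)}"]) (auto simp: chain_def)
    \<comment> \<open>With \<open>d = e / 48\<close> the off-diagonal entries of a row sum to at
      most \<open>6 * d = e / 8\<close>, while the diagonal entry exceeds \<open>e / 2\<close>; so
      each row sums to at least \<open>e / 4\<close>.\<close>
    have s2: "sparse (\<lambda>b. \<forall>i j. i \<noteq> j \<longrightarrow> \<bar>\<integral>t. y (b j) t * h (b i) t \<partial>mu\<bar> \<le> 3 * (e / 48) * (1 / 2) ^ i)"
      by (rule sparse_off_diagonal[OF pq ys Lp_zero]) (use y h e in auto)
    obtain b where b: "\<And>i. e / 2 < (\<integral>t. y (b i) t * h (b i) t \<partial>mu)"
      "\<And>i j. i \<noteq> j \<Longrightarrow> \<bar>\<integral>t. y (b j) t * h (b i) t \<partial>mu\<bar> \<le> 3 * (e / 48) * (1 / 2) ^ i"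
      "growth p r y b" "growth q s h b"
      by (rule sparse_imp_ex[OF sparse_conj[OF sparse_conj[OF s1 s2] sparse_conj[OF gy gh]]]) blast
    obtain C where C: "C \<ge> 0" "\<And>N. Lp_norm p (\<lambda>t. \<Sum>i<N. y (b i) t) \<le> C * real N powr r"
      using b(3) by (auto simp: growth_def)
    obtain D where D: "D \<ge> 0" "\<And>N. Lp_norm q (\<lambda>t. \<Sum>i<N. h (b i) t) \<le> D * real N powr s"
      using b(4) by (auto simp: growth_def)
    have "real N * (e / 4) \<le> C * D * real N powr (r + s)" for N
    proof -
      have yl: "y n \<in> Lp p" and hl: "h n \<in> Lp q" for n using up_spaceD[OF ys] up_spaceD[OF hs] by auto
      note i = Lp_mult_integrable[OF pq yl hl]
      have "(\<integral>t. (\<Sum>j<N. y (b j) t) * (\<Sum>i<N. h (b i) t) \<partial>mu) = (\<Sum>j<N. \<Sum>i<N. \<integral>t. y (b j) t * h (b i) t \<partial>mu)"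
        unfolding sum_product using i by simp
      also have "\<dots> \<ge> (\<Sum>j<N. e / 4)"
      proof (rule sum_mono)
        fix j assume j: "j \<in> {..<N}"
        let ?a = "\<lambda>i. \<integral>t. y (b j) t * h (b i) t \<partial>mu"
        have "(\<Sum>i\<in>{..<N} - {j}. \<bar>?a i\<bar>) \<le> 6 * (e / 48)"
          by (rule off_diagonal_sum_le) (use b(2) e in auto)
        then have "\<bar>\<Sum>i\<in>{..<N} - {j}. ?a i\<bar> \<le> e / 8" using sum_abs[of ?a "{..<N} - {j}"] by linarith
        moreover have "(\<Sum>i<N. ?a i) = ?a j + (\<Sum>i\<in>{..<N} - {j}. ?a i)" using j by (subst sum.remove) auto
        ultimately show "e / 4 \<le> (\<Sum>i<N. ?a i)" using b(1)[of j] e by linarith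
      qed
      finally have 1: "real N * (e / 4) \<le> (\<integral>t. (\<Sum>j<N. y (b j) t) * (\<Sum>i<N. h (b i) t) \<partial>mu)" by simp
      have "\<bar>\<integral>t. (\<Sum>j<N. y (b j) t) * (\<Sum>i<N. h (b i) t) \<partial>mu\<bar> \<le>
          Lp_norm p (\<lambda>t. \<Sum>j<N. y (b j) t) * Lp_norm q (\<lambda>t. \<Sum>i<N. h (b i) t)"
        by (rule Holder[OF pq]) (use yl hl c in auto)
      also have "\<dots> \<le> (C * real N powr r) * (D * real N powr s)"
        using C D by (intro mult_mono) auto
      also have "\<dots> = C * D * real N powr (r + s)" by (simp add: powr_add)
      finally show ?thesis using 1 by linarith
    qed
    then show False using linear_not_le_powr[of "e / 4" "r + s" "C * D"] e rs by simp
  qed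
  have "sparse (growth q s (\<lambda>n t. - h n t))"
    using gh by (rule sparse_mono) (simp add: growth_def sum_negf)
  moreover have "wnull q U (\<lambda>n t. - h n t)" using wnull_scale[OF _ h, of "-1"] c by simp
  ultimately have "\<not> pair y (\<lambda>n t. - h n t) > 0" by (intro main)
  moreover have "pair y (\<lambda>n t. - h n t) = - pair y h"
    using pair_scale_left[OF conj_exp_sym[OF pq] wnullD[OF h] wnullD[OF y], of "-1"] by (simp add: pair_commute[of y])
  ultimately show ?thesis using main[OF h gh] by linarith
qed

section \<open>Weakly null sequences\<close>

text \<open>If the values had a limit \<open>l \<noteq> 0\<close>, then along a thinned subsequence
  \<open>psi\<close> would be at least \<open>N * \<bar>l\<bar> / 2\<close> in absolute value on the
  \<open>N\<close>-th partial sum, although the norm of that sum grows only like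
  \<open>N powr r\<close>.\<close>

lemma functional_tendsto_0:
  assumes psi: "Lp_functional p psi" and y: "y \<in> up_space p" and g: "sparse (growth p r y)" and r: "r < 1" and p: "0 < p"
  shows "((\<lambda>n. psi (y n)) \<longlongrightarrow> 0) U"
proof -
  obtain C where C: "C > 0" "\<And>f. f \<in> Lp p \<Longrightarrow> \<bar>psi f\<bar> \<le> C * Lp_norm p f" using functional_bound[OF psi] by metis
  obtain B where B: "0 < B" "\<And>n. Lp_norm p (y n) \<le> B" using up_space_bound[OF y] by metis
  have "\<bar>psi (y n)\<bar> \<le> C * B" for n
    using C(2)[OF up_spaceD[OF y, of n]] mult_left_mono[OF B(2)[of n], of C] C(1) by linarith
  then have lim: "((\<lambda>n. psi (y n)) \<longlongrightarrow> Lim U (\<lambda>n. psi (y n))) U" by (rule bounded_tendsto)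
  define l where "l = Lim U (\<lambda>n. psi (y n))"
  have "l = 0"
  proof (rule ccontr)
    assume "l \<noteq> 0"
    have "((\<lambda>n. sgn l * psi (y n)) \<longlongrightarrow> sgn l * l) U" using lim unfolding l_def by (intro tendsto_mult tendsto_const)
    moreover have "sgn l * l = \<bar>l\<bar>" by (simp add: abs_sgn mult.commute)
    ultimately have "eventually (\<lambda>n. \<bar>l\<bar> / 2 < sgn l * psi (y n)) U"
      using \<open>l \<noteq> 0\<close> by (intro order_tendstoD(1)[where y="\<bar>l\<bar>"]) auto
    then have "sparse (\<lambda>b. \<forall>i. \<bar>l\<bar> / 2 < sgn l * psi (y (b i)))"
      by (intro sparseI[where A="\<lambda>n. {n. \<bar>l\<bar> / 2 < sgn l * psi (y n)}"]) (auto simp: chain_def)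
    from sparse_imp_ex[OF sparse_conj[OF this g]]
    obtain b where b: "\<And>i. \<bar>l\<bar> / 2 < sgn l * psi (y (b i))" "growth p r y b" by blast
    obtain D where D: "D \<ge> 0" "\<And>N. Lp_norm p (\<lambda>t. \<Sum>i<N. y (b i) t) \<le> D * real N powr r"
      using b(2) by (auto simp: growth_def)
    have "real N * (\<bar>l\<bar> / 2) \<le> C * D * real N powr r" for N
    proof -
      have "real N * (\<bar>l\<bar> / 2) = (\<Sum>i<N. \<bar>l\<bar> / 2)" by simp
      also have "\<dots> \<le> (\<Sum>i<N. sgn l * psi (y (b i)))" using b(1) by (intro sum_mono) (simp add: less_imp_le)
      also have "\<dots> = sgn l * psi (\<lambda>t. \<Sum>i<N. y (b i) t)"
        using functional_sum[OF psi, of N "\<lambda>i. y (b i)"] up_spaceD[OF y] p by (simp add: sum_distrib_left)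
      also have "\<dots> \<le> \<bar>sgn l\<bar> * \<bar>psi (\<lambda>t. \<Sum>i<N. y (b i) t)\<bar>"
        unfolding abs_mult[symmetric] by (rule abs_ge_self)
      also have "\<dots> = \<bar>psi (\<lambda>t. \<Sum>i<N. y (b i) t)\<bar>" using \<open>l \<noteq> 0\<close> by (simp add: abs_sgn_eq)
      also have "\<dots> \<le> C * Lp_norm p (\<lambda>t. \<Sum>i<N. y (b i) t)"
        by (rule C(2)) (use up_spaceD[OF y] p in auto)
      also have "\<dots> \<le> C * (D * real N powr r)" using C(1) D by (intro mult_left_mono) auto
      finally show ?thesis by simp
    qed
    then show False using linear_not_le_powr[of "\<bar>l\<bar> / 2" r "C * D"] \<open>l \<noteq> 0\<close> r by simp
  qed
  then show ?thesis using lim by (simp add: l_def)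
qed

lemma Disj_growth:
  assumes "conj_exp p q" "d \<in> Disj p"
  shows "sparse (growth p (1 / p) d)"
  using Disj_sparse_upper_estimate[OF assms] by (rule sparse_mono) (use conj_expD(1)[OF assms(1)] in \<open>auto intro: upper_estimate_growth\<close>)

lemma Bdd_growth:
  assumes "conj_exp p q" "y \<in> Bdd" "wnull p U y"
  shows "sparse (growth p (1 / 2) y)"
  using Bdd_sparse_upper_estimate[OF assms] by (rule sparse_mono) (use conj_expD(1)[OF assms(1)] in \<open>auto intro: upper_estimate_growth\<close>)

lemma wnull_split:
  assumes pq: "conj_exp p q" and x: "wnull p U x"
  obtains e d where "e \<in> Equi p" "wnull p U e" "d \<in> Disj p" "x = (\<lambda>n t. e n t + d n t)"
proof -
  obtain e d where ed: "e \<in> Equi p" "d \<in> Disj p" "x = (\<lambda>n t. e n t + d n t)"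
    by (rule equi_disj_split[OF pq wnullD[OF x]])
  have "wnull p U (\<lambda>n t. x n t - d n t)" by (rule wnull_diff[OF pq x Disj_wnull[OF pq ed(2)]])
  then have "wnull p U e" using ed(3) by simp
  then show ?thesis using that ed by blast
qed

text \<open>Abstract functionals are controlled by a Banach--Saks argument, so no representation theorem
  for the dual of \<open>Lp\<close> is needed.\<close>
lemma up_hat_eq:
  assumes pq: "conj_exp p q"
  shows "up_hat p U = {x. wnull p U x}"
proof (intro set_eqI iffI; unfold mem_Collect_eq)
  note c = conj_expD[OF pq]
  fix x assume x: "x \<in> up_hat p U"
  show "wnull p U x"
    unfolding wnull_def
  proof (intro conjI allI impI)
    show xs: "x \<in> up_space p" using x by (simp add: up_hat_def)
    fix g :: "real \<Rightarrow> real" and K assume g: "g \<in> borel_measurable mu" "\<forall>t. \<bar>g t\<bar> \<le> K"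
    have gq: "g \<in> Lp q" by (rule Lp_bounded[where K=K]) (use g c in auto)
    have "Lp_functional p (\<lambda>f. \<integral>t. f t * g t \<partial>mu)"
      unfolding Lp_functional_def
    proof (intro conjI ballI allI exI)
      fix f1 f2 assume "f1 \<in> Lp p" "f2 \<in> Lp p"
      then show "(\<integral>t. vadd f1 f2 t * g t \<partial>mu) = (\<integral>t. f1 t * g t \<partial>mu) + (\<integral>t. f2 t * g t \<partial>mu)"
        using Lp_mult_integrable[OF pq _ gq, of f1] Lp_mult_integrable[OF pq _ gq, of f2]
        by (simp add: vadd_def distrib_right)
    next
      fix f a assume "f \<in> Lp p"
      show "(\<integral>t. vscale a f t * g t \<partial>mu) = a * (\<integral>t. f t * g t \<partial>mu)" by (simp add: vscale_def mult.assoc)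
    next
      fix f assume "f \<in> Lp p"
      then show "\<bar>\<integral>t. f t * g t \<partial>mu\<bar> \<le> Lp_norm q g * Lp_norm p f" using Holder[OF pq _ gq, of f] by (simp add: mult.commute)
    qed
    then show "((\<lambda>n. \<integral>t. x n t * g t \<partial>mu) \<longlongrightarrow> 0) U" using x unfolding up_hat_def by blast
  qed
next
  note c = conj_expD[OF pq]
  fix x assume x: "wnull p U x"
  obtain e d where ed: "e \<in> Equi p" "wnull p U e" "d \<in> Disj p" "x = (\<lambda>n t. e n t + d n t)"
    by (rule wnull_split[OF pq x])
  note es = wnullD[OF ed(2)] and ds = Disj_up_space[OF ed(3)]
  have "((\<lambda>n. psi (x n)) \<longlongrightarrow> 0) U" if psi: "Lp_functional p psi" for psi
  proof -
    obtain C where C: "C > 0" "\<And>f. f \<in> Lp p \<Longrightarrow> \<bar>psi f\<bar> \<le> C * Lp_norm p f" using functional_bound[OF psi] by metis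
    have d0: "((\<lambda>n. psi (d n)) \<longlongrightarrow> 0) U"
      by (rule functional_tendsto_0[OF psi ds Disj_growth[OF pq ed(3)]]) (use c in auto)
    have e0: "((\<lambda>n. psi (e n)) \<longlongrightarrow> 0) U"
    proof (rule tendstoI)
      fix r :: real assume r: "r > 0"
      obtain b where b: "b \<in> Bdd" "wnull p U b" "up_norm p U (\<lambda>n t. e n t - b n t) < r / (2 * C)"
        by (rule Equi_wnull_approx[OF pq ed(1,2), of "r / (2 * C)"]) (use r C in auto)
      note bs = wnullD[OF b(2)]
      have "((\<lambda>n. psi (b n)) \<longlongrightarrow> 0) U"
        by (rule functional_tendsto_0[OF psi bs Bdd_growth[OF pq b(1,2)]]) (use c in auto)
      then have "eventually (\<lambda>n. \<bar>psi (b n)\<bar> < r / 2) U"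
        using r by (auto dest!: tendstoD[where e="r/2"] simp: dist_real_def)
      with up_norm_less[OF up_space_diff[OF pq es bs] b(3)]
      show "eventually (\<lambda>n. dist (psi (e n)) 0 < r) U"
      proof eventually_elim
        case (elim n)
        have "\<bar>psi (\<lambda>t. e n t - b n t)\<bar> \<le> C * Lp_norm p (\<lambda>t. e n t - b n t)"
          by (rule C(2)[OF up_spaceD[OF up_space_diff[OF pq es bs]]])
        also have "\<dots> \<le> C * (r / (2 * C))" using elim C by (intro mult_left_mono) auto
        also have "\<dots> = r / 2" using C by simp
        finally have "\<bar>psi (e n) - psi (b n)\<bar> \<le> r / 2"
          using functional_diff[OF psi up_spaceD[OF es] up_spaceD[OF bs], of n n] c(1) by simp
        then show ?case using elim(2) unfolding dist_real_def by linarith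
      qed
    qed
    have "psi (x n) = psi (e n) + psi (d n)" for n
    proof -
      have "psi (vadd (e n) (d n)) = psi (e n) + psi (d n)"
        using psi up_spaceD[OF es] up_spaceD[OF ds] unfolding Lp_functional_def by blast
      then show ?thesis using ed(4) by (simp add: vadd_def)
    qed
    then show ?thesis using tendsto_add[OF e0 d0] by simp
  qed
  then show "x \<in> up_hat p U" using wnullD[OF x] by (simp add: up_hat_def)
qed

section \<open>Separation\<close>

lemma pair_Bdd_Disj:
  assumes pq: "conj_exp p q" and b: "b \<in> Bdd" and h: "h \<in> Disj q"
  shows "pair b h = 0"
proof (rule pair_eqI, rule tendsto_rabs_zero_cancel)
  note qp = conj_exp_sym[OF pq]
  obtain K where K: "0 < K" "\<And>n t. \<bar>b n t\<bar> \<le> K" using BddE[OF b] by metis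
  have "((\<lambda>n. K * (\<integral>t. \<bar>h n t\<bar> \<partial>mu)) \<longlongrightarrow> K * 0) U"
    using h by (intro tendsto_mult tendsto_const) (auto simp: Disj_def)
  then have l: "((\<lambda>n. K * (\<integral>t. \<bar>h n t\<bar> \<partial>mu)) \<longlongrightarrow> 0) U" by simp
  show "((\<lambda>n. \<bar>\<integral>t. b n t * h n t \<partial>mu\<bar>) \<longlongrightarrow> 0) U"
  proof (rule tendsto_sandwich[OF _ _ tendsto_const l])
    show "\<forall>\<^sub>F n in U. \<bar>\<integral>t. b n t * h n t \<partial>mu\<bar> \<le> K * (\<integral>t. \<bar>h n t\<bar> \<partial>mu)"
    proof (rule always_eventually, rule allI)
      fix n
      have hl: "h n \<in> Lp q" using up_spaceD[OF Disj_up_space[OF h]] .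
      have bl: "b n \<in> Lp p" using up_spaceD[OF Bdd_up_space[OF b]] conj_expD[OF pq] by simp
      have "\<bar>\<integral>t. b n t * h n t \<partial>mu\<bar> \<le> (\<integral>t. \<bar>b n t * h n t\<bar> \<partial>mu)" by (rule integral_abs_bound)
      also have "\<dots> \<le> (\<integral>t. K * \<bar>h n t\<bar> \<partial>mu)"
      proof (rule Bochner_Integration.integral_mono)
        show "\<bar>b n t * h n t\<bar> \<le> K * \<bar>h n t\<bar>" for t using K by (simp add: abs_mult mult_right_mono)
      qed (use integral_abs_le_Lp_norm(1)[OF qp hl] Lp_mult_integrable[OF pq bl hl] in auto)
      finally show "\<bar>\<integral>t. b n t * h n t \<partial>mu\<bar> \<le> K * (\<integral>t. \<bar>h n t\<bar> \<partial>mu)" by simp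
    qed
  qed simp
qed

text \<open>Pairing with \<open>h\<close> is continuous and bounded sequences are dense in
  \<open>Equi p\<close>; a bounded factor leaves only a multiple of the \<open>L^1\<close> norm of
  \<open>h\<close>.\<close>

lemma pair_Equi_Disj:
  assumes pq: "conj_exp p q" and y: "y \<in> Equi p" and h: "h \<in> Disj q"
  shows "pair y h = 0"
proof -
  note c = conj_expD[OF pq]
  note ys = Equi_up_space[OF y] and hs = Disj_up_space[OF h]
  have n0: "up_norm q U h + 1 > 0" using up_norm_nonneg[OF hs] by linarith
  have "\<bar>pair y h\<bar> \<le> e" if e: "e > 0" for e
  proof -
    obtain b where b: "b \<in> Bdd" "eventually (\<lambda>n. Lp_norm p (\<lambda>t. y n t - b n t) < e / (up_norm q U h + 1)) U"
      by (rule Equi_approx[OF y, of "e / (up_norm q U h + 1)"]) (use e n0 in auto)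
    have bs: "b \<in> up_space p" using Bdd_up_space[OF b(1)] c by simp
    note ybs = up_space_diff[OF pq ys bs]
    have "up_norm p U (\<lambda>n t. y n t - b n t) \<le> e / (up_norm q U h + 1)"
      by (rule up_norm_le[OF ybs]) (use b(2) in eventually_elim, simp)
    then have "up_norm p U (\<lambda>n t. y n t - b n t) * up_norm q U h \<le> e / (up_norm q U h + 1) * (up_norm q U h + 1)"
      using up_norm_nonneg[OF hs] e n0 by (intro mult_mono) auto
    also have "\<dots> = e" using n0 by simp
    finally have "\<bar>pair (\<lambda>n t. y n t - b n t) h\<bar> \<le> e" using pair_le[OF pq ybs hs] by linarith
    then show ?thesis using pair_diff_left[OF pq ys bs hs] pair_Bdd_Disj[OF pq b(1) h] by simp
  qed
  then have "\<bar>pair y h\<bar> \<le> 0" by (rule field_le_epsilon) simp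
  then show ?thesis by simp
qed

lemma pair_Disj_Equi:
  assumes "conj_exp p q" "y \<in> Disj p" "h \<in> Equi q"
  shows "pair y h = 0"
  using pair_Equi_Disj[OF conj_exp_sym[OF assms(1)] assms(3,2)] by (simp add: pair_commute)

lemma pair_const_wnull:
  assumes "conj_exp p q" "f \<in> Lp p" "wnull q U h"
  shows "pair (\<lambda>n. f) h = 0"
  by (rule pair_eqI) (use wnull_Lq[OF conj_exp_sym[OF assms(1)] assms(3,2)] in \<open>simp add: mult.commute\<close>)

text \<open>The dual sequence \<open>Jmap p (y n)\<close> belongs to \<open>Disj q\<close>, and its
  pairing with \<open>y\<close> is the limit of the p-th powers of the norms.\<close>

lemma Disj_separated:
  assumes pq: "conj_exp p q" and y: "y \<in> Disj p" and s: "\<And>h. h \<in> Disj q \<Longrightarrow> pair y h = 0"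
  shows "up_norm p U y = 0"
proof -
  note c = conj_expD[OF pq] and ys = Disj_up_space[OF y]
  have J: "(\<lambda>n. Jmap p (y n)) \<in> Disj q" by (rule Jmap_Disj[OF pq y])
  have "((\<lambda>n. \<integral>t. y n t * Jmap p (y n) t \<partial>mu) \<longlongrightarrow> 0) U"
    using pair_tendsto[OF pq ys Disj_up_space[OF J]] s[OF J] by simp
  then have "((\<lambda>n. \<integral>t. \<bar>y n t\<bar> powr p \<partial>mu) \<longlongrightarrow> 0) U" by (simp add: Jmap_mult[OF c(1)])
  then have "((\<lambda>n. (\<integral>t. \<bar>y n t\<bar> powr p \<partial>mu) powr (1 / p)) \<longlongrightarrow> 0 powr (1 / p)) U"
    by (intro tendsto_powr') (use c in auto)
  then show ?thesis using up_norm_eq_0_iff[OF ys] by (simp add: Lp_norm_def)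
qed

text \<open>The norming sequence \<open>w\<close> is taken from the truncation \<open>v\<close> of
  \<open>y\<close>, so that it is bounded. It need not be weakly null, but its weak limit
  \<open>g\<close> may be subtracted because the weakly null \<open>y\<close> does not see fixed
  functions.\<close>

lemma Equi_separated:
  assumes pq: "conj_exp p q" and y: "y \<in> Equi p" "wnull p U y"
    and s: "\<And>h. h \<in> Bdd \<Longrightarrow> wnull q U h \<Longrightarrow> pair y h = 0"
  shows "up_norm p U y = 0"
proof -
  note c = conj_expD[OF pq] and ys = wnullD[OF y(2)] and qp = conj_exp_sym[OF pq]
  note [measurable] = up_space_meas[OF ys]
  have "up_norm p U y \<le> e" if e: "e > 0" for e
  proof -
    obtain K where K: "K \<ge> 0" "eventually (\<lambda>n. Lp_norm p (\<lambda>t. y n t - trunc K (y n t)) < e / 2) U"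
      using y(1) e unfolding Equi_def by (auto dest: spec[of _ "e/2"])
    define v where "v = (\<lambda>n t. trunc K (y n t))"
    have [measurable]: "v n \<in> borel_measurable mu" for n unfolding v_def by measurable
    have vB: "v \<in> Bdd" by (rule BddI[where K=K]) (use K in \<open>auto simp: v_def abs_trunc\<close>)
    have vs: "v \<in> up_space p" using Bdd_up_space[OF vB] c by auto
    define w where "w = (\<lambda>n. Jmap p (v n))"
    have wB: "w \<in> Bdd"
    proof (rule BddI[where K="K powr (p - 1)"])
      show "w n \<in> borel_measurable mu" for n unfolding w_def by measurable
      show "\<bar>w n t\<bar> \<le> K powr (p - 1)" for n t
        unfolding w_def abs_Jmap using K c by (intro powr_mono2) (auto simp: v_def abs_trunc)
    qed
    have ws: "w \<in> up_space q" using Bdd_up_space[OF wB] c by auto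
    obtain g L where g: "g \<in> borel_measurable mu" "\<And>t. \<bar>g t\<bar> \<le> L" "g \<in> Lp q" "wnull q U (\<lambda>n t. w n t - g t)"
      by (rule weak_limit_bounded[OF qp wB]) blast
    have gB: "(\<lambda>n. g) \<in> Bdd" by (rule BddI[where K=L]) (use g in auto)
    have "(\<lambda>n t. w n t - g t) \<in> Bdd" using Bdd_add[OF wB Bdd_scale[OF gB, of "-1"]] by simp
    then have "pair y (\<lambda>n t. w n t - g t) = 0" using s g(4) by simp
    moreover have "pair y (\<lambda>n t. w n t - g t) = pair y w - pair y (\<lambda>n. g)"
      using pair_diff_left[OF qp ws up_space_const[OF g(3)] ys] by (simp add: pair_commute)
    moreover have "pair y (\<lambda>n. g) = 0" by (rule pair_eqI) (rule wnull_Lq[OF pq y(2) g(3)])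
    ultimately have "pair y w = 0" by simp
    then have l: "((\<lambda>n. \<integral>t. y n t * w n t \<partial>mu) \<longlongrightarrow> 0) U" using pair_tendsto[OF pq ys ws] by simp
    \<comment> \<open>\<open>w n\<close> has the sign of \<open>y n\<close> or vanishes, and
      truncation only shrinks absolute values.\<close>
    have pt: "\<bar>v n t\<bar> powr p \<le> y n t * w n t" for n t
    proof -
      have "\<bar>v n t\<bar> powr p = v n t * w n t" using Jmap_mult[OF c(1), of "v n" t] by (simp add: w_def)
      also have "\<dots> = \<bar>v n t\<bar> * \<bar>w n t\<bar>"
        using Jmap_mult[OF c(1), of "v n" t] by (simp add: w_def abs_mult[symmetric])
      also have "\<dots> \<le> \<bar>y n t\<bar> * \<bar>w n t\<bar>" using K by (intro mult_right_mono) (auto simp: v_def abs_trunc)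
      also have "\<dots> = y n t * w n t"
      proof -
        have "sgn (v n t) = sgn (y n t) \<or> v n t = 0" using K(1) by (auto simp: v_def trunc_def sgn_if max_def min_def)
        then have "0 \<le> y n t * w n t"
          by (auto simp: w_def Jmap_def sgn_if zero_le_mult_iff mult_le_0_iff split: if_splits)
        then show ?thesis by (simp add: abs_mult[symmetric])
      qed
      finally show ?thesis .
    qed
    have "((\<lambda>n. \<integral>t. \<bar>v n t\<bar> powr p \<partial>mu) \<longlongrightarrow> 0) U"
    proof (rule tendsto_sandwich[OF _ _ tendsto_const l])
      show "\<forall>\<^sub>F n in U. (\<integral>t. \<bar>v n t\<bar> powr p \<partial>mu) \<le> (\<integral>t. y n t * w n t \<partial>mu)"
        by (intro always_eventually allI Bochner_Integration.integral_mono LpD(2)[OF up_spaceD[OF vs]]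
            Lp_mult_integrable[OF pq up_spaceD[OF ys] up_spaceD[OF ws]] pt)
    qed simp
    then have "((\<lambda>n. (\<integral>t. \<bar>v n t\<bar> powr p \<partial>mu) powr (1 / p)) \<longlongrightarrow> 0 powr (1 / p)) U"
      by (intro tendsto_powr') (use c in auto)
    then have "((\<lambda>n. Lp_norm p (v n)) \<longlongrightarrow> 0) U" by (simp add: Lp_norm_def)
    then have "eventually (\<lambda>n. Lp_norm p (v n) < e / 2) U" using e by (intro order_tendstoD) auto
    with K(2) have "eventually (\<lambda>n. Lp_norm p (y n) \<le> e) U"
    proof eventually_elim
      case (elim n)
      then show ?case using Lp_norm_le_diff[OF pq up_spaceD[OF ys] up_spaceD[OF vs], of n n] by (simp add: v_def)
    qed
    then show ?thesis by (rule up_norm_le[OF ys])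
  qed
  then have "up_norm p U y \<le> 0" by (rule field_le_epsilon) simp
  then show ?thesis using up_norm_nonneg[OF ys] by linarith
qed

section \<open>Approximating rank-one operators\<close>

text \<open>Read as \<open>0 - (- u)\<close>, the hypothesis says that the zero sequence has weak
  limit \<open>- u\<close>, and lower semicontinuity of the norm makes \<open>u\<close> null. This
  is the uniqueness of weak limits.\<close>

lemma wnull_const_null:
  assumes pq: "conj_exp p q" and u: "u \<in> Lp p" and w: "wnull p U (\<lambda>n. u)"
  shows "Lp_norm p u = 0"
proof -
  have "wnull p U (\<lambda>n t. 0 - - u t)" using w by simp
  then have "Lp_norm p (\<lambda>t. - u t) \<le> 0"
    by (intro weak_limit_norm[OF pq up_space_const[OF Lp_zero] Lp_uminus[OF u]]) auto
  then show ?thesis by (simp add: order_antisym)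
qed

text \<open>The sum factors through \<open>l^a\<close>. The synthesis map of \<open>h\<close> on
  \<open>l^a'\<close> is bounded by \<open>D\<close>, so its adjoint, which takes \<open>f\<close>
  to the coefficients \<open>al\<close>, maps into \<open>l^a\<close> with the same bound; the
  synthesis map of \<open>y\<close> contributes \<open>C\<close>.\<close>

lemma analysis_synthesis_bound:
  assumes pq: "conj_exp p q" and aa: "conj_exp a a'" and y: "\<And>n. y n \<in> Lp p" and h: "\<And>n. h n \<in> Lp q"
    and Sy: "upper_estimate p a y b" and Sh: "upper_estimate q a' h b"
  obtains C where "C \<ge> 0" "\<And>f N. f \<in> Lp p \<Longrightarrow>
    Lp_norm p (\<lambda>t. \<Sum>i<N. (\<integral>s. f s * h (b i) s \<partial>mu) * y (b i) t) \<le> C * Lp_norm p f"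
proof -
  note c = conj_expD[OF pq] and ca = conj_expD[OF aa]
  obtain C where C: "C \<ge> 0" "\<And>c N. (\<Sum>i<N. \<bar>c i\<bar> powr a) \<le> 1 \<Longrightarrow> Lp_norm p (\<lambda>t. \<Sum>i<N. c i * y (b i) t) \<le> C"
    using Sy by (auto simp: upper_estimate_def)
  obtain D where D: "D \<ge> 0" "\<And>c N. (\<Sum>i<N. \<bar>c i\<bar> powr a') \<le> 1 \<Longrightarrow> Lp_norm q (\<lambda>t. \<Sum>i<N. c i * h (b i) t) \<le> D"
    using Sh by (auto simp: upper_estimate_def)
  show ?thesis
  proof (rule that[of "D * C"])
    show "0 \<le> D * C" using C D by simp
    fix f N assume f: "f \<in> Lp p"
    define al where "al = (\<lambda>i. \<integral>s. f s * h (b i) s \<partial>mu)"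
    define w where "w = (\<Sum>i<N. \<bar>al i\<bar> powr a)"
    define sg where "sg = w powr (1 / a)"
    have w0: "0 \<le> w" by (simp add: w_def sum_nonneg)
    have "Lp_norm p (\<lambda>t. \<Sum>i<N. al i * y (b i) t) \<le> D * C * Lp_norm p f"
    proof (cases "w = 0")
      case True
      then have "\<And>i. i < N \<Longrightarrow> al i = 0" unfolding w_def by (subst (asm) sum_nonneg_eq_0_iff) auto
      then have "(\<lambda>t. \<Sum>i<N. al i * y (b i) t) = (\<lambda>t. 0)" by (intro ext sum.neutral) auto
      then show ?thesis using C D by simp
    next
      case False
      then have sg: "sg > 0" using w0 by (simp add: sg_def)
      have sga: "sg powr a = w" using w0 ca by (simp add: sg_def powr_powr)
      define cc where "cc = (\<lambda>i. al i / sg)"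
      have csum: "(\<Sum>i<N. \<bar>cc i\<bar> powr a) = 1"
      proof -
        have "(\<Sum>i<N. \<bar>cc i\<bar> powr a) = (\<Sum>i<N. \<bar>al i\<bar> powr a / w)"
          using sg by (simp add: cc_def powr_divide sga)
        also have "\<dots> = w / w" by (simp only: w_def sum_divide_distrib)
        finally show ?thesis using False by simp
      qed
      \<comment> \<open>The element of the dual unit ball that norms \<open>cc\<close>, by the same
        formula as for \<open>Jmap\<close>.\<close>
      define be where "be = (\<lambda>i. sgn (cc i) * \<bar>cc i\<bar> powr (a - 1))"
      have ab: "\<bar>be i\<bar> = \<bar>cc i\<bar> powr (a - 1)" for i by (cases "cc i = 0") (auto simp: be_def abs_mult abs_sgn_eq)
      have "\<bar>be i\<bar> powr a' = \<bar>cc i\<bar> powr a" for i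
        unfolding ab powr_powr ca(5) ..
      then have besum: "(\<Sum>i<N. \<bar>be i\<bar> powr a') \<le> 1" using csum by simp
      have beal: "be i * al i = sg * \<bar>cc i\<bar> powr a" for i
      proof -
        have "al i = sg * cc i" using sg by (simp add: cc_def)
        then have "be i * al i = sg * ((cc i * sgn (cc i)) * \<bar>cc i\<bar> powr (a - 1))" by (simp add: be_def)
        also have "cc i * sgn (cc i) = \<bar>cc i\<bar>" by (rule abs_sgn[symmetric])
        also have "\<bar>cc i\<bar> * \<bar>cc i\<bar> powr (a - 1) = \<bar>cc i\<bar> powr a" using powr_mult_base[of "\<bar>cc i\<bar>" "a - 1"] by simp
        finally show ?thesis .
      qed
      have hl: "(\<lambda>t. \<Sum>i<N. be i * h (b i) t) \<in> Lp q" using h c by (intro Lp_sum Lp_scale) auto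
      have "sg = (\<Sum>i<N. be i * al i)" unfolding beal sum_distrib_left[symmetric] csum by simp
      also have "\<dots> = (\<integral>t. f t * (\<Sum>i<N. be i * h (b i) t) \<partial>mu)"
      proof -
        have "(\<integral>t. f t * (\<Sum>i<N. be i * h (b i) t) \<partial>mu) = (\<integral>t. (\<Sum>i<N. be i * (f t * h (b i) t)) \<partial>mu)"
          by (simp add: sum_distrib_left mult_ac)
        also have "\<dots> = (\<Sum>i<N. \<integral>t. be i * (f t * h (b i) t) \<partial>mu)"
          by (rule Bochner_Integration.integral_sum) (use Lp_mult_integrable[OF pq f h] in auto)
        finally show ?thesis by (simp add: al_def)
      qed
      also have "\<dots> \<le> Lp_norm p f * Lp_norm q (\<lambda>t. \<Sum>i<N. be i * h (b i) t)" using Holder[OF pq f hl] by linarith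
      also have "\<dots> \<le> Lp_norm p f * D" using D(2)[OF besum] by (intro mult_left_mono) auto
      finally have sgD: "sg \<le> D * Lp_norm p f" by (simp add: mult.commute)
      have "(\<lambda>t. \<Sum>i<N. al i * y (b i) t) = (\<lambda>t. sg * (\<Sum>i<N. cc i * y (b i) t))"
        using sg by (simp add: cc_def sum_distrib_left)
      then have "Lp_norm p (\<lambda>t. \<Sum>i<N. al i * y (b i) t) = sg * Lp_norm p (\<lambda>t. \<Sum>i<N. cc i * y (b i) t)"
        using Lp_norm_scale[of p sg] sg c by simp
      also have "\<dots> \<le> (D * Lp_norm p f) * C"
        using sgD C(2)[of cc N] csum sg D by (intro mult_mono) auto
      finally show ?thesis by (simp add: mult_ac)
    qed
    then show "Lp_norm p (\<lambda>t. \<Sum>i<N. (\<integral>s. f s * h (b i) s \<partial>mu) * y (b i) t) \<le> D * C * Lp_norm p f"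
      by (simp add: al_def)
  qed
qed

text \<open>The infinite sum is taken as the weak limit of its partial sums along \<open>U\<close>,
  which uses only their uniform bound \<open>C\<close>. A weak limit is determined up to a null
  function, so \<open>T\<close> is linear in the sense of \<open>Lp_op\<close>, and lower
  semicontinuity bounds it by \<open>C\<close>.\<close>

lemma weak_sum_operator:
  assumes pq: "conj_exp p q" and y: "\<And>n. y n \<in> Lp p" and h: "\<And>n. h n \<in> Lp q"
    and C: "C \<ge> 0" "\<And>f N. f \<in> Lp p \<Longrightarrow> Lp_norm p (\<lambda>t. \<Sum>i<N. (\<integral>s. f s * h (b i) s \<partial>mu) * y (b i) t) \<le> C * Lp_norm p f"
  obtains T where "Lp_op p T" "\<And>f. f \<in> Lp p \<Longrightarrow> T f \<in> Lp p"
    "\<And>f. f \<in> Lp p \<Longrightarrow> wnull p U (\<lambda>N t. (\<Sum>i<N. (\<integral>s. f s * h (b i) s \<partial>mu) * y (b i) t) - T f t)"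
proof -
  note c = conj_expD[OF pq]
  define P where "P = (\<lambda>f N t. \<Sum>i<N. (\<integral>s. f s * h (b i) s \<partial>mu) * y (b i) t)"
  have Ps: "P f \<in> up_space p" if "f \<in> Lp p" for f
  proof (rule up_spaceI[where B="C * Lp_norm p f"])
    show "P f n \<in> Lp p" for n unfolding P_def by (intro Lp_sum Lp_scale y) (use c in auto)
    show "Lp_norm p (P f n) \<le> C * Lp_norm p f" for n unfolding P_def by (rule C(2)[OF that])
  qed
  define T where "T = (\<lambda>f. SOME g. g \<in> Lp p \<and> wnull p U (\<lambda>N t. P f N t - g t))"
  have T: "T f \<in> Lp p \<and> wnull p U (\<lambda>N t. P f N t - T f t)" if f: "f \<in> Lp p" for f
  proof -
    obtain g where "g \<in> Lp p" "wnull p U (\<lambda>N t. P f N t - g t)" by (rule weak_limit_exists[OF pq Ps[OF f]])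
    then have "\<exists>g. g \<in> Lp p \<and> wnull p U (\<lambda>N t. P f N t - g t)" by blast
    from someI_ex[OF this] show ?thesis unfolding T_def .
  qed
  have Tl: "T f \<in> Lp p" and Tw: "wnull p U (\<lambda>N t. P f N t - T f t)" if "f \<in> Lp p" for f using T[OF that] by auto
  have Padd: "P (\<lambda>t. f t + g t) N t = P f N t + P g N t" if "f \<in> Lp p" "g \<in> Lp p" for f g N t
    unfolding P_def using Lp_mult_integrable[OF pq that(1) h] Lp_mult_integrable[OF pq that(2) h]
    by (simp add: distrib_right sum.distrib)
  have Pscale: "P (\<lambda>t. k * f t) N t = k * P f N t" for f N t k
    unfolding P_def by (simp add: sum_distrib_left mult.assoc)
  have "Lp_op p T"
    unfolding Lp_op_def
  proof (intro conjI ballI allI)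
    fix f assume "f \<in> Lp p" then show "T f \<in> Lp p" by (rule Tl)
  next
    fix f g assume fg: "f \<in> Lp p" "g \<in> Lp p"
    have s: "(\<lambda>t. f t + g t) \<in> Lp p" using fg c by auto
    have "wnull p U (\<lambda>N t. ((P f N t - T f t) + (P g N t - T g t)) - (P (\<lambda>t. f t + g t) N t - T (\<lambda>t. f t + g t) t))"
      by (intro wnull_diff[OF pq] wnull_add[OF pq] Tw fg s)
    then have "wnull p U (\<lambda>N t. T (\<lambda>t. f t + g t) t - (T f t + T g t))"
      by (simp add: Padd[OF fg] algebra_simps)
    moreover have "(\<lambda>t. T (\<lambda>t. f t + g t) t - (T f t + T g t)) \<in> Lp p" by (intro Lp_diff Lp_add Tl fg s) (use c in auto)
    ultimately show "Lp_norm p (vsub (T (vadd f g)) (vadd (T f) (T g))) = 0"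
      using wnull_const_null[OF pq] by (simp add: vsub_def vadd_def)
  next
    fix f k assume f: "f \<in> Lp p"
    have s: "(\<lambda>t. k * f t) \<in> Lp p" using f by auto
    have "wnull p U (\<lambda>N t. k * (P f N t - T f t) - (P (\<lambda>t. k * f t) N t - T (\<lambda>t. k * f t) t))"
      by (intro wnull_diff[OF pq] wnull_scale Tw f s) (use c in auto)
    then have "wnull p U (\<lambda>N t. T (\<lambda>t. k * f t) t - k * T f t)"
      by (simp add: Pscale algebra_simps)
    moreover have "(\<lambda>t. T (\<lambda>t. k * f t) t - k * T f t) \<in> Lp p" by (intro Lp_diff Lp_scale Tl f s) (use c in auto)
    ultimately show "Lp_norm p (vsub (T (vscale k f)) (vscale k (T f))) = 0"
      using wnull_const_null[OF pq] by (simp add: vsub_def vscale_def)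
  next
    have "Lp_norm p (T f) \<le> C * Lp_norm p f" if f: "f \<in> Lp p" for f
      by (rule weak_limit_norm[OF pq Ps[OF f] Tl[OF f] Tw[OF f]]) (use C(2)[OF f] in \<open>simp add: P_def\<close>)
    then show "\<exists>C. \<forall>f\<in>Lp p. Lp_norm p (T f) \<le> C * Lp_norm p f" by blast
  qed
  then show ?thesis using Tl Tw unfolding P_def by (rule that)
qed

text \<open>Approximation in norm at finitely many vectors by ultrapowers of operators. In this form
  sums of such maps, and norm limits of the vector in a rank-one map, are easy to handle.\<close>

definition approximable :: "real \<Rightarrow> ((nat \<Rightarrow> real \<Rightarrow> real) \<Rightarrow> (nat \<Rightarrow> real \<Rightarrow> real)) \<Rightarrow> bool" where
  "approximable p R \<longleftrightarrow> (\<forall>(k::nat) xs e. e > 0 \<longrightarrow> (\<forall>i<k. xs i \<in> up_space p) \<longrightarrow>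
     (\<exists>T. Lp_op p T \<and> (\<forall>i<k. up_norm p U (\<lambda>n t. T (xs i n) t - R (xs i) n t) \<le> e)))"

lemma Lp_op_up_space:
  assumes "Lp_op p T" "x \<in> up_space p"
  shows "(\<lambda>n. T (x n)) \<in> up_space p"
proof -
  obtain C where C: "\<And>f. f \<in> Lp p \<Longrightarrow> Lp_norm p (T f) \<le> C * Lp_norm p f" using assms(1) unfolding Lp_op_def by blast
  obtain B where B: "0 < B" "\<And>n. Lp_norm p (x n) \<le> B" using up_space_bound[OF assms(2)] by metis
  show ?thesis
  proof (rule up_spaceI[where B="\<bar>C\<bar> * B"])
    fix n
    show "T (x n) \<in> Lp p" using assms(1) up_spaceD[OF assms(2)] unfolding Lp_op_def by blast
    have "Lp_norm p (T (x n)) \<le> C * Lp_norm p (x n)" by (rule C[OF up_spaceD[OF assms(2)]])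
    also have "\<dots> \<le> \<bar>C\<bar> * B" using B by (intro mult_mono) auto
    finally show "Lp_norm p (T (x n)) \<le> \<bar>C\<bar> * B" .
  qed
qed

text \<open>At an index \<open>n = b j\<close> the j-th term of the series is the pairing of
  \<open>xs r n\<close> with \<open>h n\<close>, times \<open>y n\<close>, and almost
  biorthogonality makes the other terms small. As the range of \<open>b\<close> belongs to
  \<open>U\<close>, these indices decide the limit.\<close>

lemma rank_one_approximable:
  assumes pq: "conj_exp p q" and aa: "conj_exp a a'" and y: "wnull p U y" and h: "wnull q U h"
    and Sy: "sparse (upper_estimate p a y)" and Sh: "sparse (upper_estimate q a' h)"
  shows "approximable p (\<lambda>x n t. pair x h * y n t)"
  unfolding approximable_def
proof (intro allI impI)
  fix k :: nat and xs :: "nat \<Rightarrow> nat \<Rightarrow> real \<Rightarrow> real" and e :: real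
  assume e: "e > 0" and xs: "\<forall>i<k. xs i \<in> up_space p"
  note c = conj_expD[OF pq] and ys = wnullD[OF y] and hs = wnullD[OF h]
  obtain B where B: "0 < B" "\<And>n. Lp_norm p (y n) \<le> B" using up_space_bound[OF ys] by metis
  \<comment> \<open>Chosen so that the off-diagonal terms contribute at most
    \<open>6 * d * B = e / 2\<close>; the other half of \<open>e\<close> is spent on replacing the
    pairing at \<open>n\<close> by its limit.\<close>
  define d where "d = e / (12 * B)"
  have d: "d > 0" using e B by (simp add: d_def)
  have "sparse (\<lambda>b. \<forall>r<k. \<forall>i j. i \<noteq> j \<longrightarrow> \<bar>\<integral>t. xs r (b j) t * h (b i) t \<partial>mu\<bar> \<le> 3 * d * (1 / 2) ^ i)"
  proof (rule sparse_all_less)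
    fix r assume "r < k"
    then have x: "xs r \<in> up_space p" using xs by simp
    obtain f where f: "f \<in> Lp p" "wnull p U (\<lambda>n t. xs r n t - f t)" by (rule weak_limit_exists[OF pq x])
    show "sparse (\<lambda>b. \<forall>i j. i \<noteq> j \<longrightarrow> \<bar>\<integral>t. xs r (b j) t * h (b i) t \<partial>mu\<bar> \<le> 3 * d * (1 / 2) ^ i)"
      by (rule sparse_off_diagonal[OF pq x f h d])
  qed
  from sparse_conj[OF this sparse_conj[OF Sy Sh]]
  obtain b where b: "strict_mono b" "eventually (\<lambda>m. m \<in> range b) U"
    and all: "(\<forall>r<k. \<forall>i j. i \<noteq> j \<longrightarrow> \<bar>\<integral>t. xs r (b j) t * h (b i) t \<partial>mu\<bar> \<le> 3 * d * (1 / 2) ^ i) \<and>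
      upper_estimate p a y b \<and> upper_estimate q a' h b"
    by (rule sparse_imp_ex)
  have off: "\<bar>\<integral>t. xs r (b j) t * h (b i) t \<partial>mu\<bar> \<le> 3 * d * (1 / 2) ^ i" if "r < k" "i \<noteq> j" for r i j
    using all that by simp
  have Syb: "upper_estimate p a y b" and Shb: "upper_estimate q a' h b" using all by simp_all
  note yl = up_spaceD[OF ys] and hl = up_spaceD[OF hs]
  obtain C where C: "C \<ge> 0" "\<And>f N. f \<in> Lp p \<Longrightarrow> Lp_norm p (\<lambda>t. \<Sum>i<N. (\<integral>s. f s * h (b i) s \<partial>mu) * y (b i) t) \<le> C * Lp_norm p f"
    by (rule analysis_synthesis_bound[OF pq aa yl hl Syb Shb]) blast
  obtain T where T: "Lp_op p T" "\<And>f. f \<in> Lp p \<Longrightarrow> T f \<in> Lp p"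
    "\<And>f. f \<in> Lp p \<Longrightarrow> wnull p U (\<lambda>N t. (\<Sum>i<N. (\<integral>s. f s * h (b i) s \<partial>mu) * y (b i) t) - T f t)"
  proof (rule weak_sum_operator[where y=y and h=h and b=b, OF pq yl hl C])
    fix T assume "Lp_op p T" "\<And>f. f \<in> Lp p \<Longrightarrow> T f \<in> Lp p"
      "\<And>f. f \<in> Lp p \<Longrightarrow> wnull p U (\<lambda>N t. (\<Sum>i<N. (\<integral>s. f s * h (b i) s \<partial>mu) * y (b i) t) - T f t)"
    then show ?thesis by (rule that)
  qed
  \<comment> \<open>\<open>T\<close> is known only as a weak limit of the partial sums; lower
    semicontinuity of the norm carries their off-diagonal bound over to it.\<close>
  have diag: "Lp_norm p (\<lambda>t. T (xs r (b j)) t - (\<integral>s. xs r (b j) s * h (b j) s \<partial>mu) * y (b j) t) \<le> e / 2" if r: "r < k" for r j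
  proof -
    define f where "f = xs r (b j)"
    have f: "f \<in> Lp p" using up_spaceD[of "xs r" p "b j"] xs r by (simp add: f_def)
    define al where "al = (\<lambda>i. \<integral>s. f s * h (b i) s \<partial>mu)"
    let ?P = "\<lambda>N t. \<Sum>i<N. al i * y (b i) t"
    have Ps: "?P \<in> up_space p"
    proof (rule up_spaceI[where B="C * Lp_norm p f"])
      show "?P N \<in> Lp p" for N by (intro Lp_sum Lp_scale yl) (use c in auto)
      show "Lp_norm p (?P N) \<le> C * Lp_norm p f" for N using C(2)[OF f] by (simp add: al_def)
    qed
    have z: "(\<lambda>t. al j * y (b j) t) \<in> Lp p" using yl by auto
    have Qs: "(\<lambda>N t. ?P N t - al j * y (b j) t) \<in> up_space p" by (rule up_space_diff[OF pq Ps up_space_const[OF z]])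
    have w: "wnull p U (\<lambda>N t. (?P N t - al j * y (b j) t) - (T f t - al j * y (b j) t))"
      using T(3)[OF f] by (simp add: al_def)
    have g: "(\<lambda>t. T f t - al j * y (b j) t) \<in> Lp p" by (intro Lp_diff T(2) f z) (use c in auto)
    have "eventually (\<lambda>N. Lp_norm p (\<lambda>t. ?P N t - al j * y (b j) t) \<le> e / 2) U"
      using eventually_ge_U[of "Suc j"]
    proof eventually_elim
      case (elim N)
      have "(\<lambda>t. ?P N t - al j * y (b j) t) = (\<lambda>t. \<Sum>i\<in>{..<N} - {j}. al i * y (b i) t)"
        using elim by (intro ext) (subst sum.remove[of "{..<N}" j], auto)
      then have "Lp_norm p (\<lambda>t. ?P N t - al j * y (b j) t) = Lp_norm p (\<lambda>t. \<Sum>i\<in>{..<N} - {j}. al i * y (b i) t)" by simp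
      also have "\<dots> \<le> (\<Sum>i\<in>{..<N} - {j}. Lp_norm p (\<lambda>t. al i * y (b i) t))"
        by (rule Lp_norm_sum[OF pq]) (use yl in auto)
      also have "\<dots> \<le> (\<Sum>i\<in>{..<N} - {j}. \<bar>al i\<bar> * B)"
        by (rule sum_mono) (use B c in \<open>auto simp: Lp_norm_scale intro!: mult_left_mono\<close>)
      also have "\<dots> = (\<Sum>i\<in>{..<N} - {j}. \<bar>al i\<bar>) * B" by (simp add: sum_distrib_right)
      also have "\<dots> \<le> (6 * d) * B"
        by (intro mult_right_mono off_diagonal_sum_le) (use off[OF r] d B in \<open>auto simp: al_def f_def\<close>)
      also have "\<dots> = e / 2" using B by (simp add: d_def)
      finally show ?case .
    qed
    then have "Lp_norm p (\<lambda>t. T f t - al j * y (b j) t) \<le> e / 2" by (rule weak_limit_norm[OF pq Qs g w])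
    then show ?thesis by (simp add: al_def f_def)
  qed
  have "up_norm p U (\<lambda>n t. T (xs r n) t - pair (xs r) h * y n t) \<le> e" if r: "r < k" for r
  proof -
    have x: "xs r \<in> up_space p" using xs r by simp
    have Ts: "(\<lambda>n. T (xs r n)) \<in> up_space p" by (rule Lp_op_up_space[OF T(1) x])
    have zs: "(\<lambda>n t. pair (xs r) h * y n t) \<in> up_space p" using up_space_scale[OF _ ys] c by simp
    have "eventually (\<lambda>n. dist (\<integral>s. xs r n s * h n s \<partial>mu) (pair (xs r) h) < e / (2 * B)) U"
      using pair_tendsto[OF pq x hs] e B by (intro tendstoD) auto
    with b(2) have "eventually (\<lambda>n. Lp_norm p (\<lambda>t. T (xs r n) t - pair (xs r) h * y n t) \<le> e) U"
    proof eventually_elim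
      case (elim n)
      then obtain j where n: "n = b j" by auto
      let ?a = "\<integral>s. xs r n s * h n s \<partial>mu"
      have 1: "(\<lambda>t. T (xs r n) t - ?a * y n t) \<in> Lp p" by (intro Lp_diff Lp_scale T(2) up_spaceD[OF x] yl) (use c in auto)
      have 2: "(\<lambda>t. (?a - pair (xs r) h) * y n t) \<in> Lp p" using yl by auto
      have "Lp_norm p (\<lambda>t. T (xs r n) t - pair (xs r) h * y n t) =
          Lp_norm p (\<lambda>t. (T (xs r n) t - ?a * y n t) + (?a - pair (xs r) h) * y n t)"
        by (simp add: algebra_simps)
      also have "\<dots> \<le> Lp_norm p (\<lambda>t. T (xs r n) t - ?a * y n t) + Lp_norm p (\<lambda>t. (?a - pair (xs r) h) * y n t)"
        by (rule Lp_norm_triangle[OF pq 1 2])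
      also have "\<dots> \<le> e / 2 + (e / (2 * B)) * B"
      proof (rule add_mono)
        show "Lp_norm p (\<lambda>t. T (xs r n) t - ?a * y n t) \<le> e / 2" using diag[OF r, of j] n by simp
        have "Lp_norm p (\<lambda>t. (?a - pair (xs r) h) * y n t) = \<bar>?a - pair (xs r) h\<bar> * Lp_norm p (y n)"
          using Lp_norm_scale[of p "?a - pair (xs r) h" "y n"] c by simp
        also have "\<dots> \<le> (e / (2 * B)) * B"
          using elim(2) B e by (intro mult_mono) (auto simp: dist_real_def)
        finally show "Lp_norm p (\<lambda>t. (?a - pair (xs r) h) * y n t) \<le> (e / (2 * B)) * B" .
      qed
      also have "\<dots> = e" using B by simp
      finally show ?case .
    qed
    then show ?thesis by (rule up_norm_le[OF up_space_diff[OF pq Ts zs]])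
  qed
  then show "\<exists>T. Lp_op p T \<and> (\<forall>i<k. up_norm p U (\<lambda>n t. T (xs i n) t - pair (xs i) h * y n t) \<le> e)"
    using T(1) by blast
qed

lemma up_dist_triangle:
  assumes "conj_exp p q" "x \<in> up_space p" "y \<in> up_space p" "z \<in> up_space p"
  shows "up_norm p U (\<lambda>n t. x n t - z n t) \<le> up_norm p U (\<lambda>n t. x n t - y n t) + up_norm p U (\<lambda>n t. y n t - z n t)"
  using up_norm_triangle[OF assms(1) up_space_diff[OF assms(1,2,3)] up_space_diff[OF assms(1,3,4)]] by simp

section \<open>Operators on \<open>Lp\<close> and their ultrapowers\<close>

lemma Lp_op_up_norm_diff:
  assumes pq: "conj_exp p q" and T: "Lp_op p T"
  obtains C where "C > 0" "\<And>x y. x \<in> up_space p \<Longrightarrow> y \<in> up_space p \<Longrightarrow>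
    up_norm p U (\<lambda>n t. T (x n) t - T (y n) t) \<le> C * up_norm p U (\<lambda>n t. x n t - y n t)"
proof -
  obtain C where C: "C > 0" "\<And>f. f \<in> Lp p \<Longrightarrow> Lp_norm p (T f) \<le> C * Lp_norm p f" using Lp_op_bound[OF T] by metis
  show ?thesis
  proof (rule that[OF C(1)])
    fix x y assume xy: "x \<in> up_space p" "y \<in> up_space p"
    note d = up_space_diff[OF pq xy]
    show "up_norm p U (\<lambda>n t. T (x n) t - T (y n) t) \<le> C * up_norm p U (\<lambda>n t. x n t - y n t)"
    proof (rule tendsto_le[OF U_ne_bot])
      show "((\<lambda>n. C * Lp_norm p (\<lambda>t. x n t - y n t)) \<longlongrightarrow> C * up_norm p U (\<lambda>n t. x n t - y n t)) U"
        by (intro tendsto_mult tendsto_const up_norm_tendsto d)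
      show "((\<lambda>n. Lp_norm p (\<lambda>t. T (x n) t - T (y n) t)) \<longlongrightarrow> up_norm p U (\<lambda>n t. T (x n) t - T (y n) t)) U"
        by (intro up_norm_tendsto up_space_diff[OF pq] Lp_op_up_space[OF T] xy)
      show "\<forall>\<^sub>F n in U. Lp_norm p (\<lambda>t. T (x n) t - T (y n) t) \<le> C * Lp_norm p (\<lambda>t. x n t - y n t)"
        using Lp_op_diff[OF pq T up_spaceD[OF xy(1)] up_spaceD[OF xy(2)]] C(2)[OF up_spaceD[OF d]] by simp
    qed
  qed
qed

lemma Lp_op_growth:
  assumes pq: "conj_exp p q" and T: "Lp_op p T" and y: "\<And>n. y n \<in> Lp p" and g: "growth p r y b"
  shows "growth p r (\<lambda>n. T (y n)) b"
proof -
  note c = conj_expD[OF pq]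
  obtain C where C: "C > 0" "\<And>f. f \<in> Lp p \<Longrightarrow> Lp_norm p (T f) \<le> C * Lp_norm p f" using Lp_op_bound[OF T] by metis
  obtain D where D: "D \<ge> 0" "\<And>N. Lp_norm p (\<lambda>t. \<Sum>i<N. y (b i) t) \<le> D * real N powr r"
    using g by (auto simp: growth_def)
  have "Lp_norm p (\<lambda>t. \<Sum>i<N. T (y (b i)) t) \<le> C * D * real N powr r" for N
  proof -
    have s: "(\<lambda>t. \<Sum>i<N. y (b i) t) \<in> Lp p" by (intro Lp_sum y) (use c in simp)
    have "Lp_norm p (\<lambda>t. \<Sum>i<N. T (y (b i)) t) = Lp_norm p (T (\<lambda>t. \<Sum>i<N. y (b i) t))"
      by (rule sym, rule Lp_norm_eq_of_diff_null[OF pq Lp_opD[OF T s] _ Lp_op_sum[OF pq T, of "\<lambda>i. y (b i)"]])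
         (intro Lp_sum y Lp_opD[OF T]; use y c in simp)+
    also have "\<dots> \<le> C * Lp_norm p (\<lambda>t. \<Sum>i<N. y (b i) t)" by (rule C(2)[OF s])
    also have "\<dots> \<le> C * (D * real N powr r)" using C D by (intro mult_left_mono) auto
    finally show ?thesis by simp
  qed
  then show ?thesis unfolding growth_def using C(1) D(1) by (intro exI[of _ "C * D"]) auto
qed

text \<open>For a functional \<open>psi\<close> the composition with \<open>T\<close> is again a
  functional, so describing weak nullity by abstract functionals does the work of an adjoint
  operator.\<close>

lemma Lp_op_wnull:
  assumes pq: "conj_exp p q" and T: "Lp_op p T" and x: "wnull p U x"
  shows "wnull p U (\<lambda>n. T (x n))"
proof -
  note c = conj_expD[OF pq]
  have xh: "x \<in> up_hat p U" using x up_hat_eq[OF pq] by simp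
  have "((\<lambda>n. psi (T (x n))) \<longlongrightarrow> 0) U" if psi: "Lp_functional p psi" for psi
  proof -
    obtain D where D: "D > 0" "\<And>f. f \<in> Lp p \<Longrightarrow> Lp_norm p (T f) \<le> D * Lp_norm p f" using Lp_op_bound[OF T] by metis
    obtain C where C: "C > 0" "\<And>f. f \<in> Lp p \<Longrightarrow> \<bar>psi f\<bar> \<le> C * Lp_norm p f" using functional_bound[OF psi] by metis
    have eq: "psi u = psi v" if "u \<in> Lp p" "v \<in> Lp p" "Lp_norm p (\<lambda>t. u t - v t) = 0" for u v
    proof -
      have "\<bar>psi (\<lambda>t. u t - v t)\<bar> \<le> C * Lp_norm p (\<lambda>t. u t - v t)" by (rule C(2), intro Lp_diff that) (use c(1) in simp)
      then show ?thesis using functional_diff[OF psi that(1,2)] that(3) c(1) by simp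
    qed
    have "Lp_functional p (\<lambda>f. psi (T f))"
      unfolding Lp_functional_def
    proof (intro conjI ballI allI)
      fix f g assume fg: "f \<in> Lp p" "g \<in> Lp p"
      have "psi (T (vadd f g)) = psi (vadd (T f) (T g))"
        unfolding vadd_def
        by (rule eq[OF _ _ Lp_op_add[OF T fg]]; intro Lp_add Lp_opD[OF T] fg; use c(1) in simp)
      also have "\<dots> = psi (T f) + psi (T g)" using psi Lp_opD[OF T] fg unfolding Lp_functional_def by blast
      finally show "psi (T (vadd f g)) = psi (T f) + psi (T g)" .
    next
      fix f k assume f: "f \<in> Lp p"
      have "psi (T (vscale k f)) = psi (vscale k (T f))"
        unfolding vscale_def by (rule eq[OF _ _ Lp_op_scale[OF T f]]; intro Lp_scale Lp_opD[OF T] f)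
      also have "\<dots> = k * psi (T f)" using psi Lp_opD[OF T] f unfolding Lp_functional_def by blast
      finally show "psi (T (vscale k f)) = k * psi (T f)" .
    next
      have "\<bar>psi (T f)\<bar> \<le> (C * D) * Lp_norm p f" if f: "f \<in> Lp p" for f
      proof -
        have "\<bar>psi (T f)\<bar> \<le> C * Lp_norm p (T f)" by (rule C(2)[OF Lp_opD[OF T f]])
        also have "\<dots> \<le> C * (D * Lp_norm p f)" using C(1) D(2)[OF f] by (intro mult_left_mono) auto
        finally show ?thesis by simp
      qed
      then show "\<exists>C. \<forall>f\<in>Lp p. \<bar>psi (T f)\<bar> \<le> C * Lp_norm p f" by blast
    qed
    then show ?thesis using xh unfolding up_hat_def by blast
  qed
  then have "(\<lambda>n. T (x n)) \<in> up_hat p U"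
    using Lp_op_up_space[OF T wnullD[OF x]] by (simp add: up_hat_def)
  then show ?thesis using up_hat_eq[OF pq] by simp
qed

section \<open>Closure properties of approximable maps\<close>

lemma approximable_zero: "approximable p (\<lambda>x n t. 0)"
  unfolding approximable_def
proof (intro allI impI exI conjI)
  show "Lp_op p (\<lambda>f t. 0)" by (auto simp: Lp_op_def vsub_def vadd_def vscale_def intro!: exI[of _ 0])
qed auto

lemma approximable_add:
  assumes pq: "conj_exp p q" and R: "approximable p R" "approximable p R'"
    and Rs: "\<And>x. x \<in> up_space p \<Longrightarrow> R x \<in> up_space p" "\<And>x. x \<in> up_space p \<Longrightarrow> R' x \<in> up_space p"
  shows "approximable p (\<lambda>x n t. R x n t + R' x n t)"
  unfolding approximable_def
proof (intro allI impI)
  fix k :: nat and xs :: "nat \<Rightarrow> nat \<Rightarrow> real \<Rightarrow> real" and e :: real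
  assume e: "e > 0" and xs: "\<forall>i<k. xs i \<in> up_space p"
  then have e2: "e / 2 > 0" by simp
  obtain T where T: "Lp_op p T" "\<And>i. i < k \<Longrightarrow> up_norm p U (\<lambda>n t. T (xs i n) t - R (xs i) n t) \<le> e / 2"
    using R(1)[unfolded approximable_def, rule_format, OF e2, of k xs] xs by auto
  obtain T' where T': "Lp_op p T'" "\<And>i. i < k \<Longrightarrow> up_norm p U (\<lambda>n t. T' (xs i n) t - R' (xs i) n t) \<le> e / 2"
    using R(2)[unfolded approximable_def, rule_format, OF e2, of k xs] xs by auto
  have "up_norm p U (\<lambda>n t. (T (xs i n) t + T' (xs i n) t) - (R (xs i) n t + R' (xs i) n t)) \<le> e" if i: "i < k" for i
  proof -
    have x: "xs i \<in> up_space p" using xs i by simp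
    note d = up_space_diff[OF pq Lp_op_up_space[OF T(1) x] Rs(1)[OF x]] up_space_diff[OF pq Lp_op_up_space[OF T'(1) x] Rs(2)[OF x]]
    show ?thesis using up_norm_triangle[OF pq d] T(2)[OF i] T'(2)[OF i] by (simp add: algebra_simps)
  qed
  then show "\<exists>T. Lp_op p T \<and> (\<forall>i<k. up_norm p U (\<lambda>n t. T (xs i n) t - (R (xs i) n t + R' (xs i) n t)) \<le> e)"
    using Lp_op_sum_op[OF pq T(1) T'(1)] by (intro exI[of _ "\<lambda>f t. T f t + T' f t"]) auto
qed

text \<open>Upper estimates are at hand for bounded \<open>y\<close>; this carries approximability
  over to norm limits, in particular to all of \<open>WEqui p\<close>.\<close>

lemma rank_one_approximable_limit:
  assumes pq: "conj_exp p q" and y: "y \<in> up_space p" and h: "h \<in> up_space q"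
    and ap: "\<And>e. e > 0 \<Longrightarrow> \<exists>y'\<in>up_space p. up_norm p U (\<lambda>n t. y n t - y' n t) < e \<and> approximable p (\<lambda>x n t. pair x h * y' n t)"
  shows "approximable p (\<lambda>x n t. pair x h * y n t)"
  unfolding approximable_def
proof (intro allI impI)
  fix k :: nat and xs :: "nat \<Rightarrow> nat \<Rightarrow> real \<Rightarrow> real" and e :: real
  assume e: "e > 0" and xs: "\<forall>i<k. xs i \<in> up_space p"
  note c = conj_expD[OF pq]
  define K where "K = 1 + (\<Sum>i<k. \<bar>pair (xs i) h\<bar>)"
  have K: "K > 0" unfolding K_def by (rule add_pos_nonneg) (simp_all add: sum_nonneg)
  have Ki: "\<bar>pair (xs i) h\<bar> \<le> K" if "i < k" for i
  proof -
    have "\<bar>pair (xs i) h\<bar> \<le> (\<Sum>i<k. \<bar>pair (xs i) h\<bar>)" by (rule member_le_sum) (use that in auto)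
    then show ?thesis by (simp add: K_def)
  qed
  have e2: "e / 2 > 0" using e by simp
  obtain y' where y': "y' \<in> up_space p" "up_norm p U (\<lambda>n t. y n t - y' n t) < e / (2 * K)" "approximable p (\<lambda>x n t. pair x h * y' n t)"
    using ap[of "e / (2 * K)"] e K by auto
  obtain T where T: "Lp_op p T" "\<And>i. i < k \<Longrightarrow> up_norm p U (\<lambda>n t. T (xs i n) t - pair (xs i) h * y' n t) \<le> e / 2"
    using y'(3)[unfolded approximable_def, rule_format, OF e2, of k xs] xs by auto
  have "up_norm p U (\<lambda>n t. T (xs i n) t - pair (xs i) h * y n t) \<le> e" if i: "i < k" for i
  proof -
    have x: "xs i \<in> up_space p" using xs i by simp
    have s: "(\<lambda>n t. pair (xs i) h * y n t) \<in> up_space p" "(\<lambda>n t. pair (xs i) h * y' n t) \<in> up_space p"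
      using up_space_scale[OF _ y] up_space_scale[OF _ y'(1)] c by auto
    have "up_norm p U (\<lambda>n t. pair (xs i) h * y' n t - pair (xs i) h * y n t) = \<bar>pair (xs i) h\<bar> * up_norm p U (\<lambda>n t. y' n t - y n t)"
      using up_norm_scale[OF _ up_space_diff[OF pq y'(1) y], of "pair (xs i) h"] c by (simp add: right_diff_distrib)
    also have "\<dots> \<le> K * (e / (2 * K))"
      using y'(2) Ki[OF i] K up_norm_nonneg[OF up_space_diff[OF pq y'(1) y]]
      by (intro mult_mono) (auto simp: up_norm_minus_commute[of p y'])
    also have "\<dots> = e / 2" using K by simp
    finally show ?thesis using up_dist_triangle[OF pq Lp_op_up_space[OF T(1) x] s(2,1)] T(2)[OF i] by linarith
  qed
  then show "\<exists>T. Lp_op p T \<and> (\<forall>i<k. up_norm p U (\<lambda>n t. T (xs i n) t - pair (xs i) h * y n t) \<le> e)"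
    using T(1) by blast
qed

text \<open>Up to a null class this map is itself the ultrapower of the rank-one operator that sends
  \<open>u\<close> to the integral of \<open>u * g\<close> times \<open>f\<close>.\<close>

lemma rank_one_const_approximable:
  assumes pq: "conj_exp p q" and g: "g \<in> Lp q" and y: "y \<in> up_const p U"
  shows "approximable p (\<lambda>x n t. pair x (\<lambda>n. g) * y n t)"
  unfolding approximable_def
proof (intro allI impI)
  fix k :: nat and xs :: "nat \<Rightarrow> nat \<Rightarrow> real \<Rightarrow> real" and e :: real
  assume e: "e > 0" and xs: "\<forall>i<k. xs i \<in> up_space p"
  note c = conj_expD[OF pq]
  obtain f where f: "f \<in> Lp p" "up_norm p U (\<lambda>n t. y n t - f t) = 0" and ys: "y \<in> up_space p"
    using y by (auto simp: up_const_def usub_def vsub_def)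
  note fs = up_space_const[OF f(1)]
  define T where "T = (\<lambda>u t. (\<integral>s. u s * g s \<partial>mu) * f t)"
  have "Lp_op p T"
    unfolding Lp_op_def
  proof (intro conjI ballI allI)
    fix u assume "u \<in> Lp p" show "T u \<in> Lp p" unfolding T_def using f by auto
  next
    fix u v assume "u \<in> Lp p" "v \<in> Lp p"
    then have "(\<integral>s. vadd u v s * g s \<partial>mu) = (\<integral>s. u s * g s \<partial>mu) + (\<integral>s. v s * g s \<partial>mu)"
      using Lp_mult_integrable[OF pq _ g, of u] Lp_mult_integrable[OF pq _ g, of v] by (simp add: vadd_def distrib_right)
    then have "vsub (T (vadd u v)) (vadd (T u) (T v)) = (\<lambda>t. 0)" by (simp add: T_def vsub_def vadd_def algebra_simps)
    then show "Lp_norm p (vsub (T (vadd u v)) (vadd (T u) (T v))) = 0" by simp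
  next
    fix u k assume "u \<in> Lp p"
    have "vsub (T (vscale k u)) (vscale k (T u)) = (\<lambda>t. 0)" by (simp add: T_def vsub_def vscale_def mult.assoc)
    then show "Lp_norm p (vsub (T (vscale k u)) (vscale k (T u))) = 0" by simp
  next
    have "Lp_norm p (T u) \<le> (Lp_norm q g * Lp_norm p f) * Lp_norm p u" if u: "u \<in> Lp p" for u
    proof -
      have "Lp_norm p (T u) = \<bar>\<integral>s. u s * g s \<partial>mu\<bar> * Lp_norm p f" unfolding T_def using Lp_norm_scale[of p] c by simp
      also have "\<dots> \<le> (Lp_norm p u * Lp_norm q g) * Lp_norm p f" by (intro mult_right_mono Holder[OF pq u g]) simp
      finally show ?thesis by (simp add: mult_ac)
    qed
    then show "\<exists>C. \<forall>f\<in>Lp p. Lp_norm p (T f) \<le> C * Lp_norm p f" by blast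
  qed
  moreover have "up_norm p U (\<lambda>n t. T (xs i n) t - pair (xs i) (\<lambda>n. g) * y n t) \<le> e" if i: "i < k" for i
  proof -
    have x: "xs i \<in> up_space p" using xs i by simp
    let ?P = "pair (xs i) (\<lambda>n. g)"
    have s: "(\<lambda>n t. ?P * y n t) \<in> up_space p" "(\<lambda>n t. ?P * f t) \<in> up_space p"
      using up_space_scale[OF _ ys] up_space_scale[OF _ fs] c by auto
    note Ts = Lp_op_up_space[OF \<open>Lp_op p T\<close> x]
    have "((\<lambda>n. \<bar>(\<integral>s. xs i n s * g s \<partial>mu) - ?P\<bar> * Lp_norm p f) \<longlongrightarrow> 0 * Lp_norm p f) U"
      using pair_tendsto[OF pq x up_space_const[OF g]] by (intro tendsto_mult tendsto_const tendsto_rabs_zero) (simp add: LIM_zero_iff)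
    moreover have "Lp_norm p (\<lambda>t. T (xs i n) t - ?P * f t) = \<bar>(\<integral>s. xs i n s * g s \<partial>mu) - ?P\<bar> * Lp_norm p f" for n
      unfolding T_def using Lp_norm_scale[of p "(\<integral>s. xs i n s * g s \<partial>mu) - ?P" f] c by (simp add: left_diff_distrib)
    ultimately have 1: "up_norm p U (\<lambda>n t. T (xs i n) t - ?P * f t) = 0"
      using up_norm_eq_0_iff[OF up_space_diff[OF pq Ts s(2)]] by simp
    have "up_norm p U (\<lambda>n t. ?P * f t - ?P * y n t) = \<bar>?P\<bar> * up_norm p U (\<lambda>n t. f t - y n t)"
      using up_norm_scale[OF _ up_space_diff[OF pq fs ys], of ?P] c by (simp add: right_diff_distrib)
    also have "\<dots> = 0" using f(2) up_norm_minus_commute[of p y "\<lambda>n. f"] by simp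
    finally show ?thesis using up_dist_triangle[OF pq Ts s(2,1)] 1 e by linarith
  qed
  ultimately show "\<exists>T. Lp_op p T \<and> (\<forall>i<k. up_norm p U (\<lambda>n t. T (xs i n) t - pair (xs i) (\<lambda>n. g) * y n t) \<le> e)" by blast
qed

section \<open>Finite-rank combinations\<close>

text \<open>A finite sum of rank-one maps; each entry holds the functional first and the vector
  second. As a list it can be extended, concatenated and mapped entrywise under an operator.\<close>

definition finite_rank :: "((nat \<Rightarrow> real \<Rightarrow> real) \<times> (nat \<Rightarrow> real \<Rightarrow> real)) list \<Rightarrow> (nat \<Rightarrow> real \<Rightarrow> real) \<Rightarrow> nat \<Rightarrow> real \<Rightarrow> real" where
  "finite_rank L x = (\<lambda>n t. \<Sum>(h, z)\<leftarrow>L. pair x h * z n t)"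

lemma finite_rank_Nil [simp]: "finite_rank [] x = (\<lambda>n t. 0)"
  by (simp add: finite_rank_def)

lemma finite_rank_Cons: "finite_rank ((h, z) # L) x = (\<lambda>n t. pair x h * z n t + finite_rank L x n t)"
  by (simp add: finite_rank_def)

lemma finite_rank_append: "finite_rank (L @ L') x = (\<lambda>n t. finite_rank L x n t + finite_rank L' x n t)"
  by (simp add: finite_rank_def)

lemma finite_rank_in_subspace:
  assumes "\<And>x y. x \<in> V \<Longrightarrow> y \<in> V \<Longrightarrow> (\<lambda>n t. x n t + y n t) \<in> V" "\<And>x c. x \<in> V \<Longrightarrow> (\<lambda>n t. c * x n t) \<in> V"
    "(\<lambda>n t. 0) \<in> V" "set L \<subseteq> F \<times> V"
  shows "finite_rank L x \<in> V"
  using assms(4)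
proof (induction L)
  case Nil
  then show ?case using assms(3) by simp
next
  case (Cons a L)
  obtain h z where a: "a = (h, z)" by (cases a)
  have "(\<lambda>n t. pair x h * z n t) \<in> V" "finite_rank L x \<in> V" using Cons a assms(2)[of z "pair x h"] by auto
  from assms(1)[OF this] show ?case by (simp add: a finite_rank_Cons)
qed

lemma finite_rank_up_space:
  assumes "conj_exp p q" "set L \<subseteq> F \<times> up_space p"
  shows "finite_rank L x \<in> up_space p"
  by (rule finite_rank_in_subspace[OF _ _ _ assms(2)])
     (use up_space_add[OF assms(1)] up_space_scale[of p] conj_expD(1)[OF assms(1)] up_space_const[OF Lp_zero] in auto)

lemma finite_rank_cong:
  assumes "\<And>h z. (h, z) \<in> set L \<Longrightarrow> pair x h = pair x' h"
  shows "finite_rank L x = finite_rank L x'"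
proof -
  have "map (\<lambda>(h, z). pair x h * z n t) L = map (\<lambda>(h, z). pair x' h * z n t) L" for n t
    using assms by (intro map_cong) auto
  then show ?thesis unfolding finite_rank_def by (simp only:)
qed

text \<open>A Gram--Schmidt process: if \<open>x'\<close> is what the current combination \<open>L\<close> misses of a new vector, then
  adding the pair \<open>(h', x')\<close>, where \<open>h'\<close> vanishes on the vectors of \<open>L\<close>, repairs it without
  disturbing the vectors reproduced so far.\<close>
lemma gram_schmidt:
  assumes pq: "conj_exp p q" and V: "V \<subseteq> up_space p" and F: "F \<subseteq> up_space q"
    and Vadd: "\<And>x y. x \<in> V \<Longrightarrow> y \<in> V \<Longrightarrow> (\<lambda>n t. x n t + y n t) \<in> V" and Vscale: "\<And>x c. x \<in> V \<Longrightarrow> (\<lambda>n t. c * x n t) \<in> V"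
    and V0: "(\<lambda>n t. 0) \<in> V"
    and Fadd: "\<And>x y. x \<in> F \<Longrightarrow> y \<in> F \<Longrightarrow> (\<lambda>n t. x n t + y n t) \<in> F" and Fscale: "\<And>x c. x \<in> F \<Longrightarrow> (\<lambda>n t. c * x n t) \<in> F"
    and F0: "(\<lambda>n t. 0) \<in> F"
    and sep: "\<And>x. x \<in> V \<Longrightarrow> (\<And>h. h \<in> F \<Longrightarrow> pair x h = 0) \<Longrightarrow> up_norm p U x = 0"
    and xs: "\<And>i. i < (k::nat) \<Longrightarrow> xs i \<in> V"
  shows "\<exists>L. set L \<subseteq> F \<times> V \<and> (\<forall>i<k. up_norm p U (\<lambda>n t. xs i n t - finite_rank L (xs i) n t) = 0)"
  using xs
proof (induction k)
  case 0
  then show ?case by (intro exI[of _ "[]"]) auto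
next
  case (Suc k)
  note c = conj_expD[OF pq] and qp = conj_exp_sym[OF pq]
  obtain L where L: "set L \<subseteq> F \<times> V" "\<And>i. i < k \<Longrightarrow> up_norm p U (\<lambda>n t. xs i n t - finite_rank L (xs i) n t) = 0"
    using Suc by auto
  have rV: "finite_rank L x \<in> V" for x by (rule finite_rank_in_subspace[OF Vadd Vscale V0 L(1)])
  define x' where "x' = (\<lambda>n t. xs k n t - finite_rank L (xs k) n t)"
  have xk: "xs k \<in> V" using Suc.prems by simp
  have x'V: "x' \<in> V" using Vadd[OF xk Vscale[OF rV[of "xs k"], of "-1"]] by (simp add: x'_def)
  show ?case
  proof (cases "up_norm p U x' = 0")
    case True
    then show ?thesis using L by (intro exI[of _ L]) (auto simp: less_Suc_eq x'_def)
  next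
    case False
    then obtain h0 where h0: "h0 \<in> F" "pair x' h0 \<noteq> 0" using sep[OF x'V] by blast
    define h where "h = (\<lambda>n t. (1 / pair x' h0) * h0 n t)"
    have hF: "h \<in> F" unfolding h_def by (rule Fscale[OF h0(1)])
    have x's: "x' \<in> up_space p" and hs: "h \<in> up_space q" using x'V hF V F by auto
    have h1: "pair x' h = 1"
      using pair_scale_left[OF qp subsetD[OF F h0(1)] x's, of "1 / pair x' h0"] h0(2)
      by (simp add: h_def pair_commute[of x'])
    \<comment> \<open>\<open>h'\<close> is \<open>h\<close> composed with the identity minus
      \<open>finite_rank M\<close>. It stays in \<open>F\<close>, being a combination of
      \<open>h\<close> and the functionals listed in \<open>M\<close>.\<close>
    have ex: "\<exists>h'\<in>F. \<forall>x\<in>up_space p. pair x h' = pair x h - pair (finite_rank M x) h" if "set M \<subseteq> F \<times> V" for M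
      using that
    proof (induction M)
      case Nil
      have "pair (\<lambda>n t. 0) h = 0" by (rule pair_eqI) simp
      then show ?case using hF by auto
    next
      case (Cons a M)
      obtain g z where a: "a = (g, z)" by (cases a)
      have gz: "g \<in> F" "z \<in> V" using Cons.prems a by auto
      obtain h' where h': "h' \<in> F" "\<And>x. x \<in> up_space p \<Longrightarrow> pair x h' = pair x h - pair (finite_rank M x) h" using Cons by auto
      note gs = subsetD[OF F gz(1)] and zs = subsetD[OF V gz(2)] and h's = subsetD[OF F h'(1)]
      let ?h = "\<lambda>n t. h' n t + (- pair z h) * g n t"
      have "pair x ?h = pair x h - pair (finite_rank (a # M) x) h" if x: "x \<in> up_space p" for x
      proof -
        have "pair x ?h = pair x h' + (- pair z h) * pair x g"
          using pair_add_left[OF qp h's up_space_scale[OF _ gs, of "- pair z h"] x]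
            pair_scale_left[OF qp gs x, of "- pair z h"] c by (simp add: pair_commute[of x])
        moreover have "finite_rank M x \<in> up_space p"
          by (rule finite_rank_up_space[OF pq, of _ F]) (use Cons.prems V in auto)
        then have "pair (finite_rank (a # M) x) h = pair x g * pair z h + pair (finite_rank M x) h"
          unfolding a finite_rank_Cons
          using pair_add_left[OF pq up_space_scale[OF _ zs, of "pair x g"] _ hs, of "finite_rank M x"]
            pair_scale_left[OF pq zs hs, of "pair x g"] c by simp
        ultimately show ?thesis using h'(2)[OF x] by (simp add: mult.commute)
      qed
      moreover have "?h \<in> F" by (rule Fadd[OF h'(1) Fscale[OF gz(1)]])
      ultimately show ?case by (intro bexI[of _ ?h]) auto
    qed
    obtain h' where h': "h' \<in> F" "\<And>x. x \<in> up_space p \<Longrightarrow> pair x h' = pair x h - pair (finite_rank L x) h" using ex[OF L(1)] by auto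
    have rs: "finite_rank L x \<in> up_space p" for x using rV V by auto
    have pd: "pair (xs i) h' = pair (\<lambda>n t. xs i n t - finite_rank L (xs i) n t) h" if "i < Suc k" for i
    proof -
      have x: "xs i \<in> up_space p" using Suc.prems[OF that] V by auto
      show ?thesis using h'(2)[OF x] pair_diff_left[OF pq x rs hs, of "xs i"] by simp
    qed
    show ?thesis
    proof (intro exI[of _ "(h', x') # L"] conjI allI impI)
      show "set ((h', x') # L) \<subseteq> F \<times> V" using L(1) h'(1) x'V by auto
      fix i assume i: "i < Suc k"
      have x: "xs i \<in> up_space p" using Suc.prems[OF i] V by auto
      show "up_norm p U (\<lambda>n t. xs i n t - finite_rank ((h', x') # L) (xs i) n t) = 0"
      proof (cases "i < k")
        case True
        have "pair (xs i) h' = 0" unfolding pd[OF i] by (rule pair_null[OF pq up_space_diff[OF pq x rs] hs L(2)[OF True]])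
        then show ?thesis using L(2)[OF True] by (simp add: finite_rank_Cons)
      next
        case False
        then have ik: "i = k" using i by simp
        have "pair (xs k) h' = 1" using pd[of k] h1 by (simp add: x'_def)
        then have "(\<lambda>n t. xs i n t - finite_rank ((h', x') # L) (xs i) n t) = (\<lambda>n t. 0)" by (simp add: finite_rank_Cons ik x'_def)
        then show ?thesis by simp
      qed
    qed
  qed
qed

section \<open>Operators on the ultrapower\<close>

lemma up_opD: "up_op p U S \<Longrightarrow> x \<in> up_space p \<Longrightarrow> S x \<in> up_space p"
  by (simp add: up_op_def)

lemma up_op_add:
  assumes "up_op p U S" "x \<in> up_space p" "y \<in> up_space p"
  shows "up_norm p U (\<lambda>n t. S (\<lambda>n t. x n t + y n t) n t - (S x n t + S y n t)) = 0"
proof -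
  have "up_norm p U (usub (S (uadd x y)) (uadd (S x) (S y))) = 0" using assms unfolding up_op_def by blast
  then show ?thesis by (simp add: usub_def uadd_def vsub_def vadd_def)
qed

lemma up_op_scale:
  assumes "up_op p U S" "x \<in> up_space p"
  shows "up_norm p U (\<lambda>n t. S (\<lambda>n t. c * x n t) n t - c * S x n t) = 0"
proof -
  have "up_norm p U (usub (S (uscale c x)) (uscale c (S x))) = 0" using assms unfolding up_op_def by blast
  then show ?thesis by (simp add: usub_def uscale_def vsub_def vscale_def)
qed

lemma up_op_null_diff:
  assumes pq: "conj_exp p q" and S: "up_op p U S" and x: "x \<in> up_space p" "y \<in> up_space p"
    and n: "up_norm p U (\<lambda>n t. x n t - y n t) = 0"
  shows "up_norm p U (\<lambda>n t. S x n t - S y n t) = 0"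
proof -
  note d = up_space_diff[OF pq x]
  let ?d = "\<lambda>n t. x n t - y n t"
  obtain C where C: "\<And>x. x \<in> up_space p \<Longrightarrow> up_norm p U (S x) \<le> C * up_norm p U x" using S unfolding up_op_def by blast
  have 1: "up_norm p U (\<lambda>n t. S x n t - (S ?d n t + S y n t)) = 0" using up_op_add[OF S d x(2)] by simp
  have 2: "up_norm p U (S ?d) \<le> 0" using C[OF d] n by simp
  note s = up_opD[OF S x(1)] up_opD[OF S x(2)] up_opD[OF S d]
  have "up_norm p U (\<lambda>n t. (S x n t - (S ?d n t + S y n t)) + S ?d n t) \<le> 0"
    using up_norm_triangle[OF pq up_space_diff[OF pq s(1) up_space_add[OF pq s(3) s(2)]] s(3)] 1 2 by simp
  then show ?thesis using up_norm_nonneg[OF up_space_diff[OF pq s(1,2)]] by (simp add: algebra_simps)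
qed

lemma up_op_finite_rank:
  assumes pq: "conj_exp p q" and S: "up_op p U S" and L: "set L \<subseteq> F \<times> up_space p"
  shows "up_norm p U (\<lambda>n t. S (finite_rank L x) n t - finite_rank (map (\<lambda>(h, z). (h, S z)) L) x n t) = 0"
  using L
proof (induction L)
  case Nil
  have "up_norm p U (\<lambda>n t. S (\<lambda>n t. 0) n t - 0 * S (\<lambda>n t. 0) n t) = 0"
    using up_op_scale[OF S up_space_const[OF Lp_zero], of 0] by simp
  then show ?case by simp
next
  case (Cons a L)
  note c = conj_expD[OF pq]
  obtain h z where a: "a = (h, z)" by (cases a)
  have z: "z \<in> up_space p" and L: "set L \<subseteq> F \<times> up_space p" using Cons.prems a by auto
  let ?r = "finite_rank L x" and ?m = "finite_rank (map (\<lambda>(h, z). (h, S z)) L) x" and ?p = "pair x h"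
  have r: "?r \<in> up_space p" by (rule finite_rank_up_space[OF pq L])
  have m: "?m \<in> up_space p" by (rule finite_rank_up_space[OF pq, of _ F]) (use L up_opD[OF S] in auto)
  have pz: "(\<lambda>n t. ?p * z n t) \<in> up_space p" using up_space_scale[OF _ z] c by simp
  have Sz: "(\<lambda>n t. ?p * S z n t) \<in> up_space p" using up_space_scale[OF _ up_opD[OF S z]] c by simp
  note Spz = up_opD[OF S pz] and Sr = up_opD[OF S r] and Ss = up_opD[OF S up_space_add[OF pq pz r]]
  have 1: "up_norm p U (\<lambda>n t. S (\<lambda>n t. ?p * z n t + ?r n t) n t - (S (\<lambda>n t. ?p * z n t) n t + S ?r n t)) = 0"
    by (rule up_op_add[OF S pz r])
  have 2: "up_norm p U (\<lambda>n t. S (\<lambda>n t. ?p * z n t) n t - ?p * S z n t) = 0" by (rule up_op_scale[OF S z])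
  have 3: "up_norm p U (\<lambda>n t. S ?r n t - ?m n t) = 0" by (rule Cons.IH[OF L])
  note d1 = up_space_diff[OF pq Ss up_space_add[OF pq Spz Sr]] and d2 = up_space_diff[OF pq Spz Sz] and d3 = up_space_diff[OF pq Sr m]
  have "up_norm p U (\<lambda>n t. (S (\<lambda>n t. ?p * z n t) n t - ?p * S z n t) + (S ?r n t - ?m n t)) \<le> 0"
    using up_norm_triangle[OF pq d2 d3] 2 3 by simp
  then have "up_norm p U (\<lambda>n t. (S (\<lambda>n t. ?p * z n t + ?r n t) n t - (S (\<lambda>n t. ?p * z n t) n t + S ?r n t)) +
      ((S (\<lambda>n t. ?p * z n t) n t - ?p * S z n t) + (S ?r n t - ?m n t))) \<le> 0"
    using up_norm_triangle[OF pq d1 up_space_add[OF pq d2 d3]] 1 by simp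
  then have "up_norm p U (\<lambda>n t. S (\<lambda>n t. ?p * z n t + ?r n t) n t - (?p * S z n t + ?m n t)) \<le> 0"
    by (simp add: algebra_simps)
  then show ?case
    using up_norm_nonneg[OF up_space_diff[OF pq Ss up_space_add[OF pq Sz m]]] by (simp add: a finite_rank_Cons)
qed

lemma rank_one_up_op:
  assumes pq: "conj_exp p q" and h: "h \<in> up_space q" and y: "y \<in> up_space p"
  shows "up_op p U (\<lambda>x n t. pair x h * y n t)"
  unfolding up_op_def
proof (intro conjI ballI allI)
  note c = conj_expD[OF pq]
  fix x assume x: "x \<in> up_space p"
  show "(\<lambda>n t. pair x h * y n t) \<in> up_space p" using up_space_scale[OF _ y] c by simp
next
  fix x x' assume x: "x \<in> up_space p" "x' \<in> up_space p"
  show "up_norm p U (usub (\<lambda>n t. pair (uadd x x') h * y n t) (uadd (\<lambda>n t. pair x h * y n t) (\<lambda>n t. pair x' h * y n t))) = 0"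
    using pair_add_left[OF pq x h] by (simp add: usub_def uadd_def vsub_def vadd_def algebra_simps)
next
  fix x k assume x: "x \<in> up_space p"
  show "up_norm p U (usub (\<lambda>n t. pair (uscale k x) h * y n t) (uscale k (\<lambda>n t. pair x h * y n t))) = 0"
    using pair_scale_left[OF pq x h, of k] by (simp add: usub_def uscale_def vsub_def vscale_def mult.assoc)
next
  note c = conj_expD[OF pq]
  have "up_norm p U (\<lambda>n t. pair x h * y n t) \<le> (up_norm q U h * up_norm p U y) * up_norm p U x" if x: "x \<in> up_space p" for x
  proof -
    have "up_norm p U (\<lambda>n t. pair x h * y n t) = \<bar>pair x h\<bar> * up_norm p U y" using up_norm_scale[OF _ y] c by simp
    also have "\<dots> \<le> (up_norm p U x * up_norm q U h) * up_norm p U y"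
      by (intro mult_right_mono pair_le[OF pq x h] up_norm_nonneg[OF y])
    finally show ?thesis by (simp add: mult_ac)
  qed
  then show "\<exists>C. \<forall>x\<in>up_space p. up_norm p U (\<lambda>n t. pair x h * y n t) \<le> C * up_norm p U x" by blast
qed

lemma pair_up_functional:
  assumes pq: "conj_exp p q" and h: "h \<in> up_space q"
  shows "up_functional p U (\<lambda>x. pair x h)"
  unfolding up_functional_def
proof (intro conjI ballI allI exI)
  fix x y assume "x \<in> up_space p" "y \<in> up_space p"
  then show "pair (uadd x y) h = pair x h + pair y h" using pair_add_left[OF pq _ _ h] by (simp add: uadd_def vadd_def)
next
  fix x c assume "x \<in> up_space p"
  then show "pair (uscale c x) h = c * pair x h" using pair_scale_left[OF pq _ h] by (simp add: uscale_def vscale_def)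
next
  fix x assume "x \<in> up_space p"
  then show "\<bar>pair x h\<bar> \<le> up_norm q U h * up_norm p U x" using pair_le[OF pq _ h] by (simp add: mult.commute)
qed

end

section \<open>The abstract characterization\<close>

text \<open>One argument serves \<open>p > 2\<close> and \<open>p < 2\<close>, where the two bands
  exchange roles. \<open>FM\<close> and \<open>FN\<close> are functionals that separate the points
  of \<open>M\<close> and \<open>N\<close> and vanish on the other band. The asymmetry lies in the
  approximation assumptions: a functional from \<open>FM\<close> is combined with vectors of
  \<open>M\<close>, one from \<open>FN\<close> with every weakly null vector, in accordance with
  \<open>operator_M\<close>.\<close>

locale band_decomposition = selective_ultrafilter +
  fixes p q :: real and M N FM FN :: "(nat \<Rightarrow> real \<Rightarrow> real) set"
  assumes pq: "conj_exp p q"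
    and closed_M: "up_closed_subspace p U M" and closed_N: "up_closed_subspace p U N"
    and M_wnull: "\<And>x. x \<in> M \<Longrightarrow> wnull p U x" and N_wnull: "\<And>x. x \<in> N \<Longrightarrow> wnull p U x"
    and split: "\<And>x. wnull p U x \<Longrightarrow> \<exists>m\<in>M. \<exists>n\<in>N. x = (\<lambda>i t. m i t + n i t)"
    and FM_wnull: "\<And>h. h \<in> FM \<Longrightarrow> wnull q U h" and FN_wnull: "\<And>h. h \<in> FN \<Longrightarrow> wnull q U h"
    and FM_add: "\<And>x y. x \<in> FM \<Longrightarrow> y \<in> FM \<Longrightarrow> (\<lambda>n t. x n t + y n t) \<in> FM"
    and FM_scale: "\<And>x c. x \<in> FM \<Longrightarrow> (\<lambda>n t. c * x n t) \<in> FM" and FM_zero: "(\<lambda>n t. 0) \<in> FM"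
    and FN_add: "\<And>x y. x \<in> FN \<Longrightarrow> y \<in> FN \<Longrightarrow> (\<lambda>n t. x n t + y n t) \<in> FN"
    and FN_scale: "\<And>x c. x \<in> FN \<Longrightarrow> (\<lambda>n t. c * x n t) \<in> FN" and FN_zero: "(\<lambda>n t. 0) \<in> FN"
    and pair_M_FN: "\<And>m h. m \<in> M \<Longrightarrow> h \<in> FN \<Longrightarrow> pair m h = 0"
    and pair_N_FM: "\<And>n h. n \<in> N \<Longrightarrow> h \<in> FM \<Longrightarrow> pair n h = 0"
    and sep_M: "\<And>m. m \<in> M \<Longrightarrow> (\<And>h. h \<in> FM \<Longrightarrow> pair m h = 0) \<Longrightarrow> up_norm p U m = 0"
    and sep_N: "\<And>n. n \<in> N \<Longrightarrow> (\<And>h. h \<in> FN \<Longrightarrow> pair n h = 0) \<Longrightarrow> up_norm p U n = 0"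
    and approx_M: "\<And>h y. h \<in> FM \<Longrightarrow> y \<in> M \<Longrightarrow> approximable p (\<lambda>x n t. pair x h * y n t)"
    and approx_N: "\<And>h y. h \<in> FN \<Longrightarrow> wnull p U y \<Longrightarrow> approximable p (\<lambda>x n t. pair x h * y n t)"
    and operator_M: "\<And>T m h. Lp_op p T \<Longrightarrow> m \<in> M \<Longrightarrow> h \<in> FN \<Longrightarrow> pair (up_lift T m) h = 0"
    and M_nontrivial: "\<exists>m\<in>M. up_norm p U m \<noteq> 0" and N_nontrivial: "\<exists>n\<in>N. up_norm p U n \<noteq> 0"
begin

lemmas qp = conj_exp_sym[OF pq]

lemma p_pos: "0 < p" using conj_expD(1)[OF pq] by simp

lemma closed_subspaceD:
  assumes "up_closed_subspace p U V"
  shows "x \<in> V \<Longrightarrow> x \<in> up_space p" "x \<in> V \<Longrightarrow> y \<in> V \<Longrightarrow> (\<lambda>n t. x n t + y n t) \<in> V"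
    "x \<in> V \<Longrightarrow> (\<lambda>n t. c * x n t) \<in> V" "(\<lambda>n t. 0) \<in> V"
    "x \<in> V \<Longrightarrow> y \<in> up_space p \<Longrightarrow> up_norm p U (\<lambda>n t. x n t - y n t) = 0 \<Longrightarrow> y \<in> V"
proof -
  show 1: "x \<in> V \<Longrightarrow> x \<in> up_space p" for x using assms by (auto simp: up_closed_subspace_def)
  show "x \<in> V \<Longrightarrow> y \<in> V \<Longrightarrow> (\<lambda>n t. x n t + y n t) \<in> V"
    using assms unfolding up_closed_subspace_def uadd_def vadd_def by blast
  show 3: "x \<in> V \<Longrightarrow> (\<lambda>n t. c * x n t) \<in> V" for x c
    using assms unfolding up_closed_subspace_def uscale_def vscale_def by blast
  obtain x0 where "x0 \<in> V" using assms unfolding up_closed_subspace_def by blast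
  from 3[OF this, of 0] show "(\<lambda>n t. 0) \<in> V" by simp
  assume xy: "x \<in> V" "y \<in> up_space p" "up_norm p U (\<lambda>n t. x n t - y n t) = 0"
  then have "\<forall>e>0. \<exists>x\<in>V. up_norm p U (usub x y) < e"
    by (intro allI impI bexI[of _ x]) (auto simp: usub_def vsub_def)
  then show "y \<in> V" using assms xy(2) unfolding up_closed_subspace_def by blast
qed

lemmas M_D = closed_subspaceD[OF closed_M] and N_D = closed_subspaceD[OF closed_N]

lemma hat_eq: "x \<in> up_hat p U \<longleftrightarrow> wnull p U x"
  using up_hat_eq[OF pq] by simp

lemma FM_space: "h \<in> FM \<Longrightarrow> h \<in> up_space q" and FN_space: "h \<in> FN \<Longrightarrow> h \<in> up_space q"
  using FM_wnull FN_wnull wnullD by blast+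

text \<open>Membership in \<open>M\<close> becomes the vanishing of functionals on a weakly null
  class, a form that survives limits in the weak operator topology. The component in
  \<open>N\<close> of such a class is null by \<open>sep_N\<close>.\<close>

lemma in_M_iff: "x \<in> M \<longleftrightarrow> wnull p U x \<and> (\<forall>h\<in>FN. pair x h = 0)"
proof
  assume "x \<in> M" then show "wnull p U x \<and> (\<forall>h\<in>FN. pair x h = 0)" using M_wnull pair_M_FN by blast
next
  assume x: "wnull p U x \<and> (\<forall>h\<in>FN. pair x h = 0)"
  then obtain m n where mn: "m \<in> M" "n \<in> N" "x = (\<lambda>i t. m i t + n i t)" using split by blast
  have "pair n h = 0" if h: "h \<in> FN" for h
    using pair_add_left[OF pq M_D(1)[OF mn(1)] N_D(1)[OF mn(2)] FN_space[OF h]] x h pair_M_FN[OF mn(1) h] mn(3) by simp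
  then have "up_norm p U n = 0" by (rule sep_N[OF mn(2)])
  moreover have "(\<lambda>i t. m i t - x i t) = (\<lambda>i t. (-1) * n i t)" using mn(3) by auto
  ultimately have "up_norm p U (\<lambda>i t. m i t - x i t) = 0"
    using up_norm_scale[OF p_pos N_D(1)[OF mn(2)], of "-1"] by simp
  then show "x \<in> M" using M_D(5)[OF mn(1)] wnullD x by blast
qed

lemma M_N_null:
  assumes "x \<in> M" "x \<in> N"
  shows "up_norm p U x = 0"
  using sep_N[OF assms(2)] pair_M_FN[OF assms(1)] by blast

lemma complemented_M: "up_complemented_in p U (up_hat p U) M"
  unfolding up_complemented_in_def
proof (intro conjI exI[of _ N] closed_M closed_N ballI)
  show "M \<subseteq> up_hat p U" "N \<subseteq> up_hat p U" using M_wnull N_wnull hat_eq by auto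
  show "up_norm p U x = 0" if "x \<in> M \<inter> N" for x using that M_N_null by auto
  show "\<exists>m\<in>M. \<exists>n\<in>N. y = uadd m n" if "y \<in> up_hat p U" for y
    using split[of y] that hat_eq by (simp add: uadd_def vadd_def)
qed

lemma const_iff: "x \<in> up_const p U \<longleftrightarrow> x \<in> up_space p \<and> (\<exists>f\<in>Lp p. up_norm p U (\<lambda>n t. x n t - f t) = 0)"
  by (simp add: up_const_def usub_def vsub_def)

lemma pair_const:
  assumes "x \<in> up_const p U" "wnull q U h"
  shows "pair x h = 0"
proof -
  obtain f where f: "f \<in> Lp p" "up_norm p U (\<lambda>n t. x n t - f t) = 0" and x: "x \<in> up_space p"
    using assms(1) by (auto simp: const_iff)
  note hs = wnullD[OF assms(2)]
  have "pair (\<lambda>n t. x n t - f t) h = 0"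
    by (rule pair_null[OF pq up_space_diff[OF pq x up_space_const[OF f(1)]] hs f(2)])
  then show ?thesis
    using pair_diff_left[OF pq x up_space_const[OF f(1)] hs] pair_const_wnull[OF pq f(1) assms(2)] by simp
qed

text \<open>After subtraction of the weak limit, \<open>FN\<close> forces the remainder into
  \<open>M\<close> and \<open>FM\<close> makes it null. So the constant classes, too, are cut out by
  functionals.\<close>

lemma in_const:
  assumes x: "x \<in> up_space p" and M: "\<And>h. h \<in> FM \<Longrightarrow> pair x h = 0" and N: "\<And>h. h \<in> FN \<Longrightarrow> pair x h = 0"
  shows "x \<in> up_const p U"
proof -
  obtain f where f: "f \<in> Lp p" "wnull p U (\<lambda>n t. x n t - f t)" by (rule weak_limit_exists[OF pq x])
  note fs = up_space_const[OF f(1)]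
  let ?y = "\<lambda>n t. x n t - f t"
  have "pair ?y h = pair x h" if "wnull q U h" for h
    using pair_diff_left[OF pq x fs wnullD[OF that]] pair_const_wnull[OF pq f(1) that] by simp
  then have y0: "pair ?y h = 0" if "h \<in> FM \<or> h \<in> FN" for h using that M N FM_wnull FN_wnull by auto
  then have "?y \<in> M" using in_M_iff f(2) by blast
  then have "up_norm p U ?y = 0" using sep_M y0 by blast
  then show ?thesis using f(1) x const_iff by blast
qed

section \<open>Operators in the closure respect the three subspaces\<close>

lemma closure_functional:
  assumes S: "S \<in> wot_closure p U {up_lift T | T. Lp_op p T}" and h: "h \<in> up_space q" and x: "x \<in> up_space p"
    and T: "\<And>T. Lp_op p T \<Longrightarrow> pair (\<lambda>n. T (x n)) h = 0"
  shows "pair (S x) h = 0"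
proof -
  have "\<bar>pair (S x) h\<bar> < e" if e: "e > 0" for e
  proof -
    have "\<exists>T\<in>{up_lift T | T. Lp_op p T}. \<forall>i<1::nat. \<bar>(\<lambda>z. pair z h) (S x) - (\<lambda>z. pair z h) (T x)\<bar> < e"
      using S[unfolded wot_closure_def, THEN CollectD, THEN conjunct2, rule_format, OF e, of 1 "\<lambda>_. x" "\<lambda>_ z. pair z h"]
        x pair_up_functional[OF pq h] by simp
    then obtain T where "Lp_op p T" "\<bar>pair (S x) h - pair (up_lift T x) h\<bar> < e" by auto
    then show ?thesis using T[of T] by (simp add: up_lift_def)
  qed
  then have "\<bar>pair (S x) h\<bar> \<le> 0" using field_le_epsilon[of "\<bar>pair (S x) h\<bar>" 0] by (simp add: less_imp_le)
  then show ?thesis by simp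
qed

text \<open>Each of the three subspaces is cut out by equations \<open>pair _ h = 0\<close> that
  ultrapowers of operators respect; one vector and one functional at a time pass them on to the
  closure.\<close>

lemma closure_imp_invariant:
  assumes S: "S \<in> wot_closure p U {up_lift T | T. Lp_op p T}"
  shows "invariant_under (up_const p U) S" "invariant_under (up_hat p U) S" "invariant_under M S"
proof -
  have op: "up_op p U S" using S by (simp add: wot_closure_def)
  show "invariant_under (up_const p U) S"
    unfolding invariant_under_def
  proof
    fix x assume x: "x \<in> up_const p U"
    then obtain f where f: "f \<in> Lp p" "up_norm p U (\<lambda>n t. x n t - f t) = 0" and xs: "x \<in> up_space p"
      by (auto simp: const_iff)
    have T0: "pair (\<lambda>n. T (x n)) h = 0" if T: "Lp_op p T" and h: "wnull q U h" for T h
    proof -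
      obtain C where C: "C > 0" "\<And>x y. x \<in> up_space p \<Longrightarrow> y \<in> up_space p \<Longrightarrow>
          up_norm p U (\<lambda>n t. T (x n) t - T (y n) t) \<le> C * up_norm p U (\<lambda>n t. x n t - y n t)"
        by (rule Lp_op_up_norm_diff[OF pq T]) blast
      have "up_norm p U (\<lambda>n t. T (x n) t - T f t) \<le> C * up_norm p U (\<lambda>n t. x n t - f t)"
        by (rule C(2)[OF xs up_space_const[OF f(1)]])
      moreover note Tx = Lp_op_up_space[OF T xs] and Tf = up_space_const[OF Lp_opD[OF T f(1)]]
      ultimately have "up_norm p U (\<lambda>n t. T (x n) t - T f t) = 0"
        using f(2) up_norm_nonneg[OF up_space_diff[OF pq Tx Tf]] by simp
      then have "(\<lambda>n. T (x n)) \<in> up_const p U" using Tx Lp_opD[OF T f(1)] const_iff by blast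
      then show ?thesis using h by (rule pair_const)
    qed
    show "S x \<in> up_const p U"
    proof (rule in_const[OF up_opD[OF op xs]])
      fix h assume "h \<in> FM"
      then show "pair (S x) h = 0" using T0 FM_wnull by (intro closure_functional[OF S FM_space xs]) auto
    next
      fix h assume "h \<in> FN"
      then show "pair (S x) h = 0" using T0 FN_wnull by (intro closure_functional[OF S FN_space xs]) auto
    qed
  qed
  show hat: "invariant_under (up_hat p U) S"
    unfolding invariant_under_def
  proof
    fix x assume "x \<in> up_hat p U"
    then have x: "wnull p U x" by (simp add: hat_eq)
    note xs = wnullD[OF x]
    have "wnull p U (S x)"
      unfolding wnull_def
    proof (intro conjI allI impI)
      show Sx: "S x \<in> up_space p" by (rule up_opD[OF op xs])
      fix g :: "real \<Rightarrow> real" and K assume g: "g \<in> borel_measurable mu" "\<forall>t. \<bar>g t\<bar> \<le> K"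
      have gq: "g \<in> Lp q" by (rule Lp_bounded[where K=K]) (use g conj_expD[OF pq] in auto)
      have "pair (S x) (\<lambda>n. g) = 0"
      proof (rule closure_functional[OF S up_space_const[OF gq] xs])
        fix T assume "Lp_op p T"
        from wnull_Lq[OF pq Lp_op_wnull[OF pq this x] gq] show "pair (\<lambda>n. T (x n)) (\<lambda>n. g) = 0" by (rule pair_eqI)
      qed
      then show "((\<lambda>n. \<integral>t. S x n t * g t \<partial>mu) \<longlongrightarrow> 0) U" using pair_tendsto[OF pq Sx up_space_const[OF gq]] by simp
    qed
    then show "S x \<in> up_hat p U" by (simp add: hat_eq)
  qed
  show "invariant_under M S"
    unfolding invariant_under_def
  proof
    fix x assume x: "x \<in> M"
    have "wnull p U (S x)" using hat x M_wnull by (simp add: invariant_under_def hat_eq)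
    moreover have "pair (S x) h = 0" if h: "h \<in> FN" for h
      by (rule closure_functional[OF S FN_space[OF h] M_D(1)[OF x]]) (use operator_M[OF _ x h] in \<open>simp add: up_lift_def\<close>)
    ultimately show "S x \<in> M" using in_M_iff by blast
  qed
qed

section \<open>Operators respecting the three subspaces lie in the closure\<close>

lemma const_approximation:
  assumes fs: "\<And>i. i < (k::nat) \<Longrightarrow> fs i \<in> Lp p"
  shows "\<exists>L. set L \<subseteq> {\<lambda>n. g | g. g \<in> Lp q} \<times> {\<lambda>n. f | f. f \<in> Lp p} \<and>
    (\<forall>i<k. up_norm p U (\<lambda>n t. fs i t - finite_rank L (\<lambda>n. fs i) n t) = 0)"
proof -
  note c = conj_expD[OF pq]
  let ?V = "{\<lambda>n::nat. f | f. f \<in> Lp p}" and ?F = "{\<lambda>n::nat. g | g. g \<in> Lp q}"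
  have add: "(\<lambda>(n::nat) t. x n t + y n t) \<in> {\<lambda>n. f | f. f \<in> Lp r}" if r: "1 < r" and xy: "x \<in> {\<lambda>n. f | f. f \<in> Lp r}" "y \<in> {\<lambda>n. f | f. f \<in> Lp r}" for x y r
  proof -
    obtain f g where fg: "x = (\<lambda>n. f)" "y = (\<lambda>n. g)" "f \<in> Lp r" "g \<in> Lp r" using xy by blast
    have "(\<lambda>t. f t + g t) \<in> Lp r" by (rule Lp_add[OF fg(3,4)]) (use r in simp)
    then show ?thesis using fg by auto
  qed
  have scale: "(\<lambda>(n::nat) t. a * x n t) \<in> {\<lambda>n. f | f. f \<in> Lp r}" if x: "x \<in> {\<lambda>n. f | f. f \<in> Lp r}" for x a r
  proof -
    obtain f where f: "x = (\<lambda>n. f)" "f \<in> Lp r" using x by blast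
    have "(\<lambda>t. a * f t) \<in> Lp r" by (rule Lp_scale[OF f(2)])
    then show ?thesis using f by auto
  qed
  have zero: "(\<lambda>(n::nat) t. 0) \<in> {\<lambda>n. f | f. f \<in> Lp r}" for r using Lp_zero by blast
  have sep: "up_norm p U x = 0" if x: "x \<in> ?V" "\<And>h. h \<in> ?F \<Longrightarrow> pair x h = 0" for x
  proof -
    obtain f where f: "x = (\<lambda>n. f)" "f \<in> Lp p" using x(1) by blast
    have J: "Jmap p f \<in> Lp q" by (rule Jmap_Lp[OF pq f(2)])
    then have "pair (\<lambda>n. f) (\<lambda>n. Jmap p f) = 0" using x(2)[of "\<lambda>n. Jmap p f"] f(1) by blast
    moreover have "pair (\<lambda>n. f) (\<lambda>n. Jmap p f) = (\<integral>t. f t * Jmap p f t \<partial>mu)" by (rule pair_eqI) simp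
    ultimately have "(\<integral>t. \<bar>f t\<bar> powr p \<partial>mu) = 0" by (simp add: Jmap_mult[OF c(1)])
    then have "Lp_norm p f = 0" by (simp add: Lp_norm_def)
    then show ?thesis using up_norm_eq_0_iff[OF up_space_const[OF f(2)]] f(1) by simp
  qed
  show ?thesis
    by (rule gram_schmidt[OF pq _ _ add[OF c(1)] scale zero add[OF c(2)] scale zero sep, where xs="\<lambda>i n. fs i"])
       (use up_space_const fs in auto)
qed

text \<open>On given vectors the identity agrees with a finite sum of rank-one maps, each with its
  functional and its vector attached to the same summand: constants, \<open>M\<close> or
  \<open>N\<close>. Applying \<open>S\<close> to the vectors gives a finite-rank map that agrees
  with \<open>S\<close> there, and invariance keeps every image where the rank-one map is
  approximable.\<close>

lemma invariant_imp_closure: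
  assumes op: "up_op p U S" and ic: "invariant_under (up_const p U) S" and ih: "invariant_under (up_hat p U) S" and iM: "invariant_under M S"
  shows "S \<in> wot_closure p U {up_lift T | T. Lp_op p T}"
proof -
  note c = conj_expD[OF pq]
  have approx: "\<exists>T. Lp_op p T \<and> (\<forall>i<k. up_norm p U (\<lambda>n t. T (xs i n) t - S (xs i) n t) \<le> e)"
    if xs: "\<And>i. i < k \<Longrightarrow> xs i \<in> up_space p" and e: "e > 0" for k :: nat and xs e
  proof -
    have "\<exists>f m n. f \<in> Lp p \<and> m \<in> M \<and> n \<in> N \<and> xs i = (\<lambda>j t. f t + (m j t + n j t))" if i: "i < k" for i
    proof -
      obtain f where f: "f \<in> Lp p" "wnull p U (\<lambda>n t. xs i n t - f t)" by (rule weak_limit_exists[OF pq xs[OF i]])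
      obtain m n where mn: "m \<in> M" "n \<in> N" "(\<lambda>n t. xs i n t - f t) = (\<lambda>i t. m i t + n i t)" using split[OF f(2)] by blast
      have "xs i = (\<lambda>j t. f t + (m j t + n j t))"
      proof (intro ext)
        fix j t show "xs i j t = f t + (m j t + n j t)" using fun_cong[OF fun_cong[OF mn(3), of j], of t] by simp
      qed
      then show ?thesis using f mn by blast
    qed
    note ex1 = this
    have ex: "\<forall>i. \<exists>d. i < k \<longrightarrow> fst d \<in> Lp p \<and> fst (snd d) \<in> M \<and> snd (snd d) \<in> N \<and>
        xs i = (\<lambda>j t. fst d t + (fst (snd d) j t + snd (snd d) j t))"
    proof
      fix i
      show "\<exists>d. i < k \<longrightarrow> fst d \<in> Lp p \<and> fst (snd d) \<in> M \<and> snd (snd d) \<in> N \<and>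
        xs i = (\<lambda>j t. fst d t + (fst (snd d) j t + snd (snd d) j t))"
      proof (cases "i < k")
        case True
        then obtain f m n where "f \<in> Lp p" "m \<in> M" "n \<in> N" "xs i = (\<lambda>j t. f t + (m j t + n j t))" using ex1 by blast
        then show ?thesis by (intro exI[of _ "(f, m, n)"]) simp
      qed simp
    qed
    from choice[OF ex] obtain d where d: "\<forall>i. i < k \<longrightarrow> fst (d i) \<in> Lp p \<and> fst (snd (d i)) \<in> M \<and>
        snd (snd (d i)) \<in> N \<and> xs i = (\<lambda>j t. fst (d i) t + (fst (snd (d i)) j t + snd (snd (d i)) j t))" ..
    define fs ms ns where "fs = (\<lambda>i. fst (d i))" and "ms = (\<lambda>i. fst (snd (d i)))" and "ns = (\<lambda>i. snd (snd (d i)))"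
    have dec: "\<And>i. i < k \<Longrightarrow> fs i \<in> Lp p" "\<And>i. i < k \<Longrightarrow> ms i \<in> M" "\<And>i. i < k \<Longrightarrow> ns i \<in> N"
      "\<And>i. i < k \<Longrightarrow> xs i = (\<lambda>j t. fs i t + (ms i j t + ns i j t))" using d by (simp_all add: fs_def ms_def ns_def)
    obtain LC where LC: "set LC \<subseteq> {\<lambda>n. g | g. g \<in> Lp q} \<times> {\<lambda>n. f | f. f \<in> Lp p}"
      "\<And>i. i < k \<Longrightarrow> up_norm p U (\<lambda>n t. fs i t - finite_rank LC (\<lambda>n. fs i) n t) = 0"
      using const_approximation[of k fs, OF dec(1)] by auto
    have "\<exists>L. set L \<subseteq> FM \<times> M \<and> (\<forall>i<k. up_norm p U (\<lambda>n t. ms i n t - finite_rank L (ms i) n t) = 0)"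
      by (rule gram_schmidt[OF pq _ _ M_D(2,3,4) FM_add FM_scale FM_zero sep_M]) (use M_D(1) FM_space dec(2) in auto)
    then obtain LM where LM: "set LM \<subseteq> FM \<times> M" "\<And>i. i < k \<Longrightarrow> up_norm p U (\<lambda>n t. ms i n t - finite_rank LM (ms i) n t) = 0" by auto
    have "\<exists>L. set L \<subseteq> FN \<times> N \<and> (\<forall>i<k. up_norm p U (\<lambda>n t. ns i n t - finite_rank L (ns i) n t) = 0)"
      by (rule gram_schmidt[OF pq _ _ N_D(2,3,4) FN_add FN_scale FN_zero sep_N]) (use N_D(1) FN_space dec(3) in auto)
    then obtain LN where LN: "set LN \<subseteq> FN \<times> N" "\<And>i. i < k \<Longrightarrow> up_norm p U (\<lambda>n t. ns i n t - finite_rank LN (ns i) n t) = 0" by auto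
    define L where "L = LC @ LM @ LN"
    have Ls: "set L \<subseteq> UNIV \<times> up_space p"
    proof
      fix a assume "a \<in> set L"
      then consider "a \<in> set LC" | "a \<in> set LM" | "a \<in> set LN" by (auto simp: L_def)
      then show "a \<in> UNIV \<times> up_space p"
      proof cases
        case 1
        then obtain g f where "a = (g, \<lambda>n. f)" "f \<in> Lp p" using LC(1) by blast
        then show ?thesis using up_space_const by simp
      next
        case 2
        from subsetD[OF LM(1) this] show ?thesis using M_D(1) by auto
      next
        case 3
        from subsetD[OF LN(1) this] show ?thesis using N_D(1) by auto
      qed
    qed
    \<comment> \<open>The functionals attached to one summand vanish on the components in the other
      two, so each of the three lists sees only its own component of \<open>xs i\<close>.\<close>
    have L0: "up_norm p U (\<lambda>n t. xs i n t - finite_rank L (xs i) n t) = 0" if i: "i < k" for i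
    proof -
      have f: "(\<lambda>n. fs i) \<in> up_space p" and m: "ms i \<in> up_space p" and n: "ns i \<in> up_space p"
        using up_space_const[OF dec(1)[OF i]] M_D(1)[OF dec(2)[OF i]] N_D(1)[OF dec(3)[OF i]] by auto
      note mn = up_space_add[OF pq m n]
      have px: "pair (xs i) h = pair (\<lambda>n. fs i) h + (pair (ms i) h + pair (ns i) h)" if h: "h \<in> up_space q" for h
        using pair_add_left[OF pq f mn h] pair_add_left[OF pq m n h] dec(4)[OF i] by simp
      have "finite_rank LC (xs i) = finite_rank LC (\<lambda>n. fs i)"
      proof (rule finite_rank_cong)
        fix h z assume "(h, z) \<in> set LC"
        then obtain g where g: "h = (\<lambda>n. g)" "g \<in> Lp q" using LC(1) by blast
        have "pair (ms i) h = 0" "pair (ns i) h = 0"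
          using wnull_Lq[OF pq M_wnull[OF dec(2)[OF i]] g(2)] wnull_Lq[OF pq N_wnull[OF dec(3)[OF i]] g(2)]
          unfolding g(1) by (intro pair_eqI; simp)+
        then show "pair (xs i) h = pair (\<lambda>n. fs i) h" using px[of h] up_space_const[OF g(2)] g(1) by simp
      qed
      moreover have "finite_rank LM (xs i) = finite_rank LM (ms i)"
      proof (rule finite_rank_cong)
        fix h z assume "(h, z) \<in> set LM"
        then have h: "h \<in> FM" using LM(1) by auto
        show "pair (xs i) h = pair (ms i) h"
          using px[OF FM_space[OF h]] pair_const_wnull[OF pq dec(1)[OF i] FM_wnull[OF h]] pair_N_FM[OF dec(3)[OF i] h] by simp
      qed
      moreover have "finite_rank LN (xs i) = finite_rank LN (ns i)"
      proof (rule finite_rank_cong)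
        fix h z assume "(h, z) \<in> set LN"
        then have h: "h \<in> FN" using LN(1) by auto
        show "pair (xs i) h = pair (ns i) h"
          using px[OF FN_space[OF h]] pair_const_wnull[OF pq dec(1)[OF i] FN_wnull[OF h]] pair_M_FN[OF dec(2)[OF i] h] by simp
      qed
      ultimately have eq: "(\<lambda>n t. xs i n t - finite_rank L (xs i) n t) = (\<lambda>n t. (fs i t - finite_rank LC (\<lambda>n. fs i) n t) +
          ((ms i n t - finite_rank LM (ms i) n t) + (ns i n t - finite_rank LN (ns i) n t)))"
        using dec(4)[OF i] by (simp add: L_def finite_rank_append algebra_simps)
      have r: "finite_rank LC (\<lambda>n. fs i) \<in> up_space p" "finite_rank LM (ms i) \<in> up_space p" "finite_rank LN (ns i) \<in> up_space p"
        by (rule finite_rank_up_space[OF pq, of _ UNIV]; use Ls in \<open>auto simp: L_def\<close>)+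
      note d = up_space_diff[OF pq f r(1)] up_space_diff[OF pq m r(2)] up_space_diff[OF pq n r(3)]
      have "up_norm p U (\<lambda>n t. xs i n t - finite_rank L (xs i) n t) \<le> 0"
        unfolding eq using up_norm_triangle[OF pq d(1) up_space_add[OF pq d(2,3)]] up_norm_triangle[OF pq d(2,3)]
          LC(2)[OF i] LM(2)[OF i] LN(2)[OF i] by simp
      moreover have "finite_rank L (xs i) \<in> up_space p" by (rule finite_rank_up_space[OF pq Ls])
      ultimately show ?thesis using up_norm_nonneg[OF up_space_diff[OF pq xs[OF i], of "finite_rank L (xs i)"]] by simp
    qed
    define SL where "SL = map (\<lambda>(h, z). (h, S z)) L"
    have SLs: "finite_rank (map (\<lambda>(h, z). (h, S z)) L') x \<in> up_space p" if "set L' \<subseteq> set L" for L' x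
    proof (rule finite_rank_up_space[OF pq, of _ UNIV], rule subsetI)
      fix a assume "a \<in> set (map (\<lambda>(h, z). (h, S z)) L')"
      then obtain h z where "(h, z) \<in> set L'" "a = (h, S z)" by auto
      then show "a \<in> UNIV \<times> up_space p" using that Ls up_opD[OF op, of z] by auto
    qed
    \<comment> \<open>Here the three invariances enter. For \<open>z \<in> N\<close> only weak
      nullity of \<open>S z\<close> is known, which is why \<open>approx_N\<close> admits every
      weakly null vector.\<close>
    have app1: "approximable p (\<lambda>x n t. pair x h * S z n t)" if hz: "(h, z) \<in> set L" for h z
    proof -
      consider "(h, z) \<in> set LC" | "(h, z) \<in> set LM" | "(h, z) \<in> set LN" using hz by (auto simp: L_def)
      then show ?thesis
      proof cases
        case 1
        then obtain g f where gf: "h = (\<lambda>n. g)" "g \<in> Lp q" "z = (\<lambda>n. f)" "f \<in> Lp p" using LC(1) by blast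
        have "z \<in> up_const p U" using gf up_space_const[OF gf(4)] by (auto simp: const_iff intro!: bexI[of _ f])
        then have "S z \<in> up_const p U" using ic by (simp add: invariant_under_def)
        then show ?thesis unfolding gf(1) by (rule rank_one_const_approximable[OF pq gf(2)])
      next
        case 2
        then have "h \<in> FM" "z \<in> M" using LM(1) by auto
        then show ?thesis using iM approx_M by (simp add: invariant_under_def)
      next
        case 3
        then have "h \<in> FN" "z \<in> N" using LN(1) by auto
        then have "wnull p U (S z)" using ih N_wnull by (simp add: invariant_under_def hat_eq)
        then show ?thesis using approx_N \<open>h \<in> FN\<close> by blast
      qed
    qed
    have app: "approximable p (finite_rank (map (\<lambda>(h, z). (h, S z)) L'))" if "set L' \<subseteq> set L" for L'
      using that
    proof (induction L')
      case Nil
      show ?case using approximable_zero[of p] by (simp add: finite_rank_def)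
    next
      case (Cons a L')
      obtain h z where a: "a = (h, z)" by (cases a)
      have z: "z \<in> up_space p" using Cons.prems Ls a by auto
      have "approximable p (\<lambda>x n t. pair x h * S z n t + finite_rank (map (\<lambda>(h, z). (h, S z)) L') x n t)"
        by (rule approximable_add[OF pq app1 Cons.IH])
           (use Cons.prems a SLs up_space_scale[OF p_pos up_opD[OF op z]] in auto)
      then show ?case by (simp add: a finite_rank_Cons[abs_def])
    qed
    obtain T where T: "Lp_op p T" "\<And>i. i < k \<Longrightarrow> up_norm p U (\<lambda>n t. T (xs i n) t - finite_rank SL (xs i) n t) \<le> e"
      using app[of L, unfolded approximable_def, rule_format, OF _ e, of k xs] xs by (auto simp: SL_def)
    have "up_norm p U (\<lambda>n t. T (xs i n) t - S (xs i) n t) \<le> e" if i: "i < k" for i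
    proof -
      have r: "finite_rank L (xs i) \<in> up_space p" by (rule finite_rank_up_space[OF pq Ls])
      have sl: "finite_rank SL (xs i) \<in> up_space p" unfolding SL_def by (rule SLs) simp
      note Sx = up_opD[OF op xs[OF i]] and Sr = up_opD[OF op r]
      have 1: "up_norm p U (\<lambda>n t. S (finite_rank L (xs i)) n t - finite_rank SL (xs i) n t) = 0"
        unfolding SL_def by (rule up_op_finite_rank[OF pq op Ls])
      have 2: "up_norm p U (\<lambda>n t. S (xs i) n t - S (finite_rank L (xs i)) n t) = 0" by (rule up_op_null_diff[OF pq op xs[OF i] r L0[OF i]])
      have "up_norm p U (\<lambda>n t. S (xs i) n t - finite_rank SL (xs i) n t) \<le> 0" using up_dist_triangle[OF pq Sx Sr sl] 1 2 by simp
      then have "up_norm p U (\<lambda>n t. finite_rank SL (xs i) n t - S (xs i) n t) \<le> 0" by (simp add: up_norm_minus_commute[of p "finite_rank SL (xs i)"])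
      then show ?thesis using up_dist_triangle[OF pq Lp_op_up_space[OF T(1) xs[OF i]] sl Sx] T(2)[OF i] by linarith
    qed
    then show ?thesis using T(1) by blast
  qed
  show ?thesis
    unfolding wot_closure_def
  proof (intro CollectI conjI op allI impI)
    fix e :: real and k :: nat and xs phis
    assume e: "0 < e" and h: "\<forall>i<k. xs i \<in> up_space p \<and> up_functional p U (phis i)"
    have "\<forall>i. \<exists>C. i < k \<longrightarrow> (\<forall>x\<in>up_space p. \<bar>phis i x\<bar> \<le> C * up_norm p U x)"
      using h unfolding up_functional_def by blast
    then obtain C where C: "\<And>i x. i < k \<Longrightarrow> x \<in> up_space p \<Longrightarrow> \<bar>phis i x\<bar> \<le> C i * up_norm p U x"
      using choice[of "\<lambda>i C. i < k \<longrightarrow> (\<forall>x\<in>up_space p. \<bar>phis i x\<bar> \<le> C * up_norm p U x)"] by blast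
    \<comment> \<open>A common bound for the constants of the finitely many functionals; the added 1
      keeps it positive, so that \<open>e / (2 * K)\<close> makes sense as a tolerance.\<close>
    define K where "K = 1 + (\<Sum>i<k. \<bar>C i\<bar>)"
    have K: "K > 0" unfolding K_def by (rule add_pos_nonneg) (simp_all add: sum_nonneg)
    have CK: "C i \<le> K" if "i < k" for i
    proof -
      have "\<bar>C i\<bar> \<le> (\<Sum>i<k. \<bar>C i\<bar>)" by (rule member_le_sum) (use that in auto)
      then show ?thesis by (simp add: K_def)
    qed
    obtain T where T: "Lp_op p T" "\<And>i. i < k \<Longrightarrow> up_norm p U (\<lambda>n t. T (xs i n) t - S (xs i) n t) \<le> e / (2 * K)"
      using approx[of k xs "e / (2 * K)"] h e K by auto
    show "\<exists>T\<in>{up_lift T | T. Lp_op p T}. \<forall>i<k. \<bar>phis i (S (xs i)) - phis i (T (xs i))\<bar> < e"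
    proof (intro bexI[of _ "up_lift T"] allI impI)
      show "up_lift T \<in> {up_lift T | T. Lp_op p T}" using T(1) by blast
      fix i assume i: "i < k"
      have x: "xs i \<in> up_space p" and phi: "up_functional p U (phis i)" using h i by auto
      note Sx = up_opD[OF op x] and Tx = Lp_op_up_space[OF T(1) x]
      let ?d = "\<lambda>n t. T (xs i n) t - S (xs i) n t"
      have d: "?d \<in> up_space p" by (rule up_space_diff[OF pq Tx Sx])
      have "phis i (uadd ?d (S (xs i))) = phis i ?d + phis i (S (xs i))"
        using phi d Sx unfolding up_functional_def by blast
      then have "phis i (up_lift T (xs i)) = phis i ?d + phis i (S (xs i))" by (simp add: uadd_def vadd_def up_lift_def)
      then have "\<bar>phis i (S (xs i)) - phis i (up_lift T (xs i))\<bar> = \<bar>phis i ?d\<bar>" by simp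
      also have "\<dots> \<le> C i * up_norm p U ?d" by (rule C[OF i d])
      also have "\<dots> \<le> K * (e / (2 * K))"
        using CK[OF i] T(2)[OF i] K up_norm_nonneg[OF d] by (intro mult_mono) auto
      also have "\<dots> < e" using K e by simp
      finally show "\<bar>phis i (S (xs i)) - phis i (up_lift T (xs i))\<bar> < e" .
    qed
  qed
qed

section \<open>Uniqueness of \<open>M\<close>\<close>

lemma rank_one_invariant_const:
  assumes "wnull q U h" "y \<in> up_space p"
  shows "invariant_under (up_const p U) (\<lambda>x n t. pair x h * y n t)"
  unfolding invariant_under_def
  using pair_const[OF _ assms(1)] up_space_const[OF Lp_zero, of p] Lp_zero by (auto simp: const_iff intro!: bexI[of _ "\<lambda>t. 0"])

text \<open>Among the operators that respect constants and weakly null classes, \<open>M\<close> and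
  \<open>M'\<close> are invariant under the same ones. A rank-one map that respects \<open>M\<close>
  sends any vector of \<open>M'\<close> seen by its functional to a multiple of a prescribed target;
  so \<open>M'\<close> consists of null classes, equals \<open>M\<close>, or contains every weakly
  null class.\<close>

lemma unique_M:
  assumes comp: "up_complemented_in p U (up_hat p U) M'"
    and iff: "\<And>S. up_op p U S \<Longrightarrow> S \<in> wot_closure p U {up_lift T | T. Lp_op p T} \<longleftrightarrow>
      invariant_under (up_const p U) S \<and> invariant_under (up_hat p U) S \<and> invariant_under M' S"
  shows "M' = M"
proof -
  have cl: "up_closed_subspace p U M'" and sub: "M' \<subseteq> up_hat p U" using comp by (auto simp: up_complemented_in_def)
  note M'_D = closed_subspaceD[OF cl]
  have inv: "invariant_under M' S" if "up_op p U S" "invariant_under (up_const p U) S" "invariant_under (up_hat p U) S" "invariant_under M S" for S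
    using iff[OF that(1)] invariant_imp_closure[OF that] by blast
  have inv': "invariant_under M S" if "up_op p U S" "invariant_under (up_const p U) S" "invariant_under (up_hat p U) S" "invariant_under M' S" for S
    using iff[OF that(1)] that closure_imp_invariant(3) by blast
  have hat_scale: "(\<lambda>n t. c * y n t) \<in> up_hat p U" if "wnull p U y" for c y
    using wnull_scale[OF p_pos that] by (simp add: hat_eq)
  have unscale: "y \<in> M'" if "(\<lambda>n t. c * y n t) \<in> M'" "c \<noteq> 0" for c y
    using M'_D(3)[OF that(1), of "1 / c"] that(2) by simp
  obtain m0 where m0: "m0 \<in> M" "up_norm p U m0 \<noteq> 0" using M_nontrivial by blast
  obtain n0 where n0: "n0 \<in> N" "up_norm p U n0 \<noteq> 0" using N_nontrivial by blast
  obtain h0 where h0: "h0 \<in> FM" "pair m0 h0 \<noteq> 0" using sep_M[OF m0(1)] m0(2) by blast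
  \<comment> \<open>This map sends \<open>m0\<close> to a non-zero multiple of \<open>n0\<close> and
    so does not respect \<open>M\<close>. It does respect the space of all weakly null classes and
    any subspace of null classes, which rules out both extremes for \<open>M'\<close>.\<close>
  let ?S0 = "\<lambda>x n t. pair x h0 * n0 n t"
  have op0: "up_op p U ?S0" by (rule rank_one_up_op[OF pq FM_space[OF h0(1)] N_D(1)[OF n0(1)]])
  have notM: "\<not> invariant_under M ?S0"
  proof
    assume "invariant_under M ?S0"
    then have "(\<lambda>n t. pair m0 h0 * n0 n t) \<in> M" using m0(1) by (simp add: invariant_under_def)
    then have "n0 \<in> M" using M_D(3)[of "\<lambda>n t. pair m0 h0 * n0 n t" "1 / pair m0 h0"] h0(2) by simp
    then show False using M_N_null[OF _ n0(1)] n0(2) by blast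
  qed
  have ic0: "invariant_under (up_const p U) ?S0"
    by (rule rank_one_invariant_const[OF FM_wnull[OF h0(1)] N_D(1)[OF n0(1)]])
  have ih0: "invariant_under (up_hat p U) ?S0"
    unfolding invariant_under_def using hat_scale[OF N_wnull[OF n0(1)]] by blast
  show ?thesis
  proof (cases "M' \<subseteq> M")
    case False
    then obtain x where x: "x \<in> M'" "x \<notin> M" by blast
    have "wnull p U x" using x(1) sub hat_eq by blast
    then obtain h where h: "h \<in> FN" "pair x h \<noteq> 0" using x(2) in_M_iff by blast
    have "y \<in> M'" if y: "wnull p U y" for y
    proof -
      let ?S = "\<lambda>x n t. pair x h * y n t"
      have "invariant_under M' ?S"
      proof (rule inv)
        show "up_op p U ?S" by (rule rank_one_up_op[OF pq FN_space[OF h(1)] wnullD[OF y]])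
        show "invariant_under (up_const p U) ?S" by (rule rank_one_invariant_const[OF FN_wnull[OF h(1)] wnullD[OF y]])
        show "invariant_under (up_hat p U) ?S" unfolding invariant_under_def using hat_scale[OF y] by blast
        show "invariant_under M ?S" unfolding invariant_under_def using pair_M_FN[OF _ h(1)] M_D(4) by simp
      qed
      then have "(\<lambda>n t. pair x h * y n t) \<in> M'" using x(1) by (simp add: invariant_under_def)
      then show ?thesis using h(2) by (rule unscale)
    qed
    then have "M' = up_hat p U" using sub hat_eq by blast
    then have "invariant_under M ?S0" using inv'[OF op0 ic0 ih0] ih0 by simp
    then show ?thesis using notM by blast
  next
    case True
    show ?thesis
    proof (cases "\<exists>x\<in>M'. up_norm p U x \<noteq> 0")
      case True
      then obtain x where x: "x \<in> M'" "up_norm p U x \<noteq> 0" by blast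
      have xM: "x \<in> M" using x(1) \<open>M' \<subseteq> M\<close> by blast
      obtain h where h: "h \<in> FM" "pair x h \<noteq> 0" using sep_M[OF xM] x(2) by blast
      have "y \<in> M'" if y: "y \<in> M" for y
      proof -
        let ?S = "\<lambda>x n t. pair x h * y n t"
        have "invariant_under M' ?S"
        proof (rule inv)
          show "up_op p U ?S" by (rule rank_one_up_op[OF pq FM_space[OF h(1)] M_D(1)[OF y]])
          show "invariant_under (up_const p U) ?S" by (rule rank_one_invariant_const[OF FM_wnull[OF h(1)] M_D(1)[OF y]])
          show "invariant_under (up_hat p U) ?S" unfolding invariant_under_def using hat_scale[OF M_wnull[OF y]] by blast
          show "invariant_under M ?S" unfolding invariant_under_def using M_D(3)[OF y] by blast
        qed
        then have "(\<lambda>n t. pair x h * y n t) \<in> M'" using x(1) by (simp add: invariant_under_def)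
        then show ?thesis using h(2) by (rule unscale)
      qed
      then show ?thesis using \<open>M' \<subseteq> M\<close> by blast
    next
      case False
      have "invariant_under M' ?S0"
        unfolding invariant_under_def
      proof
        fix x assume "x \<in> M'"
        then have "pair x h0 = 0" using False by (intro pair_null[OF pq M'_D(1) FM_space[OF h0(1)]]) auto
        then show "(\<lambda>n t. pair x h0 * n0 n t) \<in> M'" using M'_D(4) by simp
      qed
      then have "invariant_under M ?S0" by (rule inv'[OF op0 ic0 ih0])
      then show ?thesis using notM by blast
    qed
  qed
qed

theorem unique_characterization:
  "\<exists>!M. up_complemented_in p U (up_hat p U) M \<and>
           (\<forall>S. up_op p U S \<longrightarrow>
              (S \<in> wot_closure p U {up_lift T | T. Lp_op p T} \<longleftrightarrow>
               invariant_under (up_const p U) S \<and>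
               invariant_under (up_hat p U) S \<and>
               invariant_under M S))"
proof (rule ex1I[of _ M])
  show "up_complemented_in p U (up_hat p U) M \<and>
           (\<forall>S. up_op p U S \<longrightarrow>
              (S \<in> wot_closure p U {up_lift T | T. Lp_op p T} \<longleftrightarrow>
               invariant_under (up_const p U) S \<and>
               invariant_under (up_hat p U) S \<and>
               invariant_under M S))"
    using complemented_M closure_imp_invariant invariant_imp_closure by blast
qed (use unique_M in blast)

end

section \<open>The two bands\<close>

lemma cos_measurable_mu: "(\<lambda>t. cos (k * t)) \<in> borel_measurable mu" for k :: real
  by (rule continuous_imp_measurable_on_sets_lebesgue) (auto intro!: continuous_intros)

lemma integral_cos_multiple:
  assumes "k > (0::nat)"
  shows "(\<integral>t. cos (2 * pi * real k * t) \<partial>mu) = 0"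
proof -
  have int: "integrable mu (\<lambda>t. cos (2 * pi * real k * t))"
    by (rule integrable_bounded[where K=1, OF cos_measurable_mu]) simp
  have "((\<lambda>t. cos (2 * pi * real k * t)) has_integral
      (sin (2 * pi * real k * 1) / (2 * pi * real k) - sin (2 * pi * real k * 0) / (2 * pi * real k))) {0..1}"
    by (rule fundamental_theorem_of_calculus)
       (use assms in \<open>auto intro!: derivative_eq_intros simp: has_real_derivative_iff_has_vector_derivative[symmetric]\<close>)
  moreover have "sin (2 * pi * real k) = 0" using sin_int_2pin[of "int k"] by (simp add: mult_ac)
  ultimately have "integral {0..1} (\<lambda>t. cos (2 * pi * real k * t)) = 0" by (simp add: integral_unique)
  then show ?thesis using lebesgue_integral_eq_integral[OF int] by simp
qed

context selective_ultrafilter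
begin

lemma wnull_closed:
  assumes pq: "conj_exp p q" and y: "y \<in> up_space p"
    and a: "\<And>e. e > 0 \<Longrightarrow> \<exists>x. wnull p U x \<and> up_norm p U (\<lambda>n t. x n t - y n t) < e"
  shows "wnull p U y"
  unfolding wnull_def
proof (intro conjI allI impI y)
  fix g :: "real \<Rightarrow> real" and K assume g: "g \<in> borel_measurable mu" "\<forall>t. \<bar>g t\<bar> \<le> K"
  have gq: "g \<in> Lp q" by (rule Lp_bounded[where K=K]) (use g conj_expD[OF pq] in auto)
  note gs = up_space_const[OF gq]
  let ?G = "up_norm q U (\<lambda>n. g)"
  have G: "?G + 1 > 0" using up_norm_nonneg[OF gs] by linarith
  have "\<bar>pair y (\<lambda>n. g)\<bar> \<le> e" if e: "e > 0" for e
  proof -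
    obtain x where x: "wnull p U x" "up_norm p U (\<lambda>n t. x n t - y n t) < e / (?G + 1)" using a[of "e / (?G + 1)"] e G by auto
    note xs = wnullD[OF x(1)] and d = up_space_diff[OF pq wnullD[OF x(1)] y]
    have "pair x (\<lambda>n. g) = 0" by (rule pair_eqI) (rule wnull_Lq[OF pq x(1) gq])
    then have "\<bar>pair y (\<lambda>n. g)\<bar> = \<bar>pair (\<lambda>n t. x n t - y n t) (\<lambda>n. g)\<bar>" using pair_diff_left[OF pq xs y gs] by simp
    also have "\<dots> \<le> up_norm p U (\<lambda>n t. x n t - y n t) * ?G" by (rule pair_le[OF pq d gs])
    also have "\<dots> \<le> e / (?G + 1) * (?G + 1)"
      using x(2) up_norm_nonneg[OF gs] e G by (intro mult_mono) auto
    also have "\<dots> = e" using G by simp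
    finally show ?thesis .
  qed
  then have "\<bar>pair y (\<lambda>n. g)\<bar> \<le> 0" by (rule field_le_epsilon) simp
  then show "((\<lambda>n. \<integral>t. y n t * g t \<partial>mu) \<longlongrightarrow> 0) U" using pair_tendsto[OF pq y gs] by simp
qed

definition WEqui :: "real \<Rightarrow> (nat \<Rightarrow> real \<Rightarrow> real) set" where
  "WEqui p = {x \<in> Equi p. wnull p U x}"

text \<open>Upper 2-estimates are at hand for bounded sequences, so the functionals on the
  equi-integrable band are taken from this dense part of \<open>WEqui q\<close>; by
  \<open>Equi_separated\<close> they already separate the points of \<open>WEqui p\<close>.\<close>

definition WBdd :: "real \<Rightarrow> (nat \<Rightarrow> real \<Rightarrow> real) set" where
  "WBdd q = {h \<in> Bdd. wnull q U h}"

lemma closed_Disj: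
  assumes pq: "conj_exp p q"
  shows "up_closed_subspace p U (Disj p)"
  unfolding up_closed_subspace_def
proof (intro conjI ballI allI impI)
  note c = conj_expD[OF pq]
  show "Disj p \<subseteq> up_space p" using Disj_up_space by blast
  show "Disj p \<noteq> {}" using up_space_const[OF Lp_zero, of p] by (auto simp: Disj_def intro!: exI[of _ "\<lambda>n t. 0"])
  show "uadd x y \<in> Disj p" if "x \<in> Disj p" "y \<in> Disj p" for x y
    using Disj_add[OF pq that] by (simp add: uadd_def vadd_def)
  show "uscale k x \<in> Disj p" if "x \<in> Disj p" for x k
    using Disj_scale[OF _ that, of k] c by (simp add: uscale_def vscale_def)
  show "y \<in> Disj p" if "y \<in> up_space p" "\<forall>e>0. \<exists>x\<in>Disj p. up_norm p U (usub x y) < e" for y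
    by (rule DisjI_approx[OF pq that(1)]) (use that(2) in \<open>auto simp: usub_def vsub_def\<close>)
qed

lemma closed_WEqui:
  assumes pq: "conj_exp p q"
  shows "up_closed_subspace p U (WEqui p)"
  unfolding up_closed_subspace_def
proof (intro conjI ballI allI impI)
  note c = conj_expD[OF pq]
  show "WEqui p \<subseteq> up_space p" using Equi_up_space by (auto simp: WEqui_def)
  have "(\<lambda>n t. 0) \<in> Bdd" by (rule BddI[where K=0]) auto
  then have "(\<lambda>n t. 0) \<in> WEqui p"
    using Bdd_Equi[OF pq] up_space_const[OF Lp_zero, of p] by (simp add: WEqui_def wnull_def)
  then show "WEqui p \<noteq> {}" by blast
  show "uadd x y \<in> WEqui p" if "x \<in> WEqui p" "y \<in> WEqui p" for x y
    using Equi_add[OF pq, of x y] wnull_add[OF pq, of x y] that by (simp add: uadd_def vadd_def WEqui_def)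
  show "uscale k x \<in> WEqui p" if "x \<in> WEqui p" for x k
    using Equi_scale[OF pq, of x k] wnull_scale[of p x k] c that by (simp add: uscale_def vscale_def WEqui_def)
  fix y assume y: "y \<in> up_space p" "\<forall>e>0. \<exists>x\<in>WEqui p. up_norm p U (usub x y) < e"
  have "y \<in> Equi p" by (rule EquiI_up_approx[OF pq y(1)]) (use y(2) in \<open>fastforce simp: usub_def vsub_def WEqui_def\<close>)
  moreover have "wnull p U y" by (rule wnull_closed[OF pq y(1)]) (use y(2) in \<open>fastforce simp: usub_def vsub_def WEqui_def\<close>)
  ultimately show "y \<in> WEqui p" by (simp add: WEqui_def)
qed

lemma WEqui_Disj_split:
  assumes "conj_exp p q" "wnull p U x"
  shows "\<exists>e\<in>WEqui p. \<exists>d\<in>Disj p. x = (\<lambda>n t. e n t + d n t)"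
proof -
  obtain e d where "e \<in> Equi p" "wnull p U e" "d \<in> Disj p" "x = (\<lambda>n t. e n t + d n t)"
    by (rule wnull_split[OF assms])
  then show ?thesis by (intro bexI[of _ e] bexI[of _ d]) (simp_all add: WEqui_def)
qed

lemma WBdd_add: "conj_exp q p \<Longrightarrow> x \<in> WBdd q \<Longrightarrow> y \<in> WBdd q \<Longrightarrow> (\<lambda>n t. x n t + y n t) \<in> WBdd q"
  using Bdd_add wnull_add by (simp add: WBdd_def)

lemma WBdd_scale: "0 < q \<Longrightarrow> x \<in> WBdd q \<Longrightarrow> (\<lambda>n t. c * x n t) \<in> WBdd q"
  using Bdd_scale wnull_scale by (simp add: WBdd_def)

lemma WBdd_zero: "(\<lambda>n t. 0) \<in> WBdd q"
proof -
  have "(\<lambda>n t. 0) \<in> Bdd" by (rule BddI[where K=0]) auto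
  then show ?thesis using up_space_const[OF Lp_zero, of q] by (simp add: WBdd_def wnull_def)
qed

lemma Disj_zero: "(\<lambda>n t. 0) \<in> Disj q"
  using up_space_const[OF Lp_zero, of q] by (simp add: Disj_def)

lemma WBdd_Equi: "conj_exp q p \<Longrightarrow> h \<in> WBdd q \<Longrightarrow> h \<in> Equi q"
  using Bdd_Equi by (simp add: WBdd_def)

section \<open>Approximable rank-one maps between the bands\<close>

lemma approximable_Disj_Disj:
  assumes pq: "conj_exp p q" and h: "h \<in> Disj q" and y: "y \<in> Disj p"
  shows "approximable p (\<lambda>x n t. pair x h * y n t)"
  using rank_one_approximable[OF pq pq Disj_wnull[OF pq y] Disj_wnull[OF conj_exp_sym[OF pq] h]
      Disj_sparse_upper_estimate[OF pq y] Disj_sparse_upper_estimate[OF conj_exp_sym[OF pq] h]] .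

lemma approximable_WEqui:
  assumes pq: "conj_exp p q" and h: "wnull q U h" and y: "y \<in> WEqui p"
    and b: "\<And>b. b \<in> WBdd p \<Longrightarrow> approximable p (\<lambda>x n t. pair x h * b n t)"
  shows "approximable p (\<lambda>x n t. pair x h * y n t)"
proof (rule rank_one_approximable_limit[OF pq _ wnullD[OF h]])
  show "y \<in> up_space p" using y wnullD[of p U y] by (simp add: WEqui_def)
  fix e :: real assume e: "e > 0"
  have y': "y \<in> Equi p" "wnull p U y" using y by (auto simp: WEqui_def)
  obtain a where a: "a \<in> Bdd" "wnull p U a" "up_norm p U (\<lambda>n t. y n t - a n t) < e"
    by (rule Equi_wnull_approx[OF pq y' e])
  then show "\<exists>y'\<in>up_space p. up_norm p U (\<lambda>n t. y n t - y' n t) < e \<and> approximable p (\<lambda>x n t. pair x h * y' n t)"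
    using wnullD[OF a(2)] b[of a] by (auto simp: WBdd_def)
qed

text \<open>For bounded \<open>y\<close> both sides have upper 2-estimates, and 2 is its own
  conjugate exponent; density does the rest.\<close>

lemma approximable_WBdd_WEqui:
  assumes pq: "conj_exp p q" and h: "h \<in> WBdd q" and y: "y \<in> WEqui p"
  shows "approximable p (\<lambda>x n t. pair x h * y n t)"
proof (rule approximable_WEqui[OF pq _ y])
  have h': "h \<in> Bdd" "wnull q U h" using h by (auto simp: WBdd_def)
  then show "wnull q U h" by simp
  fix b assume "b \<in> WBdd p"
  then have b: "b \<in> Bdd" "wnull p U b" by (auto simp: WBdd_def)
  show "approximable p (\<lambda>x n t. pair x h * b n t)"
    by (rule rank_one_approximable[OF pq conj_exp_two b(2) h'(2) Bdd_sparse_upper_estimate[OF pq b] Bdd_sparse_upper_estimate[OF conj_exp_sym[OF pq] h']])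
qed

text \<open>\<open>h\<close> has exponent \<open>q\<close>, whose conjugate is \<open>p\<close>. For
  \<open>p \<le> 2\<close> the exponent 2 of a bounded \<open>y\<close> may be lowered to
  \<open>p\<close>.\<close>

lemma approximable_Disj_WEqui:
  assumes pq: "conj_exp p q" and p: "p \<le> 2" and h: "h \<in> Disj q" and y: "y \<in> WEqui p"
  shows "approximable p (\<lambda>x n t. pair x h * y n t)"
proof (rule approximable_WEqui[OF pq _ y])
  note qp = conj_exp_sym[OF pq]
  show hw: "wnull q U h" by (rule Disj_wnull[OF qp h])
  fix b assume "b \<in> WBdd p"
  then have b: "b \<in> Bdd" "wnull p U b" by (auto simp: WBdd_def)
  have "sparse (upper_estimate p p b)"
    using Bdd_sparse_upper_estimate[OF pq b] by (rule sparse_mono) (rule upper_estimate_mono[OF _ p], use conj_expD(1)[OF pq] in auto)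
  then show "approximable p (\<lambda>x n t. pair x h * b n t)"
    by (rule rank_one_approximable[OF pq pq b(2) hw _ Disj_sparse_upper_estimate[OF qp h]])
qed

text \<open>\<open>h\<close> has exponent 2, and for \<open>2 \<le> p\<close> the exponent
  \<open>p\<close> of \<open>y\<close> may be lowered to 2.\<close>

lemma approximable_WBdd_Disj:
  assumes pq: "conj_exp p q" and p: "2 \<le> p" and h: "h \<in> WBdd q" and y: "y \<in> Disj p"
  shows "approximable p (\<lambda>x n t. pair x h * y n t)"
proof -
  have h': "h \<in> Bdd" "wnull q U h" using h by (auto simp: WBdd_def)
  have "sparse (upper_estimate p 2 y)"
    using Disj_sparse_upper_estimate[OF pq y] by (rule sparse_mono) (rule upper_estimate_mono[OF _ p], auto)
  then show ?thesis
    by (rule rank_one_approximable[OF pq conj_exp_two Disj_wnull[OF pq y] h'(2) _ Bdd_sparse_upper_estimate[OF conj_exp_sym[OF pq] h']])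
qed

lemma approximable_split:
  assumes pq: "conj_exp p q" and y: "wnull p U y"
    and e: "\<And>e. e \<in> WEqui p \<Longrightarrow> approximable p (\<lambda>x n t. pair x h * e n t)"
    and d: "\<And>d. d \<in> Disj p \<Longrightarrow> approximable p (\<lambda>x n t. pair x h * d n t)"
  shows "approximable p (\<lambda>x n t. pair x h * y n t)"
proof -
  obtain a b where ab: "a \<in> WEqui p" "b \<in> Disj p" "y = (\<lambda>n t. a n t + b n t)" using WEqui_Disj_split[OF pq y] by blast
  have s: "a \<in> up_space p" "b \<in> up_space p" using ab(1) wnullD[of p U a] Disj_up_space[OF ab(2)] by (simp_all add: WEqui_def)
  have "approximable p (\<lambda>x n t. pair x h * a n t + pair x h * b n t)"
    by (rule approximable_add[OF pq e[OF ab(1)] d[OF ab(2)]])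
       (use up_space_scale[OF _ s(1)] up_space_scale[OF _ s(2)] conj_expD(1)[OF pq] in auto)
  then show ?thesis using ab(3) by (simp add: distrib_left)
qed

text \<open>\<open>T\<close> preserves the growth rate \<open>1 / p\<close> of \<open>d\<close>, and
  \<open>h\<close> has rate \<open>1 / 2\<close>; the sum is below 1 exactly for
  \<open>p > 2\<close>.\<close>

lemma operator_Disj:
  assumes pq: "conj_exp p q" and p: "2 < p" and T: "Lp_op p T" and d: "d \<in> Disj p" and h: "h \<in> WBdd q"
  shows "pair (\<lambda>n. T (d n)) h = 0"
proof (rule pair_eq_0_of_growth[OF pq, where r="1 / p" and s="1 / 2"])
  have h': "h \<in> Bdd" "wnull q U h" using h by (auto simp: WBdd_def)
  show "wnull p U (\<lambda>n. T (d n))" by (rule Lp_op_wnull[OF pq T Disj_wnull[OF pq d]])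
  show "wnull q U h" by (rule h'(2))
  show "sparse (growth q (1 / 2) h)" by (rule Bdd_growth[OF conj_exp_sym[OF pq] h'])
  show "sparse (growth p (1 / p) (\<lambda>n. T (d n)))"
    using Disj_growth[OF pq d] by (rule sparse_mono) (rule Lp_op_growth[OF pq T up_spaceD[OF Disj_up_space[OF d]]])
  show "1 / p + 1 / 2 < 1" using p by (simp add: field_simps)
qed

text \<open>The rates are \<open>1 / 2\<close> for images of bounded sequences and
  \<open>1 / q\<close> for \<open>h\<close>, with sum below 1 exactly for \<open>p < 2\<close>.
  Since the rate \<open>1 / 2\<close> is at hand for bounded sequences, \<open>m\<close> is first
  approximated by them.\<close>

lemma operator_WEqui:
  assumes pq: "conj_exp p q" and p: "p < 2" and T: "Lp_op p T" and m: "m \<in> WEqui p" and h: "h \<in> Disj q"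
  shows "pair (\<lambda>n. T (m n)) h = 0"
proof -
  note c = conj_expD[OF pq] and qp = conj_exp_sym[OF pq] and hs = Disj_up_space[OF h]
  have m': "m \<in> Equi p" "wnull p U m" using m by (auto simp: WEqui_def)
  note ms = wnullD[OF m'(2)]
  have q2: "1 / 2 + 1 / q < 1" unfolding c(8) using c(1) p by (simp add: field_simps)
  obtain C where C: "C > 0" "\<And>x y. x \<in> up_space p \<Longrightarrow> y \<in> up_space p \<Longrightarrow>
      up_norm p U (\<lambda>n t. T (x n) t - T (y n) t) \<le> C * up_norm p U (\<lambda>n t. x n t - y n t)"
    by (rule Lp_op_up_norm_diff[OF pq T]) blast
  let ?H = "up_norm q U h"
  \<comment> \<open>The added 1 keeps the later divisor positive even when \<open>h\<close> is a
    null class.\<close>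
  have H: "C * (?H + 1) > 0" using up_norm_nonneg[OF hs] C(1) by (simp add: add_nonneg_pos)
  have "\<bar>pair (\<lambda>n. T (m n)) h\<bar> \<le> e" if e: "e > 0" for e
  proof -
    obtain b where b: "b \<in> Bdd" "wnull p U b" "up_norm p U (\<lambda>n t. m n t - b n t) < e / (C * (?H + 1))"
      by (rule Equi_wnull_approx[OF pq m', of "e / (C * (?H + 1))"]) (use e H in auto)
    note bs = wnullD[OF b(2)]
    have "pair (\<lambda>n. T (b n)) h = 0"
    proof (rule pair_eq_0_of_growth[OF pq Lp_op_wnull[OF pq T b(2)] Disj_wnull[OF qp h] _ Disj_growth[OF qp h] q2])
      show "sparse (growth p (1 / 2) (\<lambda>n. T (b n)))"
        using Bdd_growth[OF pq b(1,2)] by (rule sparse_mono) (rule Lp_op_growth[OF pq T up_spaceD[OF bs]])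
    qed
    note Tm = Lp_op_up_space[OF T ms] and Tb = Lp_op_up_space[OF T bs]
    have "\<bar>pair (\<lambda>n. T (m n)) h\<bar> = \<bar>pair (\<lambda>n t. T (m n) t - T (b n) t) h\<bar>"
      using pair_diff_left[OF pq Tm Tb hs] \<open>pair (\<lambda>n. T (b n)) h = 0\<close> by simp
    also have "\<dots> \<le> up_norm p U (\<lambda>n t. T (m n) t - T (b n) t) * ?H" by (rule pair_le[OF pq up_space_diff[OF pq Tm Tb] hs])
    also have "\<dots> \<le> (C * up_norm p U (\<lambda>n t. m n t - b n t)) * (?H + 1)"
      using C(2)[OF ms bs] C(1) up_norm_nonneg[OF hs] up_norm_nonneg[OF up_space_diff[OF pq ms bs]]
      by (intro mult_mono) auto
    also have "\<dots> = up_norm p U (\<lambda>n t. m n t - b n t) * (C * (?H + 1))" by (simp add: mult_ac)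
    also have "\<dots> \<le> e / (C * (?H + 1)) * (C * (?H + 1))" using b(3) H by (intro mult_right_mono) auto
    also have "\<dots> = e"
      unfolding times_divide_eq_left by (rule nonzero_mult_div_cancel_right) (rule less_imp_neq[OF H, symmetric])
    finally show ?thesis .
  qed
  then have "\<bar>pair (\<lambda>n. T (m n)) h\<bar> \<le> 0" by (rule field_le_epsilon) simp
  then show ?thesis by simp
qed

text \<open>The witnesses are indicators of intervals shrinking to 0, normalised in
  \<open>Lp\<close>; their \<open>L^1\<close> norms \<open>a n powr (1 - 1 / p)\<close> tend to
  0.\<close>

lemma Disj_nontrivial:
  assumes pq: "conj_exp p q"
  shows "\<exists>d\<in>Disj p. up_norm p U d \<noteq> 0"
proof -
  note c = conj_expD[OF pq]
  define a where "a = (\<lambda>n. 1 / (real n + 1))"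
  have a: "0 < a n" "a n \<le> 1" for n by (auto simp: a_def)
  have [measurable]: "{0..a n} \<in> sets mu" for n
    by (rule sets_restrict_space_iff[THEN iffD2]) (use a[of n] in auto)
  have ma: "measure mu {0..a n} = a n" for n
    using a[of n] by (subst measure_restrict_space) auto
  define d where "d = (\<lambda>n t. a n powr (- (1 / p)) * indicator {0..a n} t :: real)"
  have d1: "Lp_norm p (d n) = 1" for n
  proof -
    have "Lp_norm p (d n) = a n powr (- (1 / p)) * a n powr (1 / p)"
      unfolding d_def using Lp_norm_scale[of p "a n powr (- (1 / p))" "indicator {0..a n}"] Lp_norm_indicator[of "{0..a n}" p] ma c by simp
    also have "\<dots> = 1" using a[of n] by (simp flip: powr_add)
    finally show ?thesis .
  qed
  have dL: "d n \<in> Lp p" for n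
    unfolding d_def by (rule Lp_scale, rule Lp_bounded[where K=1], measurable) (use c in \<open>auto simp: indicator_def\<close>)
  have ds: "d \<in> up_space p" by (rule up_spaceI[where B=1]) (use dL d1 in auto)
  have "(\<integral>t. \<bar>d n t\<bar> \<partial>mu) = a n powr (1 - 1 / p)" for n
  proof -
    have "(\<integral>t. \<bar>d n t\<bar> \<partial>mu) = (\<integral>t. a n powr (- (1 / p)) * indicator {0..a n} t \<partial>mu)"
      by (rule Bochner_Integration.integral_cong) (auto simp: d_def abs_mult indicator_def)
    also have "\<dots> = a n powr (- (1 / p)) * measure mu {0..a n}"
      using a[of n] by (simp add: min_absorb1)
    also have "\<dots> = a n powr (1 - 1 / p)" unfolding ma using powr_mult_base[of "a n" "- (1 / p)"] a[of n] by (simp add: mult.commute)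
    finally show ?thesis .
  qed
  moreover have "((\<lambda>n. a n powr (1 - 1 / p)) \<longlongrightarrow> 0 powr (1 - 1 / p)) sequentially"
  proof (rule tendsto_powr')
    show "(a \<longlongrightarrow> 0) sequentially" unfolding a_def using LIMSEQ_inverse_real_of_nat by (simp add: inverse_eq_divide add.commute)
  qed (use c a in \<open>auto simp: less_imp_le\<close>)
  ultimately have "((\<lambda>n. \<integral>t. \<bar>d n t\<bar> \<partial>mu) \<longlongrightarrow> 0) U" by (intro tendsto_along_U) simp
  then have "d \<in> Disj p" using ds by (simp add: Disj_def)
  moreover have "up_norm p U d = 1" unfolding up_norm_def d1 by (rule Lim_eq) simp
  ultimately show ?thesis by force
qed

text \<open>A bounded sequence that is uniformly separated in norm stays away from its weak limit.\<close>
lemma WEqui_nontrivial: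
  assumes pq: "conj_exp p q"
  shows "\<exists>e\<in>WEqui p. up_norm p U e \<noteq> 0"
proof -
  note c = conj_expD[OF pq]
  \<comment> \<open>The shift of the frequency by 1 excludes the constant function, whose square
    does not have integral \<open>1 / 2\<close>.\<close>
  define u where "u = (\<lambda>(n::nat) t. cos (2 * pi * real (n + 1) * t))"
  have um[measurable]: "u n \<in> borel_measurable mu" for n unfolding u_def by (rule cos_measurable_mu)
  have uB: "u \<in> Bdd" by (rule BddI[where K=1, OF um]) (simp add: u_def)
  have us: "u \<in> up_space p" using Bdd_up_space[OF uB] c by auto
  define w where "w = (\<lambda>(k::nat) t. cos (2 * pi * real k * t))"
  have wi: "integrable mu (w k)" for k
    unfolding w_def by (rule integrable_bounded[where K=1, OF cos_measurable_mu]) simp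
  have w0: "(\<integral>t. w k t \<partial>mu) = 0" if "0 < k" for k
    unfolding w_def by (rule integral_cos_multiple[OF that])
  \<comment> \<open>By orthogonality the squared difference has integral 1, one half from each
    square. As the difference is bounded by 2, its \<open>L^1\<close> norm is at least
    \<open>1 / 2\<close>, and so is its norm in \<open>Lp\<close>.\<close>
  have sep: "1 / 2 \<le> Lp_norm p (\<lambda>t. u n t - u m t)" if nm: "n < m" for n m
  proof -
    have pt: "(u n t - u m t)\<^sup>2 = 1 + w (2 * (n + 1)) t / 2 + w (2 * (m + 1)) t / 2 - w (m - n) t - w (n + m + 2) t" for t
    proof -
      define A B where "A = 2 * pi * real (n + 1) * t" and "B = 2 * pi * real (m + 1) * t"
      have e: "2 * pi * real (2 * (n + 1)) * t = 2 * A" "2 * pi * real (2 * (m + 1)) * t = 2 * B"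
        "2 * pi * real (m - n) * t = B - A" "2 * pi * real (n + m + 2) * t = B + A"
        using nm by (simp_all add: A_def B_def algebra_simps of_nat_diff)
      have "(cos A - cos B)\<^sup>2 = 1 + cos (2 * A) / 2 + cos (2 * B) / 2 - cos (B - A) - cos (B + A)"
        unfolding cos_double_cos cos_diff cos_add by (simp add: power2_eq_square field_simps)
      then show ?thesis unfolding w_def e by (simp add: u_def A_def B_def)
    qed
    have "(\<integral>t. (u n t - u m t)\<^sup>2 \<partial>mu) = 1"
      unfolding pt using nm by (simp add: wi w0)
    moreover have "(\<integral>t. (u n t - u m t)\<^sup>2 \<partial>mu) \<le> (\<integral>t. 2 * \<bar>u n t - u m t\<bar> \<partial>mu)"
    proof (rule Bochner_Integration.integral_mono)
      have b: "\<bar>u n t - u m t\<bar> \<le> 2" for t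
        using abs_cos_le_one[of "2 * pi * real (n + 1) * t"] abs_cos_le_one[of "2 * pi * real (m + 1) * t"]
        unfolding u_def by linarith
      show "(u n t - u m t)\<^sup>2 \<le> 2 * \<bar>u n t - u m t\<bar>" for t
        using mult_right_mono[OF b[of t], of "\<bar>u n t - u m t\<bar>"] by (simp add: power2_eq_square)
      show "integrable mu (\<lambda>t. 2 * \<bar>u n t - u m t\<bar>)"
        by (rule integrable_bounded[where K="2 * 2"]) (use b in \<open>auto simp: abs_mult\<close>)
      show "integrable mu (\<lambda>t. (u n t - u m t)\<^sup>2)" unfolding pt by (simp add: wi)
    qed
    moreover have "(\<integral>t. \<bar>u n t - u m t\<bar> \<partial>mu) \<le> Lp_norm p (\<lambda>t. u n t - u m t)"
      by (rule integral_abs_le_Lp_norm(2)[OF pq]) (intro Lp_diff up_spaceD[OF us], use c in simp)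
    ultimately show ?thesis by simp
  qed
  obtain f K where f: "f \<in> borel_measurable mu" "\<And>t. \<bar>f t\<bar> \<le> K" "f \<in> Lp p" "wnull p U (\<lambda>n t. u n t - f t)"
    by (rule weak_limit_bounded[OF pq uB]) blast
  have ff: "(\<lambda>n. f) \<in> Bdd" by (rule BddI[where K=K]) (use f in auto)
  have b: "(\<lambda>n t. u n t - f t) \<in> Bdd" using Bdd_add[OF uB Bdd_scale[OF ff, of "-1"]] by simp
  have "up_norm p U (\<lambda>n t. u n t - f t) \<noteq> 0"
  proof
    assume "up_norm p U (\<lambda>n t. u n t - f t) = 0"
    \<comment> \<open>Two different terms within \<open>1 / 4\<close> of \<open>f\<close> would be
      closer than \<open>1 / 2\<close> to each other, against \<open>sep\<close>.\<close>
    then have ev: "eventually (\<lambda>n. n \<in> {n. Lp_norm p (\<lambda>t. u n t - f t) < 1 / 4}) U"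
      using up_norm_less[OF wnullD[OF f(4)], of "1 / 4"] by simp
    then obtain n where n: "Lp_norm p (\<lambda>t. u n t - f t) < 1 / 4"
      using eventually_happens'[OF U_ne_bot ev] by auto
    have "eventually (\<lambda>m. Lp_norm p (\<lambda>t. u m t - f t) < 1 / 4 \<and> Suc n \<le> m) U"
      using ev eventually_ge_U[of "Suc n"] by eventually_elim simp
    then obtain m where m: "Lp_norm p (\<lambda>t. u m t - f t) < 1 / 4" "n < m"
      using eventually_happens'[OF U_ne_bot] by fastforce
    have "Lp_norm p (\<lambda>t. (u n t - f t) - (u m t - f t)) \<le> Lp_norm p (\<lambda>t. u n t - f t) + Lp_norm p (\<lambda>t. u m t - f t)"
      by (rule Lp_norm_triangle_diff[OF pq up_spaceD[OF wnullD[OF f(4)]] up_spaceD[OF wnullD[OF f(4)]]])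
    then show False using n m sep[OF m(2)] by simp
  qed
  moreover have "(\<lambda>n t. u n t - f t) \<in> WEqui p" using Bdd_Equi[OF pq b] f(4) by (simp add: WEqui_def)
  ultimately show ?thesis by blast
qed

text \<open>For \<open>2 < p\<close> functionals from \<open>WBdd q\<close> may be combined with
  targets in both bands, as \<open>approx_N\<close> demands, and they vanish on
  \<open>Disj p\<close>; hence they are \<open>FN\<close> and the disjoint band is
  \<open>M\<close>.\<close>

lemma band_decomposition_gt_2:
  assumes pq: "conj_exp p q" and p: "2 < p"
  shows "band_decomposition U p q (Disj p) (WEqui p) (Disj q) (WBdd q)"
proof unfold_locales
  note c = conj_expD[OF pq] and qp = conj_exp_sym[OF pq]
  show "conj_exp p q" by (rule pq)
  show "up_closed_subspace p U (Disj p)" "up_closed_subspace p U (WEqui p)" by (rule closed_Disj[OF pq], rule closed_WEqui[OF pq])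
  show "wnull p U x" if "x \<in> Disj p" for x by (rule Disj_wnull[OF pq that])
  show "wnull p U x" if "x \<in> WEqui p" for x using that by (simp add: WEqui_def)
  show "\<exists>m\<in>Disj p. \<exists>n\<in>WEqui p. x = (\<lambda>i t. m i t + n i t)" if x: "wnull p U x" for x
  proof -
    obtain e d where "e \<in> WEqui p" "d \<in> Disj p" "x = (\<lambda>n t. e n t + d n t)" using WEqui_Disj_split[OF pq x] by blast
    then show ?thesis by (intro bexI[of _ d] bexI[of _ e]) (auto simp: add.commute)
  qed
  show "wnull q U h" if "h \<in> Disj q" for h by (rule Disj_wnull[OF qp that])
  show "wnull q U h" if "h \<in> WBdd q" for h using that by (simp add: WBdd_def)
  show "(\<lambda>n t. x n t + y n t) \<in> Disj q" if "x \<in> Disj q" "y \<in> Disj q" for x y by (rule Disj_add[OF qp that])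
  show "(\<lambda>n t. a * x n t) \<in> Disj q" if "x \<in> Disj q" for x a by (rule Disj_scale[OF _ that]) (use c in simp)
  show "(\<lambda>n t. 0) \<in> Disj q" by (rule Disj_zero)
  show "(\<lambda>n t. x n t + y n t) \<in> WBdd q" if "x \<in> WBdd q" "y \<in> WBdd q" for x y by (rule WBdd_add[OF qp that])
  show "(\<lambda>n t. a * x n t) \<in> WBdd q" if "x \<in> WBdd q" for x a by (rule WBdd_scale[OF _ that]) (use c in simp)
  show "(\<lambda>n t. 0) \<in> WBdd q" by (rule WBdd_zero)
  show "pair m h = 0" if "m \<in> Disj p" "h \<in> WBdd q" for m h by (rule pair_Disj_Equi[OF pq that(1) WBdd_Equi[OF qp that(2)]])
  show "pair n h = 0" if "n \<in> WEqui p" "h \<in> Disj q" for n h using pair_Equi_Disj[OF pq _ that(2)] that(1) by (simp add: WEqui_def)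
  show "up_norm p U m = 0" if "m \<in> Disj p" "\<And>h. h \<in> Disj q \<Longrightarrow> pair m h = 0" for m by (rule Disj_separated[OF pq that])
  show "up_norm p U n = 0" if "n \<in> WEqui p" "\<And>h. h \<in> WBdd q \<Longrightarrow> pair n h = 0" for n
    by (rule Equi_separated[OF pq]) (use that in \<open>simp_all add: WEqui_def WBdd_def\<close>)
  show "approximable p (\<lambda>x n t. pair x h * y n t)" if "h \<in> Disj q" "y \<in> Disj p" for h y by (rule approximable_Disj_Disj[OF pq that])
  show "approximable p (\<lambda>x n t. pair x h * y n t)" if "h \<in> WBdd q" "wnull p U y" for h y
    by (rule approximable_split[OF pq that(2) approximable_WBdd_WEqui[OF pq that(1)] approximable_WBdd_Disj[OF pq _ that(1)]]) (use p in auto)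
  show "pair (up_lift T m) h = 0" if "Lp_op p T" "m \<in> Disj p" "h \<in> WBdd q" for T m h
    unfolding up_lift_def by (rule operator_Disj[OF pq p that])
  show "\<exists>m\<in>Disj p. up_norm p U m \<noteq> 0" by (rule Disj_nontrivial[OF pq])
  show "\<exists>n\<in>WEqui p. up_norm p U n \<noteq> 0" by (rule WEqui_nontrivial[OF pq])
qed

text \<open>For \<open>p < 2\<close> it is the functionals from \<open>Disj q\<close> that may be
  combined with targets in both bands, and they vanish on \<open>WEqui p\<close>.\<close>

lemma band_decomposition_less_2:
  assumes pq: "conj_exp p q" and p: "p < 2"
  shows "band_decomposition U p q (WEqui p) (Disj p) (WBdd q) (Disj q)"
proof unfold_locales
  note c = conj_expD[OF pq] and qp = conj_exp_sym[OF pq]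
  show "conj_exp p q" by (rule pq)
  show "up_closed_subspace p U (Disj p)" "up_closed_subspace p U (WEqui p)" by (rule closed_Disj[OF pq], rule closed_WEqui[OF pq])
  show "wnull p U x" if "x \<in> Disj p" for x by (rule Disj_wnull[OF pq that])
  show "wnull p U x" if "x \<in> WEqui p" for x using that by (simp add: WEqui_def)
  show "\<exists>m\<in>WEqui p. \<exists>n\<in>Disj p. x = (\<lambda>i t. m i t + n i t)" if x: "wnull p U x" for x by (rule WEqui_Disj_split[OF pq x])
  show "wnull q U h" if "h \<in> Disj q" for h by (rule Disj_wnull[OF qp that])
  show "wnull q U h" if "h \<in> WBdd q" for h using that by (simp add: WBdd_def)
  show "(\<lambda>n t. x n t + y n t) \<in> Disj q" if "x \<in> Disj q" "y \<in> Disj q" for x y by (rule Disj_add[OF qp that])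
  show "(\<lambda>n t. a * x n t) \<in> Disj q" if "x \<in> Disj q" for x a by (rule Disj_scale[OF _ that]) (use c in simp)
  show "(\<lambda>n t. 0) \<in> Disj q" by (rule Disj_zero)
  show "(\<lambda>n t. x n t + y n t) \<in> WBdd q" if "x \<in> WBdd q" "y \<in> WBdd q" for x y by (rule WBdd_add[OF qp that])
  show "(\<lambda>n t. a * x n t) \<in> WBdd q" if "x \<in> WBdd q" for x a by (rule WBdd_scale[OF _ that]) (use c in simp)
  show "(\<lambda>n t. 0) \<in> WBdd q" by (rule WBdd_zero)
  show "pair m h = 0" if "m \<in> Disj p" "h \<in> WBdd q" for m h by (rule pair_Disj_Equi[OF pq that(1) WBdd_Equi[OF qp that(2)]])
  show "pair n h = 0" if "n \<in> WEqui p" "h \<in> Disj q" for n h using pair_Equi_Disj[OF pq _ that(2)] that(1) by (simp add: WEqui_def)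
  show "up_norm p U m = 0" if "m \<in> Disj p" "\<And>h. h \<in> Disj q \<Longrightarrow> pair m h = 0" for m by (rule Disj_separated[OF pq that])
  show "up_norm p U n = 0" if "n \<in> WEqui p" "\<And>h. h \<in> WBdd q \<Longrightarrow> pair n h = 0" for n
    by (rule Equi_separated[OF pq]) (use that in \<open>simp_all add: WEqui_def WBdd_def\<close>)
  show "approximable p (\<lambda>x n t. pair x h * y n t)" if "h \<in> WBdd q" "y \<in> WEqui p" for h y by (rule approximable_WBdd_WEqui[OF pq that])
  show "approximable p (\<lambda>x n t. pair x h * y n t)" if "h \<in> Disj q" "wnull p U y" for h y
    by (rule approximable_split[OF pq that(2) approximable_Disj_WEqui[OF pq _ that(1)] approximable_Disj_Disj[OF pq that(1)]]) (use p in auto)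
  show "pair (up_lift T m) h = 0" if "Lp_op p T" "m \<in> WEqui p" "h \<in> Disj q" for T m h
    unfolding up_lift_def by (rule operator_WEqui[OF pq p that])
  show "\<exists>m\<in>Disj p. up_norm p U m \<noteq> 0" by (rule Disj_nontrivial[OF pq])
  show "\<exists>n\<in>WEqui p. up_norm p U n \<noteq> 0" by (rule WEqui_nontrivial[OF pq])
qed

end

theorem theorem1p1:
  fixes p :: real and U :: "nat filter"
  assumes "1 < p" and "p \<noteq> 2"
    and "nonprincipal_ultrafilter U" and "selective U"
  shows "\<exists>!M. up_complemented_in p U (up_hat p U) M \<and>
           (\<forall>S. up_op p U S \<longrightarrow>
              (S \<in> wot_closure p U {up_lift T | T. Lp_op p T} \<longleftrightarrow>
               invariant_under (up_const p U) S \<and>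
               invariant_under (up_hat p U) S \<and>
               invariant_under M S))"
proof -
  interpret selective_ultrafilter U using assms(3,4) by unfold_locales
  have pq: "conj_exp p (p / (p - 1))" using assms(1) by (rule conj_exp_exists)
  show ?thesis
  proof (cases "2 < p")
    case True
    then show ?thesis by (rule band_decomposition.unique_characterization[OF band_decomposition_gt_2[OF pq]])
  next
    case False
    then have "p < 2" using assms(2) by simp
    then show ?thesis by (rule band_decomposition.unique_characterization[OF band_decomposition_less_2[OF pq]])
  qed
qed

end
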